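(* Let $n\ge2$, $\gamma>0$, and let $Cone_\Sigma\subset\mathbb{R}^n$ be a $C^{1,1}$ epigraphical cone with norms $(L,K)$ whose frequency $\phi=\phi_\Sigma$ satisfies $\phi=\frac{2}{1+\gamma}$. Let $\Omega=Cone_\Sigma\cap B_1$, and let $u>0$ be a solution of $$-\Delta u(x)=f(x)\,u^{-\gamma}(x)\quad\text{in }\Omega,\qquad 0<\lambda\le f(x)\le\Lambda,$$ which vanishes on $\partial Cone_\Sigma$ (within $B_1$). Then the following three statements are equivalent: (a) $\gamma<2$; (b) there exists $w\in C(\overline{\Omega})$ satisfying $-\Delta w=H_\Sigma^{-\gamma}$ in $\Omega$ and $w=0$ on $\partial\Omega$; (c) there exists a constant $C=C(n,\gamma,L,K,\lambda,\Lambda)$ such that for all $0<r\le1/2$, $$C^{-1}r^{\phi}\left(\ln\tfrac1r\right)^{\phi/2}\le\max_{Cone_\Sigma\cap B_r}u\le C\|u\|_{L^\infty(\Omega)}\,r^{\phi}\left(\ln\tfrac1r\right)^{\phi/2}.$$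
   Context: $B_r$ is the open ball of radius $r$ centered at $0$ in $\mathbb{R}^n$; points are written $x=(x',x_n)$ and $B_r'$ is the ball in $\mathbb{R}^{n-1}$. Cones: for $\Sigma\subseteq\partial B_1=\mathbb{S}^{n-1}$, $Cone_\Sigma=\{x\in\mathbb{R}^n\setminus\{0\}: x/|x|\in\Sigma\}$. It is a $C^{1,1}$ epigraphical cone if $Cone_\Sigma=\{x_n>g(x')\}$ for some $g:\mathbb{R}^{n-1}\to\mathbb{R}$ with $g(\lambda x')=\lambda g(x')$ for all $\lambda\ge0$, and $g\in C^{1,1}(B_2'\setminus B_1')$. Its norms are $L=\|g\|_{C^{0,1}(B_2'\setminus B_1')}$ and $K=[g]_{C^{1,1}(B_2'\setminus B_1')}$. Frequency: let $\lambda_\Sigma$ be the first Dirichlet eigenvalue of the Laplace-Beltrami operator $-\Delta_\Sigma$ on $\Sigma$ and $E\ge0$ a corresponding eigenfunction (not identically zero); the frequency $\phi_\Sigma$ is the positive solution of $\phi(\phi+n-2)=\lambda_\Sigma$. The function $H_\Sigma(x)=|x|^{\phi}E(x/|x|)$ is then a positive $\phi$-homogeneous harmonic function in $Cone_\Sigma$, vanishing on $\partial Cone_\Sigma$. Solutions: $f$ is a measurable function on $\Omega$; $u$ is a positive function, continuous on $\Omega\cup(B_1\cap\partial Cone_\Sigma)$, equal to $0$ on $B_1\cap\partial Cone_\Sigma$, satisfying the equation in $\Omega$ in the sense of distributions. "Max" over $Cone_\Sigma\cap B_r$ is understood as supremum. *)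

theory Defs
  imports "HOL-Analysis.Analysis" "HOL-Probability.Essential_Supremum"
begin

text \<open>Points of \<open>\<real>\<^sup>n\<close> are pairs \<open>(x', x\<^sub>n)\<close> of type \<open>'a \<times> real\<close>, where the Euclidean space \<open>'a\<close>
  is \<open>\<real>\<^bsup>n-1\<^esup>\<close>; since \<open>DIM('a) \<ge> 1\<close>, this gives \<open>n \<ge> 2\<close>.\<close>

subsection \<open>Calculus\<close>

definition partial :: "'a::euclidean_space \<Rightarrow> ('a \<Rightarrow> real) \<Rightarrow> 'a \<Rightarrow> real" where
  "partial b f x = frechet_derivative f (at x) b"

definition grad :: "('a::euclidean_space \<Rightarrow> real) \<Rightarrow> 'a \<Rightarrow> 'a" where
  "grad f x = (\<Sum>b\<in>Basis. partial b f x *\<^sub>R b)"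

definition laplacian :: "('a::euclidean_space \<Rightarrow> real) \<Rightarrow> 'a \<Rightarrow> real" where
  "laplacian f x = (\<Sum>b\<in>Basis. partial b (partial b f) x)"

text \<open>\<open>Ck_on k S f\<close> is meant for open \<open>S\<close>.\<close>

primrec Ck_on :: "nat \<Rightarrow> 'a::euclidean_space set \<Rightarrow> ('a \<Rightarrow> real) \<Rightarrow> bool" where
  "Ck_on 0 S f \<longleftrightarrow> continuous_on S f"
| "Ck_on (Suc k) S f \<longleftrightarrow>
     (\<forall>x\<in>S. f differentiable (at x)) \<and> (\<forall>b\<in>Basis. Ck_on k S (partial b f))"

text \<open>The space \<open>C\<^sub>c\<^sup>\<infinity>(\<Omega>)\<close>.\<close>

definition test_function :: "'a::euclidean_space set \<Rightarrow> ('a \<Rightarrow> real) \<Rightarrow> bool" where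
  "test_function \<Omega> \<phi> \<longleftrightarrow> (\<forall>k. Ck_on k UNIV \<phi>) \<and>
     compact (closure {x. \<phi> x \<noteq> 0}) \<and> closure {x. \<phi> x \<noteq> 0} \<subseteq> \<Omega>"

definition locally_integrable_on :: "'a::euclidean_space set \<Rightarrow> ('a \<Rightarrow> real) \<Rightarrow> bool" where
  "locally_integrable_on \<Omega> h \<longleftrightarrow>
     (\<forall>S. compact S \<longrightarrow> S \<subseteq> \<Omega> \<longrightarrow> set_integrable lebesgue S h)"

text \<open>\<open>-\<Delta>u = h\<close> in \<open>\<Omega>\<close> in the sense of distributions.\<close>

definition poisson_distr :: "'a::euclidean_space set \<Rightarrow> ('a \<Rightarrow> real) \<Rightarrow> ('a \<Rightarrow> real) \<Rightarrow> bool" where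
  "poisson_distr \<Omega> u h \<longleftrightarrow> locally_integrable_on \<Omega> u \<and> locally_integrable_on \<Omega> h \<and>
     (\<forall>\<phi>. test_function \<Omega> \<phi> \<longrightarrow>
        - (LINT x:\<Omega>|lebesgue. u x * laplacian \<phi> x) = (LINT x:\<Omega>|lebesgue. h x * \<phi> x))"

text \<open>The \<open>L\<^sup>\<infinity>(\<Omega>)\<close> norm, with value \<open>\<infinity>\<close> for unbounded functions.\<close>

definition Linf_norm :: "'a::euclidean_space set \<Rightarrow> ('a \<Rightarrow> real) \<Rightarrow> ereal" where
  "Linf_norm \<Omega> u = esssup (lebesgue_on \<Omega>) (\<lambda>x. ereal \<bar>u x\<bar>)"

subsection \<open>Cones\<close>

definition cone_over :: "'a::euclidean_space set \<Rightarrow> 'a set" where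
  "cone_over \<Sigma> = {x. x \<noteq> 0 \<and> x /\<^sub>R norm x \<in> \<Sigma>}"

text \<open>The supremum below is meaningful for Lipschitz functions only; see \<open>C11_epigraphical_cone\<close>.\<close>

definition lip_seminorm :: "'a::metric_space set \<Rightarrow> ('a \<Rightarrow> 'b::metric_space) \<Rightarrow> real" where
  "lip_seminorm S f =
     Sup {dist (f x) (f y) / dist x y | x y. x \<in> S \<and> y \<in> S \<and> x \<noteq> y}"

definition C01_norm :: "'a::metric_space set \<Rightarrow> ('a \<Rightarrow> real) \<Rightarrow> real" where
  "C01_norm S f = (SUP x\<in>S. \<bar>f x\<bar>) + lip_seminorm S f"

text \<open>On the half-closed annulus \<open>B\<^sub>2' - B\<^sub>1'\<close>, differentiability is two-sided also on the inner sphere;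
  for positively 1-homogeneous \<open>g\<close> this is no restriction.\<close>

definition C11_epigraphical_cone ::
    "('a::euclidean_space \<times> real) set \<Rightarrow> real \<Rightarrow> real \<Rightarrow> bool" where
  "C11_epigraphical_cone \<Sigma> L K \<longleftrightarrow> \<Sigma> \<subseteq> sphere 0 1 \<and>
     (\<exists>g :: 'a \<Rightarrow> real.
        cone_over \<Sigma> = {(x', xn). xn > g x'} \<and>
        (\<forall>t\<ge>0. \<forall>x'. g (t *\<^sub>R x') = t * g x') \<and>
        (\<exists>M. M-lipschitz_on (ball 0 2 - ball 0 1) g) \<and>
        (\<forall>x'\<in>ball 0 2 - ball 0 1. g differentiable (at x')) \<and>
        (\<exists>M. M-lipschitz_on (ball 0 2 - ball 0 1) (grad g)) \<and>
        L = C01_norm (ball 0 2 - ball 0 1) g \<and>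
        K = lip_seminorm (ball 0 2 - ball 0 1) (grad g))"

subsection \<open>First Dirichlet eigenvalue, frequency and the harmonic function of a cone\<close>

definition hom0_ext :: "('a::euclidean_space \<Rightarrow> real) \<Rightarrow> 'a \<Rightarrow> real" where
  "hom0_ext E x = E (x /\<^sub>R norm x)"

text \<open>The Laplace-Beltrami operator of the unit sphere is the restriction to the sphere of the
  Euclidean Laplacian of the 0-homogeneous extension.\<close>

definition laplace_beltrami :: "('a::euclidean_space \<Rightarrow> real) \<Rightarrow> 'a \<Rightarrow> real" where
  "laplace_beltrami E \<theta> = laplacian (hom0_ext E) \<theta>"

text \<open>Dirichlet eigenfunctions on a relatively open \<open>\<Sigma>\<close> in the unit sphere, understood classically:
  \<open>E \<in> C\<^sup>2(\<Sigma>)\<close>, continuous up to the boundary of \<open>\<Sigma>\<close> in the sphere. For the \<open>C\<^bsup>1,1\<^esup>\<close> domains considered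
  here these are the same as the weak (\<open>H\<^sub>0\<^sup>1\<close>) eigenfunctions. Values of \<open>E\<close> off the closure of \<open>\<Sigma>\<close>
  are irrelevant.\<close>

definition dirichlet_eigenfunction ::
    "'a::euclidean_space set \<Rightarrow> real \<Rightarrow> ('a \<Rightarrow> real) \<Rightarrow> bool" where
  "dirichlet_eigenfunction \<Sigma> \<mu> E \<longleftrightarrow>
     Ck_on 2 (cone_over \<Sigma>) (hom0_ext E) \<and>
     (\<forall>\<theta>\<in>\<Sigma>. - laplace_beltrami E \<theta> = \<mu> * E \<theta>) \<and>
     continuous_on (closure \<Sigma>) E \<and>
     (\<forall>\<theta>\<in>top_of_set (sphere 0 1) frontier_of \<Sigma>. E \<theta> = 0) \<and>
     (\<exists>\<theta>\<in>\<Sigma>. E \<theta> \<noteq> 0)"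

definition first_eigenvalue :: "'a::euclidean_space set \<Rightarrow> real" where
  "first_eigenvalue \<Sigma> = (LEAST \<mu>. \<exists>E. dirichlet_eigenfunction \<Sigma> \<mu> E)"

definition first_eigenfunction :: "'a::euclidean_space set \<Rightarrow> ('a \<Rightarrow> real) \<Rightarrow> bool" where
  "first_eigenfunction \<Sigma> E \<longleftrightarrow>
     dirichlet_eigenfunction \<Sigma> (first_eigenvalue \<Sigma>) E \<and> (\<forall>\<theta>\<in>\<Sigma>. E \<theta> \<ge> 0)"

definition frequency :: "'a::euclidean_space set \<Rightarrow> real" where
  "frequency \<Sigma> = (THE \<phi>. \<phi> > 0 \<and> \<phi> * (\<phi> + real DIM('a) - 2) = first_eigenvalue \<Sigma>)"

definition H_cone :: "'a::euclidean_space set \<Rightarrow> ('a \<Rightarrow> real) \<Rightarrow> 'a \<Rightarrow> real" where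
  "H_cone \<Sigma> E x = norm x powr frequency \<Sigma> * E (x /\<^sub>R norm x)"

subsection \<open>The singular equation and the statements to be compared\<close>

abbreviation sector :: "'a::euclidean_space set \<Rightarrow> 'a set" where
  "sector \<Sigma> \<equiv> cone_over \<Sigma> \<inter> ball 0 1"

definition singular_solution ::
    "'a::euclidean_space set \<Rightarrow> real \<Rightarrow> ('a \<Rightarrow> real) \<Rightarrow> ('a \<Rightarrow> real) \<Rightarrow> bool" where
  "singular_solution \<Sigma> \<gamma> f u \<longleftrightarrow>
     (\<forall>x\<in>sector \<Sigma>. u x > 0) \<and>
     continuous_on (sector \<Sigma> \<union> (ball 0 1 \<inter> frontier (cone_over \<Sigma>))) u \<and>
     (\<forall>x\<in>ball 0 1 \<inter> frontier (cone_over \<Sigma>). u x = 0) \<and>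
     poisson_distr (sector \<Sigma>) u (\<lambda>x. f x * u x powr (- \<gamma>))"

definition H_problem_solvable ::
    "'a::euclidean_space set \<Rightarrow> real \<Rightarrow> ('a \<Rightarrow> real) \<Rightarrow> bool" where
  "H_problem_solvable \<Sigma> \<gamma> E \<longleftrightarrow>
     (\<exists>w. continuous_on (closure (sector \<Sigma>)) w \<and>
        poisson_distr (sector \<Sigma>) w (\<lambda>x. H_cone \<Sigma> E x powr (- \<gamma>)) \<and>
        (\<forall>x\<in>frontier (sector \<Sigma>). w x = 0))"

text \<open>If the norm of \<open>u\<close> is infinite, the upper bound is vacuous.\<close>

definition log_growth :: "'a::euclidean_space set \<Rightarrow> ('a \<Rightarrow> real) \<Rightarrow> real \<Rightarrow> bool" where
  "log_growth \<Sigma> u C \<longleftrightarrow>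
     (\<forall>r. 0 < r \<and> r \<le> 1 / 2 \<longrightarrow>
        (let \<phi> = frequency \<Sigma>;
             \<rho> = r powr \<phi> * ln (1 / r) powr (\<phi> / 2);
             m = (SUP x\<in>cone_over \<Sigma> \<inter> ball 0 r. ereal (u x))
         in ereal (inverse C * \<rho>) \<le> m \<and>
            m \<le> ereal C * Linf_norm (sector \<Sigma>) u * ereal \<rho>))"

end

(* Write H for the harmonic function of the cone, normalised to have maximum 1 on the sphere, ph for its
 degree, a = 1/(1+gamma) = ph/2, and rho(x) = x_n - g(x'). Everything is a comparison argument: distributional
 subsolutions are mollified and compared with barriers that are touched by smooth functions.
 For every gamma a multiple of H ln(1/|x|)^a is a subsolution, which gives the lower bound. If gamma < 2, then
 W = A ln(2/|x|) H + |x|^(ph-b) rho^b satisfies -Delta W >= c H^(-gamma). By concavity a multiple of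
 W^a H^(1-a) is then a supersolution of the singular equation, which gives the upper bound, and W is the
 barrier that makes the solutions of the problems with truncated right-hand sides (obtained as limits of
 finite differences) converge to a solution of (b). If gamma >= 2, the right-hand side is at least
 c rho^(-2) near the lateral boundary, and a supersolution with such a right-hand side is infinite. This
 contradicts (b); under the upper bound of (c) its quantitative form lets the best multiple of H below u
 grow faster on dyadic balls than (ln 1/r)^a. The uniformity in (L,K) comes from a Hopf lemma and an interior
 gradient estimate for H, the latter by reflection in coordinate hyperplanes. *)
theory Submission
 imports Defs "HOL-Complex_Analysis.Great_Picard" "HOL-Real_Asymp.Real_Asymp"
begin

text \<open>The equation is invariant under u -> r^(-ph) u(r x) exactly when ph = 2/(1+gamma), which
  is the degree of H; the logarithm is this resonance. For F(ln(1/|x|)) H the leading part of -Delta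
  is (n-2+2ph) F' H/|x|^2, and balancing it with F^(-gamma) H^(-gamma) along a ray gives F' F^gamma
  = const, hence F = s^a. The threshold 2 comes from the lateral boundary: H vanishes linearly
  there, and t * t^(-gamma) is integrable at 0 only for gamma < 2. Two obstacles shape the proof.
  The coefficient f is only measurable and u^(-gamma) is unbounded, so comparison asks for the
  subsolution property only where u exceeds the barrier, and there the power of the barrier controls
  u^(-gamma). The boundary is not C^2 and has a vertex, so rho is never differentiated: paraboloids
  touch it from one side at scale |x|, while near the axis rho itself is comparable to |x|.\<close>

notation scaleR (infixr "*R" 75)
notation tendsto (infixr "--->" 55)
abbreviation seq_lim (infixr "---->" 60) where "X ----> l == (X ---> l) sequentially"

section \<open>Second derivatives along coordinate directions\<close>

text \<open>Only pure second derivatives along basis directions are recorded, without mixed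
  derivatives or continuity. The maximum principle and the Laplacians of sums, products and
  compositions need no more, so a barrier never requires a proof of full \<open>C^2\<close>
  regularity.\<close>

definition D2on :: "'a::euclidean_space set => ('a => real) => ('a => 'a) => ('a => 'a => real) => bool" where
 "D2on S f G h \<longleftrightarrow> (ALL x:S. ALL b:Basis.
  DERIV (%t. f (x + t *R b)) 0 :> G x \<bullet> b &
  DERIV (%t. G (x + t *R b) \<bullet> b) 0 :> h b x)"

text \<open>The gradient field stays an argument because products and compositions feed inner
  products of gradients into the next Laplacian.\<close>

definition has_lap :: "'a::euclidean_space set => ('a => real) => ('a => 'a) => ('a => real) => bool" where
 "has_lap S f G l \<longleftrightarrow> (EX h. D2on S f G h & (ALL x:S. l x = (SUM b:Basis. h b x)))"

lemma D2on_subset: "D2on S f G h ==> T <= S ==> D2on T f G h"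
 unfolding D2on_def by blast

lemma D2on_D1: "D2on S f G h ==> x + s *R b : S ==> b : Basis ==>
 DERIV (%t. f (x + t *R b)) s :> G (x + s *R b) \<bullet> b"
proof -
 assume *: "D2on S f G h" "x + s *R b : S" "b : Basis"
 hence "DERIV (%t. f ((x + s *R b) + t *R b)) (s - s) :> G (x + s *R b) \<bullet> b"
 unfolding D2on_def by auto
 hence "DERIV (%t. f ((x + s *R b) + (t - s) *R b)) s :> G (x + s *R b) \<bullet> b"
 using DERIV_shift[of "%t. f ((x + s *R b) + t *R b)" "G (x + s *R b) \<bullet> b" s "-s"] by simp
 thus ?thesis by (simp add: algebra_simps)
qed

lemma D2on_D2: "D2on S f G h ==> x + s *R b : S ==> b : Basis ==>
 DERIV (%t. G (x + t *R b) \<bullet> b) s :> h b (x + s *R b)"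
proof -
 assume *: "D2on S f G h" "x + s *R b : S" "b : Basis"
 hence "DERIV (%t. G ((x + s *R b) + t *R b) \<bullet> b) (s - s) :> h b (x + s *R b)"
 unfolding D2on_def by auto
 hence "DERIV (%t. G ((x + s *R b) + (t - s) *R b) \<bullet> b) s :> h b (x + s *R b)"
 using DERIV_shift[of "%t. G ((x + s *R b) + t *R b) \<bullet> b" "h b (x + s *R b)" s "-s"] by simp
 thus ?thesis by (simp add: algebra_simps)
qed

lemma D2on_const: "D2on S (%x. c) (%x. 0) (%b x. 0)"
 unfolding D2on_def by auto

lemma D2on_inner: "D2on S (%x. v \<bullet> x) (%x. v) (%b x. 0)"
 unfolding D2on_def
 by (auto intro!: derivative_eq_intros simp: inner_add_right)

lemma D2on_add: "D2on S f G h ==> D2on S f' G' h' ==>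
 D2on S (%x. f x + f' x) (%x. G x + G' x) (%b x. h b x + h' b x)"
 unfolding D2on_def by (auto intro!: DERIV_add simp: inner_add_left)

lemma D2on_cmul: "D2on S f G h ==>
 D2on S (%x. c * f x) (%x. c *R G x) (%b x. c * h b x)"
 unfolding D2on_def by (auto intro!: DERIV_cmult)

lemma D2on_mult:
 assumes "D2on S f G h" "D2on S f' G' h'"
 shows "D2on S (%x. f x * f' x) (%x. f x *R G' x + f' x *R G x)
  (%b x. f x * h' b x + f' x * h b x + 2 * (G x \<bullet> b) * (G' x \<bullet> b))"
 unfolding D2on_def
proof (intro ballI conjI)
 fix x b :: 'a assume x: "x : S" and b: "b : Basis"
 have d: "DERIV (%t. f (x + t *R b)) 0 :> G x \<bullet> b"
 "DERIV (%t. f' (x + t *R b)) 0 :> G' x \<bullet> b"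
 "DERIV (%t. G (x + t *R b) \<bullet> b) 0 :> h b x"
 "DERIV (%t. G' (x + t *R b) \<bullet> b) 0 :> h' b x"
 using assms x b unfolding D2on_def by auto
 show "DERIV (%t. f (x + t *R b) * f' (x + t *R b)) 0 :> (f x *R G' x + f' x *R G x) \<bullet> b"
 using d by (auto intro!: derivative_eq_intros simp: inner_add_left)
 show "DERIV (%t. (f (x + t *R b) *R G' (x + t *R b) + f' (x + t *R b) *R G (x + t *R b)) \<bullet> b) 0 :> f x * h' b x + f' x * h b x + 2 * (G x \<bullet> b) * (G' x \<bullet> b)"
 unfolding inner_add_left using d by (auto intro!: derivative_eq_intros)
qed

lemma D2on_comp:
 assumes "D2on S f G h"
 "!!x. x : S ==> DERIV F (f x) :> F1 (f x)"
 "!!x. x : S ==> DERIV F1 (f x) :> F2 (f x)"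
 shows "D2on S (%x. F (f x)) (%x. F1 (f x) *R G x)
  (%b x. F2 (f x) * (G x \<bullet> b)^2 + F1 (f x) * h b x)"
 unfolding D2on_def
proof (intro ballI conjI)
 fix x b :: 'a assume x: "x : S" and b: "b : Basis"
 have d: "DERIV (%t. f (x + t *R b)) 0 :> G x \<bullet> b"
 "DERIV (%t. G (x + t *R b) \<bullet> b) 0 :> h b x"
 using assms x b unfolding D2on_def by auto
 have F: "DERIV F (f (x + 0 *R b)) :> F1 (f x)"
 "DERIV F1 (f (x + 0 *R b)) :> F2 (f x)"
 using assms x by auto
 note c = DERIV_chain2[OF F(1) d(1)] DERIV_chain2[OF F(2) d(1)]
 show "DERIV (%t. F (f (x + t *R b))) 0 :> (F1 (f x) *R G x) \<bullet> b"
 using c(1) by simp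
 show "DERIV (%t. (F1 (f (x + t *R b)) *R G (x + t *R b)) \<bullet> b) 0 :> F2 (f x) * (G x \<bullet> b)^2 + F1 (f x) * h b x"
 unfolding inner_scaleR_left
 by (rule DERIV_cong[OF DERIV_mult[OF c(2) d(2)]]) (simp add: power2_eq_square)
qed

lemma D2on_shift:
 assumes "D2on S f G h"
 shows "D2on {x. x + c : S} (%x. f (x + c)) (%x. G (x + c)) (%b x. h b (x + c))"
 unfolding D2on_def
proof (intro ballI)
 fix x b :: 'a assume "x : {x. x + c : S}" "b : Basis"
 hence xb: "x + c : S" "b : Basis" by auto
 have e: "x + t *R b + c = x + c + t *R b" for t by simp
 show "DERIV (%t. f (x + t *R b + c)) 0 :> G (x + c) \<bullet> b &
  DERIV (%t. G (x + t *R b + c) \<bullet> b) 0 :> h b (x + c)"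
 unfolding e using assms xb unfolding D2on_def by simp
qed

lemma D2on_scale:
 assumes "D2on S f G h"
 shows "D2on {x. r *R x : S} (%x. f (r *R x)) (%x. r *R G (r *R x)) (%b x. r^2 * h b (r *R x))"
 unfolding D2on_def
proof (intro ballI conjI)
 fix x b :: 'a assume x: "x : {x. r *R x : S}" and b: "b : Basis"
 have d: "DERIV (%t. f (r *R x + t *R b)) (r * 0) :> G (r *R x) \<bullet> b"
 "DERIV (%t. G (r *R x + t *R b) \<bullet> b) (r * 0) :> h b (r *R x)"
 using assms x b unfolding D2on_def by auto
 have r: "DERIV (%t. r * t) 0 :> r" by simp
 show "DERIV (%t. f (r *R (x + t *R b))) 0 :> r *R G (r *R x) \<bullet> b"
 using DERIV_chain2[OF d(1) r] by (simp add: scaleR_add_right mult.commute)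
 show "DERIV (%t. r *R G (r *R (x + t *R b)) \<bullet> b) 0 :> r^2 * h b (r *R x)"
 using DERIV_cmult[OF DERIV_chain2[OF d(2) r], of r] by (simp add: scaleR_add_right mult.commute power2_eq_square mult.assoc)
qed

lemma has_lap_subset: "has_lap S f G l ==> T <= S ==> has_lap T f G l"
 unfolding has_lap_def using D2on_subset by blast

lemma has_lap_const: "has_lap S (%x. c) (%x. 0) (%x. 0)"
 unfolding has_lap_def by (rule exI, rule conjI[OF D2on_const]) simp

lemma has_lap_inner: "has_lap S (%x. v \<bullet> x) (%x. v) (%x. 0)"
 unfolding has_lap_def by (rule exI, rule conjI[OF D2on_inner]) simp

lemma has_lap_add: "has_lap S f G l ==> has_lap S f' G' l' ==>
 has_lap S (%x. f x + f' x) (%x. G x + G' x) (%x. l x + l' x)"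
 unfolding has_lap_def by (elim exE conjE, rule exI, rule conjI, erule (1) D2on_add) (simp add: sum.distrib)

lemma has_lap_cmul: "has_lap S f G l ==>
 has_lap S (%x. c * f x) (%x. c *R G x) (%x. c * l x)"
 unfolding has_lap_def by (elim exE conjE, rule exI, rule conjI, erule D2on_cmul) (simp add: sum_distrib_left)

lemma has_lap_minus: "has_lap S f G l ==> has_lap S (%x. - f x) (%x. - G x) (%x. - l x)"
 using has_lap_cmul[of S f G l "-1"] by simp

lemma has_lap_diff: "has_lap S f G l ==> has_lap S f' G' l' ==>
 has_lap S (%x. f x - f' x) (%x. G x - G' x) (%x. l x - l' x)"
 using has_lap_add[OF _ has_lap_minus, of S f G l f' G' l'] by simp

lemma has_lap_mult:
 assumes "has_lap S f G l" "has_lap S f' G' l'"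
 shows "has_lap S (%x. f x * f' x) (%x. f x *R G' x + f' x *R G x)
 (%x. f x * l' x + f' x * l x + 2 * (G x \<bullet> G' x))"
proof -
 from assms obtain h h' where h: "D2on S f G h" "ALL x:S. l x = (SUM b:Basis. h b x)"
 "D2on S f' G' h'" "ALL x:S. l' x = (SUM b:Basis. h' b x)"
 unfolding has_lap_def by blast
 show ?thesis unfolding has_lap_def
 proof (rule exI, rule conjI[OF D2on_mult[OF h(1,3)]], intro ballI)
 fix x assume "x : S"
 thus "f x * l' x + f' x * l x + 2 * (G x \<bullet> G' x) =
  (SUM b:Basis. f x * h' b x + f' x * h b x + 2 * (G x \<bullet> b) * (G' x \<bullet> b))"
  unfolding euclidean_inner[of "G x" "G' x"]
  by (simp add: h(2,4) sum.distrib sum_distrib_left mult.assoc)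
 qed
qed

lemma has_lap_comp:
 assumes "has_lap S f G l"
 "!!x. x : S ==> DERIV F (f x) :> F1 (f x)"
 "!!x. x : S ==> DERIV F1 (f x) :> F2 (f x)"
 shows "has_lap S (%x. F (f x)) (%x. F1 (f x) *R G x)
 (%x. F2 (f x) * (G x \<bullet> G x) + F1 (f x) * l x)"
proof -
 from assms(1) obtain h where h: "D2on S f G h" "ALL x:S. l x = (SUM b:Basis. h b x)"
 unfolding has_lap_def by blast
 show ?thesis unfolding has_lap_def
 proof (rule exI, rule conjI[OF D2on_comp[OF h(1) assms(2,3)]], assumption, assumption, intro ballI)
 fix x assume "x : S"
 thus "F2 (f x) * (G x \<bullet> G x) + F1 (f x) * l x =
  (SUM b:Basis. F2 (f x) * (G x \<bullet> b)^2 + F1 (f x) * h b x)"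
  unfolding euclidean_inner[of "G x" "G x"]
  by (simp add: h(2) sum.distrib sum_distrib_left power2_eq_square)
 qed
qed

lemma has_lap_scale: "has_lap S f G l ==>
 has_lap {x. r *R x : S} (%x. f (r *R x)) (%x. r *R G (r *R x)) (%x. r^2 * l (r *R x))"
 unfolding has_lap_def by (elim exE conjE, rule exI, rule conjI, erule D2on_scale) (simp add: sum_distrib_left)

lemma has_lap_sqnorm:
 "has_lap S (%x::'a::euclidean_space. (norm (x - c))^2) (%x. 2 *R (x - c)) (%x. 2 * real DIM('a))"
proof -
 have e: "(norm (x + t *R b - c))^2 = (norm (x - c))^2 + 2 * ((x - c) \<bullet> b) * t + t^2"
 "2 *R (x + t *R b - c) \<bullet> b = 2 * ((x - c) \<bullet> b) + 2 * t" if "b : Basis" for x b :: 'a and t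
 using that by (simp_all only: power2_norm_eq_inner inner_simps) (simp_all add: inner_commute power2_eq_square algebra_simps)
 have "D2on S (%x::'a. (norm (x - c))^2) (%x. 2 *R (x - c)) (%b x. 2)"
 unfolding D2on_def
 proof (intro ballI conjI)
 fix x b :: 'a assume "b : Basis"
 note e = e[OF this]
 show "DERIV (%t. (norm (x + t *R b - c))^2) 0 :> 2 *R (x - c) \<bullet> b"
  unfolding e by (auto intro!: derivative_eq_intros)
 show "DERIV (%t. 2 *R (x + t *R b - c) \<bullet> b) 0 :> 2"
  unfolding e by (auto intro!: derivative_eq_intros)
 qed
 thus ?thesis unfolding has_lap_def by auto
qed

text \<open>The first derivative vanishes at the maximum; a positive second derivative would make it
  positive just to the right, so \<open>f\<close> would increase there.\<close>

lemma second_deriv_local_max: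
 assumes "D2on S f G h" "open S" "x : S" "!!y. y : S ==> f y <= f x" "b : Basis"
 shows "h b x <= 0"
proof (rule ccontr)
 assume "~ h b x <= 0"
 hence pos: "h b x > 0" by simp
 have cont: "((%t::real. x + t *R b) ---> x + 0 *R b) (nhds 0)"
 by (intro tendsto_intros filterlim_ident)
 hence "\<forall>\<^sub>F t in nhds (0::real). x + t *R b : S"
 using topological_tendstoD[OF _ assms(2)] assms(3) by simp
 then obtain d where d: "d > 0" "!!t. abs t < d ==> x + t *R b : S"
 unfolding eventually_nhds_metric by auto
 have D1: "DERIV (%t. f (x + t *R b)) s :> G (x + s *R b) \<bullet> b" if "abs s < d" for s
 using D2on_D1[OF assms(1) d(2)[OF that] assms(5)] .
 have D2: "DERIV (%t. G (x + t *R b) \<bullet> b) 0 :> h b x"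
 using assms unfolding D2on_def by blast
 have z: "G x \<bullet> b = 0"
 using DERIV_local_max[OF D1[of 0] d(1)] d assms(4) by auto
 obtain e where e: "e > 0" "!!t. 0 < t ==> t < e ==> G (x + t *R b) \<bullet> b > 0"
 using DERIV_pos_inc_right[OF D2 pos] z by auto
 define s where "s = min d e / 2"
 have s: "0 < s" "s < d" "s < e" using d e by (auto simp: s_def)
 have "f (x + 0 *R b) < f (x + s *R b)"
 proof (rule DERIV_pos_imp_increasing_open[OF s(1)])
 fix t assume "0 < t" "t < s"
 thus "EX y. DERIV (%t. f (x + t *R b)) t :> y & y > 0"
  using D1[of t] e(2)[of t] s by auto
 next
 show "continuous_on {0..s} (%t. f (x + t *R b))"
  by (rule DERIV_continuous_on[where D="%t. G (x + t *R b) \<bullet> b"])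
  (use D1 s in \<open>auto intro: has_field_derivative_at_within\<close>)
 qed
 moreover have "f (x + s *R b) <= f x" using assms(4) d(2)[of s] s by auto
 ultimately show False by simp
qed

lemma has_lap_local_max:
 assumes "has_lap S f G l" "open S" "x : S" "!!y. y : S ==> f y <= f x"
 shows "l x <= 0"
proof -
 from assms(1) obtain h where h: "D2on S f G h" "l x = (SUM b:Basis. h b x)"
 using assms(3) unfolding has_lap_def by blast
 show ?thesis unfolding h(2)
 by (intro sum_nonpos second_deriv_local_max[OF h(1) assms(2,3)]) (use assms(4) in auto)
qed

text \<open>The Lagrange remainder asks only for existence of the second derivative on the segment,
  which is the regularity that \<open>D2on\<close> offers. It serves both differentiation under the
  integral and the consistency of finite differences.\<close>

lemma line_taylor:
 assumes "D2on S f G h" "b : Basis" "!!s. abs s <= abs t ==> x + s *R b : S"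
 obtains s where "abs s <= abs t" "f (x + t *R b) = f x + t * (G x \<bullet> b) + h b (x + s *R b) * t^2 / 2"
proof (cases "t = 0")
 case True
 thus ?thesis using that[of 0] by auto
next
 case False
 define diff where "diff = (%m::nat. if m = 0 then (%t. f (x + t *R b)) else if m = 1 then (%t. G (x + t *R b) \<bullet> b)
  else (%t. h b (x + t *R b)))"
 have "EX s. (if t < 0 then t < s & s < 0 else 0 < s & s < t) &
 f (x + t *R b) = (\<Sum>m<2. diff m 0 / fact m * (t - 0) ^ m) + diff 2 s / fact 2 * (t - 0) ^ 2"
 proof (rule Taylor[where a="-\<bar>t\<bar>" and b="abs t"])
 show "ALL m s. m < 2 & - abs t <= s & s <= abs t --> DERIV (diff m) s :> diff (Suc m) s"
 proof (intro allI impI)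
  fix m :: nat and s assume *: "m < 2 & - abs t <= s & s <= abs t"
  hence "abs s <= abs t" by auto
  note d = D2on_D1[OF assms(1) assms(3)[OF this] assms(2)] D2on_D2[OF assms(1) assms(3)[OF this] assms(2)]
  consider "m = 0" | "m = 1" using * by linarith
  thus "DERIV (diff m) s :> diff (Suc m) s"
  by cases (use d in \<open>simp_all add: diff_def\<close>)
 qed
 qed (use False in \<open>auto simp: diff_def\<close>)
 then obtain s where s': "if t < 0 then t < s & s < 0 else 0 < s & s < t"
 and s2: "f (x + t *R b) = (\<Sum>m<2. diff m 0 / fact m * (t - 0) ^ m) + diff 2 s / fact 2 * (t - 0) ^ 2"
 by blast
 from s' have s: "abs s <= abs t" by (simp split: if_splits)
 have "(\<Sum>m<2. diff m 0 / fact m * (t - 0) ^ m) = diff 0 0 + diff 1 0 * t"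
 by (simp add: numeral_2_eq_2)
 hence "f (x + t *R b) = f x + t * (G x \<bullet> b) + h b (x + s *R b) * t^2 / 2"
 using s2 by (simp add: diff_def)
 thus ?thesis using that[of s] s by blast
qed

section \<open>Mollification of distributional solutions\<close>

text \<open>The derivatives of \<open>exp (- (1 / t))\<close> extended by zero are combinations of
  these functions, so the family is closed under differentiation, also at 0.\<close>

definition bumpk :: "nat => real => real" where
 "bumpk k t = (if t <= 0 then 0 else exp (- (1 / t)) / t ^ k)"

lemma bumpk_tendsto_0: "(bumpk k ---> 0) (at_right 0)"
proof -
 have "((%t::real. (inverse t) ^ k / exp (inverse t)) ---> 0) (at_right 0)"
 by (rule filterlim_compose[OF tendsto_power_div_exp_0 filterlim_inverse_at_top_right])
 moreover have "\<forall>\<^sub>F t::real in at_right 0. (inverse t) ^ k / exp (inverse t) = bumpk k t"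
 unfolding eventually_at_filter bumpk_def by (rule always_eventually) (auto simp: exp_minus field_simps)
 ultimately show ?thesis by (rule Lim_transform_eventually)
qed

lemma DERIV_bumpk:
 "DERIV (bumpk k) t :> bumpk (k + 2) t - real k * bumpk (k + 1) t"
proof -
 consider "t < 0" | "t > 0" | "t = 0" by linarith
 thus ?thesis
 proof cases
 case 1
 have "\<forall>\<^sub>F s in nhds t. bumpk k s = 0"
  using eventually_nhds_in_open[of "{..<0::real}" t] 1
  by (auto elim!: eventually_mono simp: bumpk_def)
 thus ?thesis
  using DERIV_cong_ev[OF refl _ refl, of "bumpk k" "%_. 0" t 0] 1 by (simp add: bumpk_def)
 next
 case 2
 have "\<forall>\<^sub>F s in nhds t. bumpk k s = exp (- (1 / s)) / s ^ k"
  using eventually_nhds_in_open[of "{0::real<..}" t] 2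
  by (auto elim!: eventually_mono simp: bumpk_def)
 moreover have "DERIV (%s. exp (- (1 / s)) / s ^ k) t :> bumpk (k + 2) t - real k * bumpk (k + 1) t"
 proof (cases k)
  case 0
  thus ?thesis using 2 by (auto intro!: derivative_eq_intros simp: bumpk_def)
 next
  case (Suc m)
  hence "t * t ^ (k - Suc 0) = t ^ k" by simp
  hence "t ^ k = t * t ^ (k - Suc 0)" by simp
  hence "exp (- (1 / t)) * (1 / t^2) / t ^ k - exp (- (1 / t)) * (k * t ^ (k - 1)) / (t ^ k * t ^ k)
   = bumpk (k + 2) t - real k * bumpk (k + 1) t"
  using 2 by (simp add: bumpk_def field_simps power2_eq_square)
  moreover have "DERIV (%s. exp (- (1 / s)) / s ^ k) t :> (exp (- (1 / t)) * (1 / t^2) / t ^ k - exp (- (1 / t)) * (k * t ^ (k - 1)) / (t ^ k * t ^ k))"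
  using 2 by (auto intro!: derivative_eq_intros simp: power2_eq_square diff_divide_distrib)
  ultimately show ?thesis by simp
 qed
 ultimately show ?thesis by (subst DERIV_cong_ev[OF refl _ refl])
 next
 case 3
 \<comment> \<open>The difference quotient from the right is the next member of the family, which
   tends to 0.\<close>
 have r: "((%s. (bumpk k s - bumpk k 0) / (s - 0)) ---> 0) (at_right 0)"
 proof (rule Lim_transform_eventually[OF bumpk_tendsto_0[of "k+1"]])
  show "\<forall>\<^sub>F s in at_right 0. bumpk (k + 1) s = (bumpk k s - bumpk k 0) / (s - 0)"
  by (rule always_eventually) (auto simp: bumpk_def)
 qed
 have l: "((%s. (bumpk k s - bumpk k 0) / (s - 0)) ---> 0) (at_left 0)"
 proof (rule Lim_transform_eventually[OF tendsto_const])
  show "\<forall>\<^sub>F s in at_left 0. 0 = (bumpk k s - bumpk k 0) / (s - 0)"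
  unfolding eventually_at_filter by (rule always_eventually) (auto simp: bumpk_def)
 qed
 have "DERIV (bumpk k) 0 :> 0"
  unfolding has_field_derivative_iff using filterlim_split_at_real[OF l r] by simp
 thus ?thesis using 3 by (simp add: bumpk_def)
 qed
qed

lemma bumpk_pos: "t > 0 ==> bumpk k t > 0" and bumpk_0: "t <= 0 ==> bumpk k t = 0"
 and bumpk_nonneg: "bumpk k t >= 0"
 by (auto simp: bumpk_def)

text \<open>The algebra generated by the bumps about \<open>c\<close>, the constants and the linear
  functionals. Structural induction shows it closed under partial derivatives, so smoothness of
  every order follows without any higher chain rule.\<close>

inductive bsm :: "real => 'a::euclidean_space => ('a => real) => bool" for e c where
 base: "bsm e c (%y. bumpk k (e^2 - (norm (y - c))^2))"
| const: "bsm e c (%y. a)"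
| inner: "bsm e c (%y. v \<bullet> y)"
| add: "bsm e c f ==> bsm e c g ==> bsm e c (%y. f y + g y)"
| mult: "bsm e c f ==> bsm e c g ==> bsm e c (%y. f y * g y)"

lemma bsm_deriv:
 assumes "bsm e c f"
 shows "EX D. (ALL x. (f has_derivative D x) (at x)) & (ALL b. bsm e c (%x. D x b))"
 using assms
proof induction
 case (base k)
 define D where "D = (%x b. (bumpk (k+2) (e^2 - (norm (x - c))^2) + (- real k) * bumpk (k+1) (e^2 - (norm (x - c))^2)) * ((-2 *R b) \<bullet> x + 2 * (b \<bullet> c)))"
 have "((%y. bumpk k (e^2 - (norm (y - c))^2)) has_derivative D x) (at x)" for x
 proof -
 have s: "((%y. e^2 - (norm (y - c))^2) has_derivative (%h. - 2 * (h \<bullet> (x - c)))) (at x)"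
  unfolding power2_norm_eq_inner
  by (auto intro!: derivative_eq_intros simp: inner_commute)
 have "((%y. bumpk k (e^2 - (norm (y - c))^2)) has_derivative
  (%h. (- 2 * (h \<bullet> (x - c))) * (bumpk (k+2) (e^2 - (norm (x - c))^2) - real k * bumpk (k+1) (e^2 - (norm (x - c))^2)))) (at x)"
  using DERIV_compose_FDERIV[OF DERIV_bumpk s] .
 thus ?thesis
  by (rule has_derivative_eq_rhs) (auto simp: D_def inner_diff_right)
 qed
 moreover have "bsm e c (%x. D x b)" for b
 unfolding D_def by (intro bsm.intros)
 ultimately show ?case by blast
next
 case (const a)
 show ?case by (intro exI[of _ "%x b. 0"]) (auto intro: bsm.intros)
next
 case (inner v)
 show ?case
 by (intro exI[of _ "%x b. v \<bullet> b"]) (auto intro!: bsm.intros derivative_eq_intros)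
next
 case (add f g)
 then obtain D D' where *: "ALL x. (f has_derivative D x) (at x)" "ALL b. bsm e c (%x. D x b)"
 "ALL x. (g has_derivative D' x) (at x)" "ALL b. bsm e c (%x. D' x b)" by blast
 show ?case
 by (intro exI[of _ "%x b. D x b + D' x b"] conjI allI) (use * in \<open>auto intro!: bsm.intros\<close>)
next
 case (mult f g)
 then obtain D D' where *: "ALL x. (f has_derivative D x) (at x)" "ALL b. bsm e c (%x. D x b)"
 "ALL x. (g has_derivative D' x) (at x)" "ALL b. bsm e c (%x. D' x b)" by blast
 show ?case
 by (intro exI[of _ "%x b. f x * D' x b + D x b * g x"] conjI allI) (use * mult in \<open>auto intro!: bsm.intros\<close>)
qed

lemma bsm_differentiable: "bsm e c f ==> f differentiable (at x)"
 using bsm_deriv unfolding differentiable_def by blast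

lemma bsm_partial:
 assumes "bsm e c f"
 shows "bsm e c (partial b f)"
proof -
 obtain D where D: "ALL x. (f has_derivative D x) (at x)" "ALL b. bsm e c (%x. D x b)"
 using bsm_deriv[OF assms] by blast
 have "frechet_derivative f (at x) = D x" for x
 using frechet_derivative_at[OF D(1)[rule_format, of x]] by simp
 hence "partial b f = (%x. D x b)" by (simp add: partial_def fun_eq_iff)
 thus ?thesis using D by simp
qed

lemma bsm_continuous: "bsm e c f ==> continuous_on S f"
 using bsm_differentiable by (meson continuous_at_imp_continuous_on differentiable_imp_continuous_within)

lemma bsm_Ck: "bsm e c f ==> Ck_on k UNIV f"
proof (induction k arbitrary: f)
 case 0 thus ?case using bsm_continuous by auto
next
 case (Suc k) thus ?case by (auto intro: bsm_differentiable bsm_partial)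
qed

lemma has_derivative_line:
 assumes "(f has_derivative D) (at x)"
 shows "DERIV (%t. f (x + t *R b)) 0 :> D b"
proof -
 have "(f has_derivative D) (at (x + 0 *R b))" using assms by simp
 moreover have "((%t. x + t *R b) has_derivative (%t. t *R b)) (at (0::real))"
 by (auto intro!: derivative_eq_intros)
 ultimately have "((%t. f (x + t *R b)) has_derivative (%t. D (t *R b))) (at (0::real))"
 using has_derivative_compose by blast
 moreover have "D (t *R b) = D b * t" for t
 using linear_scale[OF has_derivative_linear[OF assms]] by simp
 ultimately show ?thesis by (simp add: has_field_derivative_def)
qed

lemma partial_line:
 assumes "f differentiable (at x)"
 shows "DERIV (%t. f (x + t *R b)) 0 :> partial b f x"
 using has_derivative_line assms unfolding partial_def frechet_derivative_works by blast

lemma grad_Basis: "b : Basis ==> grad f x \<bullet> b = partial b f x"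
 unfolding grad_def by simp

lemma D2on_C2:
 assumes "!!x. x : S ==> f differentiable (at x)"
 "!!x b. x : S ==> b : Basis ==> partial b f differentiable (at x)"
 shows "D2on S f (grad f) (%b. partial b (partial b f))"
 unfolding D2on_def using assms by (simp add: grad_Basis partial_line)

lemma bsm_D2on: "bsm e c f ==> D2on UNIV f (grad f) (%b. partial b (partial b f))"
 by (intro D2on_C2 bsm_differentiable) (auto intro: bsm_partial)

text \<open>Openness makes the first derivatives agree near \<open>x\<close>, hence also their
  derivatives at \<open>x\<close>. This identifies the second derivatives of a reflected kernel and
  those of a homogeneous function.\<close>

lemma D2on_unique:
 assumes "D2on S f G h" "D2on S f G' h'" "open S" "x : S" "b : Basis"
 shows "h b x = h' b x"
proof -
 have "G y \<bullet> b = G' y \<bullet> b" if "y : S" for y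
 using assms that unfolding D2on_def by (metis DERIV_unique)
 hence "DERIV (%t. (G (x + t *R b) \<bullet> b)) 0 :> h b x"
 "DERIV (%t. (G' (x + t *R b) \<bullet> b)) 0 :> h' b x"
 "!!y. y : S ==> G y \<bullet> b = G' y \<bullet> b"
 using assms unfolding D2on_def by auto
 moreover have "\<forall>\<^sub>F t in nhds (0::real). x + t *R b : S"
 proof -
 have "((%t::real. x + t *R b) ---> x + 0 *R b) (nhds 0)"
  by (intro tendsto_intros filterlim_ident)
 thus ?thesis using topological_tendstoD[OF _ assms(3)] assms(4) by simp
 qed
 moreover from calculation have "\<forall>\<^sub>F t in nhds (0::real). G (x + t *R b) \<bullet> b = G' (x + t *R b) \<bullet> b"
 by (auto elim!: eventually_mono)
 ultimately have "DERIV (%t. (G (x + t *R b) \<bullet> b)) 0 :> h' b x"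
 using DERIV_cong_ev[OF refl _ refl, of "%t. (G (x + t *R b) \<bullet> b)" "%t. (G' (x + t *R b) \<bullet> b)" 0]
 by blast
 thus ?thesis using \<open>DERIV (%t. (G (x + t *R b) \<bullet> b)) 0 :> h b x\<close>
 using DERIV_unique by blast
qed

section \<open>Convolutions with compactly supported kernels\<close>

lemma partial_outside:
 assumes "!!y. y ~: S ==> f y = 0" "closed S" "x ~: S"
 shows "partial b f x = 0"
proof -
 have "(f has_derivative (%h. 0)) (at x)"
 by (rule has_derivative_transform_within_open[of "%_. 0" _ _ _ "- S"]) (use assms in auto)
 thus ?thesis unfolding partial_def using frechet_derivative_at by metis
qed

lemma cont_compact_support_bounded:
 fixes f :: "'a::euclidean_space => real"
 assumes "continuous_on UNIV f" "!!y. y ~: S ==> f y = 0" "compact S"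
 obtains M where "M > 0" "!!y. abs (f y) <= M"
proof -
 have "bounded (f ` S)"
 by (intro compact_imp_bounded compact_continuous_image assms continuous_on_subset[OF assms(1)] subset_UNIV)
 then obtain M where "!!y. y : S ==> abs (f y) <= M" unfolding bounded_iff by auto
 hence "abs (f y) <= max M 1" for y using assms(2)[of y] by (cases "y : S") (simp_all add: le_max_iff_disj)
 thus ?thesis using that[of "max M 1"] by auto
qed

lemma borel_cont_lebesgue:
 fixes f :: "'a::euclidean_space => real"
 assumes "continuous_on UNIV f"
 shows "f : borel_measurable lebesgue"
 using borel_measurable_continuous_onI[OF assms] measurable_completion measurable_lborel2 by blast

lemma integrable_mult_bounded:
 fixes U k :: "'a::euclidean_space => real"
 assumes "integrable lebesgue U" "continuous_on UNIV k" "!!y. abs (k y) <= M"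
 shows "integrable lebesgue (%y. U y * k y)"
proof (rule Bochner_Integration.integrable_bound)
 show "integrable lebesgue (%y. M * U y)" using assms by auto
 show "(%y. U y * k y) : borel_measurable lebesgue"
 using assms borel_cont_lebesgue by (intro borel_measurable_times) auto
 have "abs (U y) * abs (k y) <= abs (U y) * abs M" for y using assms(3)[of y] by (intro mult_left_mono) auto
 thus "AE y in lebesgue. norm (U y * k y) <= norm (M * U y)"
 by (auto simp: abs_mult mult.commute)
qed

text \<open>The second-order Taylor bound on the kernel is uniform, so the difference quotient of
  the convolution misses its limit by at most \<open>M2 * J * abs t\<close>, where \<open>J\<close>
  is the \<open>L^1\<close> norm of \<open>U\<close>. No smoothness of \<open>U\<close>
  enters.\<close>

lemma conv_deriv:
 fixes U :: "'a::euclidean_space => real"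
 assumes f: "bsm e 0 f" "!!y. norm y > e ==> f y = 0" and U: "integrable lebesgue U" and b: "b : Basis"
 shows "DERIV (%t. LINT y|lebesgue. U y * f (x + t *R b - y)) 0 :> (LINT y|lebesgue. U y * partial b f (x - y))"
proof -
 have z: "!!y. y ~: cball 0 e ==> f y = 0" using f(2) by auto
 have z1: "!!y. y ~: cball 0 e ==> partial b f y = 0" using partial_outside[of "cball 0 e" f] z by auto
 have z2: "!!y. y ~: cball 0 e ==> partial b (partial b f) y = 0"
 using partial_outside[of "cball 0 e" "partial b f"] z1 by auto
 note b1 = bsm_partial[OF f(1), of b] and b2 = bsm_partial[OF bsm_partial[OF f(1), of b], of b]
 obtain M0 where M0: "M0 > 0" "!!y. abs (f y) <= M0"
 using cont_compact_support_bounded[OF bsm_continuous[OF f(1)] z compact_cball] by blast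
 obtain M1 where M1: "M1 > 0" "!!y. abs (partial b f y) <= M1"
 using cont_compact_support_bounded[OF bsm_continuous[OF b1] z1 compact_cball] by blast
 obtain M2 where M2: "M2 > 0" "!!y. abs (partial b (partial b f) y) <= M2"
 using cont_compact_support_bounded[OF bsm_continuous[OF b2] z2 compact_cball] by blast
 have T: "abs (f (z + t *R b) - f z - t * partial b f z) <= M2 * t^2" for z t
 proof -
 obtain s where s: "f (z + t *R b) = f z + t * (grad f z \<bullet> b) + partial b (partial b f) (z + s *R b) * t^2 / 2"
  using line_taylor[OF bsm_D2on[OF f(1)] b, of t z] by auto
 have "abs (partial b (partial b f) (z + s *R b) * t^2 / 2) <= M2 * t^2"
  using M2(2)[of "z + s *R b"] mult_mono[of "abs (partial b (partial b f) (z + s *R b))" M2 "t^2 / 2" "t^2"] by (simp add: abs_mult)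
 thus ?thesis using s by (simp add: grad_Basis[OF b])
 qed
 have c0: "continuous_on UNIV (%y. f (w - y))" for w
 by (intro continuous_on_compose2[OF bsm_continuous[OF f(1), of UNIV]] continuous_intros) auto
 have c1: "continuous_on UNIV (%y. partial b f (w - y))" for w
 by (intro continuous_on_compose2[OF bsm_continuous[OF b1, of UNIV]] continuous_intros) auto
 have i0: "integrable lebesgue (%y. U y * f (w - y))" for w
 by (rule integrable_mult_bounded[OF U c0 M0(2)])
 have i1: "integrable lebesgue (%y. U y * partial b f (w - y))" for w
 by (rule integrable_mult_bounded[OF U c1 M1(2)])
 define I where "I = (LINT y|lebesgue. U y * partial b f (x - y))"
 define J where "J = (LINT y|lebesgue. abs (U y))"
 define g where "g = (%t. LINT y|lebesgue. U y * f (x + t *R b - y))"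
 have est: "abs (g t - g 0 - t * I) <= M2 * t^2 * J" for t
 proof -
 have "g t - g 0 - t * I = (LINT y|lebesgue. U y * f (x + t *R b - y) - U y * f (x - y) - t * (U y * partial b f (x - y)))"
  unfolding g_def I_def using i0[of "x + t *R b"] i0[of x] i1[of x] by simp
 also have "abs (...) <= (LINT y|lebesgue. M2 * t^2 * abs (U y))"
 proof (rule order_trans[OF integral_abs_bound], rule integral_mono)
  show "integrable lebesgue (%y. abs (U y * f (x + t *R b - y) - U y * f (x - y) - t * (U y * partial b f (x - y))))"
  by (intro integrable_abs Bochner_Integration.integrable_diff integrable_mult_right i0 i1)
  show "integrable lebesgue (%y. M2 * t^2 * abs (U y))" using U by auto
  fix y
  have "U y * f (x + t *R b - y) - U y * f (x - y) - t * (U y * partial b f (x - y))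
  = U y * (f ((x - y) + t *R b) - f (x - y) - t * partial b f (x - y))"
  by (simp add: algebra_simps)
  thus "abs (U y * f (x + t *R b - y) - U y * f (x - y) - t * (U y * partial b f (x - y))) <= M2 * t^2 * abs (U y)"
  using mult_left_mono[OF T[of "x - y" t], of "abs (U y)"] by (simp add: abs_mult mult.commute)
 qed
 also have "... = M2 * t^2 * J" unfolding J_def by simp
 finally show ?thesis .
 qed
 have "((%t. (g t - g 0) / (t - 0)) ---> I) (at 0)"
 proof (rule LIM_zero_cancel, rule Lim_null_comparison)
 show "\<forall>\<^sub>F t in at 0. norm ((g t - g 0) / (t - 0) - I) <= M2 * J * abs t"
  unfolding eventually_at_filter
 proof (rule always_eventually, intro allI impI)
  fix t :: real assume t: "t ~= 0"
  have "(g t - g 0) / (t - 0) - I = (g t - g 0 - t * I) / t"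
  using t by (simp add: diff_divide_distrib)
  hence "abs ((g t - g 0) / (t - 0) - I) = abs (g t - g 0 - t * I) / abs t"
  by simp
  also have "... <= M2 * t^2 * J / abs t" using est by (simp add: divide_right_mono)
  also have "M2 * t^2 * J / abs t = M2 * \<bar>t\<bar>^2 * J / abs t" by simp
  also have "... = M2 * J * abs t" unfolding power2_eq_square by (simp del: abs_mult_self_eq)
  finally show "norm ((g t - g 0) / (t - 0) - I) <= M2 * J * abs t" by simp
 qed
 show "((%t. M2 * J * abs t) ---> 0) (at 0)"
  by (auto intro!: tendsto_eq_intros)
 qed
 thus ?thesis unfolding has_field_derivative_iff g_def I_def by simp
qed

lemma D2on_conv:
 fixes U :: "'a::euclidean_space => real"
 assumes f: "bsm e 0 f" "!!y. norm y > e ==> f y = 0" and U: "integrable lebesgue U"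
 shows "D2on UNIV (%x. LINT y|lebesgue. U y * f (x - y))
  (%x. SUM b:Basis. (LINT y|lebesgue. U y * partial b f (x - y)) *R b)
  (%b x. LINT y|lebesgue. U y * partial b (partial b f) (x - y))"
proof -
 have *: "!!b y. norm y > e ==> partial b f y = 0"
 using partial_outside[of "cball 0 e" f] f(2) by auto
 have s: "(\<Sum>b'\<in>Basis. g b' *R b') \<bullet> b = (g b :: real)" if "b : Basis" for g and b :: 'a
 using that by simp
 show ?thesis unfolding D2on_def
 proof (intro ballI conjI)
 fix x b :: 'a assume b: "b : Basis"
 show "DERIV (%t. LINT y|lebesgue. U y * f (x + t *R b - y)) 0 :> (SUM b:Basis. (LINT y|lebesgue. U y * partial b f (x - y)) *R b) \<bullet> b"
  unfolding s[OF b] by (rule conv_deriv[OF f U b])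
 show "DERIV (%t. (\<Sum>b'\<in>Basis. (LINT y|lebesgue. U y * partial b' f (x + t *R b - y)) *R b') \<bullet> b) 0 :> (LINT y|lebesgue. U y * partial b (partial b f) (x - y))"
  unfolding s[OF b] by (rule conv_deriv[OF bsm_partial[OF f(1)] * U b])
 qed
qed

lemma laplacian_outside:
 assumes "x ~: closure {y. f y ~= 0}"
 shows "laplacian f x = 0"
proof -
 let ?S = "closure {y. f y ~= 0}"
 have z: "!!y. y ~: ?S ==> f y = 0" using closure_subset[of "{y. f y ~= 0}"] by auto
 have z1: "partial b f y = 0" if "y ~: ?S" for b y by (rule partial_outside[OF z closed_closure that]) auto
 have "partial b (partial b f) x = 0" for b by (rule partial_outside[OF z1 closed_closure assms]) auto
 thus ?thesis unfolding laplacian_def by simp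
qed

section \<open>Distributional equations tested with a radial kernel\<close>

lemma poisson_distr_subset:
 assumes "poisson_distr Om u h" "D <= Om"
 shows "poisson_distr D u h"
 unfolding poisson_distr_def
proof (intro conjI allI impI)
 show "locally_integrable_on D u" "locally_integrable_on D h"
 using assms unfolding poisson_distr_def locally_integrable_on_def by auto
next
 fix ph :: "'a => real" assume t: "test_function D ph"
 hence sub: "closure {x. ph x ~= 0} <= D" and t': "test_function Om ph"
 using assms(2) unfolding test_function_def by auto
 have z: "ph x = 0" "laplacian ph x = 0" if "x ~: D" for x
 using laplacian_outside[of x ph] that sub closure_subset[of "{x. ph x ~= 0}"] by auto
 have e: "(LINT x:D|lebesgue. v x * w x) = (LINT x:Om|lebesgue. v x * w x)"
 if "!!x. x ~: D ==> w x = 0" for v w :: "'a => real"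
 unfolding set_lebesgue_integral_def
 by (rule Bochner_Integration.integral_cong[OF refl]) (use assms(2) that in \<open>auto simp: indicator_def\<close>)
 show "- (LINT x:D|lebesgue. u x * laplacian ph x) = (LINT x:D|lebesgue. h x * ph x)"
 proof -
 have "(LINT x:D|lebesgue. u x * laplacian ph x) = (LINT x:Om|lebesgue. u x * laplacian ph x)"
  by (rule e) (rule z(2))
 moreover have "(LINT x:D|lebesgue. h x * ph x) = (LINT x:Om|lebesgue. h x * ph x)"
  by (rule e) (rule z(1))
 moreover have "- (LINT x:Om|lebesgue. u x * laplacian ph x) = (LINT x:Om|lebesgue. h x * ph x)"
  using assms(1) t' unfolding poisson_distr_def by blast
 ultimately show ?thesis by simp
 qed
qed

lemma set_lint_minus: "(LINT x:D|M. - f x) = - (LINT x:D|M. (f x::real))"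
 unfolding set_lebesgue_integral_def by simp

lemma poisson_distr_minus:
 assumes "poisson_distr D u h"
 shows "poisson_distr D (%x. - u x) (%x. - h x)"
 using assms unfolding poisson_distr_def locally_integrable_on_def set_integrable_def
 by (simp add: set_lint_minus)

definition kern :: "real => 'a::euclidean_space => real" where
 "kern e z = bumpk 0 (e^2 - (norm z)^2)"

lemma bsm_kern_at: "bsm e c (%y. kern e (y - c))"
 unfolding kern_def by (rule bsm.base)

lemma bsm_kern: "bsm e 0 (kern e)"
 using bsm_kern_at[of e 0] by simp

lemma kern_nonneg: "kern e z >= 0"
 by (simp add: kern_def bumpk_nonneg)

lemma kern_minus: "kern e (x - y) = kern e (y - x)"
 by (simp add: kern_def norm_minus_commute)

lemma kern_0: "e >= 0 ==> norm z >= e ==> kern e z = 0"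
 by (simp add: kern_def bumpk_0)

lemma kern_pos: "norm z < e ==> kern e z > 0"
 by (simp add: kern_def bumpk_pos power_strict_mono)

lemma kern_bounded: "e >= 0 ==> EX M. ALL z::'a::euclidean_space. abs (kern e z) <= M"
 using cont_compact_support_bounded[OF bsm_continuous[OF bsm_kern[of e]], of "cball (0::'a) e"] kern_0[of e]
 by (metis compact_cball dist_0_norm linear mem_cball)

lemma kern_cont: "continuous_on S (kern e)"
 using bsm_continuous[OF bsm_kern] .

lemma lborel_integral_translate:
 fixes f :: "'a::euclidean_space => real"
 assumes "f : borel_measurable borel"
 shows "(LINT y|lborel. f (c + y)) = (LINT y|lborel. f y)"
 using integral_distr[of "(+) c" lborel borel f] assms by (simp add: lborel_distr_plus)

lemma lebesgue_integral_translate: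
 fixes f :: "'a::euclidean_space => real"
 assumes f: "f : borel_measurable borel"
 shows "(LINT y|lebesgue. f (c + y)) = (LINT y|lebesgue. f y)"
proof -
 have "(%y. f (c + y)) : borel_measurable borel" using f by simp
 thus ?thesis using lborel_integral_translate[OF f] f by (simp add: integral_completion)
qed

lemma kern_integrable:
 assumes "e > 0"
 shows "integrable lebesgue (%y::'a::euclidean_space. kern e (x - y))"
proof -
 have i: "integrable lebesgue (indicat_real (cball x e))"
 using emeasure_bounded_finite[of "cball x e"] by auto
 obtain M where M: "ALL z::'a. abs (kern e z) <= M" using kern_bounded[of e] assms by auto
 have "integrable lebesgue (%y. indicat_real (cball x e) y * kern e (x - y))"
 by (rule integrable_mult_bounded[OF i, where M=M])
  (use M in \<open>auto intro!: continuous_on_compose2[OF kern_cont[of UNIV]] continuous_intros\<close>)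
 moreover have "indicat_real (cball x e) y * kern e (x - y) = kern e (x - y)" for y
 using kern_0[of e "x - y"] assms by (auto simp: indicator_def dist_norm)
 ultimately show ?thesis by simp
qed

text \<open>The total mass of the kernel, divided out when it is used as a mollifier. The type
  argument is needed because \<open>e\<close> alone does not determine the space.\<close>

definition kernc :: "'a::euclidean_space itself => real => real" where
 "kernc T e = (LINT y|lebesgue. kern e (y::'a))"

lemma kern_integral:
 fixes x :: "'a::euclidean_space"
 shows "(LINT y|lebesgue. kern e (x - y)) = kernc TYPE('a) e"
proof -
 have "(LINT y|lebesgue. kern e (x - y)) = (LINT y|lebesgue. kern e (- x + y))"
 by (simp add: kern_minus[of e x])
 also have "... = (LINT y|lebesgue. kern e (y::'a))"
 by (rule lebesgue_integral_translate[of "kern e" "- x"]) (rule borel_measurable_continuous_onI[OF kern_cont])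
 finally show ?thesis unfolding kernc_def .
qed

lemma kernc_pos:
 assumes "e > 0"
 shows "kernc TYPE('a::euclidean_space) e > 0"
proof (rule ccontr)
 assume "~ ?thesis"
 moreover have "kernc TYPE('a) e >= 0" unfolding kernc_def by (simp add: kern_nonneg)
 ultimately have z: "kernc TYPE('a) e = 0" by simp
 have i: "integrable lebesgue (kern e :: 'a => real)"
 using kern_integrable[OF assms, of "0::'a"] by (simp add: kern_def[abs_def])
 have "AE y in lebesgue. kern e (y::'a) = 0"
 using z integral_nonneg_eq_0_iff_AE[OF i] unfolding kernc_def by (simp add: kern_nonneg)
 hence "AE y in lebesgue. y ~: ball (0::'a) e"
 by eventually_elim (use kern_pos in fastforce)
 hence "ball (0::'a) e : null_sets lebesgue"
 using AE_iff_null_sets[of "ball (0::'a) e" lebesgue] by auto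
 thus False using open_not_negligible[of "ball (0::'a) e"] assms
 by (auto simp: negligible_iff_null_sets)
qed

lemma test_function_kern:
 assumes "e > 0" "cball x e <= D"
 shows "test_function D (%y. kern e (y - x))"
proof -
 have "{y. kern e (y - x) ~= 0} <= cball x e"
 proof
 fix y assume "y : {y. kern e (y - x) ~= 0}"
 thus "y : cball x e" using kern_0[of e "y - x"] assms(1)
  by (cases "e <= norm (y - x)") (auto simp: dist_norm norm_minus_commute)
 qed
 hence s: "closure {y. kern e (y - x) ~= 0} <= cball x e"
 by (simp add: closure_minimal)
 moreover have "compact (closure {y. kern e (y - x) ~= 0})"
 using s bounded_subset compact_eq_bounded_closed by blast
 ultimately show ?thesis unfolding test_function_def
 using bsm_Ck[OF bsm_kern_at] assms(2) by blast
qed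

text \<open>The equation is tested in \<open>y\<close>, while the convolution is differentiated in
  \<open>x\<close>. The reflection of \<open>y\<close> to \<open>x - y\<close> exchanges the two,
  and second derivatives are even under it.\<close>

lemma laplacian_kern:
 fixes x :: "'a::euclidean_space"
 shows "laplacian (%y. kern e (y - x)) y = (SUM b:Basis. partial b (partial b (kern e)) (x - y))"
proof -
 have "D2on {y. y + x : {y. -1 *R y : UNIV}} (%y. kern e (-1 *R (y + - x))) (%y. -1 *R grad (kern e) (-1 *R (y + - x)))
  (%b y. (-1)^2 * partial b (partial b (kern e)) (-1 *R (y + - x)))"
 using D2on_shift[OF D2on_scale[OF bsm_D2on[OF bsm_kern], of "-1"], of "- x"] by simp
 hence 1: "D2on UNIV (%y. kern e (x - y)) (%y. - grad (kern e) (x - y))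
  (%b y. partial b (partial b (kern e)) (x - y))" by simp
 have 2: "D2on UNIV (%y. kern e (x - y)) (grad (%y. kern e (y - x)))
  (%b. partial b (partial b (%y. kern e (y - x))))"
 using bsm_D2on[OF bsm_kern_at, of e x] by (simp add: kern_minus[of e x])
 show ?thesis unfolding laplacian_def using D2on_unique[OF 2 1] by simp
qed

text \<open>The left side is the Laplacian at \<open>x\<close> of the convolution of
  \<open>u\<close>, so a mollified solution is classical at points whose \<open>e\<close>-ball lies
  in \<open>D\<close>, with the mollified right-hand side.\<close>

lemma poisson_kernel:
 fixes u h :: "'a::euclidean_space => real"
 assumes p: "poisson_distr D u h" and e: "e > 0" "cball x e <= D"
 and i: "integrable lebesgue (%y. indicator D y * u y)"
 shows "(SUM b:Basis. LINT y|lebesgue. (indicator D y * u y) * partial b (partial b (kern e)) (x - y))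
  = - (LINT y|lebesgue. indicator D y * h y * kern e (x - y))"
proof -
 have i2: "integrable lebesgue (%y. (indicator D y * u y) * partial b (partial b (kern e)) (x - y))" for b
 proof -
 have z0: "!!z::'a. z ~: cball 0 e ==> kern e z = 0" using e by (intro kern_0) auto
 have z1: "!!z::'a. z ~: cball 0 e ==> partial b (kern e) z = 0"
  using partial_outside[of "cball (0::'a) e" "kern e"] z0 by blast
 have z: "!!z::'a. z ~: cball 0 e ==> partial b (partial b (kern e)) z = 0"
  using partial_outside[of "cball (0::'a) e" "partial b (kern e)"] z1 by blast
 note c = bsm_continuous[OF bsm_partial[OF bsm_partial[OF bsm_kern[of e]]], of UNIV b b]
 obtain M where M: "M > 0" "!!z. abs (partial b (partial b (kern e)) z) <= M"
  using cont_compact_support_bounded[OF c z compact_cball] by blast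
 have "continuous_on UNIV (%y. partial b (partial b (kern e)) (x - y))"
  by (intro continuous_on_compose2[OF c] continuous_intros) auto
 thus ?thesis using integrable_mult_bounded[OF i _ M(2)] by blast
 qed
 have "(SUM b:Basis. LINT y|lebesgue. (indicator D y * u y) * partial b (partial b (kern e)) (x - y))
  = (LINT y|lebesgue. (SUM b:Basis. (indicator D y * u y) * partial b (partial b (kern e)) (x - y)))"
 using i2 by simp
 also have "... = (LINT y:D|lebesgue. u y * laplacian (%y. kern e (y - x)) y)"
 unfolding set_lebesgue_integral_def laplacian_kern
 by (simp add: sum_distrib_left mult.assoc)
 also have "... = - (LINT y:D|lebesgue. h y * kern e (y - x))"
 using p test_function_kern[OF e] unfolding poisson_distr_def by auto
 also have "(LINT y:D|lebesgue. h y * kern e (y - x)) = (LINT y|lebesgue. indicator D y * h y * kern e (x - y))"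
 unfolding set_lebesgue_integral_def by (simp add: kern_minus[of e x] mult.assoc)
 finally show ?thesis .
qed

section \<open>The comparison principle\<close>

text \<open>Subsolutions of \<open>-\<Delta>u \<le> q\<close> in a sense that covers both classical and distributional ones
 and is stable under addition.\<close>

definition asub :: "'a::euclidean_space set => ('a => real) => ('a => real) => bool" where
 "asub D u q \<longleftrightarrow> (ALL K e. compact K & K <= D & e > 0 -->
  (EX S v G l. open S & K <= S & has_lap S v G l & continuous_on K v &
  (ALL x:K. abs (v x - u x) <= e & - l x <= q x + e)))"

lemma asubE:
 assumes "asub D u q" "compact K" "K <= D" "e > 0"
 obtains S v G l where "open S" "K <= S" "has_lap S v G l" "continuous_on K v"
 "!!x. x : K ==> abs (v x - u x) <= e" "!!x. x : K ==> - l x <= q x + e"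
proof -
 have "EX S v G l. open S & K <= S & has_lap S v G l & continuous_on K v &
  (ALL x:K. abs (v x - u x) <= e & - l x <= q x + e)"
 using assms unfolding asub_def by simp
 thus ?thesis using that by auto
qed

lemma asub_mono: "asub D u q ==> D' <= D ==> (!!x. x : D' ==> q x <= q' x) ==> asub D' u q'"
 unfolding asub_def by (smt (verit, best) subsetD subset_trans)

lemma asub_classical:
 assumes "open D" "has_lap D u G l" "continuous_on D u" "!!x. x : D ==> - l x <= q x"
 shows "asub D u q"
 unfolding asub_def
proof (intro allI impI)
 fix K :: "'a set" and e :: real assume K: "compact K & K <= D & e > 0"
 hence "continuous_on K u" "ALL x:K. abs (u x - u x) <= e & - l x <= q x + e"
 using assms by (auto intro: continuous_on_subset simp: add_increasing2)
 thus "EX S v G l. open S & K <= S & has_lap S v G l & continuous_on K v &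
  (ALL x:K. abs (v x - u x) <= e & - l x <= q x + e)"
 using assms K by blast
qed

lemma asub_add:
 assumes "asub D u q" "asub D u' q'"
 shows "asub D (%x. u x + u' x) (%x. q x + q' x)"
 unfolding asub_def
proof (intro allI impI)
 fix K :: "'a set" and e :: real assume K: "compact K & K <= D & e > 0"
 hence K': "compact K" "K <= D" "e/2 > 0" by auto
 obtain S v G l where 1: "open S" "K <= S" "has_lap S v G l" "continuous_on K v"
  "!!x. x : K ==> abs (v x - u x) <= e/2" "!!x. x : K ==> - l x <= q x + e/2"
 by (rule asubE[OF assms(1) K']) blast
 obtain S' v' G' l' where 2: "open S'" "K <= S'" "has_lap S' v' G' l'" "continuous_on K v'"
  "!!x. x : K ==> abs (v' x - u' x) <= e/2" "!!x. x : K ==> - l' x <= q' x + e/2"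
 by (rule asubE[OF assms(2) K']) blast
 have "has_lap (S Int S') (%x. v x + v' x) (%x. G x + G' x) (%x. l x + l' x)"
 by (intro has_lap_add has_lap_subset[OF 1(3)] has_lap_subset[OF 2(3)]) auto
 moreover have "ALL x:K. abs ((v x + v' x) - (u x + u' x)) <= e & - (l x + l' x) <= (q x + q' x) + e"
 proof
 fix x assume "x : K"
 from 1(5,6)[OF this] 2(5,6)[OF this]
 show "abs ((v x + v' x) - (u x + u' x)) <= e & - (l x + l' x) <= (q x + q' x) + e"
  by (intro conjI; linarith)
 qed
 moreover have "continuous_on K (%x. v x + v' x)" using 1 2 by (intro continuous_intros)
 ultimately show "EX S v G l. open S & K <= S & has_lap S v G l & continuous_on K v &
  (ALL x:K. abs (v x - (u x + u' x)) <= e & - l x <= q x + q' x + e)"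
 using 1(1,2) 2(1,2) by blast
qed

lemma asub_scale:
 assumes "asub D u q" "r > 0" "c > 0"
 shows "asub {x. r *R x : D} (%x. c * u (r *R x)) (%x. c * (r^2 * q (r *R x)))"
 unfolding asub_def
proof (intro allI impI)
 fix K :: "'a set" and e :: real assume K: "compact K & K <= {x. r *R x : D} & e > 0"
 define d where "d = min (e / c) (e / (c * r^2))"
 have d: "d > 0" "c * d <= e" "c * r^2 * d <= e"
 using K assms by (auto simp: d_def min_def field_simps)
 let ?K = "(%x. r *R x) ` K"
 have K': "compact ?K" "?K <= D" "d > 0" using K d by (auto intro: compact_scaling)
 obtain S v G l where 1: "open S" "?K <= S" "has_lap S v G l" "continuous_on ?K v"
  "!!x. x : ?K ==> abs (v x - u x) <= d" "!!x. x : ?K ==> - l x <= q x + d"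
 by (rule asubE[OF assms(1) K']) blast
 have o: "open {x. r *R x : S}" using open_vimage[OF 1(1), of "%x. r *R x"]
 by (simp add: vimage_def continuous_intros)
 have l: "has_lap {x. r *R x : S} (%x. c * v (r *R x)) (%x. c *R r *R G (r *R x)) (%x. c * (r^2 * l (r *R x)))"
 by (rule has_lap_cmul[OF has_lap_scale[OF 1(3)]])
 have "abs (c * v (r *R x) - c * u (r *R x)) <= e & - (c * (r^2 * l (r *R x))) <= c * (r^2 * q (r *R x)) + e" if "x : K" for x
 proof -
 have *: "abs (v (r *R x) - u (r *R x)) <= d" "- l (r *R x) <= q (r *R x) + d" using 1(5,6) that by auto
 have "abs (c * v (r *R x) - c * u (r *R x)) = c * abs (v (r *R x) - u (r *R x))"
  using assms(3) by (simp add: right_diff_distrib[symmetric] abs_mult del: right_diff_distrib)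
 also have "... <= c * d" using *(1) assms(3) by auto
 finally have a: "abs (c * v (r *R x) - c * u (r *R x)) <= e" using d by simp
 have "c * r^2 * (- l (r *R x)) <= c * r^2 * (q (r *R x) + d)"
  using *(2) assms by (intro mult_left_mono) auto
 hence "- (c * (r^2 * l (r *R x))) <= c * (r^2 * q (r *R x)) + e"
  using d(3) by (simp add: algebra_simps)
 thus ?thesis using a by simp
 qed
 moreover have "continuous_on K (%x. c * v (r *R x))"
 by (intro continuous_intros continuous_on_compose2[OF 1(4)]) auto
 ultimately show "EX S v G l. open S & K <= S & has_lap S v G l & continuous_on K v &
  (ALL x:K. abs (v x - c * u (r *R x)) <= e & - l x <= c * (r^2 * q (r *R x)) + e)"
 using o l 1(2) by blast
qed

text \<open>The right-hand side \<open>h\<close> may be merely measurable. Mollification replaces it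
  by averages over small balls; these are at most the supremum of \<open>q\<close> there, which
  uniform continuity puts within \<open>ep\<close> of \<open>q x\<close>.\<close>

lemma asub_poisson:
 fixes u h :: "'a::euclidean_space => real"
 assumes p: "poisson_distr Om u h" and D: "open D" "D <= Om" and cu: "continuous_on D u"
 and cq: "continuous_on D q" and hq: "!!x. x : D ==> h x <= q x"
 shows "asub D u q"
 unfolding asub_def
proof (intro allI impI)
 fix K :: "'a set" and ep :: real assume K: "compact K & K <= D & ep > 0"
 obtain e0 where e0: "e0 > 0" "(\<Union>x\<in>K. cball x e0) <= D"
 using compact_subset_open_imp_cball_epsilon_subset[of K D] K D by blast
 define K1 where "K1 = (\<Union>x\<in>K. cball x e0)"
 have K1: "compact K1" "K1 <= D" using compact_minkowski_sum_cball e0 K unfolding K1_def by auto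
 have "uniformly_continuous_on K1 u" "uniformly_continuous_on K1 q"
 using K1 cu cq compact_uniformly_continuous continuous_on_subset by blast+
 then obtain d1 d2 where d12: "d1 > 0" "d2 > 0"
  "!!x y. x : K1 ==> y : K1 ==> dist x y < d1 ==> dist (u x) (u y) < ep"
  "!!x y. x : K1 ==> y : K1 ==> dist x y < d2 ==> dist (q x) (q y) < ep"
 using K unfolding uniformly_continuous_on_def by (metis dist_commute)
 define e where "e = min e0 (min d1 d2) / 2"
 have e: "e > 0" "e < e0" "e < d1" "e < d2" using e0 d12 by (auto simp: e_def)
 \<comment> \<open>The equation is restricted to this open collar of \<open>K\<close>: it lies in
   the compact set \<open>K1\<close>, so \<open>u\<close> and \<open>h\<close> are integrable on it,
   which need not hold on \<open>D\<close>.\<close>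
 define D0 where "D0 = (\<Union>x\<in>K. ball x e0)"
 have D0: "open D0" "D0 <= K1" by (auto simp: D0_def K1_def)
 have ball: "cball x e <= D0" if "x : K" for x using that e by (force simp: D0_def)
 have pD: "poisson_distr D0 u h" using poisson_distr_subset[OF p] D0 K1 D by blast
 have "set_integrable lebesgue K1 u" "set_integrable lebesgue K1 h"
 using p K1 D unfolding poisson_distr_def locally_integrable_on_def by auto
 hence "set_integrable lebesgue D0 u" "set_integrable lebesgue D0 h"
 using set_integrable_subset[of lebesgue K1 _ D0] D0 by auto
 hence iu: "integrable lebesgue (%y. indicator D0 y * u y)"
 and ih: "integrable lebesgue (%y. indicator D0 y * h y)"
 unfolding set_integrable_def by auto
 define c where "c = kernc TYPE('a) e"
 have c: "c > 0" using kernc_pos[OF e(1)] by (simp add: c_def)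
 obtain M where M: "ALL z::'a. abs (kern e z) <= M" using kern_bounded[of e] e by auto
 have ck: "continuous_on UNIV (%y. kern e (x - y))" for x :: 'a
 by (intro continuous_on_compose2[OF kern_cont[of UNIV]] continuous_intros) auto
 note ku = integrable_mult_bounded[OF iu ck M[rule_format]]
 note kh = integrable_mult_bounded[OF ih ck M[rule_format]]
 have kc: "integrable lebesgue (%y. a * kern e (x - y))" for x :: 'a and a
 using kern_integrable[OF e(1), of x] by simp
 have Ikc: "(LINT y|lebesgue. a * kern e (x - y)) = a * c" for x :: 'a and a
 using kern_integral[of e x] by (simp add: c_def)
 define v where "v = (%x. (1 / c) * (LINT y|lebesgue. (indicator D0 y * u y) * kern e (x - y)))"
 define l where "l = (%x. (1 / c) * (SUM b:Basis. LINT y|lebesgue. (indicator D0 y * u y) * partial b (partial b (kern e)) (x - y)))"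
 obtain G where lap: "has_lap UNIV v G l"
 proof -
 have z: "kern e y = 0" if "norm y > e" for y :: 'a using kern_0[of e y] that e by simp
 have "has_lap UNIV (%x. LINT y|lebesgue. (indicator D0 y * u y) * kern e (x - y))
  (%x. SUM b:Basis. (LINT y|lebesgue. (indicator D0 y * u y) * partial b (kern e) (x - y)) *R b)
  (%x. SUM b:Basis. LINT y|lebesgue. (indicator D0 y * u y) * partial b (partial b (kern e)) (x - y))"
  unfolding has_lap_def by (rule exI, rule conjI[OF D2on_conv[OF bsm_kern z iu]]) auto
 from has_lap_cmul[OF this, of "1/c"] show ?thesis using that unfolding v_def l_def by blast
 qed
 have cont: "continuous_on UNIV v"
 unfolding continuous_on_sequentially
 proof (intro allI ballI impI)
 fix X :: "nat => 'a" and a assume X: "(ALL n. X n : UNIV) & X ----> a"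
 have "(%n. LINT y|lebesgue. (indicator D0 y * u y) * kern e (X n - y)) ---->
  (LINT y|lebesgue. (indicator D0 y * u y) * kern e (a - y))"
 proof (rule integral_dominated_convergence[where w="%y. M * abs (indicator D0 y * u y)"])
  show "AE y in lebesgue. (%n. (indicator D0 y * u y) * kern e (X n - y)) ----> (indicator D0 y * u y) * kern e (a - y)"
  proof (rule AE_I2)
  fix y
  have "(%n. kern e (X n - y)) ----> kern e (a - y)"
   using X by (intro continuous_on_tendsto_compose[OF kern_cont[of UNIV]] tendsto_intros) auto
  thus "(%n. (indicator D0 y * u y) * kern e (X n - y)) ----> (indicator D0 y * u y) * kern e (a - y)"
   by (intro tendsto_intros)
  qed
  fix n
  show "AE y in lebesgue. norm ((indicator D0 y * u y) * kern e (X n - y)) <= M * abs (indicator D0 y * u y)"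
  proof (rule AE_I2)
  fix y
  have "abs (kern e (X n - y)) * abs (indicator D0 y * u y) <= M * abs (indicator D0 y * u y)"
   using M by (intro mult_right_mono) auto
  thus "norm ((indicator D0 y * u y) * kern e (X n - y)) <= M * abs (indicator D0 y * u y)"
   by (simp add: abs_mult mult_ac)
  qed
 qed (use ku iu in \<open>auto intro: borel_measurable_integrable\<close>)
 thus "(v \<circ> X) ----> v a" unfolding v_def comp_def by (intro tendsto_intros)
 qed
 have "abs (v x - u x) <= ep & - l x <= q x + ep" if x: "x : K" for x
 proof
 have xK1: "x : K1" using x e0 by (force simp: K1_def)
 have near: "y : D0" "abs (u x - u y) <= ep" "q y <= q x + ep" if "kern e (x - y) ~= 0" for y
 proof -
  have "norm (x - y) < e" using kern_0[of e "x - y"] that e by fastforce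
  hence y: "y : cball x e" "dist x y < d1" "dist x y < d2" using e by (auto simp: dist_norm)
  thus "y : D0" using ball[OF x] by auto
  hence "y : K1" using D0 by auto
  with y d12(3,4)[OF xK1 this] show "abs (u x - u y) <= ep" "q y <= q x + ep" by (auto simp: dist_real_def)
 qed
 have "v x - u x = (1 / c) * ((LINT y|lebesgue. (indicator D0 y * u y) * kern e (x - y)) - (LINT y|lebesgue. u x * kern e (x - y)))"
  unfolding v_def Ikc using c by (simp add: field_simps)
 also have "... = (1 / c) * (LINT y|lebesgue. (indicator D0 y * u y) * kern e (x - y) - u x * kern e (x - y))"
  using ku kc by auto
 finally have e1: "abs (v x - u x) = (1 / c) * abs (LINT y|lebesgue. (indicator D0 y * u y) * kern e (x - y) - u x * kern e (x - y))"
  using c by auto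
 have e2: "abs (LINT y|lebesgue. (indicator D0 y * u y) * kern e (x - y) - u x * kern e (x - y)) <= (LINT y|lebesgue. ep * kern e (x - y))"
 proof (rule order_trans[OF integral_abs_bound], rule integral_mono)
  show "integrable lebesgue (%y. abs ((indicator D0 y * u y) * kern e (x - y) - u x * kern e (x - y)))"
  by (intro integrable_abs Bochner_Integration.integrable_diff ku kc)
  fix y
  show "abs ((indicator D0 y * u y) * kern e (x - y) - u x * kern e (x - y)) <= ep * kern e (x - y)"
  proof (cases "kern e (x - y) = 0")
  case False
  have "abs ((indicator D0 y * u y) * kern e (x - y) - u x * kern e (x - y)) = abs (u x - u y) * kern e (x - y)"
   using near(1)[OF False] kern_nonneg[of e "x - y"]
   by (simp add: left_diff_distrib[symmetric] abs_mult abs_minus_commute del: left_diff_distrib)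
  thus ?thesis using near(2)[OF False] kern_nonneg[of e "x - y"] by (simp add: mult_right_mono)
  qed simp
 qed (rule kc)
 show "abs (v x - u x) <= ep" using e2 c unfolding e1 Ikc by (simp add: field_simps)
 have "- l x = (1 / c) * (LINT y|lebesgue. indicator D0 y * h y * kern e (x - y))"
  unfolding l_def poisson_kernel[OF pD e(1) ball[OF x] iu] by simp
 also have "... <= (1 / c) * (LINT y|lebesgue. (q x + ep) * kern e (x - y))"
 proof (intro mult_left_mono integral_mono kh kc)
  fix y
  show "indicator D0 y * h y * kern e (x - y) <= (q x + ep) * kern e (x - y)"
  proof (cases "kern e (x - y) = 0")
  case False
  have "y : D" using near(1)[OF False] D0 K1 by auto
  hence "h y <= q x + ep" using hq near(3)[OF False] by fastforce
  thus ?thesis using near(1)[OF False] kern_nonneg[of e "x - y"] by (simp add: mult_right_mono)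
  qed simp
 qed (use c in simp)
 also have "... = q x + ep" unfolding Ikc using c by simp
 finally show "- l x <= q x + ep" .
 qed
 thus "EX S v G l. open S & K <= S & has_lap S v G l & continuous_on K v &
  (ALL x:K. abs (v x - u x) <= ep & - l x <= q x + ep)"
 using lap continuous_on_subset[OF cont subset_UNIV] by blast
qed

text \<open>A pointwise supersolution condition: a function with a Laplacian lies above
  \<open>V\<close>, meets it at \<open>x\<close>, and has negative Laplacian at least
  \<open>m\<close> there. It passes to minima, makes sense where \<open>V\<close> is not
  differentiable, and suffices because a maximum of \<open>u - V\<close> at \<open>x\<close> is also
  one of \<open>u - ps\<close>.\<close>

definition touch_above :: "('a::euclidean_space => real) => 'a => real => bool" where
 "touch_above V x m \<longleftrightarrow> (EX S ps G l. open S & x : S & has_lap S ps G l & ps x = V x &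
  (ALL y:S. V y <= ps y) & m <= - l x)"

text \<open>The subsolution property is requested only where \<open>u\<close> exceeds
  \<open>V\<close>, so a right-hand side that is singular in \<open>u\<close> is met only where the
  barrier bounds it.\<close>

lemma comparison:
 fixes u V :: "'a::euclidean_space => real"
 assumes D: "open D" "bounded D" and cu: "continuous_on (closure D) u"
 and cV: "continuous_on (closure D) V"
 and fr: "!!x. x : frontier D ==> u x <= V x"
 and as: "asub {x:D. V x < u x} u q"
 and tV: "!!x. x : D ==> V x < u x ==> touch_above V x (q x)"
 and x0: "x0 : D"
 shows "u x0 <= V x0"
proof (rule ccontr)
 assume "~ ?thesis"
 hence gt: "u x0 - V x0 > 0" by simp
 define n where "n = real DIM('a)"
 have n: "n > 0" by (simp add: n_def)
 obtain R where R: "R > 0" "!!x. x : closure D ==> norm x <= R"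
 using bounded_closure[OF D(2)] unfolding bounded_pos by blast
 \<comment> \<open>The paraboloid \<open>et * (R^2 - (norm x)^2)\<close> makes the barrier strict by
   \<open>2 * n * et\<close> and uses up at most half of the gap at \<open>x0\<close>.\<close>
 define et where "et = (u x0 - V x0) / (2 * R^2)"
 have et: "et > 0" "et * R^2 = (u x0 - V x0) / 2" using gt R(1) by (auto simp: et_def)
 define f where "f = (%x. u x - V x - et * (R^2 - (norm x)^2))"
 have pos: "et * (R^2 - (norm x)^2) >= 0" if "x : closure D" for x
 using R(2)[OF that] et(1) by (simp add: power_mono)
 have cf: "continuous_on (closure D) f"
 unfolding f_def using cu cV by (intro continuous_intros)
 have cpt: "compact (closure D)" using D(2) by auto
 have x0c: "x0 : closure D" using x0 closure_subset by blast
 obtain xm where xm: "xm : closure D" "!!x. x : closure D ==> f x <= f xm"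
 proof -
 have "closure D ~= {}" using x0c by auto
 from continuous_attains_sup[OF cpt this cf] obtain y where "y : closure D" "ALL x:closure D. f x <= f y" by auto
 thus ?thesis using that by simp
 qed
 define m where "m = f xm"
 have "f x0 >= (u x0 - V x0) / 2"
 proof -
 have "et * (R^2 - (norm x0)^2) <= et * R^2" using et(1) by auto
 thus ?thesis unfolding f_def et(2) by simp
 qed
 moreover have "(u x0 - V x0) / 2 > 0" using gt by simp
 ultimately have m: "m > 0" using xm(2)[OF x0c] unfolding m_def by auto
 define K where "K = {x : closure D. m / 2 <= f x}"
 have Kc: "compact K"
 proof -
 have "closed (closure D Int f -` {m/2..})"
  by (rule continuous_closed_preimage[OF cf]) auto
 moreover have "K = closure D Int (closure D Int f -` {m/2..})" by (auto simp: K_def)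
 ultimately show ?thesis using compact_Int_closed[OF cpt] by metis
 qed
 have KD: "K <= {x:D. V x < u x}"
 proof
 fix x assume "x : K"
 hence x: "x : closure D" "f x >= m/2" by (auto simp: K_def)
 hence gt: "u x > V x" using pos[OF x(1)] m unfolding f_def by simp
 hence "x ~: frontier D" using fr by force
 thus "x : {x:D. V x < u x}" using x(1) gt closure_Un_frontier[of D] by auto
 qed
 \<comment> \<open>The bound \<open>m/16\<close> keeps the maximum of the approximated difference
   inside the open set where \<open>f\<close> exceeds \<open>m/2\<close>; the bound
   \<open>n * et\<close> keeps the approximation error below the strictness
   \<open>2 * n * et\<close>.\<close>
 define e where "e = min (m/16) (n * et)"
 have e: "e > 0" "e <= m/16" "e <= n * et" using m n et by (auto simp: e_def)
 obtain S v G l where S: "open S" "K <= S" "has_lap S v G l" "continuous_on K v"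
  "!!x. x : K ==> abs (v x - u x) <= e" "!!x. x : K ==> - l x <= q x + e"
 by (rule asubE[OF as Kc KD e(1)]) blast
 define F where "F = (%x. v x - V x - et * (R^2 - (norm x)^2))"
 have KcD: "K <= closure D" by (auto simp: K_def)
 have "continuous_on K F"
 unfolding F_def using S(4) continuous_on_subset[OF cV KcD] by (intro continuous_intros)
 moreover have xmK: "xm : K" using xm m by (simp add: K_def m_def)
 ultimately obtain x1 where x1: "x1 : K" "!!x. x : K ==> F x <= F x1"
 using continuous_attains_sup[OF Kc, of F] by auto
 have Ff: "abs (F x - f x) <= m / 16" if "x : K" for x
 using S(5)[OF that] e unfolding F_def f_def by auto
 have fx1: "f x1 > m / 2"
 using Ff[OF xmK] Ff[OF x1(1)] x1(2)[OF xmK] m unfolding m_def[symmetric] by linarith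
 have x1D: "x1 : D" "V x1 < u x1" using x1(1) KD by auto
 obtain S' ps G' l' where S': "open S'" "x1 : S'" "has_lap S' ps G' l'" "ps x1 = V x1"
  "ALL y:S'. V y <= ps y" "q x1 <= - l' x1"
 using tV[OF x1D] unfolding touch_above_def by blast
 define T where "T = {x:D. f x : {m/2<..}}"
 have oT: "open T"
 proof -
 have "continuous_on D f" using cf closure_subset continuous_on_subset by blast
 hence "open (D Int f -` {m/2<..})" using D(1) by (intro continuous_open_preimage) auto
 moreover have "T = D Int f -` {m/2<..}" by (auto simp: T_def)
 ultimately show ?thesis by metis
 qed
 have TK: "T <= K" using closure_subset[of D] by (auto simp: T_def K_def)
 define N where "N = S Int S' Int T"
 have N: "open N" "x1 : N" using S(1,2) S'(1,2) oT x1D fx1 x1(1) by (auto simp: N_def T_def)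
 define P where "P = (%x. v x - ps x + (et * (norm (x - 0))^2 - et * R^2))"
 have P: "has_lap N P (%x. G x - G' x + (et *R (2 *R (x - 0)) - 0)) (%x. l x - l' x + (et * (2 * n) - 0))"
 unfolding P_def n_def
 by (intro has_lap_add has_lap_diff has_lap_cmul has_lap_sqnorm has_lap_const
   has_lap_subset[OF S(3)] has_lap_subset[OF S'(3)]) (auto simp: N_def)
 have "l x1 - l' x1 + (et * (2 * n) - 0) <= 0"
 proof (rule has_lap_local_max[OF P N])
 fix y assume y: "y : N"
 have "P y <= F y" using y S'(5) by (auto simp: P_def F_def N_def algebra_simps)
 also have "... <= F x1" using x1(2) y TK by (auto simp: N_def)
 also have "... = P x1" by (simp add: P_def F_def S'(4) algebra_simps)
 finally show "P y <= P x1" .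
 qed
 moreover have "- l x1 <= q x1 + e" using S(6) x1(1) by auto
 ultimately have "et * (2 * n) <= e" using S'(6) by simp
 moreover have "n * et > 0" using n et(1) by simp
 ultimately show False using e(3) by (simp add: algebra_simps)
qed

definition touch_below :: "('a::euclidean_space => real) => 'a => real => bool" where
 "touch_below V x m \<longleftrightarrow> touch_above (%y. - V y) x (- m)"

lemma comparison_below:
 fixes u V :: "'a::euclidean_space => real"
 assumes D: "open D" "bounded D" and cu: "continuous_on (closure D) u"
 and cV: "continuous_on (closure D) V"
 and fr: "!!x. x : frontier D ==> V x <= u x"
 and as: "asub {x:D. u x < V x} (%x. - u x) (%x. - q x)"
 and tV: "!!x. x : D ==> u x < V x ==> touch_below V x (q x)"
 and x0: "x0 : D"
 shows "V x0 <= u x0"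
proof -
 have "- u x0 <= - V x0"
 by (rule comparison[OF D, of _ _ "%x. - q x"])
  (use assms in \<open>auto simp: touch_below_def intro!: continuous_intros\<close>)
 thus ?thesis by simp
qed

lemma touch_aboveI:
 assumes "open S" "x : S" "has_lap S ps G l" "ps x = V x" "!!y. y : S ==> V y <= ps y" "m <= - l x"
 shows "touch_above V x m"
 using assms unfolding touch_above_def by blast

lemma touch_belowI:
 assumes "open S" "x : S" "has_lap S ps G l" "ps x = V x" "!!y. y : S ==> ps y <= V y" "- l x <= m"
 shows "touch_below V x m"
 unfolding touch_below_def
 by (rule touch_aboveI[OF assms(1,2) has_lap_minus[OF assms(3)]]) (use assms in auto)

section \<open>Cones and barriers\<close>

text \<open>The shape of the cone in global form. The curvature constant is
  \<open>K / norm z\<close> because second derivatives of a 1-homogeneous function have degree -1.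
  The vector \<open>v\<close> stands for the gradient at \<open>z\<close>, so no derivative is
  mentioned; the origin, where \<open>g\<close> is only Lipschitz, is excluded.\<close>

definition epi :: "real => real => ('a::euclidean_space => real) => bool" where
 "epi L K g \<longleftrightarrow> 1 <= L & 1 <= K & (ALL t>=0. ALL x. g (t *R x) = t * g x) &
  (ALL x y. abs (g x - g y) <= L * norm (x - y)) &
  (ALL z. z ~= 0 --> (EX v. norm v <= L &
  (ALL x. abs (g x - g z - v \<bullet> (x - z)) <= K / norm z * (norm (x - z))^2)))"

text \<open>The vertical distance to the graph. For Lipschitz \<open>g\<close> it is comparable to
  the distance to the boundary and, unlike that distance, exactly 1-homogeneous and
  explicit.\<close>

definition rho :: "('a::euclidean_space => real) => 'a * real => real" where
 "rho g x = snd x - g (fst x)"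

definition epicone :: "('a::euclidean_space => real) => ('a * real) set" where
 "epicone g = {x. 0 < rho g x}"

abbreviation usec where "usec g \<equiv> epicone g Int ball 0 1"

abbreviation csec where "csec g \<equiv> {x. 0 <= rho g x & norm x < 1}"

lemma epiD:
 assumes "epi L K g"
 shows "1 <= L" "1 <= K" "t >= 0 ==> g (t *R x) = t * g x" "abs (g x - g y) <= L * norm (x - y)"
 using assms unfolding epi_def by auto

lemma rho_scale: "epi L K g ==> t >= 0 ==> rho g (t *R x) = t * rho g x"
 using epiD(3) by (fastforce simp: rho_def algebra_simps)

lemma cone_scale: "epi L K g ==> t > 0 ==> t *R x : epicone g \<longleftrightarrow> x : epicone g"
 by (simp add: epicone_def rho_scale zero_less_mult_iff)

lemma norm_fst_snd: "norm (fst x) <= norm x" "norm (snd x) <= norm x"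
 using norm_fst_le[of "fst x" "snd x"] norm_snd_le[of "snd x" "fst x"] by auto

lemma rho_lip:
 assumes "epi L K g"
 shows "abs (rho g x - rho g y) <= (1 + L) * norm (x - y)"
proof -
 have "abs (g (fst x) - g (fst y)) <= L * norm (fst x - fst y)" using epiD(4)[OF assms] .
 also have "... <= L * norm (x - y)" using epiD(1)[OF assms] norm_fst_snd(1)[of "x - y"] by simp
 finally have "abs (g (fst x) - g (fst y)) <= L * norm (x - y)" .
 moreover have "abs (snd x - snd y) <= norm (x - y)" using norm_fst_snd(2)[of "x - y"] by simp
 ultimately show ?thesis unfolding rho_def by (simp add: algebra_simps)
qed

lemma rho_0: "epi L K g ==> rho g 0 = 0"
 using rho_scale[of L K g 0 0] by simp

lemma rho_bound: "epi L K g ==> abs (rho g x) <= (1 + L) * norm x"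
 using rho_lip[of L K g x 0] by (simp add: rho_0)

lemma rho_up: "rho g (x + (0, s)) = rho g x + s"
 by (simp add: rho_def)

lemma continuous_rho:
 assumes "epi L K g"
 shows "continuous_on S (rho g)"
proof -
 have "(1 + L)-lipschitz_on S (rho g)"
 using rho_lip[OF assms] epiD(1)[OF assms] by (intro lipschitz_onI) (auto simp: dist_norm)
 thus ?thesis by (rule lipschitz_on_continuous_on)
qed

lemma open_cone: "epi L K g ==> open (epicone g)"
 unfolding epicone_def by (intro open_Collect_less continuous_rho continuous_intros)

lemma cone_nz: "epi L K g ==> x : epicone g ==> x ~= 0"
 using rho_0[of L K g] by (auto simp: epicone_def)

text \<open>For a point of the cone close to the axis the height is nearly \<open>norm x\<close>,
  while \<open>g (fst x)\<close> is small. Read backwards: points with small \<open>rho\<close>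
  project away from the origin, where touching paraboloids exist.\<close>

lemma axis:
 assumes e: "epi L K g" and x: "rho g x > 0" and s: "norm (fst x) <= norm x / (4 * (1 + L))"
 shows "norm x / 2 <= rho g x"
proof -
 have L: "L >= 1" using epiD(1)[OF e] .
 define f where "f = norm (fst x)"
 have f: "0 <= f" by (simp add: f_def)
 have "4 * (1 + L) * f <= norm x" using s L by (simp add: f_def field_simps)
 hence s': "4 * f + 4 * (L * f) <= norm x" by (simp add: algebra_simps)
 have Lf: "L * f >= 0" using L f by simp
 have n: "norm x <= f + abs (snd x)" unfolding f_def using norm_Pair_le[of "fst x" "snd x"] by simp
 have "g 0 = 0" using epiD(3)[OF e, of 0 0] by simp
 hence "abs (g (fst x)) <= L * f" using epiD(4)[OF e, of "fst x" 0] by (simp add: f_def)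
 thus ?thesis using n x s' Lf f unfolding rho_def by auto
qed

text \<open>With \<open>M = 0\<close> this is the height over the tangent plane at \<open>z\<close>;
  a large positive \<open>M\<close> puts it above \<open>rho\<close>, a large negative one below,
  with contact at the foot \<open>z\<close>. The last component of its gradient is 1, so the
  gradient has norm at least 1.\<close>

definition para :: "('a::euclidean_space => real) => 'a => 'a => real => 'a * real => real" where
 "para g z v M x = snd x - g z - v \<bullet> (fst x - z) + M * (norm (fst x - z))^2"

lemma sum_Basis_fst: "(SUM b:(Basis :: ('a::euclidean_space * real) set). (norm (fst b))^2) = real DIM('a)"
proof -
 have d: "(%u::'a. (u, 0::real)) ` Basis Int (%v. (0, v)) ` Basis = {}"
 by auto
 have "(SUM b:(Basis :: ('a * real) set). (norm (fst b))^2)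
  = (SUM b:(%u::'a. (u, 0::real)) ` Basis. (norm (fst b))^2) + (SUM b:(%v::real. (0::'a, v)) ` Basis. (norm (fst b))^2)"
 unfolding Basis_prod_def by (rule sum.union_disjoint) auto
 also have "... = (SUM b:(Basis::'a set). (norm b)^2)"
 by (simp add: sum.reindex inj_on_def)
 finally show ?thesis by simp
qed

text \<open>Only horizontal directions see the quadratic term: \<open>norm (fst b)\<close> is 1 for
  them and 0 for the vertical basis vector.\<close>

lemma has_lap_para:
 fixes g :: "'a::euclidean_space => real"
 shows "has_lap S (para g z v M) (%x. ((2 * M) *R (fst x - z) - v, 1)) (%x. 2 * M * real DIM('a))"
 unfolding has_lap_def
proof (intro exI conjI ballI)
 have e1: "para g z v M (x + t *R b) = para g z v M x + t * ((((2 * M) *R (fst x - z) - v, 1)) \<bullet> b) + t^2 * (M * (norm (fst b))^2)"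
 for x b :: "'a * real" and t
 proof -
 have "(norm (fst (x + t *R b) - z))^2 = (norm (fst x - z))^2 + 2 * t * ((fst x - z) \<bullet> fst b) + t^2 * (norm (fst b))^2"
  unfolding power2_norm_eq_inner by (simp add: inner_commute power2_eq_square algebra_simps)
 thus ?thesis unfolding para_def by (simp only: distrib_left) (simp add: inner_prod_def algebra_simps)
 qed
 have e2: "(((2 * M) *R (fst (x + t *R b) - z) - v, 1)) \<bullet> b = (((2 * M) *R (fst x - z) - v, 1)) \<bullet> b + t * (2 * M * (norm (fst b))^2)"
 for x b :: "'a * real" and t
 unfolding power2_norm_eq_inner by (simp add: inner_prod_def algebra_simps)
 show "D2on S (para g z v M) (%x. ((2 * M) *R (fst x - z) - v, 1)) (%b x. 2 * M * (norm (fst b))^2)"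
 unfolding D2on_def e1 e2 by (auto intro!: derivative_eq_intros)
 show "2 * M * real DIM('a) = (SUM b:Basis. 2 * M * (norm (fst (b::'a\<times>real)))^2)" if "x : S" for x
 unfolding sum_distrib_left[symmetric] sum_Basis_fst ..
qed

lemma continuous_para: "continuous_on S (para g z v M)"
 unfolding para_def by (intro continuous_intros)

text \<open>\<open>bd\<close> is the thickness of the boundary layer in which the barriers below work, \<open>bM\<close> bounds
 the Laplacians of the paraboloids that touch the graph of \<open>g\<close> at feet of points with norm at least \<open>t\<close>.\<close>

definition bM :: "'a::euclidean_space itself => real => real => real => real" where
 "bM T L K t = 16 * K * (1 + L) * real DIM('a) / t"

definition bd :: "'a::euclidean_space itself => real => real => real => real" where
 "bd T L K t = min ((t / (8 * (3 + L)))^2) (1 / (2 * bM T L K t))"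

lemma bM_pos: "1 <= L ==> 1 <= K ==> 0 < t ==> bM TYPE('a::euclidean_space) L K t > 0"
 unfolding bM_def by simp

lemma bd_pos: "1 <= L ==> 1 <= K ==> 0 < t ==> bd TYPE('a::euclidean_space) L K t > 0"
 using bM_pos[of L K t, where 'a='a] unfolding bd_def by simp

lemma bd_le:
 assumes "1 <= L" "1 <= K" "0 < t" "t <= 1/2"
 shows "bd TYPE('a::euclidean_space) L K t <= t / 64"
 "bd TYPE('a::euclidean_space) L K t * bM TYPE('a) L K t <= 1/2"
 "sqrt (bd TYPE('a::euclidean_space) L K t) <= t / (8 * (3 + L))"
proof -
 have a: "bd TYPE('a) L K t <= (t / (8 * (3 + L)))^2" unfolding bd_def by simp
 have "t / (8 * (3 + L)) >= 0" using assms by simp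
 thus "sqrt (bd TYPE('a) L K t) <= t / (8 * (3 + L))" using a real_le_lsqrt real_sqrt_le_iff by auto
 have s: "t / (8 * (3 + L)) <= t / 32"
 using assms by (intro divide_left_mono) auto
 have "t / 32 <= 1" using assms by simp
 hence "(t / (8 * (3 + L)))^2 <= (t / 32) * 1" unfolding power2_eq_square
 using s assms by (intro mult_mono) auto
 hence a': "bd TYPE('a) L K t <= t / 32" using a by simp
 have "(t / (8 * (3 + L)))^2 <= (t / 32) * (1/2)" unfolding power2_eq_square
 using s assms by (intro mult_mono) auto
 thus "bd TYPE('a) L K t <= t / 64" using a by simp
 have "bd TYPE('a) L K t <= 1 / (2 * bM TYPE('a) L K t)" unfolding bd_def by simp
 thus "bd TYPE('a) L K t * bM TYPE('a) L K t <= 1/2"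
 using bM_pos[OF assms(1-3), where 'a='a] by (simp add: field_simps)
qed

lemma epi_foot:
 fixes g :: "'a::euclidean_space => real"
 assumes e: "epi L K g" and t: "0 < t" "t <= norm x"
 and r: "0 < rho g x" "rho g x < t / 2"
 obtains v M where "norm v <= L" "0 <= M" "2 <= M * norm x" "2 * M * real DIM('a) <= bM TYPE('a) L K t"
 "norm (fst x) ~= 0" "t / (4 * (1 + L)) <= norm (fst x)"
 "!!y. abs (rho g y - para g (fst x) v 0 y) <= (M / 2) * (norm (fst y - fst x))^2"
proof -
 have L: "1 <= L" "1 <= K" using epiD[OF e] by auto
 define z where "z = fst x"
 have z1: "norm z > norm x / (4 * (1 + L))"
 using axis[OF e r(1)] r(2) t unfolding z_def by fastforce
 moreover have "t / (4 * (1 + L)) <= norm x / (4 * (1 + L))" using t L by (intro divide_right_mono) auto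
 moreover have "t / (4 * (1 + L)) > 0" using t L by simp
 ultimately have z2: "t / (4 * (1 + L)) <= norm z" "norm z > 0" by auto
 have z3: "norm z <= norm x" using norm_fst_snd(1)[of x] unfolding z_def by auto
 obtain v where v: "norm v <= L" "!!y. abs (g y - g z - v \<bullet> (y - z)) <= K / norm z * (norm (y - z))^2"
 using e z2 unfolding epi_def by (metis norm_eq_zero less_irrefl)
 \<comment> \<open>Twice the curvature constant: half of \<open>M\<close> already bounds the error,
   and the other half is a quadratic margin that keeps the comparison regions narrow.\<close>
 define M where "M = 2 * K / norm z"
 have M0: "0 <= M" using L unfolding M_def by simp
 have M4: "2 <= M * norm x"
 proof -
 have "1 * norm z <= K * norm x" using L z3 by (intro mult_mono) auto
 thus ?thesis using z2 unfolding M_def by (simp add: field_simps)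
 qed
 have "M <= 8 * K * (1 + L) / t"
 proof -
 have "t <= norm z * (4 * (1 + L))" using z2(1) L by (simp add: pos_divide_le_eq)
 hence "2 * K * t <= 2 * K * (norm z * (4 * (1 + L)))" using L by auto
 thus ?thesis unfolding M_def using z2 t by (simp add: field_simps)
 qed
 hence "2 * M * real DIM('a) <= 2 * (8 * K * (1 + L) / t) * real DIM('a)"
 by (intro mult_right_mono mult_left_mono) auto
 hence M: "2 * M * real DIM('a) <= bM TYPE('a) L K t" unfolding bM_def by simp
 have "abs (rho g y - para g (fst x) v 0 y) <= (M / 2) * (norm (fst y - fst x))^2" for y
 using v(2)[of "fst y"] unfolding rho_def para_def M_def z_def[symmetric] by auto
 thus ?thesis using that[of v M] v(1) M0 M4 M z2 unfolding z_def by auto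
qed

lemma para_split: "para g z v M y = para g z v 0 y + M * (norm (fst y - z))^2"
 by (simp add: para_def)

text \<open>The square in \<open>bd\<close> is made for this: its root is at most
  \<open>s = t / (8 * (3 + L))\<close>, which bounds the horizontal displacement, and the vertical
  displacement is then at most \<open>(2 + L) * s\<close>.\<close>

lemma layer_near:
 fixes g :: "'a::euclidean_space => real"
 assumes e: "epi L K g" and t: "0 < t" "t <= 1/2"
 and y: "(norm (fst y - fst x))^2 <= bd TYPE('a) L K t" "abs (rho g y - rho g x) <= 2 * bd TYPE('a) L K t"
 shows "norm (y - x) <= t / 8"
proof -
 have L: "1 <= L" "1 <= K" using epiD[OF e] by auto
 define d where "d = bd TYPE('a) L K t"
 define s where "s = t / (8 * (3 + L))"
 have s: "sqrt d <= s" using bd_le(3)[OF L t] by (simp add: d_def s_def)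
 have d0: "d > 0" using bd_pos[OF L t(1)] by (simp add: d_def)
 have s1: "s >= 0" "s <= 1"
 proof -
 show "s >= 0" using L t by (simp add: s_def)
 show "s <= 1" using L t unfolding s_def by simp
 qed
 have ds: "d <= s"
 proof -
 have "d = (sqrt d)^2" using d0 by simp
 also have "... <= s^2" using s d0 by (intro power_mono) auto
 also have "... <= s" using s1 by (simp add: power2_eq_square mult_left_le)
 finally show ?thesis .
 qed
 have f: "norm (fst y - fst x) <= s"
 using y(1) s real_le_rsqrt unfolding d_def by fastforce
 have "abs (g (fst y) - g (fst x)) <= L * norm (fst y - fst x)" using epiD(4)[OF e] .
 also have "... <= L * s" using f L by auto
 finally have "abs (snd y - snd x) <= 2 * s + L * s"
 using y(2) ds unfolding rho_def d_def by auto
 moreover have "norm (y - x) <= norm (fst y - fst x) + abs (snd y - snd x)"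
 using norm_Pair_le[of "fst (y - x)" "snd (y - x)"] unfolding prod.collapse by simp
 ultimately have "norm (y - x) <= (3 + L) * s" using f by (simp add: algebra_simps)
 also have "... = t / 8" using L unfolding s_def by (simp add: field_simps)
 finally show ?thesis .
qed

lemma two_sided_region:
 fixes A B :: "'b::euclidean_space => real"
 assumes "continuous_on UNIV A" "continuous_on UNIV B"
 shows "open {y. 0 < A y & B y < d}"
 "y : closure {y. 0 < A y & B y < d} ==> 0 <= A y & B y <= d"
 "y : frontier {y. 0 < A y & B y < d} ==> 0 <= A y & B y <= d & (A y = 0 | B y = d)"
proof -
 show o: "open {y. 0 < A y & B y < d}"
 using assms by (intro open_Collect_conj open_Collect_less continuous_intros)
 have c: "closed {y. 0 <= A y & B y <= d}"
 using assms by (intro closed_Collect_conj closed_Collect_le continuous_intros)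
 have "closure {y. 0 < A y & B y < d} <= {y. 0 <= A y & B y <= d}"
 by (rule closure_minimal[OF _ c]) auto
 thus cl: "y : closure {y. 0 < A y & B y < d} ==> 0 <= A y & B y <= d" for y by blast
 show "y : frontier {y. 0 < A y & B y < d} ==> 0 <= A y & B y <= d & (A y = 0 | B y = d)"
 using cl[of y] o unfolding frontier_def interior_open[OF o] by auto
qed

lemma continuous_on_norm_id: "continuous_on S norm" and continuous_on_norm_id2: "continuous_on S (%y. norm (y - z))"
 by (intro continuous_intros)+

text \<open>The competitor is a concave increasing profile \<open>Ps\<close> of the outer paraboloid
  \<open>p\<close>, which equals \<open>rho\<close> at \<open>x\<close>. Since the gradient of
  \<open>p\<close> has norm at least 1 and the Laplacian of \<open>p\<close> is at most
  \<open>bM\<close>, an ordinary differential inequality for \<open>Ps\<close> makes it a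
  supersolution. Hypothesis \<open>as\<close> leaves the equation for \<open>u\<close> open, so
  linear and singular problems are both covered.\<close>

lemma upper_barrier:
 fixes g :: "'a::euclidean_space => real" and L K t :: real
 assumes e: "epi L K g" and de: "0 < de" "de <= bd TYPE('a) L K t" and t: "0 < t" "t <= norm x" "norm x <= 1/2"
 and r: "0 < rho g x" "rho g x < de"
 and cu: "continuous_on {y. 0 <= rho g y & norm (y - x) <= t/4} u"
 and u0: "!!y. rho g y = 0 ==> norm (y - x) <= t/4 ==> u y <= 0"
 and uS: "!!y. 0 <= rho g y ==> norm (y - x) <= t/4 ==> u y <= Ps de"
 and P: "continuous_on {0..de} Ps"
 "!!s. 0 < s ==> s < de ==> DERIV (Ps) s :> Ps1 s"
 "!!s. 0 < s ==> s < de ==> DERIV (Ps1) s :> Ps2 s"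
 "!!s. 0 < s ==> s < de ==> 0 <= Ps1 s" "!!s. 0 < s ==> s < de ==> Ps2 s <= 0"
 "!!s. 0 < s ==> s < de ==> Q s <= - Ps2 s - bM TYPE('a) L K t * Ps1 s"
 "!!s. 0 <= s ==> s <= de ==> 0 <= Ps s"
 and as: "!!p D. open D ==> continuous_on D p ==>
  (!!y. y : D ==> 0 < rho g y & norm (y - x) < t/4 & 0 < p y & p y < de & Ps (p y) < u y) ==>
  asub D u (%y. Q (p y))"
 shows "u x <= Ps (rho g x)"
proof -
 have L: "1 <= L" "1 <= K" using epiD[OF e] by auto
 have t2: "t <= 1/2" using t by auto
 have dele: "de <= t / 64" using bd_le(1)[OF L t(1) t2, where 'a='a] de by simp
 have r2: "rho g x < t / 2" using r(2) dele t(1) by simp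
 obtain v M where f': "norm v <= L" "0 <= M" "2 <= M * norm x" "2 * M * real DIM('a) <= bM TYPE('a) L K t"
 "!!y. abs (rho g y - para g (fst x) v 0 y) <= (M / 2) * (norm (fst y - fst x))^2"
 by (rule epi_foot[OF e t(1,2) r(1) r2]) blast
 \<comment> \<open>As \<open>norm x <= 1/2\<close>, this gives \<open>4 <= M\<close>, so
   \<open>p\<close> exceeds \<open>rho\<close> by at least twice the squared horizontal
   distance.\<close>
 have "M * norm x <= M * (1/2)" using f'(2) t(3) by (intro mult_left_mono) auto
 hence "4 <= M" using f'(3) by auto
 note f = f'(1) this f'(4,5)
 define p where "p = para g (fst x) v M"
 have p: "rho g y + 2 * (norm (fst y - fst x))^2 <= p y" for y
 proof -
 have "2 * (norm (fst y - fst x))^2 <= (M / 2) * (norm (fst y - fst x))^2"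
  using f(2) by (intro mult_right_mono) auto
 thus ?thesis using f(4)[of y] para_split[of g "fst x" v M y] unfolding p_def by linarith
 qed
 have px: "p x = rho g x" by (simp add: p_def para_def rho_def)
 have cp: "continuous_on S p" for S unfolding p_def by (rule continuous_para)
 \<comment> \<open>Bounded below by the true boundary, where \<open>u <= 0\<close>, and above by a
   level set of the paraboloid, where the a priori bound \<open>uS\<close> applies.\<close>
 define D where "D = {y. 0 < rho g y & p y < de}"
 note reg = two_sided_region[OF continuous_rho[OF e] cp, where d=de, folded D_def]
 have near: "norm (y - x) <= t / 8" if "0 <= rho g y" "p y <= de" for y
 proof (rule layer_near[OF e t(1) t2])
 have "2 * (norm (fst y - fst x))^2 <= de" using p[of y] that by auto
 moreover have "(norm (fst y - fst x))^2 >= 0" by simp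
 ultimately show "(norm (fst y - fst x))^2 <= bd TYPE('a) L K t" using de(2) by linarith
 have "2 * (norm (fst y - fst x))^2 >= 0" by simp
 hence "rho g y <= de" using p[of y] that by linarith
 thus "abs (rho g y - rho g x) <= 2 * bd TYPE('a) L K t" using that r de(2) by auto
 qed
 have clD: "0 <= rho g y" "0 <= p y" "p y <= de" "norm (y - x) <= t / 8" if "y : closure D" for y
 proof -
 show *: "0 <= rho g y" "p y <= de" using reg(2)[OF that] by auto
 have "2 * (norm (fst y - fst x))^2 >= 0" by simp
 thus "0 <= p y" using p[of y] * by linarith
 show "norm (y - x) <= t / 8" using near * by blast
 qed
 have pos: "0 < p y" if "y : D" for y
 proof -
 have "2 * (norm (fst y - fst x))^2 >= 0" by simp
 moreover have "0 < rho g y" using that unfolding D_def by simp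
 ultimately show ?thesis using p[of y] by linarith
 qed
 have bD: "bounded D"
 proof (rule bounded_subset[of "cball x (t/8)"])
 show "D <= cball x (t/8)"
  using clD(4) closure_subset[of D] by (auto simp: dist_norm norm_minus_commute)
 qed simp
 define S where "S = {y. 0 < p y & p y < de}"
 have oS: "open S" unfolding S_def by (intro open_Collect_conj open_Collect_less cp continuous_intros)
 have lap: "has_lap S (%y. Ps (p y)) (%y. Ps1 (p y) *R ((2 * M) *R (fst y - fst x) - v, 1))
  (%y. Ps2 (p y) * (((2 * M) *R (fst y - fst x) - v, 1) \<bullet> ((2 * M) *R (fst y - fst x) - v, 1::real)) + Ps1 (p y) * (2 * M * real DIM('a)))"
 by (rule has_lap_comp[OF has_lap_para[where g=g and z="fst x" and v=v and M=M and S=S, folded p_def],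
  where F=Ps and ?F1.0=Ps1 and ?F2.0=Ps2]; rule P(2,3); simp add: S_def)
 have sub: "closure D <= {y. 0 <= rho g y & norm (y - x) <= t/4}"
 proof
 fix y assume "y : closure D"
 from clD[OF this] show "y : {y. 0 <= rho g y & norm (y - x) <= t/4}" using t by auto
 qed
 have cPp: "continuous_on (closure D) (%y. Ps (p y))"
 by (rule continuous_on_compose2[OF P(1) cp]) (use clD in auto)
 have "u x <= Ps (p x)"
 proof (rule comparison[OF reg(1) bD, where q="%y. Q (p y)"])
 show "continuous_on (closure D) u"
  by (rule continuous_on_subset[OF cu sub])
 show "continuous_on (closure D) (%y. Ps (p y))" by (rule cPp)
 show "u y <= Ps (p y)" if "y : frontier D" for y
 proof -
  have "y : closure D" using that unfolding frontier_def by blast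
  note c = clD[OF this]
  have n4: "norm (y - x) <= t/4" using c(4) t by auto
  have "rho g y = 0 | p y = de" using reg(3)[OF that] by blast
  then consider "rho g y = 0" | "p y = de" by blast
  thus ?thesis
  proof cases
  case 1 thus ?thesis using u0[OF 1 n4] P(7)[OF c(2,3)] by auto
  next
  case 2 thus ?thesis using uS[OF c(1) n4] by simp
  qed
 qed
 have "open {y : D. Ps (p y) < u y}"
 proof -
  have DS: "D <= closure D" by (rule closure_subset)
  have "continuous_on D (%y. u y - Ps (p y))"
  proof (intro continuous_intros)
  show "continuous_on D u"
   by (rule continuous_on_subset[OF cu order_trans[OF DS sub]])
  show "continuous_on D (%y. Ps (p y))"
   by (rule continuous_on_subset[OF cPp DS])
  qed
  hence "open (D Int (%y. u y - Ps (p y)) -` {0<..})"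
  using reg(1) by (intro continuous_open_preimage) auto
  moreover have "D Int (%y. u y - Ps (p y)) -` {0<..} = {y : D. Ps (p y) < u y}" by auto
  ultimately show ?thesis by metis
 qed
 thus "asub {y : D. Ps (p y) < u y} u (%y. Q (p y))"
 proof (rule as[OF _ cp])
  fix y assume "y : {y : D. Ps (p y) < u y}"
  hence y: "y : D" "Ps (p y) < u y" by auto
  hence "y : closure D" using closure_subset by blast
  hence "norm (y - x) < t/4" using clD(4)[of y] t(1) by simp
  thus "0 < rho g y & norm (y - x) < t/4 & 0 < p y & p y < de & Ps (p y) < u y"
  using y pos[OF y(1)] unfolding D_def by auto
 qed
 show "touch_above (%y. Ps (p y)) y (Q (p y))" if "y : D" for y
 proof (rule touch_aboveI[OF oS _ lap])
  have s: "0 < p y" "p y < de" using pos[OF that] that unfolding D_def by auto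
  thus "y : S" unfolding S_def by simp
  define N where "N = ((2 * M) *R (fst y - fst x) - v, 1) \<bullet> ((2 * M) *R (fst y - fst x) - v, 1::real)"
  have N: "N >= 1" unfolding N_def by simp
  have "Ps2 (p y) * N <= Ps2 (p y) * 1" using N P(5)[OF s] by (intro mult_left_mono_neg) auto
  moreover have "Ps1 (p y) * (2 * M * real DIM('a)) <= Ps1 (p y) * bM TYPE('a) L K t"
  using f(3) P(4)[OF s] by (intro mult_left_mono) auto
  ultimately have "Q (p y) <= - (Ps2 (p y) * N + Ps1 (p y) * (2 * M * real DIM('a)))"
  using P(6)[OF s] by (simp add: mult.commute)
  thus "Q (p y) <= - (Ps2 (p y) * (((2 * M) *R (fst y - fst x) - v, 1) \<bullet> ((2 * M) *R (fst y - fst x) - v, 1::real)) + Ps1 (p y) * (2 * M * real DIM('a)))"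
  unfolding N_def .
 qed auto
 show "x : D" using r px unfolding D_def by simp
 qed
 thus ?thesis unfolding px .
qed

text \<open>The offset \<open>ta\<close> lets the equation be known only where
  \<open>u > ta\<close>; for a singular right-hand side that is the region in which it is
  bounded.\<close>

lemma linear_upper:
 fixes g :: "'a::euclidean_space => real"
 assumes e: "epi L K g" and t: "0 < t" "t <= norm x" "norm x <= 1/2" and r: "0 < rho g x"
 and cu: "continuous_on {y. 0 <= rho g y & norm (y - x) <= t/4} u"
 and u0: "!!y. rho g y = 0 ==> norm (y - x) <= t/4 ==> u y <= 0"
 and uM: "!!y. 0 <= rho g y ==> norm (y - x) <= t/4 ==> u y <= M"
 and A: "0 <= A" "2 * M <= A * bd TYPE('a) L K t" "q <= A * bM TYPE('a) L K t" and ta: "0 <= ta"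
 and as: "!!D. open D ==> (!!y. y : D ==> 0 < rho g y & norm (y - x) < t/4 & ta < u y) ==> asub D u (%_. q)"
 shows "u x <= ta + A * rho g x"
proof -
 define de where "de = bd TYPE('a) L K t"
 define C where "C = bM TYPE('a) L K t"
 have L: "1 <= L" "1 <= K" and t2: "t <= 1/2" using epiD[OF e] t by auto
 have de: "0 < de" "de * C <= 1/2" "0 < C"
 unfolding de_def C_def by (rule bd_pos[OF L t(1)] bd_le(2)[OF L t(1) t2] bM_pos[OF L t(1)])+
 \<comment> \<open>The second derivative contributes \<open>2 * A * C\<close>, the Laplacian of the
   paraboloid costs at most \<open>A * C\<close>, and the remaining \<open>A * C\<close> absorbs
   \<open>q\<close>.\<close>
 define P where "P = (%s. ta + A * (s - C * s^2))"
 have Cs: "C * s <= 1/2" "s / 2 <= s - C * s^2" if "0 <= s" "s <= de" for s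
 proof -
 have "C * s <= C * de" using that de by simp
 thus 1: "C * s <= 1/2" using de(2) by (simp add: mult.commute)
 have "C * s * s <= 1/2 * s" using 1 that by (intro mult_right_mono) auto
 thus "s / 2 <= s - C * s^2" by (simp add: power2_eq_square)
 qed
 have P0: "ta <= P s" if "0 <= s" "s <= de" for s
 unfolding P_def using A(1) Cs(2)[OF that] that by simp
 show ?thesis
 proof (cases "rho g x < de")
 case False
 have "u x <= M" using uM[of x] r t by simp
 moreover have "A * de <= A * rho g x" using False A by (intro mult_left_mono) auto
 moreover have "0 <= A * de" using A de by simp
 ultimately show ?thesis using A(2) ta unfolding de_def by simp
 next
 case True
 have "u x <= P (rho g x)"
 proof (rule upper_barrier[OF e de(1) _ t r True cu, where ?Ps1.0="%s. A * (1 - 2 * C * s)" and ?Ps2.0="%s. A * (- 2 * C)" and Q="%_. q", folded C_def])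
  show "u y <= P de" if "0 <= rho g y" "norm (y - x) <= t/4" for y
  proof -
  have "A * (de / 2) <= P de" unfolding P_def using Cs(2)[of de] de A ta by (intro add_increasing mult_left_mono) auto
  thus ?thesis using uM[OF that] A(2) unfolding de_def by simp
  qed
  show "continuous_on {0..de} P" unfolding P_def by (intro continuous_intros)
  show "DERIV P s :> A * (1 - 2 * C * s)" for s
  unfolding P_def by (auto intro!: derivative_eq_intros)
  show "DERIV (%s. A * (1 - 2 * C * s)) s :> A * (- 2 * C)" for s
  by (auto intro!: derivative_eq_intros)
  show "0 <= A * (1 - 2 * C * s)" "A * (- 2 * C) <= 0" if "0 < s" "s < de" for s
  using Cs(1)[of s] that A de by auto
  show "q <= - (A * (- 2 * C)) - C * (A * (1 - 2 * C * s))" if "0 < s" "s < de" for s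
  proof -
  have "0 <= A * C * (2 * (C * s))" using A de that by simp
  thus ?thesis using A(3) unfolding C_def[symmetric] by (simp add: algebra_simps)
  qed
  show "0 <= P s" if "0 <= s" "s <= de" for s using P0[OF that] ta by simp
  show "asub D u (%y. q)" if "open D"
  "!!y. y : D ==> 0 < rho g y & norm (y - x) < t/4 & 0 < p y & p y < de & P (p y) < u y" for p D
  proof (rule as[OF that(1)])
  fix y assume "y : D"
  with that(2)[OF this] P0[of "p y"] show "0 < rho g y & norm (y - x) < t/4 & ta < u y" by simp
  qed
 qed (use u0 in \<open>auto simp: de_def\<close>)
 also have "... <= ta + A * rho g x" unfolding P_def using A de by (intro add_left_mono mult_left_mono) auto
 finally show ?thesis .
 qed
qed

text \<open>A quantitative Hopf lemma. The competitor is a convex function of the inner paraboloid,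
  which stays below \<open>rho\<close>; its convexity compensates the negative Laplacian of the
  paraboloid.\<close>

lemma lower_barrier:
 fixes g :: "'a::euclidean_space => real" and L K t :: real
 defines "de \<equiv> bd TYPE('a) L K t"
 assumes e: "epi L K g" and t: "0 < t" "t <= norm x" "norm x <= 1/2"
 and r: "0 < rho g x" "rho g x < de" and m: "0 <= m"
 and cu: "continuous_on {y. 0 <= rho g y & norm (y - x) <= t/4} u"
 and u0: "!!y. 0 <= rho g y ==> norm (y - x) <= t/4 ==> 0 <= u y"
 and um: "!!y. de / 2 <= rho g y ==> norm (y - x) <= t/4 ==> m <= u y"
 and as: "asub {y. 0 < rho g y & norm (y - x) < t/4} (%y. - u y) (%y. 0)"
 shows "m * rho g x / (2 * de) <= u x"
proof -
 have L: "1 <= L" "1 <= K" using epiD[OF e] by auto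
 have t2: "t <= 1/2" using t by auto
 note dele = bd_le(1)[OF L t(1) t2, where 'a='a, folded de_def]
 have de0: "de > 0" using bd_pos[OF L t(1)] by (simp add: de_def)
 have r2: "rho g x < t / 2" using r(2) dele t(1) by simp
 obtain v M where f': "norm v <= L" "0 <= M" "2 <= M * norm x" "2 * M * real DIM('a) <= bM TYPE('a) L K t"
 "!!y. abs (rho g y - para g (fst x) v 0 y) <= (M / 2) * (norm (fst y - fst x))^2"
 by (rule epi_foot[OF e t(1,2) r(1) r2]) blast
 have "M * norm x <= M * (1/2)" using f'(2) t(3) by (intro mult_left_mono) auto
 hence "4 <= M" using f'(3) by auto
 note f = f'(1) this f'(4,5)
 define C where "C = bM TYPE('a) L K t"
 have C: "C > 0" "C * de <= 1/2" using bM_pos[OF L t(1)] bd_le(2)[OF L t(1) t2, where 'a='a]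
 unfolding C_def de_def by (auto simp: mult.commute)
 define l where "l = para g (fst x) v 0"
 define p where "p = para g (fst x) v (- M)"
 have pl: "p y = l y - M * (norm (fst y - fst x))^2" for y
 using para_split[of g "fst x" v "-M" y] by (simp add: p_def l_def)
 have rl: "abs (rho g y - l y) <= (M / 2) * (norm (fst y - fst x))^2" for y using f(4) by (simp add: l_def)
 have N4: "4 * (norm (fst y - fst x))^2 <= M * (norm (fst y - fst x))^2" for y
 using f(2) by (intro mult_right_mono) auto
 have px: "p x = rho g x" "l x = rho g x" by (simp_all add: p_def l_def para_def rho_def)
 have cp: "continuous_on S p" "continuous_on S l" for S unfolding p_def l_def by (rule continuous_para)+
 \<comment> \<open>The lid is a level of the tangent plane, not of the paraboloid. On the lid
   \<open>p >= 0\<close> bounds the quadratic term by \<open>de\<close>, hence \<open>rho\<close> is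
   at least \<open>de / 2\<close> and the interior bound \<open>um\<close> is available.\<close>
 define D where "D = {y. 0 < p y & l y < de}"
 note reg = two_sided_region[OF cp, where d=de, folded D_def]
 have clD: "0 <= p y" "l y <= de" "p y <= rho g y" "p y <= de" "norm (y - x) <= t / 8"
  "l y = de ==> de / 2 <= rho g y" if "y : closure D" for y
 proof -
 have z: "0 <= (norm (fst y - fst x))^2" by simp
 show *: "0 <= p y" "l y <= de" using reg(2)[OF that] by auto
 show "p y <= rho g y" using rl[of y] pl[of y] by linarith
 hence r0: "0 <= rho g y" using * by simp
 show "p y <= de" using * pl[of y] N4[of y] z by linarith
 show "norm (y - x) <= t / 8"
 proof (rule layer_near[OF e t(1) t2])
  show "(norm (fst y - fst x))^2 <= bd TYPE('a) L K t"
  using * pl[of y] N4[of y] z unfolding de_def by linarith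
  have "rho g y <= 2 * de" using rl[of y] pl[of y] * by linarith
  thus "abs (rho g y - rho g x) <= 2 * bd TYPE('a) L K t" using r0 r unfolding de_def by auto
 qed
 show "l y = de ==> de / 2 <= rho g y"
  using rl[of y] pl[of y] * by linarith
 qed
 have bD: "bounded D"
 proof (rule bounded_subset[of "cball x (t/8)"])
 show "D <= cball x (t/8)"
  using clD(5) closure_subset[of D] by (auto simp: dist_norm norm_minus_commute)
 qed simp
 define k where "k = m / (2 * de)"
 have k: "k >= 0" using m de0 by (simp add: k_def)
 \<comment> \<open>The square adds at least \<open>2 * C\<close> to the Laplacian, while the
   paraboloid costs at most \<open>2 * C\<close> because \<open>C * p <= 1/2\<close>.\<close>
 define V where "V = (%y. k * (p y + C * (p y)^2))"
 have sq: "DERIV (%s. s + C * s^2) s :> 1 + 2 * C * s"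
 "DERIV (%s. 1 + 2 * C * s) s :> 2 * C" for s
 by (auto intro!: derivative_eq_intros)
 define N where "N = (%y::'a\<times>real. ((2 * - M) *R (fst y - fst x) - v, 1) \<bullet> ((2 * - M) *R (fst y - fst x) - v, 1::real))"
 have lap: "has_lap UNIV V (%y. k *R (1 + 2 * C * p y) *R ((2 * - M) *R (fst y - fst x) - v, 1))
  (%y. k * (2 * C * N y + (1 + 2 * C * p y) * (2 * - M * real DIM('a))))"
 unfolding V_def N_def p_def
 by (rule has_lap_cmul[OF has_lap_comp[OF has_lap_para, where F="%s. s + C * s^2" and ?F1.0="%s. 1 + 2 * C * s" and ?F2.0="%s. 2 * C"]])
  (use sq in auto)
 have sub: "closure D <= {y. 0 <= rho g y & norm (y - x) <= t/4}"
 proof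
 fix y assume "y : closure D"
 from clD[OF this] show "y : {y. 0 <= rho g y & norm (y - x) <= t/4}" using t by auto
 qed
 have "V x <= u x"
 proof (rule comparison_below[OF reg(1) bD, where q="%y. 0"])
 show "continuous_on (closure D) u" by (rule continuous_on_subset[OF cu sub])
 show "continuous_on (closure D) V" unfolding V_def by (intro continuous_intros cp)
 show "V y <= u y" if "y : frontier D" for y
 proof -
  have yc: "y : closure D" using that unfolding frontier_def by blast
  note c = clD[OF this]
  have n4: "norm (y - x) <= t/4" "0 <= rho g y" using sub yc by auto
  have "p y = 0 | l y = de" using reg(3)[OF that] by blast
  then consider "p y = 0" | "l y = de" by blast
  thus ?thesis
  proof cases
  case 1 thus ?thesis using u0[OF n4(2,1)] by (simp add: V_def)
  next
  case 2
  have "C * (p y)^2 <= C * (de * de)" unfolding power2_eq_square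
   using c(1,4) C by (intro mult_left_mono mult_mono) auto
  also have "... <= 1/2 * de" using mult_right_mono[OF C(2), of de] de0 by simp
  finally have "p y + C * (p y)^2 <= 2 * de" using c(4) de0 by auto
  hence "V y <= k * (2 * de)" unfolding V_def using k by (intro mult_left_mono)
  also have "... = m" using de0 by (simp add: k_def)
  finally show ?thesis using um[OF c(6)[OF 2] n4(1)] by auto
  qed
 qed
 show "asub {y : D. u y < V y} (%x. - u x) (%x. - 0)"
 proof (rule asub_mono[OF as])
  show "{y : D. u y < V y} <= {y. 0 < rho g y & norm (y - x) < t / 4}"
  proof
  fix y assume "y : {y : D. u y < V y}"
  hence y: "y : D" by simp
  hence yc: "y : closure D" using closure_subset by blast
  from clD[OF yc] y t show "y : {y. 0 < rho g y & norm (y - x) < t / 4}" unfolding D_def by auto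
  qed
 qed simp
 show "touch_below V y 0" if "y : D" for y
 proof (rule touch_belowI[OF open_UNIV _ lap])
  have yc: "y : closure D" using that closure_subset by blast
  note c = clD[OF yc]
  have "N y >= 1" unfolding N_def by simp
  hence 1: "2 * C * N y >= 2 * C" using C by simp
  have "C * p y <= C * de" using c(4) C by simp
  hence "1 + 2 * C * p y <= 2" using C by linarith
  moreover have "0 <= 2 * M * real DIM('a)" using f(2) by simp
  moreover have "0 <= 1 + 2 * C * p y" using c(1) C by simp
  ultimately have "(1 + 2 * C * p y) * (2 * M * real DIM('a)) <= 2 * C"
  using f(3) unfolding C_def[symmetric] by (intro mult_mono) auto
  hence "2 * C * N y + (1 + 2 * C * p y) * (2 * - M * real DIM('a)) >= 0" using 1 by simp
  thus "- (k * (2 * C * N y + (1 + 2 * C * p y) * (2 * - M * real DIM('a)))) <= 0" using k by simp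
 qed auto
 show "x : D" using r px unfolding D_def by simp
 qed
 moreover have "k * rho g x <= V x" unfolding V_def px using k C by (intro mult_left_mono) auto
 ultimately show ?thesis unfolding k_def by auto
qed

section \<open>Harmonic functions of a cone\<close>

text \<open>Ratio of the values at radii \<open>2 * r\<close> and \<open>r\<close> of a Gaussian
  barrier that vanishes at radius \<open>4 * r\<close>; its decay rate is
  \<open>n / r^2\<close>.\<close>

definition chc :: "real => real" where
 "chc n = (exp (- (4 * n)) - exp (- (16 * n))) / (exp (- n) - exp (- (16 * n)))"

lemma chc: "n > 0 ==> 0 < chc n" "n > 0 ==> chc n <= 1"
 by (auto simp: chc_def)

text \<open>A weak Harnack step for nonnegative superharmonic functions: the Gaussian with rate
  \<open>n / r^2\<close> is subharmonic outside the ball of radius \<open>r\<close> and is compared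
  with \<open>v\<close> on the annulus between \<open>r\<close> and \<open>4 * r\<close>.\<close>

lemma spread:
 fixes v :: "'b::euclidean_space => real"
 assumes r: "r > 0" and m: "m >= 0" and cv: "continuous_on (cball x (4 * r)) v"
 and v0: "!!y. y : cball x (4 * r) ==> 0 <= v y" and vm: "!!y. y : cball x r ==> m <= v y"
 and as: "asub (ball x (4 * r)) (%y. - v y) (%y. 0)"
 and y: "y : cball x (2 * r)"
 shows "chc (real DIM('b)) * m <= v y"
proof -
 define n where "n = real DIM('b)"
 have n: "n > 0" by (simp add: n_def)
 have den: "exp (- n) - exp (- (16 * n)) > 0" using n by simp
 define k where "k = m / (exp (- n) - exp (- (16 * n)))"
 have k: "k >= 0" using m den by (simp add: k_def)
 define be where "be = n / r^2"
 have be: "be > 0" using n r by (simp add: be_def)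
 have ber: "be * (a * r)^2 = a^2 * n" for a using r by (simp add: be_def power_mult_distrib)
 define B where "B = (%y. k * (exp (- be * (norm (y - x))^2) - exp (- (16 * n))))"
 have Bmono: "B y <= k * (exp (- (a^2 * n)) - exp (- (16 * n)))" if "a * r <= norm (y - x)" "0 <= a" for y a
 proof -
 have "(a * r)^2 <= (norm (y - x))^2" using that r by simp
 hence "a^2 * n <= be * (norm (y - x))^2" using be ber[of a] by (metis mult_left_mono less_imp_le)
 thus ?thesis unfolding B_def using k by (intro mult_left_mono) auto
 qed
 have Bmono2: "k * (exp (- (4 * n)) - exp (- (16 * n))) <= B y" if "norm (y - x) <= 2 * r" for y
 proof -
 have "(norm (y - x))^2 <= (2 * r)^2" using that by (intro power_mono) auto
 hence "be * (norm (y - x))^2 <= be * (2 * r)^2" using be by auto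
 hence "be * (norm (y - x))^2 <= 4 * n" unfolding ber by simp
 thus ?thesis unfolding B_def using k by (intro mult_left_mono) auto
 qed
 show ?thesis
 proof (cases "norm (y - x) <= r")
 case True
 hence "m <= v y" using vm[of y] by (simp add: dist_norm norm_minus_commute)
 moreover have "chc n * m <= 1 * m" using chc[OF n] m by (intro mult_right_mono) auto
 ultimately show ?thesis by (simp add: n_def)
 next
 case False
 define D where "D = {y. 0 < norm (y - x) - r & norm (y - x) < 4 * r}"
 have reg: "open D" "y : closure D ==> 0 <= norm (y - x) - r & norm (y - x) <= 4 * r"
  "y : frontier D ==> 0 <= norm (y - x) - r & norm (y - x) <= 4 * r & (norm (y - x) - r = 0 | norm (y - x) = 4 * r)" for y
  unfolding D_def
  by (rule two_sided_region[of "%y. norm (y - x) - r" "%y. norm (y - x)"]; auto intro!: continuous_intros)+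
 have cl: "closure D <= cball x (4 * r)" using reg(2) by (auto simp: dist_norm norm_minus_commute)
 have lap: "has_lap UNIV B (%y. k *R (- be * exp (- be * (norm (y - x))^2)) *R 2 *R (y - x))
  (%y. k * (be^2 * exp (- be * (norm (y - x))^2) * (2 *R (y - x) \<bullet> 2 *R (y - x)) + (- be * exp (- be * (norm (y - x))^2)) * (2 * real DIM('b))))"
  unfolding B_def
  by (rule has_lap_cmul[OF has_lap_comp[OF has_lap_sqnorm, where F="%s. exp (- be * s) - exp (- (16 * n))" and ?F1.0="%s. - be * exp (- be * s)" and ?F2.0="%s. be^2 * exp (- be * s)"]])
  (auto intro!: derivative_eq_intros simp: power2_eq_square)
 have "B y <= v y"
 proof (rule comparison_below[OF reg(1), where q="%y. 0"])
  show "bounded D" using cl closure_subset[of D] bounded_subset[OF bounded_cball] by blast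
  show "continuous_on (closure D) v" by (rule continuous_on_subset[OF cv cl])
  show "continuous_on (closure D) B" unfolding B_def by (intro continuous_intros)
  show "B z <= v z" if "z : frontier D" for z
  proof -
  note f = reg(3)[OF that]
  have "norm (z - x) = r | norm (z - x) = 4 * r" using f by auto
  thus ?thesis
  proof
   assume a: "norm (z - x) = r"
   hence "B z <= k * (exp (- n) - exp (- (16 * n)))" using Bmono[of 1 z] by simp
   also have "... = m" using den by (simp add: k_def)
   finally show ?thesis using vm[of z] a by (simp add: dist_norm norm_minus_commute)
  next
   assume a: "norm (z - x) = 4 * r"
   hence "B z <= 0" using Bmono[of 4 z] by simp
   thus ?thesis using v0[of z] a by (simp add: dist_norm norm_minus_commute)
  qed
  qed
  show "asub {x : D. v x < B x} (%x. - v x) (%x. - 0)"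
  by (rule asub_mono[OF as]) (auto simp: D_def dist_norm norm_minus_commute)
  show "touch_below B z 0" if "z : D" for z
  proof (rule touch_belowI[OF open_UNIV _ lap])
  define E where "E = exp (- be * (norm (z - x))^2)"
  have E: "E > 0" by (simp add: E_def)
  have "r^2 <= (norm (z - x))^2" using that by (intro power_mono) (auto simp: D_def)
  hence "be * r^2 <= be * (norm (z - x))^2" using be by auto
  hence "n <= be * (norm (z - x))^2" using ber[of 1] by simp
  hence "0 <= 2 * be * E * (2 * (be * (norm (z - x))^2) - n)" using E be n by auto
  also have "... = be^2 * E * (4 * (norm (z - x))^2) + (- be * E) * (2 * n)"
   by (simp add: power2_eq_square algebra_simps)
  finally have "0 <= k * (be^2 * E * (4 * (norm (z - x))^2) + (- be * E) * (2 * n))" using k by simp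
  moreover have "(2 *R (z - x)) \<bullet> (2 *R (z - x)) = 4 * (norm (z - x))^2"
   by (simp add: power2_norm_eq_inner)
  ultimately show "- (k * (be^2 * exp (- be * (norm (z - x))^2) * (2 *R (z - x) \<bullet> 2 *R (z - x)) + (- be * exp (- be * (norm (z - x))^2)) * (2 * real DIM('b)))) <= 0"
   unfolding E_def n_def by simp
  qed auto
  show "y : D" using False y by (auto simp: D_def dist_norm norm_minus_commute)
 qed
 moreover have "chc n * m = k * (exp (- (4 * n)) - exp (- (16 * n)))" by (simp add: chc_def k_def)
 ultimately show ?thesis using Bmono2[of y] y unfolding n_def[symmetric]
  by (simp add: dist_norm norm_minus_commute)
 qed
qed

text \<open>Consecutive centres are at most \<open>r\<close> apart, so each ball of radius
  \<open>r\<close> lies in the ball of radius \<open>2 * r\<close> about its predecessor and every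
  step loses one factor \<open>chc\<close>.\<close>

lemma spread_segment:
 fixes v :: "'b::euclidean_space => real" and N :: nat
 assumes r: "r > 0" and m: "m >= 0" and cv: "continuous_on S v"
 and v0: "!!y. y : S ==> 0 <= v y" and vm: "!!y. y : cball a r ==> m <= v y"
 and as: "asub S (%y. - v y) (%y. 0)"
 and seg: "!!s. 0 <= s ==> s <= 1 ==> cball (a + s *R (b - a)) (4 * r) <= S"
 and N: "norm (b - a) <= real N * r"
 and y: "y : cball b r"
 shows "chc (real DIM('b)) ^ N * m <= v y"
proof (cases "N = 0")
 case True
 thus ?thesis using N y vm by simp
next
 case False
 define p where "p = (%k::nat. a + (real k / real N) *R (b - a))"
 have "k <= N --> (ALL y:cball (p k) r. chc (real DIM('b)) ^ k * m <= v y)" for k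
 proof (induction k)
 case 0 thus ?case using vm by (simp add: p_def)
 next
 case (Suc k)
 show ?case
 proof (intro impI ballI)
  fix y assume k: "Suc k <= N" and y: "y : cball (p (Suc k)) r"
  have sub: "cball (p k) (4 * r) <= S" unfolding p_def using k by (intro seg) auto
  have "p (Suc k) - p k = (1 / real N) *R (b - a)"
  by (simp add: p_def scaleR_left_diff_distrib[symmetric] diff_divide_distrib[symmetric])
  hence "norm (p (Suc k) - p k) = norm (b - a) / real N" by auto
  moreover have "norm (b - a) / real N <= r" using N False by (simp add: pos_divide_le_eq mult.commute)
  ultimately have "norm (p (Suc k) - p k) <= r" by simp
  hence y2: "y : cball (p k) (2 * r)"
  using y norm_triangle_ineq[of "p (Suc k) - p k" "y - p (Suc k)"]
  by (simp add: dist_norm norm_minus_commute)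
  have "chc (real DIM('b)) * (chc (real DIM('b)) ^ k * m) <= v y"
  proof (rule spread[OF r _ continuous_on_subset[OF cv sub] _ _ _ y2])
  show "0 <= chc (real DIM('b)) ^ k * m" using chc(1)[of "real DIM('b)"] m by simp
  show "asub (ball (p k) (4 * r)) (%y. - v y) (%y. 0)"
   by (rule asub_mono[OF as]) (use sub in auto)
  qed (use Suc k sub v0 in auto)
  thus "chc (real DIM('b)) ^ Suc k * m <= v y" by auto
 qed
 qed
 moreover have "p N = b" using False by (simp add: p_def)
 ultimately show ?thesis using y by auto
qed

text \<open>Chosen so that a point of norm at most \<open>t0 L\<close>, lifted vertically by
  \<open>2 * (1 + L) * t0 L\<close>, still has norm at most 1/2.\<close>

definition t0 :: "real => real" where "t0 L = 1 / (2 * (3 + 2 * L))"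

lemma t0: "1 <= L ==> 0 < t0 L" "1 <= L ==> t0 L <= 1/10" "1 <= L ==> t0 L * (3 + 2 * L) = 1/2"
 by (auto simp: t0_def)

text \<open>The chain goes up, across and down, hence the exponent \<open>3 * N\<close>. A direct
  segment could leave the cone; after the lift every point of the ball of radius \<open>t0 L\<close>
  has \<open>rho\<close> at least \<open>(1 + L) * t0 L\<close>, which is at least
  \<open>d\<close>.\<close>

lemma cone_chain:
 fixes g :: "'a::euclidean_space => real"
 assumes e: "epi L K g" and d: "0 < d" and m: "m >= 0"
 and cv: "continuous_on (usec g) v"
 and v0: "!!y. y : usec g ==> 0 <= v y"
 and as: "asub (usec g) (%y. - v y) (%y. 0)"
 and xy: "norm x <= t0 L" "norm y <= t0 L" "d <= rho g x" "d <= rho g y"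
 and r: "r = d / (8 * (1 + L))" and N: "2 * (1 + L) * t0 L <= real N * r"
 and vm: "!!w. w : cball x r ==> m <= v w" and w: "w : cball y r"
 shows "chc (real DIM('a * real)) ^ (3 * N) * m <= v w"
proof -
 have L: "1 <= L" using epiD[OF e] by auto
 have r0: "r > 0" using d L r by simp
 define h where "h = 2 * (1 + L) * t0 L"
 have h0: "h > 0" using L t0[OF L] by (simp add: h_def)
 have th: "t0 L + h = 1/2" using t0(3)[OF L] by (simp add: h_def algebra_simps)
 have rx: "rho g z <= (1 + L) * t0 L" "- ((1 + L) * t0 L) <= rho g z" if "norm z <= t0 L" for z
 proof -
 have "abs (rho g z) <= (1 + L) * norm z" by (rule rho_bound[OF e])
 also have "... <= (1 + L) * t0 L" using that L by simp
 finally show "rho g z <= (1 + L) * t0 L" "- ((1 + L) * t0 L) <= rho g z" by auto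
 qed
 have dt: "d <= (1 + L) * t0 L" using rx(1)[OF xy(1)] xy(3) by auto
 have r4: "4 * r <= t0 L / 2" using dt L by (simp add: r field_simps)
 have ball: "cball p (4 * r) <= usec g" if p: "d <= rho g p" "norm p <= 1/2" for p
 proof
 fix q assume "q : cball p (4 * r)"
 hence q: "norm (q - p) <= 4 * r" by (simp add: dist_norm norm_minus_commute)
 have "abs (rho g q - rho g p) <= (1 + L) * norm (q - p)" by (rule rho_lip[OF e])
 also have "... <= (1 + L) * (4 * r)" using q L by simp
 also have "... = d / 2" using L by (simp add: r field_simps)
 finally have "0 < rho g q" using p d by linarith
 moreover have "norm q <= norm p + norm (q - p)" using norm_triangle_ineq[of p "q - p"] by simp
 hence "norm q < 1" using p q r4 t0(2)[OF L] by simp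
 ultimately show "q : usec g" by (simp add: epicone_def)
 qed
 have up: "cball (z + s *R ((z + (0, h)) - z)) (4 * r) <= usec g"
 if "norm z <= t0 L" "d <= rho g z" "0 <= s" "s <= 1" for z s
 proof (rule ball)
 have sh: "0 <= s * h" "s * h <= h" using that h0 by auto
 have eq: "z + s *R ((z + (0, h)) - z) = z + (0, s * h)" by simp
 show "d <= rho g (z + s *R ((z + (0, h)) - z))" unfolding eq rho_up using that sh by auto
 have "norm (z + (0, s * h)) <= norm z + norm (0::'a, s * h)" by (rule norm_triangle_ineq)
 also have "... <= 1/2" using that sh th by auto
 finally show "norm (z + s *R ((z + (0, h)) - z)) <= 1/2" unfolding eq .
 qed
 have N1: "norm ((z + (0::'a, h)) - z) <= real N * r" for z
 using N h0 by (simp add: h_def)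
 define c where "c = chc (real DIM('a * real))"
 have c: "c > 0" unfolding c_def by (intro chc) simp
 have 1: "c ^ N * m <= v w" if "w : cball (x + (0, h)) r" for w
 by (rule spread_segment[OF r0 m cv v0 vm as up N1 that, folded c_def]) (use xy in auto)
 have 2: "c ^ N * (c ^ N * m) <= v w" if "w : cball (y + (0, h)) r" for w
 proof (rule spread_segment[OF r0 _ cv v0 1 as _ _ that, folded c_def])
 show "0 <= c ^ N * m" using c m by simp
 have "norm ((y + (0, h)) - (x + (0, h))) <= norm y + norm x" using norm_triangle_ineq4[of y x] by simp
 also have "... <= 2 * (1 + L) * t0 L"
 proof -
  have "norm y + norm x <= 2 * t0 L" using xy by simp
  also have "... <= 2 * (1 + L) * t0 L" using L t0(1)[OF L] by simp
  finally show ?thesis .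
 qed
 finally show "norm ((y + (0, h)) - (x + (0, h))) <= real N * r" using N by simp
 next
 fix s :: real assume s: "0 <= s" "s <= 1"
 define z where "z = x + s *R (y - x)"
 have eq: "(x + (0, h)) + s *R ((y + (0, h)) - (x + (0, h))) = z + (0, h)" by (simp add: z_def)
 have "z = (1 - s) *R x + s *R y" by (simp add: z_def algebra_simps)
 hence "norm z <= (1 - s) * norm x + s * norm y" using s norm_triangle_ineq[of "(1 - s) *R x" "s *R y"] by simp
 also have "... <= (1 - s) * t0 L + s * t0 L" using s xy by (intro add_mono mult_left_mono) auto
 finally have z: "norm z <= t0 L" by (simp add: algebra_simps)
 show "cball ((x + (0, h)) + s *R ((y + (0, h)) - (x + (0, h)))) (4 * r) <= usec g"
  unfolding eq
 proof (rule ball)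
  show "d <= rho g (z + (0, h))" unfolding rho_up using rx(2)[OF z] dt by (simp add: h_def algebra_simps)
  have "norm (z + (0, h)) <= norm z + norm (0::'a, h)" by (rule norm_triangle_ineq)
  thus "norm (z + (0, h)) <= 1/2" using z th h0 by simp
 qed
 qed auto
 have "c ^ N * (c ^ N * (c ^ N * m)) <= v w"
 proof (rule spread_segment[OF r0 _ cv v0 2 as _ _ w, folded c_def])
 show "0 <= c ^ N * (c ^ N * m)" using c m by simp
 show "norm (y - (y + (0, h))) <= real N * r" using N1[of y] by simp
 fix s :: real assume s: "0 <= s" "s <= 1"
 have "(y + (0, h)) + s *R (y - (y + (0, h))) = y + (1 - s) *R ((y + (0, h)) - y)"
  by (simp add: algebra_simps)
 moreover have "cball (y + (1 - s) *R ((y + (0, h)) - y)) (4 * r) <= usec g"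
  by (rule up[OF xy(2,4)]) (use s in auto)
 ultimately show "cball ((y + (0, h)) + s *R (y - (y + (0, h)))) (4 * r) <= usec g"
  by (simp only:)
 qed auto
 moreover have "c ^ (3 * N) * m = c ^ N * (c ^ N * (c ^ N * m))"
 proof -
 have "3 * N = N + (N + N)" by simp
 thus ?thesis by (simp only: power_add mult.assoc)
 qed
 ultimately show ?thesis unfolding c_def by auto
qed

text \<open>Harnack chains carry the bound to all points with \<open>rho >= de / 2\<close>, and the
  Hopf barrier carries it down to the lateral boundary. The constant precedes \<open>g\<close> and
  \<open>v\<close>, which is where uniformity over all cones with the same \<open>L\<close> and
  \<open>K\<close> comes from.\<close>

lemma cone_spread:
 fixes L K d :: real
 assumes L: "1 <= L" "1 <= K" and d: "0 < d"
 shows "EX c>0. ALL (g :: 'a::euclidean_space => real) v m x0.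
  epi L K g --> 0 <= m --> continuous_on (csec g) v -->
  (ALL y. 0 <= rho g y & norm y < 1 --> 0 <= v y) -->
  asub (usec g) (%y. - v y) (%y. 0) -->
  norm x0 <= t0 L --> d <= rho g x0 --> (ALL w:cball x0 (d / (8 * (1 + L))). m <= v w) -->
  (ALL x. 0 < rho g x & t0 L / 2 <= norm x & norm x <= 3/4 * t0 L --> c * m * rho g x <= v x)"
proof -
 define t where "t = t0 L / 2"
 have t: "0 < t" "t <= 1/2" "t <= 1/20" using t0(1,2)[OF L(1)] by (auto simp: t_def)
 define de where "de = bd TYPE('a) L K t"
 have de: "de > 0" using bd_pos[OF L t(1)] by (simp add: de_def)
 define d' where "d' = min d (de / 2)"
 have d': "0 < d'" "d' <= d" "d' <= de/2" using d de by (auto simp: d'_def)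
 define r where "r = d' / (8 * (1 + L))"
 have r: "r > 0" "r <= d / (8 * (1 + L))"
 using d' L by (auto simp: r_def intro!: divide_right_mono)
 define N where "N = nat \<lceil>2 * (1 + L) * t0 L / r\<rceil>"
 have N: "2 * (1 + L) * t0 L <= real N * r"
 proof -
 have "2 * (1 + L) * t0 L / r <= real N" unfolding N_def by linarith
 thus ?thesis using r(1) by (simp add: field_simps)
 qed
 define c0 where "c0 = chc (real DIM('a * real)) ^ (3 * N)"
 have c0: "c0 > 0" unfolding c0_def by (intro zero_less_power chc) simp
 define c where "c = min (c0 / (2 * de)) (c0 / (1 + L))"
 have c: "c > 0" "c <= c0 / (2 * de)" "c <= c0 / (1 + L)" using c0 de L by (auto simp: c_def)
 show ?thesis
 proof (intro exI[of _ c] conjI allI impI)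
 show "c > 0" by (rule c)
 fix g :: "'a => real" and v m x0 x
 assume e: "epi L K g" and m: "0 <= m" and cv: "continuous_on (csec g) v"
  and v0: "ALL y. 0 <= rho g y & norm y < 1 --> 0 <= v y"
  and as: "asub (usec g) (%y. - v y) (%y. 0)"
  and x0: "norm x0 <= t0 L" "d <= rho g x0" "ALL w:cball x0 (d / (8 * (1 + L))). m <= v w"
  and x: "0 < rho g x & t0 L / 2 <= norm x & norm x <= 3/4 * t0 L"
 have chain: "c0 * m <= v y" if "norm y <= t0 L" "de / 2 <= rho g y" for y
  unfolding c0_def
 proof (rule cone_chain[OF e d'(1) m _ _ as x0(1) that(1) _ _ r_def N])
  show "continuous_on (usec g) v"
  by (rule continuous_on_subset[OF cv]) (auto simp: epicone_def)
  show "0 <= v w" if "w : usec g" for w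
  using v0[rule_format, of w] that by (simp add: epicone_def)
  show "d' <= rho g x0" "d' <= rho g y" using x0(2) d' that by auto
  show "m <= v w" if "w : cball x0 r" for w using x0(3) that r(2) by auto
  show "y : cball y r" using r(1) by simp
 qed
 have cm: "0 <= c0 * m" using c0 m by simp
 show "c * m * rho g x <= v x"
 proof (cases "rho g x < de")
  case True
  have nx: "norm y <= t0 L" if "norm (y - x) <= t/4" for y
  using norm_triangle_ineq[of x "y - x"] that x by (simp add: t_def)
  have nx1: "norm y < 1" if "norm (y - x) <= t/4" for y
  using nx[OF that] t0(2)[OF L(1)] by simp
  have "c0 * m * rho g x / (2 * de) <= v x"
  unfolding de_def
  proof (rule lower_barrier[OF e t(1) _ _ _ _ cm])
  show "t <= norm x" "norm x <= 1/2" "0 < rho g x" using x t by (auto simp: t_def)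
  show "rho g x < bd TYPE('a) L K t" using True by (simp add: de_def)
  show "continuous_on {y. 0 <= rho g y & norm (y - x) <= t / 4} v"
   by (rule continuous_on_subset[OF cv]) (use nx1 in auto)
  show "0 <= v y" if "0 <= rho g y" "norm (y - x) <= t / 4" for y
   using v0[rule_format, of y] nx1 that by simp
  show "c0 * m <= v y" if "bd TYPE('a) L K t / 2 <= rho g y" "norm (y - x) <= t / 4" for y
   by (rule chain) (use nx that in \<open>auto simp: de_def\<close>)
  show "asub {y. 0 < rho g y & norm (y - x) < t / 4} (%y. - v y) (%y. 0)"
   by (rule asub_mono[OF as]) (use nx1 in \<open>auto simp: epicone_def\<close>)
  qed
  moreover have "c * (m * rho g x) <= c0 / (2 * de) * (m * rho g x)"
  using c(2) m x by (intro mult_right_mono) auto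
  ultimately show ?thesis by auto
 next
  case False
  have "norm x <= t0 L" using x t0(1)[OF L(1)] by auto
  hence "c0 * m <= v x" using chain[of x] False de by simp
  moreover have "c * m * rho g x <= c0 * m"
  proof -
  have "rho g x <= (1 + L) * norm x" using rho_bound[OF e, of x] by simp
  also have "... <= (1 + L) * 1" using x t0(2)[OF L(1)] L by simp
  finally have "c * rho g x <= c0 / (1 + L) * (1 + L)" using c x by (intro mult_mono) auto
  hence "c * rho g x <= c0" using L by simp
  hence "m * (c * rho g x) <= m * c0" using m by (intro mult_left_mono) auto
  thus ?thesis by (simp add: mult_ac)
  qed
  ultimately show ?thesis by auto
 qed
 qed
qed

text \<open>Interior gradient estimate: compare a harmonic function with its reflection in a
 coordinate hyperplane on a half ball, where the difference vanishes on the flat part.\<close>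

lemma D2on_reflect:
 fixes f :: "'b::euclidean_space => real" and m :: 'b
 assumes D: "D2on S f G h" and b: "b : Basis"
 defines "R \<equiv> %x. x - (2 * ((x - m) \<bullet> b)) *R b"
 shows "D2on {x. R x : S} (%x. f (R x)) (%x. G (R x) - (2 * (G (R x) \<bullet> b)) *R b) (%b' x. h b' (R x))"
 unfolding D2on_def
proof (intro ballI conjI)
 fix x b' :: 'b assume x: "x : {x. R x : S}" and b': "b' : Basis"
 hence xS: "R x : S" by simp
 define si :: real where "si = (if b' = b then -1 else 1)"
 have bb: "b' \<bullet> b = (if b' = b then 1 else 0)" "b \<bullet> b' = (if b' = b then 1 else 0)"
 using b b' by (auto simp: inner_Basis)
 have line: "R (x + t *R b') = R x + (si * t) *R b'" for t
 proof -
 have "(x + t *R b' - m) \<bullet> b = (x - m) \<bullet> b + t * (b' \<bullet> b)" by (simp add: inner_simps)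
 hence l: "R (x + t *R b') = x + t *R b' - (2 * ((x - m) \<bullet> b) + 2 * (t * (b' \<bullet> b))) *R b"
  unfolding R_def by simp
 show ?thesis
 proof (cases "b' = b")
  case True
  have "x + t *R b - (2 * ((x - m) \<bullet> b) + 2 * t) *R b = x - (2 * ((x - m) \<bullet> b)) *R b + (- 1 * t) *R b"
  by (simp only: scaleR_left_distrib mult_2) simp
  thus ?thesis unfolding l unfolding si_def R_def using bb(1) by simp
 next
  case False
  thus ?thesis unfolding l unfolding si_def R_def using bb(1) by simp
 qed
 qed
 have g: "(G y - (2 * (G y \<bullet> b)) *R b) \<bullet> b' = si * (G y \<bullet> b')" for y
 unfolding si_def using bb by (auto simp: inner_simps)
 have d: "DERIV (%t. f (R x + t *R b')) (si * 0) :> G (R x) \<bullet> b'"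
 "DERIV (%t. G (R x + t *R b') \<bullet> b') (si * 0) :> h b' (R x)"
 using D xS b' unfolding D2on_def by auto
 have r: "DERIV (%t. si * t) 0 :> si" by auto
 have s2: "si * si = 1" by (simp add: si_def)
 show "DERIV (%t. f (R (x + t *R b'))) 0 :> (G (R x) - (2 * (G (R x) \<bullet> b)) *R b) \<bullet> b'"
 unfolding line g using DERIV_chain2[OF d(1) r] by (simp add: mult.commute)
 have "DERIV (%t. si * (G (R x + (si * t) *R b') \<bullet> b')) 0 :> si * (h b' (R x) * si)"
 by (rule DERIV_cmult[OF DERIV_chain2[OF d(2) r]])
 moreover have "si * (h b' (R x) * si) = h b' (R x)" using s2 by auto
 ultimately show "DERIV (%t. (G (R (x + t *R b')) - (2 * (G (R (x + t *R b')) \<bullet> b)) *R b) \<bullet> b') 0 :> h b' (R x)"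
 unfolding line g by simp
qed

text \<open>Reflection in the hyperplane through the midpoint of the step exchanges the two
  endpoints, so the increment of \<open>H\<close> is the value of the antisymmetric part at one
  endpoint, at distance \<open>abs t / 2\<close> from the flat side.\<close>

lemma harmonic_step:
 fixes H :: "'b::euclidean_space => real"
 assumes lap: "has_lap (ball c (2 * d)) H G (%_. 0)" and cH: "continuous_on (ball c (2 * d)) H"
 and B: "!!y. y : ball c (2 * d) ==> abs (H y) <= B" and d: "d > 0"
 and b: "b : Basis" and t: "t ~= 0" "abs t <= d"
 shows "H (c + t *R b) - H c <= 2 * (1 + real DIM('b)) * B * abs t / d"
proof -
 define n where "n = real DIM('b)"
 have n: "n > 0" by (simp add: n_def)
 have B0: "B >= 0" using B[of c] d by force
 define m where "m = c + (t / 2) *R b"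
 define e where "e = sgn t *R b"
 have bb: "b \<bullet> b = 1" using b by simp
 have ee: "e \<bullet> e = 1" using t bb by (simp add: e_def)
 define R where "R = (%x. x - (2 * ((x - m) \<bullet> b)) *R b)"
 have Rn: "norm (R y - m) = norm (y - m)" for y
 proof -
 have "(norm (R y - m))^2 = (norm (y - m))^2"
  unfolding R_def power2_norm_eq_inner using bb by (simp add: inner_commute algebra_simps)
 thus ?thesis by auto
 qed
 have inb: "y : ball c (2 * d)" if "norm (y - m) <= d" for y
 proof -
 have "norm (y - c) <= norm (y - m) + norm (m - c)" using norm_triangle_ineq[of "y - m" "m - c"] by simp
 also have "norm (m - c) = abs t / 2" using b by (simp add: m_def)
 finally show ?thesis using that t by (simp add: dist_norm norm_minus_commute)
 qed
 have inbR: "R y : ball c (2 * d)" if "norm (y - m) <= d" for y using inb[of "R y"] that by (simp add: Rn)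
 have contR: "continuous_on S R" for S unfolding R_def by (intro continuous_intros)
 define D where "D = {y. 0 < (y - m) \<bullet> e & norm (y - m) < d}"
 have reg: "open D" "y : closure D ==> 0 <= (y - m) \<bullet> e & norm (y - m) <= d"
  "y : frontier D ==> 0 <= (y - m) \<bullet> e & norm (y - m) <= d & ((y - m) \<bullet> e = 0 | norm (y - m) = d)" for y
 unfolding D_def
 by (rule two_sided_region[of "%y. (y - m) \<bullet> e" "%y. norm (y - m)"]; auto intro!: continuous_intros)+
 obtain h where h: "D2on (ball c (2 * d)) H G h" "ALL x:ball c (2 * d). 0 = (SUM b:Basis. h b x)"
 using lap unfolding has_lap_def by blast
 define u where "u = (%y. H y - H (R y))"
 have "has_lap {x. R x : ball c (2 * d)} (%x. H (R x)) (%x. G (R x) - (2 * (G (R x) \<bullet> b)) *R b) (%x. 0)"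
 unfolding has_lap_def
 proof (intro exI conjI)
 show "D2on {x. R x : ball c (2 * d)} (%x. H (R x)) (%x. G (R x) - (2 * (G (R x) \<bullet> b)) *R b) (%b x. h b (R x))"
  using D2on_reflect[OF h(1) b, of m] unfolding R_def .
 qed (use h(2) in auto)
 note lapR = this
 have DR: "D <= {x. R x : ball c (2 * d)}" "D <= ball c (2 * d)"
 using inb inbR by (auto simp del: mem_ball simp: D_def)
 have lapu: "has_lap D u (%x. G x - (G (R x) - (2 * (G (R x) \<bullet> b)) *R b)) (%x. 0 - 0)"
 unfolding u_def
 by (rule has_lap_diff[OF has_lap_subset[OF lap DR(2)] has_lap_subset[OF lapR DR(1)]])
 have cu: "continuous_on (closure D) u"
 proof -
 have "continuous_on (closure D) H" by (rule continuous_on_subset[OF cH]) (use reg(2) inb in blast)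
 moreover have "continuous_on (closure D) (%y. H (R y))"
  by (rule continuous_on_compose2[OF cH contR]) (use reg(2) inbR in blast)
 ultimately show ?thesis unfolding u_def by (intro continuous_intros)
 qed
 define ta where "ta = (%y. (1/d) * (e \<bullet> y + - (e \<bullet> m)))"
 have ta: "ta y = ((y - m) \<bullet> e) / d" for y by (simp add: ta_def inner_simps inner_commute)
 have ta1: "ta y <= 1" if "norm (y - m) <= d" for y
 proof -
 have "(y - m) \<bullet> e <= norm (y - m) * norm e" by (rule norm_cauchy_schwarz)
 also have "norm e = 1" using ee by (simp add: norm_eq_sqrt_inner)
 finally show ?thesis using that d by (simp add: ta)
 qed
 \<comment> \<open>A harmonic barrier: the Laplacian \<open>2 * n / d^2\<close> of the first term is
   cancelled by the concave term in the normal coordinate \<open>ta\<close>. It is at least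
   \<open>2 * B\<close> on the round part of the boundary and nonnegative on the flat part.\<close>
 define V where "V = (%y. 2 * B * ((1 / d^2) * (norm (y - m))^2 + n * (ta y - (ta y)^2)))"
 have lapt: "has_lap UNIV ta (%y. (1/d) *R (e + 0)) (%y. (1/d) * (0 + 0))"
 unfolding ta_def by (intro has_lap_cmul has_lap_add has_lap_inner has_lap_const)
 have lapV: "has_lap UNIV V (%y. (2 * B) *R ((1 / d^2) *R 2 *R (y - m) + n *R (1 - 2 * ta y) *R (1/d) *R (e + 0)))
  (%y. 2 * B * ((1 / d^2) * (2 * real DIM('b)) + n * (- 2 * (((1/d) *R (e + 0)) \<bullet> ((1/d) *R (e + 0))) + (1 - 2 * ta y) * ((1/d) * (0 + 0)))))"
 unfolding V_def
 by (intro has_lap_cmul has_lap_add has_lap_sqnorm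
  has_lap_comp[OF lapt, where F="%s. s - s^2" and ?F1.0="%s. 1 - 2 * s" and ?F2.0="%s. - 2"])
  (auto intro!: derivative_eq_intros)
 have V0: "V y >= 2 * B * ((norm (y - m))^2 / d^2)" if "0 <= (y - m) \<bullet> e" "norm (y - m) <= d" for y
 proof -
 have "0 <= ta y" using that d by (simp add: ta)
 hence "(ta y)^2 <= ta y" using ta1[OF that(2)] by (simp add: power2_eq_square mult_left_le)
 hence "n * (ta y - (ta y)^2) >= 0" using n by simp
 thus ?thesis unfolding V_def using B0 by (intro mult_left_mono) auto
 qed
 define x where "x = c + t *R b"
 have xm: "x - m = (t / 2) *R b"
 by (simp add: x_def m_def flip: scaleR_diff_left)
 have xe: "(x - m) \<bullet> e = abs t / 2" unfolding xm e_def using bb by (simp add: sgn_if)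
 have xn: "norm (x - m) = abs t / 2" unfolding xm using b by simp
 have "u x <= V x"
 proof (rule comparison[OF reg(1) _ cu, where q="%_. 0"])
 show "bounded D" by (rule bounded_subset[of "cball m d"]) (auto simp: D_def dist_norm norm_minus_commute)
 show "continuous_on (closure D) V" unfolding V_def ta_def by (intro continuous_intros)
 show "u y <= V y" if "y : frontier D" for y
 proof -
  note f = reg(3)[OF that]
  have "(y - m) \<bullet> e = 0 | norm (y - m) = d" using f by auto
  thus ?thesis
  proof
  assume "(y - m) \<bullet> e = 0"
  hence "(y - m) \<bullet> b = 0" using t by (auto simp: e_def sgn_if split: if_splits)
  hence "R y = y" by (simp add: R_def)
  hence "u y = 0" by (simp add: u_def)
  moreover have "0 <= 2 * B * ((norm (y - m))^2 / d^2)" using B0 by simp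
  ultimately show ?thesis using V0[of y] f by auto
  next
  assume a: "norm (y - m) = d"
  have "u y <= abs (H y) + abs (H (R y))" unfolding u_def by simp
  also have "... <= 2 * B" using B[OF inb[of y]] B[OF inbR[of y]] a by simp
  also have "... = 2 * B * ((norm (y - m))^2 / d^2)" using a d by simp
  finally show ?thesis using V0[of y] f by auto
  qed
 qed
 show "asub {x : D. V x < u x} u (%_. 0)"
 proof (rule asub_mono)
  show "asub D u (%_. 0)"
  by (rule asub_classical[OF reg(1) lapu continuous_on_subset[OF cu closure_subset]]) simp
 qed auto
 show "touch_above V y 0" for y
 proof (rule touch_aboveI[OF open_UNIV _ lapV])
  have "2 * B * ((1 / d^2) * (2 * n) + n * (- 2 * (1 / d^2))) = 0" by simp
  moreover have "((1/d) *R (e + 0)) \<bullet> ((1/d) *R (e + 0)) = 1 / d^2"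
  using ee by (simp add: power2_eq_square)
  ultimately show "0 <= - (2 * B * ((1 / d^2) * (2 * real DIM('b)) + n * (- 2 * (((1/d) *R (e + 0)) \<bullet> ((1/d) *R (e + 0))) + (1 - 2 * ta y) * ((1/d) * (0 + 0)))))"
  unfolding n_def[symmetric] by simp
 qed auto
 show "x : D" unfolding D_def using xe xn t d by simp
 qed
 moreover have "R x = c"
 proof -
 have "(x - m) \<bullet> b = t / 2" unfolding xm using bb by simp
 thus ?thesis by (simp add: R_def x_def)
 qed
 ultimately have "H x - H c <= V x" by (simp add: u_def)
 define a where "a = abs t / d"
 have q: "0 <= a" "a <= 1" using t by (auto simp: a_def)
 note \<open>H x - H c <= V x\<close>
 also have "V x <= 2 * B * (a + n * a)"
 unfolding V_def
 proof (intro mult_left_mono add_mono)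
 have "(1 / d^2) * (norm (x - m))^2 = a * a / 4"
  unfolding xn a_def by (simp add: power2_eq_square)
 moreover have "a * a <= a" using q by (intro mult_left_le) auto
 ultimately show "(1 / d^2) * (norm (x - m))^2 <= a" using q by linarith
 have "ta x = a / 2" unfolding ta xe a_def by simp
 thus "ta x - (ta x)^2 <= a" using q zero_le_power2[of "ta x"] by linarith
 qed (use B0 n in auto)
 also have "2 * B * (a + n * a) = 2 * (1 + n) * B * abs t / d" by (simp add: a_def algebra_simps add_divide_distrib)
 finally show ?thesis unfolding x_def n_def .
qed

lemma harmonic_step_abs:
 fixes H :: "'b::euclidean_space => real"
 assumes lap: "has_lap (ball c (2 * d)) H G (%_. 0)" and cH: "continuous_on (ball c (2 * d)) H"
 and B: "!!y. y : ball c (2 * d) ==> abs (H y) <= B" and d: "d > 0"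
 and b: "b : Basis" and t: "abs t <= d"
 shows "abs (H (c + t *R b) - H c) <= 2 * (1 + real DIM('b)) * B * abs t / d"
proof (cases "t = 0")
 case True thus ?thesis by simp
next
 case False
 have "has_lap (ball c (2 * d)) (%x. - H x) (%x. - G x) (%x. 0)"
 using has_lap_minus[OF lap] by simp
 hence "- H (c + t *R b) - - H c <= 2 * (1 + real DIM('b)) * B * abs t / d"
 by (rule harmonic_step) (use assms False in \<open>auto intro!: continuous_intros\<close>)
 moreover have "H (c + t *R b) - H c <= 2 * (1 + real DIM('b)) * B * abs t / d"
 by (rule harmonic_step[OF lap cH B d b False t])
 ultimately show ?thesis by auto
qed

text \<open>The displacement is added one coordinate at a time. By Pythagoras no intermediate point
  is farther from \<open>c\<close> than \<open>w\<close>, so each step has a ball of radius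
  \<open>d\<close> at its disposal.\<close>

lemma harmonic_osc:
 fixes H :: "'b::euclidean_space => real"
 assumes lap: "has_lap (ball c (2 * d)) H G (%_. 0)" and cH: "continuous_on (ball c (2 * d)) H"
 and B: "!!y. y : ball c (2 * d) ==> abs (H y) <= B" and d: "d > 0"
 and w: "norm (w - c) <= d / 2"
 shows "abs (H w - H c) <= 4 * real DIM('b) * (1 + real DIM('b)) * B * norm (w - c) / d"
proof -
 define s where "s = norm (w - c)"
 define q where "q = (%F. c + (SUM b:F. ((w - c) \<bullet> b) *R b))"
 have B0: "B >= 0" using B[of c] d by force
 define M where "M = 2 * (1 + real DIM('b)) * B * s / (d / 2)"
 have "finite F ==> F <= Basis ==> abs (H (q F) - H c) <= real (card F) * M" for F
 proof (induction F rule: finite_induct)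
 case empty thus ?case by (simp add: q_def)
 next
 case (insert b F)
 have b: "b : Basis" using insert by auto
 have qF: "q (insert b F) = q F + ((w - c) \<bullet> b) *R b" using insert by (simp add: q_def)
 have le: "abs ((w - c) \<bullet> b) <= s" unfolding s_def using Basis_le_norm[OF b, of "w - c"] by simp
 have near: "norm (q F - c) <= s"
 proof -
  have "(norm (q F - c))^2 = (SUM b:F. (norm (((w - c) \<bullet> b) *R b))^2)"
  unfolding q_def
  proof -
  have "pairwise (%i j. orthogonal (((w - c) \<bullet> i) *R i) (((w - c) \<bullet> j) *R j)) F"
   using insert(4) by (auto simp: pairwise_def orthogonal_def inner_not_same_Basis subset_iff)
  thus "(norm (c + (SUM b:F. ((w - c) \<bullet> b) *R b) - c))^2 = (SUM b:F. (norm (((w - c) \<bullet> b) *R b))^2)"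
   using norm_sum_Pythagorean[OF insert(1), of "%b. ((w - c) \<bullet> b) *R b"] by auto
  qed
  also have "... = (SUM b:F. ((w - c) \<bullet> b)^2)"
  by (rule sum.cong) (use insert in auto)
  also have "... <= (SUM b:Basis. ((w - c) \<bullet> b)^2)"
  using insert by (intro sum_mono2) auto
  also have "... = s^2" unfolding s_def power2_norm_eq_inner euclidean_inner[of "w - c" "w - c"]
  by (simp add: power2_eq_square)
  finally show ?thesis unfolding s_def by auto
 qed
 have sub: "ball (q F) (2 * (d / 2)) <= ball c (2 * d)"
 proof
  fix y assume "y : ball (q F) (2 * (d / 2))"
  hence "norm (y - q F) < d" by (simp add: dist_norm norm_minus_commute)
  moreover have "norm (y - c) <= norm (y - q F) + norm (q F - c)"
  using norm_triangle_ineq[of "y - q F" "q F - c"] by simp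
  ultimately show "y : ball c (2 * d)" using near w d unfolding s_def
  by (simp add: dist_norm norm_minus_commute)
 qed
 have "abs (H (q F + ((w - c) \<bullet> b) *R b) - H (q F)) <= 2 * (1 + real DIM('b)) * B * abs ((w - c) \<bullet> b) / (d / 2)"
  by (rule harmonic_step_abs[OF has_lap_subset[OF lap sub] continuous_on_subset[OF cH sub] _ _ b])
  (use sub B d le w in \<open>auto simp: s_def\<close>)
 also have "... <= M" unfolding M_def using le d B0 by (intro divide_right_mono mult_left_mono) auto
 finally have "abs (H (q (insert b F)) - H (q F)) <= M" unfolding qF .
 moreover have "abs (H (q F) - H c) <= real (card F) * M" using insert by auto
 ultimately show ?case using insert by (simp add: algebra_simps)
 qed
 from this[of Basis] have "abs (H (q Basis) - H c) <= real DIM('b) * M" by simp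
 moreover have "q Basis = w" unfolding q_def by (simp add: euclidean_representation)
 ultimately show ?thesis unfolding M_def s_def by (simp add: field_simps)
qed

text \<open>The normal form of the harmonic function: maximum 1 on the sphere, attained, with the
  Euler identity recorded beside harmonicity. Continuity of the derivatives is included for the
  finite difference barriers, which need it.\<close>

definition cone_harm :: "('a::euclidean_space => real) => real => ('a * real => real) => bool" where
 "cone_harm g ph H \<longleftrightarrow> 0 < ph & continuous_on {x. 0 <= rho g x} H & (ALL x. rho g x = 0 --> H x = 0) &
  (ALL x:epicone g. ALL t>0. H (t *R x) = t powr ph * H x) &
  (ALL x:epicone g. 0 <= H x & H x <= norm x powr ph) &
  (EX x:epicone g. norm x = 1 & H x = 1) &
  (EX G h. D2on (epicone g) H G h & continuous_on (epicone g) G &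
  (ALL b:Basis. continuous_on (epicone g) (h b)) &
  (ALL x:epicone g. (SUM b:Basis. h b x) = 0 & G x \<bullet> x = ph * H x))"

lemma cone_harmD:
 assumes "cone_harm g ph H"
 shows "0 < ph" "continuous_on {x. 0 <= rho g x} H" "rho g x = 0 ==> H x = 0"
 "x : epicone g ==> t > 0 ==> H (t *R x) = t powr ph * H x"
 "x : epicone g ==> 0 <= H x" "x : epicone g ==> H x <= norm x powr ph"
 "EX x:epicone g. norm x = 1 & H x = 1" "EX G. has_lap (epicone g) H G (%_. 0) & (ALL x:epicone g. G x \<bullet> x = ph * H x)"
 using assms unfolding cone_harm_def has_lap_def by (blast, blast, blast, blast, blast, blast, blast, metis)

lemma cone_harm_asub:
 assumes "epi L K g" "cone_harm g ph H" "open S" "S <= epicone g"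
 shows "asub S H (%_. 0)" "asub S (%x. - H x) (%_. 0)"
proof -
 obtain G where G: "has_lap (epicone g) H G (%_. 0)" using cone_harmD(8)[OF assms(2)] by blast
 have c: "continuous_on S H"
 by (rule continuous_on_subset[OF cone_harmD(2)[OF assms(2)]]) (use assms in \<open>auto simp: epicone_def\<close>)
 show "asub S H (%_. 0)"
 by (rule asub_classical[OF assms(3) has_lap_subset[OF G assms(4)] c]) simp
 show "asub S (%x. - H x) (%_. 0)"
 by (rule asub_classical[OF assms(3) has_lap_minus[OF has_lap_subset[OF G assms(4)]]])
  (auto intro!: continuous_intros c)
qed

text \<open>The normalisation gives \<open>H <= 1\<close> in the unit ball, so the linear barrier
  applies with \<open>M = 1\<close> and no right-hand side.\<close>

lemma cone_harm_upper:
 fixes g :: "'a::euclidean_space => real"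
 assumes e: "epi L K g" and H: "cone_harm g ph H" and x: "0 <= rho g x" "norm x = 1/2"
 shows "H x <= 2 / bd TYPE('a) L K (1/2) * rho g x"
proof (cases "rho g x = 0")
 case True thus ?thesis using cone_harmD(3)[OF H True] by simp
next
 case False
 define de where "de = bd TYPE('a) L K (1/2)"
 have L: "1 <= L" "1 <= K" using epiD[OF e] by auto
 have de: "de > 0" using bd_pos[OF L, of "1/2"] by (simp add: de_def)
 have n1: "norm y <= 1" if "norm (y - x) <= 1/2/4" for y
 using norm_triangle_ineq[of x "y - x"] that x by simp
 have "H x <= 0 + 2 / de * rho g x"
 proof (rule linear_upper[OF e, where t="1/2" and M=1 and q=0])
 show "continuous_on {y. 0 <= rho g y & norm (y - x) <= 1/2/4} H"
  by (rule continuous_on_subset[OF cone_harmD(2)[OF H]]) auto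
 show "H y <= 0" if "rho g y = 0" for y using cone_harmD(3)[OF H that] by simp
 show "H y <= 1" if y: "0 <= rho g y" "norm (y - x) <= 1/2/4" for y
 proof (cases "rho g y = 0")
  case True thus ?thesis using cone_harmD(3)[OF H True] by simp
 next
  case False
  hence "H y <= norm y powr ph" using y by (intro cone_harmD(6)[OF H]) (simp add: epicone_def)
  also have "... <= 1" using n1[OF y(2)] cone_harmD(1)[OF H] by (intro powr_le1) auto
  finally show ?thesis .
 qed
 show "asub D H (%y. 0)" if "open D" "!!y. y : D ==> 0 < rho g y & norm (y - x) < 1/2/4 & 0 < H y" for D
  by (rule cone_harm_asub(1)[OF e H that(1)]) (use that(2) in \<open>auto simp: epicone_def\<close>)
 show "0 <= 2 / de * bM TYPE('a) L K (1/2)" using de bM_pos[OF L, of "1/2", where 'a='a] by simp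
 qed (use x False de in \<open>auto simp: de_def\<close>)
 thus ?thesis by (simp add: de_def)
qed


text \<open>Uniformity in \<open>g\<close> is the difficulty, since the maximum point of
  \<open>H\<close> on the sphere is unknown. The linear upper bound keeps that point away from the
  boundary by \<open>d1\<close>, the interior gradient estimate yields a ball where \<open>H\<close>
  is bounded below, and \<open>cone_spread\<close> with homogeneity does the rest.\<close>

lemma cone_harm_lower:
 fixes L K ph :: real
 assumes L: "1 <= L" "1 <= K" and ph: "ph > 0"
 shows "EX c>0. ALL (g :: 'a::euclidean_space => real) H. epi L K g --> cone_harm g ph H -->
  (ALL x:epicone g. c * norm x powr ph * (rho g x / norm x) <= H x)"
proof -
 define de where "de = bd TYPE('a) L K (1/2)"
 have de: "de > 0" using bd_pos[OF L, of "1/2"] by (simp add: de_def)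
 define p where "p = (1/2) powr ph"
 have p: "p > 0" by (simp add: p_def)
 define d1 where "d1 = de / 2 * p"
 have d1: "d1 > 0" using de p by (simp add: d1_def)
 define n where "n = real DIM('a * real)"
 have n: "n > 0" by (simp add: n_def)
 \<comment> \<open>Within distance \<open>2 * D0\<close> of the half-radius point \<open>rho\<close>
   changes by at most \<open>d1 / 2\<close>, so the ball stays in the cone.\<close>
 define D0 where "D0 = d1 / (4 * (1 + L))"
 have D0: "D0 > 0" using d1 L by (simp add: D0_def)
 define q where "q = 4 * n * (1 + n) * 1"
 have q: "q > 0" using n by (simp add: q_def)
 \<comment> \<open>At this radius the oscillation estimate is at most \<open>p / 2\<close>, half the
   value of \<open>H\<close> at the centre.\<close>
 define s where "s = min (D0 / 2) (p / 2 * D0 / q)"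
 have s: "s > 0" "s <= D0 / 2" "s <= p / 2 * D0 / q" using D0 p q by (auto simp: s_def)
 define T where "T = t0 L"
 have T: "T > 0" using t0 L by (simp add: T_def)
 define d where "d = min (2 * T * d1) (16 * (1 + L) * T * s)"
 have d: "d > 0" "d <= 2 * T * d1" "d <= 16 * (1 + L) * T * s"
 using T d1 L s by (auto simp: d_def)
 have ds: "d / (8 * (1 + L)) <= 2 * T * s" using d(3) L by (simp add: field_simps)
 define m where "m = (2 * T) powr ph * (p / 2)"
 have m: "m > 0" using T p by (simp add: m_def)
 obtain c0 where c0: "c0 > 0" "ALL (g :: 'a => real) v m x0.
  epi L K g --> 0 <= m --> continuous_on (csec g) v -->
  (ALL y. 0 <= rho g y & norm y < 1 --> 0 <= v y) -->
  asub (usec g) (%y. - v y) (%y. 0) -->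
  norm x0 <= t0 L --> d <= rho g x0 --> (ALL w:cball x0 (d / (8 * (1 + L))). m <= v w) -->
  (ALL x. 0 < rho g x & t0 L / 2 <= norm x & norm x <= 3/4 * t0 L --> c0 * m * rho g x <= v x)"
 using cone_spread[OF L d(1)] by blast
 define c where "c = c0 * m * (T / 2) * (2 / T) powr ph"
 have c: "c > 0" using c0 m T by (simp add: c_def)
 show ?thesis
 proof (intro exI[of _ c] conjI allI impI ballI)
 show "c > 0" by (rule c)
 fix g :: "'a => real" and H x assume e: "epi L K g" and H: "cone_harm g ph H" and x: "x : epicone g"
 obtain th where th: "th : epicone g" "norm th = 1" "H th = 1" using cone_harmD(7)[OF H] by blast
 define x1 where "x1 = (1/2::real) *R th"
 have nx1: "norm x1 = 1/2" using th by (simp add: x1_def)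
 have x1c: "x1 : epicone g" unfolding x1_def using cone_scale[OF e, of "1/2" th] th by simp
 have Hx1: "H x1 = p" unfolding x1_def p_def using cone_harmD(4)[OF H th(1), of "1/2"] th by simp
 have "p <= 2 / de * rho g x1"
  using cone_harm_upper[OF e H _ nx1] x1c Hx1 by (simp add: de_def epicone_def)
 hence r1: "d1 <= rho g x1" using de by (simp add: d1_def field_simps)
 have "rho g x1 <= (1 + L) * (1/2)" using rho_bound[OF e, of x1] nx1 by simp
 hence "d1 <= (1 + L) / 2" using r1 by simp
 hence D02: "2 * D0 <= 1/4" using L by (simp add: D0_def)
 have sub: "ball x1 (2 * D0) <= usec g"
 proof
  fix y assume "y : ball x1 (2 * D0)"
  hence y: "norm (y - x1) < 2 * D0" by (simp add: dist_norm norm_minus_commute)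
  have "abs (rho g y - rho g x1) <= (1 + L) * norm (y - x1)" by (rule rho_lip[OF e])
  also have "... <= (1 + L) * (2 * D0)" using y L by simp
  also have "... = d1 / 2" using L by (simp add: D0_def field_simps)
  finally have "0 < rho g y" using r1 d1 by linarith
  moreover have "norm y < 1" using norm_triangle_ineq[of x1 "y - x1"] nx1 y D02 by simp
  ultimately show "y : usec g" by (simp add: epicone_def)
 qed
 have H1: "abs (H y) <= 1" if "y : usec g" for y
 proof -
  have "norm y powr ph <= 1" using that ph by (intro powr_le1) auto
  thus ?thesis using cone_harmD(5,6)[OF H, of y] that by auto
 qed
 obtain G where G: "has_lap (epicone g) H G (%_. 0)" using cone_harmD(8)[OF H] by blast
 have osc: "p / 2 <= H w" "w : epicone g" if "norm (w - x1) <= s" for w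
 proof -
  have "abs (H w - H x1) <= 4 * real DIM('a * real) * (1 + real DIM('a * real)) * 1 * norm (w - x1) / D0"
  proof (rule harmonic_osc[of x1 D0 H G])
  show "has_lap (ball x1 (2 * D0)) H G (%_. 0)" by (rule has_lap_subset[OF G]) (use sub in auto)
  show "continuous_on (ball x1 (2 * D0)) H"
   by (rule continuous_on_subset[OF cone_harmD(2)[OF H]]) (use sub in \<open>auto simp: epicone_def\<close>)
  show "abs (H y) <= 1" if "y : ball x1 (2 * D0)" for y using H1 sub that by blast
  show "norm (w - x1) <= D0 / 2" using that s by simp
  qed (rule D0)
  also have "... = q * norm (w - x1) / D0" by (simp add: q_def n_def)
  also have "... <= q * (p / 2 * D0 / q) / D0"
  using that s q by (intro divide_right_mono mult_left_mono) auto
  also have "... = p / 2" using q D0 by simp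
  finally show "p / 2 <= H w" unfolding Hx1 by linarith
  have "norm (w - x1) < 2 * D0" using that s(2) D0 by simp
  hence "w : ball x1 (2 * D0)" by (simp add: dist_norm norm_minus_commute)
  thus "w : epicone g" using sub by blast
 qed
 \<comment> \<open>Homogeneity moves the good ball from radius 1/2 to radius \<open>T\<close>, where
   \<open>cone_spread\<close> expects its starting point.\<close>
 define x0 where "x0 = (2 * T) *R x1"
 have x0: "norm x0 = T" "rho g x0 = 2 * T * rho g x1"
  using T nx1 rho_scale[OF e, of "2 * T" x1] by (simp_all add: x0_def)
 have mw: "m <= H w" if "w : cball x0 (d / (8 * (1 + L)))" for w
 proof -
  have "norm (w - x0) <= 2 * T * s" using that ds by (simp add: dist_norm norm_minus_commute)
  define w' where "w' = (1 / (2 * T)) *R w"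
  have w: "w = (2 * T) *R w'" using T by (simp add: w'_def)
  have "w - x0 = (2 * T) *R (w' - x1)" unfolding x0_def w by (simp add: scaleR_diff_right)
  hence "norm (w - x0) = 2 * T * norm (w' - x1)" using T by simp
  hence "2 * T * norm (w' - x1) <= 2 * T * s" using \<open>norm (w - x0) <= 2 * T * s\<close> by simp
  hence "norm (w' - x1) <= s" using T by simp
  from osc[OF this] have "p / 2 <= H w'" "w' : epicone g" .
  moreover have "H w = (2 * T) powr ph * H w'"
  unfolding w by (rule cone_harmD(4)[OF H]) (use calculation T in auto)
  moreover have "(2 * T) powr ph * (p / 2) <= (2 * T) powr ph * H w'"
  using calculation by (intro mult_left_mono) auto
  ultimately show ?thesis unfolding m_def by auto
 qed
 have nonneg: "0 <= H y" if "0 <= rho g y" for y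
  using cone_harmD(3,5)[OF H, of y] that by (cases "rho g y = 0") (auto simp: epicone_def)
 have conc: "c0 * m * rho g y <= H y" if "0 < rho g y" "norm y = T / 2" for y
 proof (rule c0(2)[rule_format, OF e])
  show "0 < rho g y & t0 L / 2 <= norm y & norm y <= 3/4 * t0 L"
   using that T by (simp add: T_def)
  show "0 <= m" using m by simp
  show "continuous_on (csec g) H"
   by (rule continuous_on_subset[OF cone_harmD(2)[OF H]]) auto
  show "!!y. 0 <= rho g y & norm y < 1 ==> 0 <= H y" using nonneg by blast
  show "asub (usec g) (%y. - H y) (%y. 0)"
   by (rule cone_harm_asub(2)[OF e H]) (auto intro: open_cone[OF e])
  show "norm x0 <= t0 L" using x0 by (simp add: T_def)
  show "d <= rho g x0" unfolding x0(2) using d(2) T mult_left_mono[OF r1, of "2 * T"] by linarith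
  show "!!w. w : cball x0 (d / (8 * (1 + L))) ==> m <= H w" by (rule mw)
 qed
 have nx: "norm x > 0" using cone_nz[OF e x] by simp
 define y where "y = (T / 2 / norm x) *R x"
 have y: "rho g y = T / 2 / norm x * rho g x" "norm y = T / 2"
  using nx T rho_scale[OF e, of "T / 2 / norm x" x] by (simp_all add: y_def)
 have yp: "0 < rho g y" using y(1) x T nx by (simp add: epicone_def)
 have xy: "x = (2 / T * norm x) *R y" using T by (simp add: y_def)
 have "H x = (2 / T * norm x) powr ph * H y"
  by (subst xy) (rule cone_harmD(4)[OF H], use yp T nx in \<open>auto simp: epicone_def\<close>)
 also have "... >= (2 / T * norm x) powr ph * (c0 * m * rho g y)"
  using conc[OF yp y(2)] by (intro mult_left_mono) auto
 also have "(2 / T * norm x) powr ph = (2 / T) powr ph * norm x powr ph"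
  by (intro powr_mult)
 also have "(2 / T) powr ph * norm x powr ph * (c0 * m * rho g y) = c * norm x powr ph * (rho g x / norm x)"
  unfolding y(1) c_def by simp
 finally show "c * norm x powr ph * (rho g x / norm x) <= H x" .
 qed
qed

lemma has_lap_eq: "has_lap S f G l ==> (!!x. x : S ==> l x = l' x) ==> has_lap S f G l'"
 unfolding has_lap_def by auto

section \<open>Growth of solutions at the vertex\<close>

definition sing :: "('a::euclidean_space => real) => real => real => real => ('a * real => real) => bool" where
 "sing g ga lam Lam u \<longleftrightarrow> continuous_on (csec g) u &
  (ALL x. rho g x = 0 & norm x < 1 --> u x = 0) & (ALL x:usec g. 0 < u x) &
  (EX f. poisson_distr (usec g) u (%x. f x * u x powr (- ga)) &
  (ALL x:usec g. lam <= f x & f x <= Lam))"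

lemma singD:
 assumes "sing g ga lam Lam u"
 shows "continuous_on (csec g) u" "rho g x = 0 ==> norm x < 1 ==> u x = 0"
 "0 < rho g x ==> norm x < 1 ==> 0 < u x" "0 <= rho g x ==> norm x < 1 ==> 0 <= u x"
proof -
 show 1: "continuous_on (csec g) u" using assms unfolding sing_def by blast
 show 2: "rho g x = 0 ==> norm x < 1 ==> u x = 0" for x using assms unfolding sing_def by blast
 show 3: "0 < rho g x ==> norm x < 1 ==> 0 < u x" for x using assms unfolding sing_def epicone_def by auto
 show "0 <= rho g x ==> norm x < 1 ==> 0 <= u x"
 using 2[of x] 3[of x] by linarith
qed

text \<open>The unknown coefficient is replaced by its two bounds, which is why upper and lower
  estimates need different one-sided continuous majorants.\<close>

lemma sing_asub:
 assumes e: "epi L K g" and s: "sing g ga lam Lam u" and S: "open S" "S <= usec g" and q: "continuous_on S q"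
 shows "(!!x. x : S ==> Lam * u x powr (- ga) <= q x) ==> asub S u q"
 "(!!x. x : S ==> q x <= lam * u x powr (- ga)) ==> asub S (%x. - u x) (%x. - q x)"
proof -
 obtain f where f: "poisson_distr (usec g) u (%x. f x * u x powr (- ga))"
 "!!x. x : usec g ==> lam <= f x & f x <= Lam"
 using s unfolding sing_def by blast
 have cu: "continuous_on S u"
 by (rule continuous_on_subset[OF singD(1)[OF s]]) (use S in \<open>auto simp: epicone_def\<close>)
 show "asub S u q" if le: "!!x. x : S ==> Lam * u x powr (- ga) <= q x"
 proof (rule asub_poisson[OF f(1) S cu q])
 fix x assume x: "x : S"
 have "x : usec g" using x S by blast
 hence "f x * u x powr (- ga) <= Lam * u x powr (- ga)" using f(2)[of x] by (intro mult_right_mono) auto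
 thus "f x * u x powr (- ga) <= q x" using le[OF x] by simp
 qed
 show "asub S (%x. - u x) (%x. - q x)" if le: "!!x. x : S ==> q x <= lam * u x powr (- ga)"
 proof (rule asub_poisson[OF poisson_distr_minus[OF f(1)] S])
 show "continuous_on S (%x. - u x)" "continuous_on S (%x. - q x)" by (intro continuous_intros cu q)+
 fix x assume x: "x : S"
 have "x : usec g" using x S by blast
 hence "lam * u x powr (- ga) <= f x * u x powr (- ga)" using f(2)[of x] by (intro mult_right_mono) auto
 thus "- (f x * u x powr (- ga)) <= - q x" using le[OF x] by simp
 qed
qed

section \<open>Radial functions and radial multiples of \<open>H\<close>\<close>

lemma D2on_sqnorm: "D2on S (%z::'b::euclidean_space. R - (norm z)^2) (%z. - (2 *R z)) (%b z. - 2)"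
 unfolding D2on_def
proof (intro ballI conjI)
 fix x b :: 'b assume b: "b : Basis"
 have "(norm (x + t *R b))^2 = (norm x)^2 + 2 * t * (x \<bullet> b) + t^2" for t
 using b unfolding power2_norm_eq_inner by (simp add: inner_add_right inner_commute power2_eq_square)
 thus "DERIV (%t. R - (norm (x + t *R b))^2) 0 :> - (2 *R x) \<bullet> b"
 by (auto intro!: derivative_eq_intros)
 have "- (2 *R (x + t *R b)) \<bullet> b = - 2 * (x \<bullet> b) - 2 * t" for t using b by (simp add: inner_add_left)
 thus "DERIV (%t. - (2 *R (x + t *R b)) \<bullet> b) 0 :> - 2"
 by (auto intro!: derivative_eq_intros)
qed

lemma D2on_norm_powr:
 assumes "0 ~: S"
 shows "D2on S (%x::'b::euclidean_space. norm x powr ph) (%x. (ph * norm x powr (ph - 2)) *R x)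
  (%b x. ph * (ph - 2) * norm x powr (ph - 4) * (x \<bullet> b)^2 + ph * norm x powr (ph - 2))"
proof -
 have D0: "D2on S (%x::'b. (norm x)^2) (%x. 2 *R x) (%b x. 2)"
 using D2on_cmul[OF D2on_sqnorm[of S 0], of "-1"] by simp
 have pos: "0 < (norm x)^2" if "x : S" for x using assms that by auto
 have D: "D2on S (%x::'b. (norm x)\<^sup>2 powr (ph / 2)) (%x. (ph / 2 * (norm x)\<^sup>2 powr (ph / 2 - 1)) *R (2 *R x))
  (%b x. (ph / 2 * ((ph / 2 - 1) * (norm x)\<^sup>2 powr (ph / 2 - 1 - 1))) * ((2 *R x) \<bullet> b)^2 + (ph / 2 * (norm x)\<^sup>2 powr (ph / 2 - 1)) * 2)"
 by (rule D2on_comp[OF D0]) (use pos in \<open>auto intro!: derivative_eq_intros \<close>)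
 have eq: "(norm y)\<^sup>2 powr c = norm y powr (2 * c)" for y :: 'b and c
 using powr_powr[of "norm y" 2 c] by auto
 show ?thesis using D unfolding eq by (simp add: algebra_simps)
qed

lemma sum_second_derivs_norm_powr:
 fixes x :: "'b::euclidean_space"
 assumes n: "norm x > 0"
 shows "(SUM b:Basis. m * (m - 2) * norm x powr (m - 4) * (x \<bullet> b)^2 + m * norm x powr (m - 2))
 = m * (m + real DIM('b) - 2) * norm x powr (m - 2)"
proof -
 have "(norm x)^2 = norm x powr 2" by auto
 hence "norm x powr (m - 4) * (norm x)^2 = norm x powr (m - 2)" by (simp only: powr_add[symmetric]) simp
 moreover have "(SUM b:Basis. (x \<bullet> b)^2) = (norm x)^2"
 unfolding power2_eq_square euclidean_inner[of x x, symmetric] dot_square_norm ..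
 ultimately show ?thesis
 by (simp add: sum.distrib sum_distrib_left[symmetric]) (simp add: algebra_simps)
qed

lemma has_lap_norm_powr:
 fixes S :: "'b::euclidean_space set"
 assumes "0 ~: S"
 shows "has_lap S (%y. norm y powr m) (%y. (m * norm y powr (m - 2)) *R y)
  (%y. m * (m + real DIM('b) - 2) * norm y powr (m - 2))"
 unfolding has_lap_def
proof (rule exI, rule conjI[OF D2on_norm_powr[OF assms]], rule ballI)
 fix x assume "x : S"
 hence "norm x > 0" using assms by auto
 from sum_second_derivs_norm_powr[OF this] show "m * (m + real DIM('b) - 2) * norm x powr (m - 2)
 = (SUM b:Basis. m * (m - 2) * norm x powr (m - 4) * (x \<bullet> b)^2 + m * norm x powr (m - 2))" ..
qed

lemma has_lap_ln:
 fixes S :: "'b::euclidean_space set"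
 assumes "0 ~: S"
 shows "has_lap S (%y. c - ln (norm y)) (%y. - ((1 / (norm y)^2) *R y)) (%y. (2 - real DIM('b)) / (norm y)^2)"
proof -
 have p: "0 < norm y" if "y : S" for y using assms that by auto
 have q: "norm y powr 1 = norm y" "norm y powr (1 - 2) = 1 / norm y" for y :: 'b
 by auto
 have "has_lap S (%y. c - ln (norm y powr 1)) (%y. (- 1 / norm y powr 1) *R ((1 * norm y powr (1 - 2)) *R y))
  (%y. 1 / (norm y powr 1)^2 * (((1 * norm y powr (1 - 2)) *R y) \<bullet> ((1 * norm y powr (1 - 2)) *R y))
  + - 1 / norm y powr 1 * (1 * (1 + real DIM('b) - 2) * norm y powr (1 - 2)))"
 by (rule has_lap_comp[OF has_lap_norm_powr[OF assms], where F="%s. c - ln s"])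
  (use p in \<open>auto intro!: derivative_eq_intros simp: power2_eq_square\<close>)
 note P = this[unfolded q]
 have G: "(- 1 / norm y) *R ((1 * (1 / norm y)) *R y) = - ((1 / (norm y)^2) *R y)" for y :: 'b
 by (simp add: power2_eq_square)
 show ?thesis
 proof (rule has_lap_eq[OF P[unfolded G]])
 fix y assume "y : S"
 note n = p[OF this]
 have "((1 * (1 / norm y)) *R y) \<bullet> ((1 * (1 / norm y)) *R y) = 1" using n by (simp add: dot_square_norm)
 thus "1 / (norm y)^2 * (((1 * (1 / norm y)) *R y) \<bullet> ((1 * (1 / norm y)) *R y)) + - 1 / norm y * (1 * (1 + real DIM('b) - 2) * (1 / norm y))
  = (2 - real DIM('b)) / (norm y)^2" by (simp only:) (simp add: power2_eq_square diff_divide_distrib)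
 qed
qed

text \<open>The logarithm contributes \<open>(2 - n) / (norm x)^2\<close> with
  \<open>n = DIM('a) + 1\<close>, and the Euler identity turns the cross term into
  \<open>- 2 * ph * F1 * H / (norm x)^2\<close>. In the variable \<open>s = c - ln (norm x)\<close>
  only an ordinary differential operator in \<open>s\<close> remains.\<close>

lemma has_lap_radial:
 fixes g :: "'a::euclidean_space => real"
 assumes e: "epi L K g" and H: "cone_harm g ph H" and S: "S <= epicone g"
 and F: "!!x. x : S ==> DERIV F (c - ln (norm x)) :> F1 (c - ln (norm x))"
 "!!x. x : S ==> DERIV F1 (c - ln (norm x)) :> F2 (c - ln (norm x))"
 shows "EX G. has_lap S (%x. F (c - ln (norm x)) * H x) G
  (%x. H x / (norm x)^2 * (F2 (c - ln (norm x)) - (real DIM('a) - 1 + 2 * ph) * F1 (c - ln (norm x))))"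
proof -
 have nz: "0 ~: S" using cone_nz[OF e] S by blast
 obtain G where G: "has_lap (epicone g) H G (%_. 0)" "!!x. x : epicone g ==> G x \<bullet> x = ph * H x"
 using cone_harmD(8)[OF H] by blast
 define s where "s = (%x::'a\<times>real. c - ln (norm x))"
 define V where "V = (%x::'a\<times>real. - ((1 / (norm x)^2) *R x))"
 have "has_lap S (%x. F (s x)) (%x. F1 (s x) *R V x) (%x. F2 (s x) * (V x \<bullet> V x) + F1 (s x) * ((2 - real DIM('a * real)) / (norm x)^2))"
 unfolding s_def V_def by (rule has_lap_comp[OF has_lap_ln[OF nz] F])
 hence P: "has_lap S (%x. F (s x) * H x) (%x. F (s x) *R G x + H x *R F1 (s x) *R V x)
  (%x. F (s x) * 0 + H x * (F2 (s x) * (V x \<bullet> V x) + F1 (s x) * ((2 - real DIM('a * real)) / (norm x)^2)) + 2 * ((F1 (s x) *R V x) \<bullet> G x))"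
 by (rule has_lap_mult[OF _ has_lap_subset[OF G(1) S]])
 have "F (s x) * 0 + H x * (F2 (s x) * (V x \<bullet> V x) + F1 (s x) * ((2 - real DIM('a * real)) / (norm x)^2)) + 2 * ((F1 (s x) *R V x) \<bullet> G x)
  = H x / (norm x)^2 * (F2 (s x) - (real DIM('a) - 1 + 2 * ph) * F1 (s x))" if x: "x : S" for x
 proof -
 have n: "norm x > 0" using nz x by auto
 define r where "r = (norm x)^2"
 have r: "r > 0" using n by (simp add: r_def)
 have "V x \<bullet> V x = (1 / r) * (1 / r) * (x \<bullet> x)" by (simp add: V_def r_def)
 also have "x \<bullet> x = r" by (simp add: r_def power2_norm_eq_inner)
 finally have VV: "V x \<bullet> V x = 1 / r" by simp
 have VG: "(F1 (s x) *R V x) \<bullet> G x = - (F1 (s x) * (ph * H x) / r)"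
 proof -
  have "x : epicone g" using x S by blast
  thus ?thesis using G(2)[of x] by (simp add: V_def r_def inner_commute)
 qed
 show ?thesis unfolding VV VG r_def[symmetric] using r by (simp add: field_simps)
 qed
 hence "has_lap S (%x. F (s x) * H x) (%x. F (s x) *R G x + H x *R F1 (s x) *R V x)
  (%x. H x / (norm x)^2 * (F2 (s x) - (real DIM('a) - 1 + 2 * ph) * F1 (s x)))"
 by (rule has_lap_eq[OF P])
 thus ?thesis unfolding s_def by blast
qed

lemma cone_harm_bounds:
 assumes "cone_harm g ph H" "0 <= rho g x"
 shows "0 <= H x" "H x <= norm x powr ph"
proof -
 have "rho g x = 0 | x : epicone g" using assms(2) unfolding epicone_def mem_Collect_eq by auto
 hence "0 <= H x & H x <= norm x powr ph"
 proof
 assume "rho g x = 0"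
 thus ?thesis using cone_harmD(3)[OF assms(1)] by simp
 next
 assume "x : epicone g"
 thus ?thesis using cone_harmD(5,6)[OF assms(1)] by blast
 qed
 thus "0 <= H x" "H x <= norm x powr ph" by auto
qed

text \<open>Only the vertex needs care: there \<open>F\<close> may blow up, but \<open>H\<close> is
  at most \<open>norm x powr ph\<close>, and \<open>lim\<close> says that this power wins.\<close>

lemma continuous_radial:
 assumes e: "epi L K g" and H: "cone_harm g ph H" and F: "continuous_on {0<..R} (%r. F (c - ln r))"
 and lim: "((%r. F (c - ln r) * r powr ph) ---> 0) (at_right 0)"
 shows "continuous_on {x. 0 <= rho g x & norm x <= R} (%x. F (c - ln (norm x)) * H x)"
 unfolding continuous_on_def
proof
 let ?S = "{x. 0 <= rho g x & norm x <= R}"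
 fix x assume x: "x : ?S"
 show "((%x. F (c - ln (norm x)) * H x) ---> F (c - ln (norm x)) * H x) (at x within ?S)"
 proof (cases "x = 0")
 case False
 let ?S' = "{x. 0 <= rho g x & norm x <= R} Int - {0}"
 have "continuous_on ?S' (%x. F (c - ln (norm x)) * H x)"
 proof (intro continuous_on_mult)
  show "continuous_on ?S' H" by (rule continuous_on_subset[OF cone_harmD(2)[OF H]]) auto
  show "continuous_on ?S' (%x. F (c - ln (norm x)))"
  by (rule continuous_on_compose2[OF F]) (auto intro!: continuous_intros)
 qed
 hence "((%x. F (c - ln (norm x)) * H x) ---> F (c - ln (norm x)) * H x) (at x within ?S')"
  using x False unfolding continuous_on_def by auto
 moreover have "at x within ?S' = at x within ?S"
  by (rule at_within_nhd[of x "- {0}"]) (use False in auto)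
 ultimately show ?thesis by auto
 next
 case True
 have H0: "H 0 = 0" using cone_harmD(3)[OF H] rho_0[OF e] by auto
 have "((%x. F (c - ln (norm x)) * norm x powr ph) ---> 0) (at (0::'a\<times>real))"
 proof (rule filterlim_compose[OF lim])
  show "filterlim norm (at_right 0) (at (0::'a\<times>real))"
  unfolding filterlim_at by (auto intro!: tendsto_norm_zero simp: eventually_at_filter)
 qed
 hence l: "((%x. abs (F (c - ln (norm x)) * norm x powr ph)) ---> 0) (at (0::'a\<times>real) within ?S)"
  using tendsto_rabs_zero tendsto_within_subset by blast
 have "((%x. F (c - ln (norm x)) * H x) ---> 0) (at 0 within ?S)"
 proof (rule Lim_null_comparison[OF _ l])
  show "\<forall>\<^sub>F x in at 0 within ?S. norm (F (c - ln (norm x)) * H x) <= abs (F (c - ln (norm x)) * norm x powr ph)"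
  unfolding eventually_at_filter
  proof (rule always_eventually, intro allI impI)
  fix x assume "x : ?S"
  hence "abs (H x) <= norm x powr ph" using cone_harm_bounds[OF H, of x] by simp
  thus "norm (F (c - ln (norm x)) * H x) <= abs (F (c - ln (norm x)) * norm x powr ph)"
   by (simp add: abs_mult mult_left_mono)
  qed
 qed
 thus ?thesis using True H0 by simp
 qed
qed

lemma ln_facts: "ln (2::real) >= 1/2" "ln (3/2 :: real) > 0" "ln (3/2::real) - ln (3/4) = ln 2"
proof -
 show "ln (2::real) >= 1/2" using ln2_ge_two_thirds by simp
 show "ln (3/2 :: real) > 0" by simp
 have "ln (2 * (3/4) :: real) = ln 2 + ln (3/4)" by (subst ln_mult) auto
 thus "ln (3/2::real) - ln (3/4) = ln 2" by simp
qed

lemma log_limits: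
 assumes "a > 0"
 shows "((%r::real. ((c - ln r) powr a - k) * r powr (2 * a)) ---> 0) (at_right 0)"
 "((%r::real. (c - ln r) * r powr (2 * a)) ---> 0) (at_right 0)"
 using assms by real_asymp+

text \<open>With \<open>s = ln (3 / (2 |x|))\<close> the function \<open>ka H (s\<^sup>a - (ln 2)\<^sup>a)\<close> is an explicit subsolution, for every \<open>ga\<close>.\<close>

lemma sol_lower:
 fixes g :: "'a::euclidean_space => real"
 assumes e: "epi L K g" and H: "cone_harm g (2 * a) H" and s: "sing g ga lam Lam u"
 and ga: "ga > 0" and lam: "lam > 0" and a: "a = 1 / (1 + ga)"
 and ka: "ka = (lam / (a * (real DIM('a) + 1 + 4 * a))) powr a"
 and x: "0 < rho g x" "norm x < 3/4"
 shows "ka * H x * ((ln (3/2) - ln (norm x)) powr a - ln 2 powr a) <= u x"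
proof -
 have a0: "0 < a" "a < 1" using ga by (auto simp: a)
 have a1: "a * (1 + ga) = 1" using ga by (simp add: a)
 have aga: "a * ga = 1 - a" using a1 by (simp add: algebra_simps)
 define N where "N = real DIM('a) - 1 + 2 * (2 * a)"
 have "1 <= real DIM('a)" by simp
 hence N: "N > 0" unfolding N_def using a0 by linarith
 have ka': "ka = (lam / (a * (N + 2))) powr a"  proof -
 have "N + 2 = real DIM('a) + 1 + 4 * a" by (simp add: N_def)
 thus ?thesis unfolding ka by (simp only:)
 qed
 have ka0: "ka > 0" unfolding ka' using lam a0 N by simp
 have ka1: "ka powr (1 + ga) = lam / (a * (N + 2))"
 unfolding ka' using lam a0 N a1 by (simp add: powr_powr)
 \<comment> \<open>With \<open>c = ln (3/2)\<close> the variable \<open>s\<close> equals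
   \<open>ln 2\<close> on the sphere of radius 3/4, so the competitor vanishes there; inside,
   \<open>s >= ln 2 >= 1/2\<close> stays off the singularity of the power.\<close>
 define R where "R = (3/4 :: real)"
 define c where "c = ln (3/2 :: real)"
 define F where "F = (%s::real. ka * (s powr a - ln 2 powr a))"
 define S where "S = (%y::'a\<times>real. c - ln (norm y))"
 define V where "V = (%y. F (c - ln (norm y)) * H y)"
 define D where "D = {y. 0 < rho g y & norm y < R}"
 note reg = two_sided_region[OF continuous_rho[OF e] continuous_on_norm_id, where d="R", folded D_def]
 have sge: "ln 2 <= c - ln r" if "0 < r" "r <= R" for r
 proof -
 have "ln r <= ln (3/4)" using that by (simp add: R_def)
 thus ?thesis using ln_facts(3) unfolding c_def by simp
 qed
 have ln2: "ln (2::real) >= 1/2" by (rule ln_facts)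
 have ny: "norm y > 0" "norm y <= R" "y : epicone g" if "y : D" for y
 using that cone_nz[OF e, of y] by (auto simp: D_def epicone_def)
 have "V x <= u x"
 proof (rule comparison_below[OF reg(1), where q="%y. lam * V y powr (- ga)"])
 show "bounded D" by (rule bounded_subset[of "cball 0 R"]) (auto simp: D_def)
 have cl: "closure D <= {y. 0 <= rho g y & norm y <= R}" using reg(2) by blast
 show "continuous_on (closure D) u"
  by (rule continuous_on_subset[OF singD(1)[OF s]]) (use cl in \<open>auto simp: R_def\<close>)
 have cV: "continuous_on {y. 0 <= rho g y & norm y <= R} V"
  unfolding V_def
 proof (rule continuous_radial[OF e H])
  have "c - ln r ~= 0" if "r : {0<..R}" for r using sge[of r] that by auto
  thus "continuous_on {0<..R} (%r. F (c - ln r))" unfolding F_def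
  by (auto intro!: continuous_intros)
  show "((%r. F (c - ln r) * r powr (2 * a)) ---> 0) (at_right 0)"
  using tendsto_mult_left[OF log_limits(1)[OF a0(1), of c "ln 2 powr a"], of ka]
  unfolding F_def by (simp add: mult.assoc)
 qed
 thus "continuous_on (closure D) V" using cl continuous_on_subset by blast
 show "V y <= u y" if "y : frontier D" for y
 proof -
  note f = reg(3)[OF that]
  have "rho g y = 0 | norm y = R" using f by blast
  hence "V y = 0"
  proof
  assume "rho g y = 0" thus ?thesis using cone_harmD(3)[OF H] by (simp add: V_def)
  next
  assume "norm y = R"
  hence "c - ln (norm y) = ln 2" using ln_facts(3) unfolding c_def R_def by (simp only:)
  thus ?thesis by (simp add: V_def F_def)
  qed
  thus ?thesis using singD(4)[OF s, of y] f by (simp add: R_def)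
 qed
 show "asub {x : D. u x < V x} (%x. - u x) (%x. - (lam * V x powr (- ga)))"
 proof (rule sing_asub(2)[OF e s])
  have sub: "D <= {y. 0 <= rho g y & norm y <= R}" by (auto simp: D_def)
  have cVD: "continuous_on D V" by (rule continuous_on_subset[OF cV sub])
  have cuD: "continuous_on D u" by (rule continuous_on_subset[OF singD(1)[OF s]]) (auto simp: D_def R_def)
  have "open (D Int (%y. V y - u y) -` {0<..})"
  using reg(1) cVD cuD by (intro continuous_open_preimage continuous_intros) auto
  moreover have "D Int (%y. V y - u y) -` {0<..} = {x : D. u x < V x}" by auto
  ultimately show "open {x : D. u x < V x}" by metis
  show "{x : D. u x < V x} <= usec g" by (auto simp: D_def epicone_def R_def)
  have up: "0 < u y" if "y : D" for y using singD(3)[OF s, of y] that by (auto simp: D_def R_def)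
  show "continuous_on {x : D. u x < V x} (%x. lam * V x powr - ga)"
  proof (intro continuous_intros continuous_on_subset[OF cVD] ballI)
  fix y assume "y : {x : D. u x < V x}"
  thus "V y ~= 0" using up[of y] by auto
  qed auto
  \<comment> \<open>Only points with \<open>u < V\<close> matter, and there the decreasing
    nonlinearity points the right way.\<close>
  show "lam * V y powr (- ga) <= lam * u y powr (- ga)" if "y : {x : D. u x < V x}" for y
  using that up[of y] lam ga by (intro mult_left_mono powr_mono2') auto
 qed
 show "touch_below V y (lam * V y powr (- ga))" if y: "y : D" "u y < V y" for y
 proof -
  have Sp: "ln 2 <= S z" if "z : D" for z using sge ny[OF that] by (simp add: S_def)
  have d1: "DERIV F (S z) :> ka * (a * S z powr (a - 1))" if "z : D" for z
  unfolding F_def using Sp[OF that] ln2 by (auto intro!: derivative_eq_intros)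
  have d2: "DERIV (%s. ka * (a * s powr (a - 1))) (S z) :> ka * (a * ((a - 1) * S z powr (a - 1 - 1)))" if "z : D" for z
  using Sp[OF that] ln2 by (intro DERIV_cmult has_real_derivative_powr) auto
  have DC: "D <= epicone g" by (auto simp: D_def epicone_def)
  obtain G where G: "has_lap D V G (%x. H x / (norm x)^2 * (ka * (a * ((a - 1) * S x powr (a - 1 - 1))) - N * (ka * (a * S x powr (a - 1)))))"
  using has_lap_radial[OF e H DC, of F "%s. ka * (a * s powr (a - 1))" c "%s. ka * (a * ((a - 1) * s powr (a - 1 - 1)))"] d1 d2
  unfolding V_def N_def S_def by blast
  show ?thesis
  proof (rule touch_belowI[OF reg(1) y(1) G])
  define h where "h = H y"
  define r where "r = norm y"
  define si where "si = S y"
  have r: "r > 0" using ny[OF y(1)] by (simp add: r_def)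
  have si: "si >= ln 2" using Sp[OF y(1)] by (simp add: si_def)
  have si0: "si > 0" using si ln2 by auto
  have Vp: "0 < V y" using y singD(3)[OF s, of y] by (auto simp: D_def R_def)
  have h0: "0 <= h" using cone_harmD(5)[OF H] ny[OF y(1)] by (simp add: h_def)
  have h: "0 < h" using Vp h0 by (cases "h = 0") (auto simp: V_def h_def)
  have hr: "h <= r powr (2 * a)" using cone_harmD(6)[OF H] ny[OF y(1)] by (simp add: h_def r_def)
  have "h powr (1 + ga) <= (r powr (2 * a)) powr (1 + ga)" using h hr ga by (intro powr_mono2) auto
  also have "... = r powr (2 * (a * (1 + ga)))" by (simp add: powr_powr mult.assoc)
  also have "... = r^2" unfolding a1 using r by simp
  finally have hr2: "h powr (1 + ga) <= r^2" .
  have "si powr (a - 1 - 1) = si powr (a - 1) / si" by (subst powr_diff) (use si0 in simp)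
  also have "... <= si powr (a - 1) * 2"
  proof -
   have "1 <= 2 * si" using si ln2 by auto
   hence "si powr (a - 1) * 1 <= si powr (a - 1) * (2 * si)" by auto
   thus ?thesis unfolding pos_divide_le_eq[OF si0] by simp
  qed
  finally have s2: "si powr (a - 1 - 1) <= si powr (a - 1) * 2" .
  have "(1 - a) * si powr (a - 1 - 1) <= 1 * (si powr (a - 1) * 2)" using a0 s2 by (intro mult_mono) auto
  hence "ka * a * ((1 - a) * si powr (a - 1 - 1) + N * si powr (a - 1)) <= ka * a * ((N + 2) * si powr (a - 1))"
   using ka0 a0 by (intro mult_left_mono) (auto simp: algebra_simps)
  hence 1: "- (ka * (a * ((a - 1) * si powr (a - 1 - 1))) - N * (ka * (a * si powr (a - 1)))) <= ka * a * ((N + 2) * si powr (a - 1))"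
   by (simp add: algebra_simps)
  \<comment> \<open>The identities \<open>a * ga = 1 - a\<close> and
    \<open>2 * a * (1 + ga) = 2\<close> bring both sides to the same powers of \<open>h\<close>,
    \<open>si\<close> and \<open>r\<close>; \<open>ka\<close> is the value for which the constants
    agree.\<close>
  have "ka * a * (N + 2) * h * si powr (a - 1) <= r^2 * (lam * (ka * si powr a * h) powr (- ga))"
  proof -
   have k1: "ka = ka powr (1 + ga) * ka powr (- ga)" using ka0 by (simp flip: powr_add)
   have h1: "h = h powr (1 + ga) * h powr (- ga)" using h by (simp flip: powr_add)
   have s1: "si powr (a - 1) = (si powr a) powr (- ga)" using aga by (simp add: powr_powr)
   have "ka * a * (N + 2) * h * si powr (a - 1)
   = (ka powr (1 + ga) * (a * (N + 2))) * h powr (1 + ga) * (ka powr (- ga) * (si powr a) powr (- ga) * h powr (- ga))"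
   by (subst k1, subst h1, subst s1) simp
   also have "ka powr (1 + ga) * (a * (N + 2)) = lam" unfolding ka1 using a0 N by simp
   also have "ka powr (- ga) * (si powr a) powr (- ga) * h powr (- ga) = (ka * si powr a * h) powr (- ga)"
   by (simp add: powr_mult)
   also have "lam * h powr (1 + ga) * (ka * si powr a * h) powr (- ga) <= lam * r^2 * (ka * si powr a * h) powr (- ga)"
   using hr2 lam by (intro mult_right_mono mult_left_mono) auto
   finally show ?thesis by (simp add: mult_ac)
  qed
  hence 2: "h / r^2 * (ka * a * ((N + 2) * si powr (a - 1))) <= lam * (ka * si powr a * h) powr (- ga)"
   using r by (simp add: field_simps)
  have "V y <= ka * si powr a * h" unfolding V_def F_def si_def S_def using ka0 h0 unfolding h_def by (intro mult_right_mono mult_left_mono) auto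
  hence 3: "(ka * si powr a * h) powr (- ga) <= V y powr (- ga)"
   using Vp ga by (intro powr_mono2') auto
  have "h / r^2 * - (ka * (a * ((a - 1) * si powr (a - 1 - 1))) - N * (ka * (a * si powr (a - 1)))) <= h / r^2 * (ka * a * ((N + 2) * si powr (a - 1)))"
   using 1 h0 by (intro mult_left_mono) auto
  also note 2
  also have "lam * (ka * si powr a * h) powr (- ga) <= lam * V y powr (- ga)" using 3 lam by auto
  finally show "- (H y / (norm y)^2 * (ka * (a * ((a - 1) * S y powr (a - 1 - 1))) - N * (ka * (a * S y powr (a - 1))))) <= lam * V y powr (- ga)"
   unfolding h_def r_def si_def by linarith
  qed auto
 qed
 show "x : D" using x by (simp add: D_def R_def)
 qed
 thus ?thesis unfolding V_def F_def c_def by (simp add: mult_ac)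
qed

text \<open>The minimum with \<open>norm x / 2\<close> replaces \<open>rho\<close> where no
  paraboloid touches it; a minimum keeps the supersolution property. The powers are balanced so that
  the second term has degree \<open>ph\<close>.\<close>

definition Wf :: "real => real => real => ('a::euclidean_space => real) => ('a * real => real) => 'a * real => real" where
 "Wf A ph b g H x = A * ((ln 2 - ln (norm x)) * H x) + norm x powr (ph - b) * (min (rho g x) (norm x / 2)) powr b"

lemma has_lap_logH:
 fixes g :: "'a::euclidean_space => real"
 assumes e: "epi L K g" and H: "cone_harm g ph H"
 obtains G where "has_lap (epicone g) (%x. (c - ln (norm x)) * H x) G
  (%x. H x / (norm x)^2 * (0 - (real DIM('a) - 1 + 2 * ph) * 1))"
proof -
 have "EX G. has_lap (epicone g) (%x. (c - ln (norm x)) * H x) G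
  (%x. H x / (norm x)^2 * (0 - (real DIM('a) - 1 + 2 * ph) * 1))"
 by (rule has_lap_radial[OF e H, where F="%s. s" and ?F1.0="%s. 1" and ?F2.0="%s. 0"]) auto
 thus ?thesis using that by blast
qed

text \<open>The function \<open>A ln (2/|x|) H\<close> supplies positivity of \<open>-\<Delta>\<close> away from the boundary,
 \<open>|x|\<^bsup>ph-b\<^esup> rho\<^sup>b\<close> supplies the singular part near the boundary.\<close>

lemma W_touch:
 fixes L K ph b ga c1 :: real
 assumes L: "1 <= L" "1 <= K" and ph: "ph > 0" and b: "0 < b" "b < 1" "b <= 2 - ga" and ga: "ga > 0"
 and phga: "ph * ga = 2 - ph" and c1: "c1 > 0"
 shows "EX A>0. EX c>0. ALL (g :: 'a::euclidean_space => real) H. epi L K g --> cone_harm g ph H -->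
  (ALL x:epicone g. c1 * norm x powr ph * (rho g x / norm x) <= H x) -->
  (ALL x:epicone g. touch_above (Wf A ph b g H) x (c * H x powr (- ga)))"
proof -
 define n' where "n' = real DIM('a)"
 define n where "n = real DIM('a * real)"
 have "1 <= real DIM('a)" by auto
 hence n: "n' >= 1" "n = n' + 1" by (simp_all add: n_def n'_def)
 define m where "m = ph - b"
 define B where "B = 16 * K * (1 + L) * n'"
 have B: "B > 0" using L n by (simp add: B_def)
 define N where "N = n' - 1 + 2 * ph"
 have N: "N > 0" using n ph by (simp add: N_def)
 \<comment> \<open>Three errors in the Laplacian of the boundary term: the paraboloid, the power of
   the norm, and the product of their gradients. Each is smaller than the main term
   \<open>c0\<close> by the factor \<open>y = rho / norm x\<close>.\<close>
 define C1 where "C1 = B + abs m * (abs m + n) + 2 * abs m * (1 + L)"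
 have C1: "C1 > 0" unfolding C1_def using B n L by (intro add_pos_nonneg mult_nonneg_nonneg) auto
 define c0 where "c0 = b * (1 - b)"
 have c0: "c0 > 0" using b by (simp add: c0_def)
 define d where "d = min (1/4) (c0 / (2 * C1))"
 have d: "0 < d" "d <= 1/4" "C1 * d <= c0 / 2"
 proof -
 show "0 < d" "d <= 1/4" using c0 C1 by (auto simp: d_def)
 have "C1 * d <= C1 * (c0 / (2 * C1))" using C1 by (intro mult_left_mono) (auto simp: d_def)
 thus "C1 * d <= c0 / 2" using C1 by simp
 qed
 \<comment> \<open>Away from the boundary layer the logarithmic term must absorb the worst negative
   contributions \<open>C1 * d powr (b - 1)\<close> and \<open>ph * (ph + n)\<close> and still leave
   1.\<close>
 define A where "A = (1 + C1 * d powr (b - 1) + ph * (ph + n)) / (N * c1 * d)"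
 have A: "A > 0" unfolding A_def using C1 ph n N c1 d by (intro divide_pos_pos add_pos_nonneg) auto
 have AN: "A * N * (c1 * d) = 1 + C1 * d powr (b - 1) + ph * (ph + n)" using N c1 d by (simp add: A_def)
 define c where "c = min (c0 / 2 * c1 powr ga) ((c1 * d) powr ga)"
 have c: "c > 0" "c <= c0 / 2 * c1 powr ga" "c <= (c1 * d) powr ga" using c0 c1 d by (auto simp: c_def)
 show ?thesis
 proof (rule exI[of _ A], rule conjI[OF A], rule exI[of _ c], rule conjI[OF c(1)], intro allI impI ballI)
 fix g :: "'a => real" and H x
 assume e: "epi L K g" and H: "cone_harm g ph H"
  and Hl: "ALL x:epicone g. c1 * norm x powr ph * (rho g x / norm x) <= H x" and x: "x : epicone g"
 define r where "r = norm x"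
 define y where "y = rho g x / r"
 have r: "r > 0" using cone_nz[OF e x] by (simp add: r_def)
 have rx: "0 < rho g x" using x by (simp add: epicone_def)
 have y: "0 < y" "rho g x = r * y" using r rx by (auto simp: y_def)
 have Hx: "c1 * r powr ph * y <= H x" using Hl x by (simp add: r_def y_def)
 have H0: "0 < H x" using Hx c1 r y by (metis less_le_trans mult_pos_pos powr_gt_zero less_irrefl)
 obtain G where G: "has_lap (epicone g) (%x. (ln 2 - ln (norm x)) * H x) G
  (%x. H x / (norm x)^2 * (0 - (real DIM('a) - 1 + 2 * ph) * 1))"
  by (rule has_lap_logH[OF e H])
 have GA: "has_lap (epicone g) (%x. A * ((ln 2 - ln (norm x)) * H x)) (%x. A *R G x)
  (%x. A * (H x / (norm x)^2 * (0 - (real DIM('a) - 1 + 2 * ph) * 1)))"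
  by (rule has_lap_cmul[OF G])
 define Z where "Z = r powr (ph - 2) * y powr (b - 2)"
 have Z: "Z > 0" using r y by (simp add: Z_def)
 have pos: "0 < r powr (ph - 2)" using r by simp
 \<comment> \<open>\<open>E\<close> is the negative Laplacian of the function touching the second
   summand, in either of its two forms. For \<open>y <= d\<close> it suffices alone, where
   \<open>b <= 2 - ga\<close> makes \<open>y powr (b - 2)\<close> dominate
   \<open>y powr (- ga)\<close>; otherwise the \<open>A\<close> term takes over.\<close>
 have fin: "c * H x powr (- ga) <= A * N * (H x / r^2) + E"
  if E: "Z * (c0 - C1 * y) <= E | 1/2 <= y & - (ph * (ph + n) * r powr (ph - 2)) <= E" for E
 proof -
  have HN: "H x powr (- ga) <= (c1 * r powr ph * q) powr (- ga)" if "0 < q" "q <= y" for q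
  proof -
  have "c1 * r powr ph * q <= c1 * r powr ph * y" using that c1 by (intro mult_left_mono) auto
  hence "c1 * r powr ph * q <= H x" using Hx by simp
  thus ?thesis using that c1 r ga by (intro powr_mono2') auto
  qed
  have split: "(c1 * r powr ph * q) powr (- ga) = c1 powr (- ga) * q powr (- ga) * r powr (ph - 2)" if "0 < q" for q
  proof -
  have "ph * - ga = ph - 2" using phga by simp
  hence "(r powr ph) powr (- ga) = r powr (ph - 2)" by (simp add: powr_powr)
  thus ?thesis by (simp add: powr_mult)
  qed
  show ?thesis
  proof (cases "y <= d")
  case True
  hence "y <= 1/2" using d by simp
  have EZ: "Z * (c0 / 2) <= E"
  proof -
   have "C1 * y <= C1 * d" using True C1 by simp
   hence "c0 / 2 <= c0 - C1 * y" using d(3) by simp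
   hence "Z * (c0 / 2) <= Z * (c0 - C1 * y)" using Z by simp
   thus ?thesis using E True d(2) by simp
  qed
  have "c * H x powr (- ga) <= (c0 / 2 * c1 powr ga) * (c1 powr (- ga) * y powr (- ga) * r powr (ph - 2))"
   using HN[of y] split[of y] y c by (intro mult_mono) auto
  also have "... = c0 / 2 * (c1 powr ga * c1 powr (- ga)) * (y powr (- ga) * r powr (ph - 2))" by simp
  also have "c1 powr ga * c1 powr (- ga) = 1" using c1 by (simp flip: powr_add)
  also have "c0 / 2 * 1 * (y powr (- ga) * r powr (ph - 2)) <= c0 / 2 * 1 * (y powr (b - 2) * r powr (ph - 2))"
   using b c0 y \<open>y <= 1/2\<close> by (intro mult_left_mono mult_right_mono powr_mono') auto
  also have "... = Z * (c0 / 2)" by (simp add: Z_def)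
  finally have "c * H x powr (- ga) <= E" using EZ by auto
  moreover have "0 <= A * N * (H x / r^2)" using A N H0 by simp
  ultimately show ?thesis by simp
  next
  case False
  hence yd: "d <= y" by simp
  have "c1 * r powr ph * d <= H x"
  proof -
   have "c1 * r powr ph * d <= c1 * r powr ph * y" using yd c1 by (intro mult_left_mono) auto
   thus ?thesis using Hx by simp
  qed
  moreover have "r powr ph = r powr (ph - 2) * r^2"
  proof -
   have "r powr (ph - 2) * r^2 = r powr (ph - 2) * r powr 2" using r by simp
   thus ?thesis by (simp only: powr_add[symmetric]) simp
  qed
  ultimately have "c1 * d * r powr (ph - 2) <= H x / r^2" using r by (simp add: field_simps)
  hence "A * N * (c1 * d * r powr (ph - 2)) <= A * N * (H x / r^2)" using A N by (intro mult_left_mono) auto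
  hence 1: "(1 + C1 * d powr (b - 1) + ph * (ph + n)) * r powr (ph - 2) <= A * N * (H x / r^2)"
   unfolding AN[symmetric] by simp
  have 2: "- ((C1 * d powr (b - 1) + ph * (ph + n)) * r powr (ph - 2)) <= E"
   using E
  proof
   assume a: "Z * (c0 - C1 * y) <= E"
   have "Z * (C1 * y) = C1 * y powr (b - 1) * r powr (ph - 2)"
   proof -
   have "y powr (b - 2) * y = y powr (b - 2) * y powr 1" using y by simp
   also have "... = y powr (b - 1)" by (simp only: powr_add[symmetric]) simp
   finally show ?thesis unfolding Z_def by simp
   qed
   also have "... <= C1 * d powr (b - 1) * r powr (ph - 2)"
   using yd d b C1 by (intro mult_right_mono mult_left_mono powr_mono2') auto
   finally have "Z * (C1 * y) <= C1 * d powr (b - 1) * r powr (ph - 2)" .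
   moreover have "0 <= Z * c0" using Z c0 by simp
   moreover have "0 <= ph * (ph + n) * r powr (ph - 2)" using ph n by simp
   ultimately show ?thesis using a by (simp add: algebra_simps)
  next
   assume a: "1/2 <= y & - (ph * (ph + n) * r powr (ph - 2)) <= E"
   moreover have "0 <= C1 * d powr (b - 1) * r powr (ph - 2)" using C1 by simp
   ultimately show ?thesis by (simp add: algebra_simps)
  qed
  have "c * H x powr (- ga) <= (c1 * d) powr ga * (c1 powr (- ga) * d powr (- ga) * r powr (ph - 2))"
   using HN[of d] split[of d] d yd c by (intro mult_mono) auto
  also have "... = ((c1 * d) powr ga * (c1 * d) powr (- ga)) * r powr (ph - 2)" by (simp add: powr_mult)
  also have "(c1 * d) powr ga * (c1 * d) powr (- ga) = 1" using c1 d by (simp flip: powr_add)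
  finally have "c * H x powr (- ga) <= r powr (ph - 2)" by simp
  thus ?thesis using 1 2 by (simp add: algebra_simps)
  qed
 qed
 have nz: "0 ~: epicone g" using cone_nz[OF e] by blast
 have AH: "- (A * (H x / (norm x)^2 * (0 - (real DIM('a) - 1 + 2 * ph) * 1)) + s) = A * N * (H x / r^2) + - s" for s
  unfolding n'_def[symmetric] N_def[symmetric] r_def[symmetric] by simp
 show "touch_above (Wf A ph b g H) x (c * H x powr (- ga))"
 proof (cases "rho g x < r / 2")
  case False
  have lap2: "has_lap (epicone g) (%y. (1/2) powr b * norm y powr ph) (%y. (1/2) powr b *R ((ph * norm y powr (ph - 2)) *R y))
   (%y. (1/2) powr b * (ph * (ph + real DIM('a * real) - 2) * norm y powr (ph - 2)))"
  by (rule has_lap_cmul[OF has_lap_norm_powr[OF nz]])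
  have eq: "norm z powr (ph - b) * (norm z / 2) powr b = (1/2) powr b * norm z powr ph" for z :: "'a * real"
  proof -
  have "(norm z / 2) powr b = norm z powr b * (1/2) powr b" by (subst powr_mult[symmetric]) auto
  moreover have "norm z powr (ph - b) * norm z powr b = norm z powr ph" by (simp flip: powr_add)
  ultimately show ?thesis by simp
  qed
  show ?thesis
  proof (rule touch_aboveI[OF open_cone[OF e] x has_lap_add[OF GA lap2]])
  have "min (rho g x) (norm x / 2) = norm x / 2" using False by (simp add: r_def)
  thus "A * ((ln 2 - ln (norm x)) * H x) + (1 / 2) powr b * norm x powr ph = Wf A ph b g H x"
   unfolding Wf_def by (simp only: eq)
  fix z assume z: "z : epicone g"
  have "norm z powr (ph - b) * (min (rho g z) (norm z / 2)) powr b <= norm z powr (ph - b) * (norm z / 2) powr b"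
   using z b by (intro mult_left_mono powr_mono2) (auto simp: epicone_def)
  thus "Wf A ph b g H z <= A * ((ln 2 - ln (norm z)) * H z) + (1 / 2) powr b * norm z powr ph"
   unfolding Wf_def eq by simp
  next
  have yh: "1/2 <= y" using False r by (simp add: y_def)
  have "(1/2) powr b * (ph * (ph + n - 2) * r powr (ph - 2)) <= 1 * (ph * (ph + n) * r powr (ph - 2))"
  proof (rule mult_mono')
   show "(1/2) powr b <= (1::real)" using b by (intro powr_le1) auto
   show "ph * (ph + n - 2) * r powr (ph - 2) <= ph * (ph + n) * r powr (ph - 2)"
   using ph by (intro mult_right_mono mult_left_mono) auto
   show "0 <= ph * (ph + n - 2) * r powr (ph - 2)"
   using ph n by simp
  qed auto
  hence "c * H x powr (- ga) <= A * N * (H x / r^2) + - ((1/2) powr b * (ph * (ph + n - 2) * r powr (ph - 2)))"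
   by (intro fin) (use yh in auto)
  thus "c * H x powr - ga <= - (A * (H x / (norm x)^2 * (0 - (real DIM('a) - 1 + 2 * ph) * 1)) +
   (1 / 2) powr b * (ph * (ph + real DIM('a * real) - 2) * norm x powr (ph - 2)))"
   unfolding AH unfolding n_def r_def .
  qed
 next
  case True
  \<comment> \<open>The minimum is now \<open>rho\<close>, touched from above by the paraboloid at
    the foot of \<open>x\<close>. The scale is \<open>r = norm x\<close> itself, so the curvature
    cost is \<open>B / r\<close>.\<close>
  obtain v M where f: "norm v <= L" "0 <= M" "2 * M * real DIM('a) <= bM TYPE('a) L K r"
  "!!y. abs (rho g y - para g (fst x) v 0 y) <= (M / 2) * (norm (fst y - fst x))^2"
  by (rule epi_foot[OF e r _ rx True]) (auto simp: r_def)
  define p where "p = para g (fst x) v M"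
  have pr: "rho g z <= p z" for z
  proof -
  have "(M / 2) * (norm (fst z - fst x))^2 <= M * (norm (fst z - fst x))^2"
   using f(2) by simp
  thus ?thesis using f(4)[of z] para_split[of g "fst x" v M z] unfolding p_def by linarith
  qed
  have pp: "0 < p z" if "z : epicone g" for z using pr[of z] that by (simp add: epicone_def)
  have px: "p x = rho g x" by (simp add: p_def para_def rho_def)
  define w where "w = ((2 * M) *R (fst x - fst x) - v, 1::real)"
  have lapp: "has_lap (epicone g) (%y. p y powr b) (%y. (b * p y powr (b - 1)) *R ((2 * M) *R (fst y - fst x) - v, 1))
  (%y. b * ((b - 1) * p y powr (b - 1 - 1)) * (((2 * M) *R (fst y - fst x) - v, 1) \<bullet> ((2 * M) *R (fst y - fst x) - v, 1::real)) + (b * p y powr (b - 1)) * (2 * M * real DIM('a)))"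
  by (rule has_lap_comp[OF has_lap_para[where g=g and z="fst x" and v=v and M=M, folded p_def],
   where F="%s. s powr b" and ?F1.0="%s. b * s powr (b - 1)" and ?F2.0="%s. b * ((b - 1) * s powr (b - 1 - 1))"];
   (rule DERIV_cmult)?; rule has_real_derivative_powr; erule pp)
  note lap1 = has_lap_mult[OF has_lap_norm_powr[OF nz, of m] lapp]
  show ?thesis
  proof (rule touch_aboveI[OF open_cone[OF e] x has_lap_add[OF GA lap1]])
  have "min (rho g x) (norm x / 2) = p x" using True by (simp add: r_def px)
  thus "A * ((ln 2 - ln (norm x)) * H x) + norm x powr m * p x powr b = Wf A ph b g H x"
   unfolding Wf_def m_def by simp
  fix z assume z: "z : epicone g"
  have "norm z powr (ph - b) * (min (rho g z) (norm z / 2)) powr b <= norm z powr (ph - b) * p z powr b"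
   using z b pr[of z] by (intro mult_left_mono powr_mono2) (auto simp: epicone_def)
  thus "Wf A ph b g H z <= A * ((ln 2 - ln (norm z)) * H z) + norm z powr m * p z powr b"
   unfolding Wf_def m_def by simp
  next
  define rh where "rh = rho g x"
  have rh: "rh > 0" "rh = r * y" unfolding rh_def by (rule rx, rule y(2))
  have "y < 1/2" unfolding y_def using True r by simp
  hence y2: "y <= 1" "0 <= y" using y(1) by auto
  define P where "P = rh powr (b - 2)"
  have P: "P > 0" using rh(1) by (simp add: P_def)
  define R where "R = r powr m"
  have R: "R > 0" using r by (simp add: R_def)
  have ZRP: "Z = R * P"
  proof -
   have "P = r powr (b - 2) * y powr (b - 2)" unfolding P_def rh(2) by (simp add: powr_mult)
   moreover have "R * r powr (b - 2) = r powr (ph - 2)" unfolding R_def m_def by (simp flip: powr_add)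
   ultimately show ?thesis by (simp add: Z_def)
  qed
  have Pb: "rh powr (b - 1) = P * rh" "rh powr b = P * rh^2" "rh powr (b - 1 - 1) = P"
  proof -
   have "P * rh powr 1 = rh powr (b - 1)" unfolding P_def by (simp only: powr_add[symmetric]) simp
   thus "rh powr (b - 1) = P * rh" using rh(1) by simp
   have "P * rh powr 2 = rh powr b" unfolding P_def by (simp only: powr_add[symmetric]) simp
   thus "rh powr b = P * rh^2" using rh(1) by simp
   show "rh powr (b - 1 - 1) = P" by (simp add: P_def)
  qed
  have Rm: "r powr (m - 2) = R / r^2" unfolding R_def using r by (simp add: powr_diff)
  have ww: "w \<bullet> w >= 1" unfolding w_def by auto
  have "norm w <= norm v + 1" unfolding w_def using norm_Pair_le[of "- v" "1::real"] by simp
  hence wn: "norm w <= 1 + L" using f(1) by simp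
  have xw: "abs (x \<bullet> w) <= r * (1 + L)"
   using Cauchy_Schwarz_ineq2[of x w] mult_left_mono[OF wn, of r] r unfolding r_def by linarith
  have yr: "rh / r = y" unfolding y_def rh_def ..
  have t1: "R * (b * ((b - 1) * P) * (w \<bullet> w)) <= - (c0 * Z)"
  proof -
   have "c0 * Z * 1 <= c0 * Z * (w \<bullet> w)" using ww c0 Z by simp
   thus ?thesis unfolding ZRP c0_def by (simp add: algebra_simps)
  qed
  have t2: "R * (b * (P * rh) * (2 * M * real DIM('a))) <= Z * (B * y)"
  proof -
   have "b * (2 * M * real DIM('a)) <= 1 * (B / r)"
   using f b by (intro mult_mono) (auto simp: bM_def B_def n'_def)
   hence "Z * rh * (b * (2 * M * real DIM('a))) <= Z * rh * (B / r)"
   using Z rh(1) by (intro mult_left_mono) auto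
   also have "... = Z * (B * y)" unfolding yr[symmetric] by simp
   finally show ?thesis unfolding ZRP by (simp add: mult_ac)
  qed
  have t3: "P * rh^2 * (m * (m + n - 2) * (R / r^2)) <= Z * (abs m * (abs m + n) * y)"
  proof -
   have "m * (m + n - 2) <= abs m * abs (m + n - 2)" by (metis abs_ge_self abs_mult)
   also have "... <= abs m * (abs m + n)" using n by (intro mult_left_mono) auto
   finally have a: "m * (m + n - 2) <= abs m * (abs m + n)" .
   have "y^2 * (m * (m + n - 2)) <= y^2 * (abs m * (abs m + n))" using a by (intro mult_left_mono) auto
   also have "... <= y * (abs m * (abs m + n))" using y2 n unfolding power2_eq_square
   by (intro mult_right_mono mult_left_le) auto
   finally have "Z * (y^2 * (m * (m + n - 2))) <= Z * (y * (abs m * (abs m + n)))"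
   using Z by simp
   moreover have "P * rh^2 * (m * (m + n - 2) * (R / r^2)) = Z * (y^2 * (m * (m + n - 2)))"
   unfolding ZRP yr[symmetric] by (simp add: power_divide)
   ultimately show ?thesis by (simp add: mult_ac)
  qed
  have t4: "2 * (((m * (R / r^2)) *R x) \<bullet> ((b * (P * rh)) *R w)) <= Z * (2 * abs m * (1 + L) * y)"
  proof -
   have "m * b * (x \<bullet> w) <= abs (m * b * (x \<bullet> w))" by simp
   also have "... = (abs m * b) * abs (x \<bullet> w)" using b by (simp add: abs_mult)
   also have "... <= (abs m * 1) * (r * (1 + L))" using xw b by (intro mult_mono) auto
   finally have "2 * Z * (rh / r^2) * (m * b * (x \<bullet> w)) <= 2 * Z * (rh / r^2) * ((abs m * 1) * (r * (1 + L)))"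
   using Z rh(1) by (intro mult_left_mono) auto
   also have "... = Z * (2 * abs m * (1 + L) * y)" unfolding yr[symmetric] by (simp add: power2_eq_square)
   finally show ?thesis unfolding ZRP by (simp add: mult_ac)
  qed
  define lx where "lx = R * (b * ((b - 1) * P) * (w \<bullet> w) + b * (P * rh) * (2 * M * real DIM('a))) + P * rh^2 * (m * (m + n - 2) * (R / r^2)) + 2 * (((m * (R / r^2)) *R x) \<bullet> ((b * (P * rh)) *R w))"
  have "lx <= - (Z * (c0 - C1 * y))"
   using t1 t2 t3 t4 unfolding lx_def C1_def by (simp add: algebra_simps)
  hence "c * H x powr (- ga) <= A * N * (H x / r^2) + - lx" by (intro fin) auto
  thus "c * H x powr - ga <= - (A * (H x / (norm x)^2 * (0 - (real DIM('a) - 1 + 2 * ph) * 1)) +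
   (norm x powr m * (b * ((b - 1) * p x powr (b - 1 - 1)) * (((2 * M) *R (fst x - fst x) - v, 1::real) \<bullet> ((2 * M) *R (fst x - fst x) - v, 1::real)) + b * p x powr (b - 1) * (2 * M * real DIM('a))) +
   p x powr b * (m * (m + real DIM('a * real) - 2) * norm x powr (m - 2)) +
   2 * ((m * norm x powr (m - 2)) *R x \<bullet> (b * p x powr (b - 1)) *R ((2 * M) *R (fst x - fst x) - v, 1))))"
   unfolding AH unfolding w_def[symmetric] px rh_def[symmetric] r_def[symmetric] Pb Rm R_def[symmetric] n_def[symmetric]
   unfolding lx_def[symmetric] .
  qed
 qed
 qed
qed

text \<open>The function \<open>w powr a * h powr (1 - a)\<close> is increasing and jointly concave,
  so superharmonicity survives. The mean turns the factor \<open>ln (1 / norm x)\<close> of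
  \<open>W\<close> into its power \<open>a\<close>.\<close>

lemma touch_geometric_mean:
 fixes W H :: "'b::euclidean_space => real"
 assumes t: "touch_above W x q" and S: "open S" "x : S" "has_lap S H GH (%_. 0)"
 and pos: "!!y. y : S ==> 0 < W y" "!!y. y : S ==> 0 < H y" and a: "0 < a" "a < 1" and A: "A > 0"
 shows "touch_above (%y. A * (W y powr a * H y powr (1 - a))) x (A * (a * W x powr (a - 1) * H x powr (1 - a) * q))"
proof -
 obtain T ps G l where T: "open T" "x : T" "has_lap T ps G l" "ps x = W x" "!!y. y : T ==> W y <= ps y" "q <= - l x"
 using t unfolding touch_above_def by blast
 define D where "D = S Int T"
 have D: "open D" "x : D" "D <= S" "D <= T" using S T by (auto simp: D_def)
 have ps: "0 < ps y" if "y : D" for y using T(5)[of y] pos(1)[of y] that by (force simp: D_def)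
 have Hp: "0 < H y" if "y : D" for y using pos(2) that D by blast
 have l1: "has_lap D (%y. ps y powr a) (%y. (a * ps y powr (a - 1)) *R G y)
  (%y. a * ((a - 1) * ps y powr (a - 1 - 1)) * (G y \<bullet> G y) + a * ps y powr (a - 1) * l y)"
 by (rule has_lap_comp[OF has_lap_subset[OF T(3) D(4)], where F="%s. s powr a" and ?F1.0="%s. a * s powr (a - 1)" and ?F2.0="%s. a * ((a - 1) * s powr (a - 1 - 1))"];
  (rule DERIV_cmult)?; rule has_real_derivative_powr; erule ps)
 have l2: "has_lap D (%y. H y powr (1 - a)) (%y. ((1 - a) * H y powr (1 - a - 1)) *R GH y)
  (%y. (1 - a) * ((1 - a - 1) * H y powr (1 - a - 1 - 1)) * (GH y \<bullet> GH y) + (1 - a) * H y powr (1 - a - 1) * 0)"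
 by (rule has_lap_comp[OF has_lap_subset[OF S(3) D(3)], where F="%s. s powr (1 - a)" and ?F1.0="%s. (1 - a) * s powr (1 - a - 1)" and ?F2.0="%s. (1 - a) * ((1 - a - 1) * s powr (1 - a - 1 - 1))"];
  (rule DERIV_cmult)?; rule has_real_derivative_powr; erule Hp)
 note l3 = has_lap_cmul[OF has_lap_mult[OF l1 l2], of A]
 show ?thesis
 proof (rule touch_aboveI[OF D(1,2) l3])
 show "A * (ps x powr a * H x powr (1 - a)) = A * (W x powr a * H x powr (1 - a))" by (simp add: T(4))
 fix y assume y: "y : D"
 have "W y <= ps y" "0 < W y" using T(5) pos(1) y D by auto
 thus "A * (W y powr a * H y powr (1 - a)) <= A * (ps y powr a * H y powr (1 - a))"
  using A a by (intro mult_left_mono mult_right_mono powr_mono2) auto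
 next
 define w h p b s where "w = W x" and "h = H x" and "p = w powr a" and "b = h powr (1 - a)" and "s = l x"
 have wh: "w > 0" "h > 0" using pos S by (auto simp: w_def h_def)
 have pb: "p > 0" "b > 0" using wh by (auto simp: p_def b_def)
 have e1: "w powr (a - 1) = p / w" "w powr (a - 1 - 1) = p / w / w"
 proof -
  show *: "w powr (a - 1) = p / w" unfolding p_def using wh by (simp add: powr_diff)
  have "w powr (a - 1 - 1) = w powr (a - 1) / w powr 1" by (rule powr_diff)
  thus "w powr (a - 1 - 1) = p / w / w" unfolding * using wh by simp
 qed
 have e2: "h powr (1 - a - 1) = b / h" "h powr (1 - a - 1 - 1) = b / h / h"
 proof -
  have "h powr (1 - a - 1) = h powr (1 - a) / h powr 1" by (rule powr_diff)
  thus *: "h powr (1 - a - 1) = b / h" unfolding b_def using wh by simp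
  have "h powr (1 - a - 1 - 1) = h powr (1 - a - 1) / h powr 1" by (rule powr_diff)
  thus "h powr (1 - a - 1 - 1) = b / h / h" unfolding * using wh by simp
 qed
 \<comment> \<open>In terms of the logarithmic gradients \<open>X\<close> and \<open>Y\<close> all
   second-order terms combine to \<open>- a * (1 - a)\<close> times the squared length of
   \<open>X - Y\<close>, which has the good sign.\<close>
 define X where "X = (1 / w) *R G x"
 define Y where "Y = (1 / h) *R GH x"
 have G: "G x = w *R X" "GH x = h *R Y" using wh by (simp_all add: X_def Y_def)
 have q: "b / h / h * (GH x \<bullet> GH x) = b * (Y \<bullet> Y)" "p / w / w * (G x \<bullet> G x) = p * (X \<bullet> X)"
  "p / w * (b / h) * (G x \<bullet> GH x) = p * b * (X \<bullet> Y)"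
  unfolding G using wh by auto
 have "p * ((1 - a) * ((1 - a - 1) * (b / h / h)) * (GH x \<bullet> GH x) + (1 - a) * (b / h) * 0) +
  b * (a * ((a - 1) * (p / w / w)) * (G x \<bullet> G x) + a * (p / w) * s) +
  2 * ((a * (p / w)) *R G x \<bullet> ((1 - a) * (b / h)) *R GH x)
  = p * (1 - a) * (1 - a - 1) * (b / h / h * (GH x \<bullet> GH x)) + b * a * (a - 1) * (p / w / w * (G x \<bullet> G x))
  + a * (p / w) * b * s + 2 * a * (1 - a) * (p / w * (b / h) * (G x \<bullet> GH x))"
  by (simp add: distrib_left mult_ac)
 also have "... = a * (p / w) * b * s - a * (1 - a) * p * b * ((X - Y) \<bullet> (X - Y))"
  unfolding q by (simp add: inner_commute algebra_simps)
 also have "... <= a * (p / w) * b * s" using a pb by simp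
 also have "... <= a * (p / w) * b * (- q)" using T(6) a pb wh unfolding s_def by (intro mult_left_mono) auto
 finally have "A * (a * (p / w) * b * q) <= A * - (p * ((1 - a) * ((1 - a - 1) * (b / h / h)) * (GH x \<bullet> GH x) + (1 - a) * (b / h) * 0) +
  b * (a * ((a - 1) * (p / w / w)) * (G x \<bullet> G x) + a * (p / w) * s) +
  2 * ((a * (p / w)) *R G x \<bullet> ((1 - a) * (b / h)) *R GH x))"
  using A by (intro mult_left_mono) auto
 thus "A * (a * W x powr (a - 1) * H x powr (1 - a) * q) <= - (A * (ps x powr a * ((1 - a) * ((1 - a - 1) * H x powr (1 - a - 1 - 1)) * (GH x \<bullet> GH x) + (1 - a) * H x powr (1 - a - 1) * 0) +
  H x powr (1 - a) * (a * ((a - 1) * ps x powr (a - 1 - 1)) * (G x \<bullet> G x) + a * ps x powr (a - 1) * l x) +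
  2 * ((a * ps x powr (a - 1)) *R G x \<bullet> ((1 - a) * H x powr (1 - a - 1)) *R GH x)))"
  unfolding T(4) w_def[symmetric] h_def[symmetric] p_def[symmetric] b_def[symmetric] s_def[symmetric] e1 e2 p_def[symmetric] b_def[symmetric] by linarith
 qed
qed

section \<open>Continuity and positivity of the barrier\<close>

lemma continuous_rho_part:
 assumes e: "epi L K g" and ph: "ph > 0" and b: "0 < b"
 shows "continuous_on {x. 0 <= rho g x} (%x. norm x powr (ph - b) * (min (rho g x) (norm x / 2)) powr b)"
 (is "continuous_on ?S ?f")
 unfolding continuous_on_def
proof
 fix x assume x: "x : ?S"
 show "(?f ---> ?f x) (at x within ?S)"
 proof (cases "x = 0")
 case False
 let ?S' = "?S Int - {0}"
 have "continuous_on ?S' ?f"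
 proof (intro continuous_on_mult)
  show "continuous_on ?S' (%x. norm x powr (ph - b))"
  by (intro continuous_on_powr continuous_intros) auto
  show "continuous_on ?S' (%x. (min (rho g x) (norm x / 2)) powr b)"
  using b by (intro continuous_on_powr' continuous_on_min continuous_rho[OF e] continuous_intros) auto
 qed
 hence "(?f ---> ?f x) (at x within ?S')" using x False unfolding continuous_on_def by auto
 moreover have "at x within ?S' = at x within ?S"
  by (rule at_within_nhd[of x "- {0}"]) (use False in auto)
 ultimately show ?thesis by simp
 next
 case True
 have z: "?f x = 0" using True by simp
 have l: "((%x. norm x powr ph) ---> 0) (at (0::'a * real) within ?S)"
 proof -
  have "((%x::'a * real. norm x powr ph) ---> 0 powr ph) (at 0 within ?S)"
  using ph by (intro tendsto_powr' tendsto_norm_zero tendsto_intros) auto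
  thus ?thesis by simp
 qed
 have "(?f ---> 0) (at 0 within ?S)"
 proof (rule Lim_null_comparison[OF _ l])
  show "\<forall>\<^sub>F x in at 0 within ?S. norm (?f x) <= norm x powr ph"
  unfolding eventually_at_filter
  proof (rule always_eventually, intro allI impI)
  fix x assume x: "x ~= 0" "x : ?S"
  have "min (rho g x) (norm x / 2) <= norm x" using norm_ge_zero[of x] by linarith
  hence "(min (rho g x) (norm x / 2)) powr b <= norm x powr b" using x b by (intro powr_mono2) auto
  hence "?f x <= norm x powr (ph - b) * norm x powr b" by (intro mult_left_mono) auto
  also have "... = norm x powr ph" by (simp flip: powr_add)
  finally show "norm (?f x) <= norm x powr ph" by simp
  qed
 qed
 thus ?thesis using True by simp
 qed
qed

lemma continuous_logH:
 assumes e: "epi L K g" and H: "cone_harm g ph H"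
 shows "continuous_on {x. 0 <= rho g x & norm x <= R} (%x. (c - ln (norm x)) * H x)"
proof (rule continuous_radial[OF e H, of R "%s. s"])
 show "continuous_on {0<..R} (%r. c - ln r)" by (auto intro!: continuous_intros)
 have "((%r. (c - ln r) * r powr (2 * (ph / 2))) ---> 0) (at_right 0)"
 by (rule log_limits(2)) (use cone_harmD(1)[OF H] in simp)
 thus "((%r. (c - ln r) * r powr ph) ---> 0) (at_right 0)" by simp
qed

lemma Wf_cont:
 assumes e: "epi L K g" and H: "cone_harm g ph H" and b: "0 < b"
 shows "continuous_on {x. 0 <= rho g x & norm x <= R} (Wf A ph b g H)"
 unfolding Wf_def
 by (intro continuous_on_add continuous_on_mult continuous_on_const continuous_logH[OF e H]
  continuous_on_subset[OF continuous_rho_part[OF e cone_harmD(1)[OF H] b]]) auto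

lemma Wf_ge:
 assumes "cone_harm g ph H" "0 <= rho g x" "norm x <= 1" "0 <= A"
 shows "norm x powr (ph - b) * (min (rho g x) (norm x / 2)) powr b <= Wf A ph b g H x" "0 <= Wf A ph b g H x"
proof -
 have "0 <= ln 2 - ln (norm x)"
 proof (cases "x = 0")
 case False
 hence "ln (norm x) <= ln 1" using assms(3) by auto
 thus ?thesis using ln_facts(1) by simp
 qed simp
 hence "0 <= A * ((ln 2 - ln (norm x)) * H x)" using cone_harm_bounds(1)[OF assms(1,2)] assms(4) by simp
 thus 1: "norm x powr (ph - b) * (min (rho g x) (norm x / 2)) powr b <= Wf A ph b g H x"
 unfolding Wf_def by simp
 have "0 <= norm x powr (ph - b) * (min (rho g x) (norm x / 2)) powr b" by simp
 thus "0 <= Wf A ph b g H x" using 1 by linarith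
qed

lemma Wf_pos:
 assumes "epi L K g" "cone_harm g ph H" "0 < rho g x" "norm x <= 1" "0 <= A"
 shows "0 < Wf A ph b g H x"
proof -
 have "x ~= 0" using rho_0[OF assms(1)] assms(3) by auto
 hence "0 < min (rho g x) (norm x / 2)" "0 < norm x" using assms(3) by auto
 hence "min (rho g x) (norm x / 2) ~= 0" "norm x ~= 0" by linarith+
 hence "0 < norm x powr (ph - b) * (min (rho g x) (norm x / 2)) powr b"
 by simp
 thus ?thesis using Wf_ge(1)[OF assms(2), of x A b] assms by simp
qed

lemma sol_sup_lower:
 fixes g :: "'a::euclidean_space => real"
 assumes e: "epi L K g" and H: "cone_harm g (2 * a) H" and s: "sing g ga lam Lam u"
 and ga: "ga > 0" and lam: "lam > 0" and a: "a = 1 / (1 + ga)"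
 and ka: "ka = (lam / (a * (real DIM('a) + 1 + 4 * a))) powr a"
 and r: "0 < r" "r < 3/4"
 shows "EX x:epicone g. norm x = r & ka * r powr (2 * a) * ((ln (3/2) - ln r) powr a - ln 2 powr a) <= u x"
proof -
 obtain th where th: "th : epicone g" "norm th = 1" "H th = 1" using cone_harmD(7)[OF H] by blast
 have x: "r *R th : epicone g" "norm (r *R th) = r" using cone_scale[OF e r(1)] th r by auto
 have "H (r *R th) = r powr (2 * a)" using cone_harmD(4)[OF H th(1) r(1)] th by simp
 thus ?thesis using sol_lower[OF e H s ga lam a ka, of "r *R th"] x r
 by (intro bexI[of _ "r *R th"]) (auto simp: epicone_def)
qed

text \<open>The barrier must first dominate \<open>u\<close> on the sphere of radius 1/2, including
  its approach to the lateral boundary; this is a separate estimate by a power of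
  \<open>rho\<close>. Comparison in the half-size sector then gives the logarithmic bound. All
  constants precede \<open>g\<close> and \<open>u\<close>.\<close>

lemma sol_upper:
 fixes L K ga lam Lam :: real
 assumes L: "1 <= L" "1 <= K" and ga: "0 < ga" "ga < 2" and lam: "lam > 0" and a: "a = 1 / (1 + ga)"
 shows "EX C>0. ALL (g :: 'a::euclidean_space => real) H u s. epi L K g --> cone_harm g (2 * a) H -->
  sing g ga lam Lam u --> (ALL x:epicone g. norm x < 1 --> u x <= s) -->
  (ALL x:epicone g. norm x < 1/2 --> u x <= C * s * norm x powr (2 * a) * ln (1 / norm x) powr a)"
proof -
 define ph where "ph = 2 * a"
 have a0: "0 < a" "a < 1" using ga by (auto simp: a)
 have a1: "a * (1 + ga) = 1" using ga by (simp add: a)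
 have aga: "a * ga = 1 - a" using a1 by (simp add: algebra_simps)
 have ph: "ph > 0" "ph * ga = 2 - ph" using a0 aga by (auto simp: ph_def)
 define b where "b = min (1/2) (2 - ga)"
 have b: "0 < b" "b < 1" "b <= 2 - ga" using ga by (auto simp: b_def)
 \<comment> \<open>The rate at which \<open>W powr a * H powr (1 - a)\<close> is known to dominate
   powers of \<open>rho\<close>. The bound \<open>b' * (1 + ga) <= 2\<close> makes a large multiple
   of \<open>rho powr b'\<close> a supersolution.\<close>
 define b' where "b' = a * b + (1 - a)"
 have b': "0 < b'" "b' < 1" "b' * (1 + ga) <= 2"
 proof -
 show "0 < b'" using a0 b by (simp add: b'_def add_pos_pos)
 have "a * b < a * 1" using a0 b by auto
 thus "b' < 1" by (simp add: b'_def)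
 have "b' * (1 + ga) = (a * (1 + ga)) * b + (1 + ga) - a * (1 + ga)" by (simp add: b'_def algebra_simps)
 thus "b' * (1 + ga) <= 2" unfolding a1 using b by simp
 qed
 define LL where "LL = max Lam 1"
 have LL: "LL > 0" "Lam <= LL" by (auto simp: LL_def)
 obtain c1 where c1: "c1 > 0" "ALL (g :: 'a => real) H. epi L K g --> cone_harm g ph H -->
  (ALL x:epicone g. c1 * norm x powr ph * (rho g x / norm x) <= H x)"
 using cone_harm_lower[OF L ph(1), where 'a='a] by blast
 obtain A c4 where Ac: "A > 0" "c4 > 0" "ALL (g :: 'a => real) H. epi L K g --> cone_harm g ph H -->
  (ALL x:epicone g. c1 * norm x powr ph * (rho g x / norm x) <= H x) -->
  (ALL x:epicone g. touch_above (Wf A ph b g H) x (c4 * H x powr (- ga)))"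
 using W_touch[OF L ph(1) b ga(1) ph(2) c1(1), where 'a='a] by blast
 define ka where "ka = (lam / (a * (real DIM('a) + 1 + 4 * a))) powr a"
 have ka: "ka > 0" using lam a0 by (simp add: ka_def)
 \<comment> \<open>A lower bound for \<open>u\<close> at some point of norm 1/4, hence for
   \<open>s\<close>. It turns the fixed sizes forced by the singular equation into multiples of
   \<open>s\<close>, so the final estimate is linear in \<open>s\<close>.\<close>
 define s0 where "s0 = ka * (1/4) powr ph * ((ln (3/2) - ln (1/4)) powr a - ln 2 powr a)"
 have s0: "s0 > 0"
 proof -
 have "ln (1/4::real) < ln (3/4)" by simp
 hence "ln 2 < ln (3/2::real) - ln (1/4)" using ln_facts(3) by linarith
 hence "ln 2 powr a < (ln (3/2::real) - ln (1/4)) powr a" using a0 by (intro powr_less_mono2) auto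
 thus ?thesis using ka by (simp add: s0_def)
 qed
 define bm where "bm = bM TYPE('a) L K (1/2)"
 have bm: "bm > 0" using bM_pos[OF L, of "1/2", where 'a='a] by (simp add: bm_def)
 define de where "de = min (bd TYPE('a) L K (1/2)) ((1 - b') / (2 * bm))"
 have de: "0 < de" "de <= bd TYPE('a) L K (1/2)" "de <= (1 - b') / (2 * bm)"
 using bd_pos[OF L, of "1/2", where 'a='a] b' bm by (auto simp: de_def)
 have de1: "de <= 1" using de(2) bd_le(1)[OF L, of "1/2", where 'a='a] by simp
 have bmde: "bm * si <= (1 - b') / 2" if "si <= de" for si
 proof -
 have "bm * si <= bm * ((1 - b') / (2 * bm))" using that de(3) bm by (intro mult_left_mono) auto
 thus ?thesis using bm by simp
 qed
 define k0 where "k0 = (2 * LL / (b' * (1 - b'))) powr a"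
 have k0: "k0 > 0" using LL b' by (simp add: k0_def)
 define Cu where "Cu = max (de powr (- b')) (k0 / s0)"
 have Cu: "Cu > 0" "de powr (- b') <= Cu" "k0 / s0 <= Cu" using k0 s0 by (auto simp: Cu_def less_max_iff_disj)
 define cw where "cw = ((1/2) powr (ph - b) * (1 / (2 * (1 + L))) powr b) powr a * (c1 * (1/2) powr ph * 2) powr (1 - a)"
 have cw: "cw > 0" using c1 L by (simp add: cw_def)
 define Cv where "Cv = max (Cu / cw) ((LL / (a * c4)) powr a / s0)"
 have Cv: "Cv > 0" "Cu / cw <= Cv" "(LL / (a * c4)) powr a / s0 <= Cv"
 using Cu cw by (auto simp: Cv_def less_max_iff_disj)
 define C where "C = Cv * (2 * A + 2) powr a"
 have C: "C > 0" using Cv Ac by (simp add: C_def)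
 show ?thesis
 proof (rule exI[of _ C], rule conjI[OF C], intro allI impI ballI)
 fix g :: "'a => real" and H u s x
 assume e: "epi L K g" and H': "cone_harm g (2 * a) H" and sg: "sing g ga lam Lam u"
  and us: "ALL x:epicone g. norm x < 1 --> u x <= s" and x: "x : epicone g" and xn: "norm x < 1/2"
 have H: "cone_harm g ph H" using H' by (simp add: ph_def)
 have Hl: "ALL x:epicone g. c1 * norm x powr ph * (rho g x / norm x) <= H x" using c1(2) e H by blast
 have tW: "!!x. x : epicone g ==> touch_above (Wf A ph b g H) x (c4 * H x powr (- ga))" using Ac(3) e H Hl by blast
 have Hp: "0 < H y" if "y : epicone g" for y
 proof -
  have "0 < c1 * norm y powr ph * (rho g y / norm y)"
  using that c1 cone_nz[OF e that] by (simp add: epicone_def)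
  thus ?thesis using Hl that by auto
 qed
 have usx: "u y <= s" if "0 <= rho g y" "norm y < 1" for y
 proof (cases "rho g y = 0")
  case True
  obtain z where z: "z : epicone g" "norm z = 1/4" using sol_sup_lower[OF e H' sg ga(1) lam a ka_def, of "1/4"] by auto
  have "0 < u z" using singD(3)[OF sg, of z] z by (simp add: epicone_def)
  moreover have "u z <= s" using us z by simp
  ultimately have "0 <= s" by simp
  thus ?thesis using singD(2)[OF sg True that(2)] by simp
 next
  case False
  hence "y : epicone g" using that by (simp add: epicone_def)
  thus ?thesis using us that(2) by blast
 qed
 have s: "s0 <= s"
 proof -
  obtain z where z: "z : epicone g" "norm z = 1/4" "s0 <= u z"
  using sol_sup_lower[OF e H' sg ga(1) lam a ka_def, of "1/4"] unfolding s0_def ph_def by auto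
  have "u z <= s" using us z by simp
  thus ?thesis using z by auto
 qed
 have sp: "s > 0" using s s0 by auto
 text \<open>Near the lateral boundary of the sphere of radius 1/2.\<close>
 define Au where "Au = Cu * s"
 have Au: "Au > 0" using Cu sp by (simp add: Au_def)
 have Auk: "k0 <= Au"
 proof -
  have "k0 = k0 / s0 * s0" using s0 by simp
  also have "... <= Cu * s" using Cu s s0 by (intro mult_mono) auto
  finally show ?thesis by (simp add: Au_def)
 qed
 have Au1: "2 * LL / (b' * (1 - b')) <= Au powr (1 + ga)"
 proof -
  have "k0 powr (1 + ga) <= Au powr (1 + ga)" using Auk k0 ga by (intro powr_mono2) auto
  moreover have "k0 powr (1 + ga) = 2 * LL / (b' * (1 - b'))" using LL b' a1 by (simp add: k0_def powr_powr)
  ultimately show ?thesis by simp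
 qed
 have Aus: "s <= Au * de powr b'"
 proof -
  have "s * (de powr (- b') * de powr b') <= s * (Cu * de powr b')"
  using Cu sp by (intro mult_left_mono mult_right_mono) auto
  moreover have "de powr (- b') * de powr b' = 1" using de by (simp flip: powr_add)
  ultimately show ?thesis by (simp add: Au_def mult_ac)
 qed
 have lat: "u y <= Au * rho g y powr b'" if y: "0 < rho g y" "norm y = 1/2" for y
 proof (cases "rho g y < de")
  case False
  have "u y <= s" using usx[of y] y by simp
  also have "s <= Au * de powr b'" by (rule Aus)
  also have "... <= Au * rho g y powr b'" using False de Au b' by (intro mult_left_mono powr_mono2) auto
  finally show ?thesis .
 next
  case True
  have n1: "norm z < 1" if "norm (z - y) <= 1/2/4" for z
  using norm_triangle_ineq[of y "z - y"] that y by simp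
  show ?thesis
  proof (rule upper_barrier[OF e de(1,2) _ _ _ y(1) True, where Ps="%si. Au * si powr b'" and ?Ps1.0="%si. Au * (b' * si powr (b' - 1))"
   and ?Ps2.0="%si. Au * (b' * ((b' - 1) * si powr (b' - 1 - 1)))" and Q="%si. LL * (Au * si powr b') powr (- ga)" and u=u, folded bm_def])
  show "continuous_on {z. 0 <= rho g z & norm (z - y) <= 1 / 2 / 4} u"
   by (rule continuous_on_subset[OF singD(1)[OF sg]]) (use n1 in auto)
  show "u z <= 0" if "rho g z = 0" "norm (z - y) <= 1 / 2 / 4" for z
   using singD(2)[OF sg that(1) n1[OF that(2)]] by simp
  show "u z <= Au * de powr b'" if "0 <= rho g z" "norm (z - y) <= 1 / 2 / 4" for z
   using usx[OF that(1) n1[OF that(2)]] Aus by simp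
  show "continuous_on {0..de} (%si. Au * si powr b')"
   using b' by (intro continuous_intros continuous_on_powr') auto
  show "DERIV (%si. Au * si powr b') si :> Au * (b' * si powr (b' - 1))" if "0 < si" for si
   using that by (intro DERIV_cmult has_real_derivative_powr)
  show "DERIV (%si. Au * (b' * si powr (b' - 1))) si :> Au * (b' * ((b' - 1) * si powr (b' - 1 - 1)))" if "0 < si" for si
   using that by (intro DERIV_cmult has_real_derivative_powr)
  show "0 <= Au * (b' * si powr (b' - 1))" for si using Au b' by simp
  show "Au * (b' * ((b' - 1) * si powr (b' - 1 - 1))) <= 0" for si
   using Au b' by (intro mult_nonneg_nonpos mult_nonpos_nonneg) auto
  show "0 <= Au * si powr b'" for si using Au by simp
  show "LL * (Au * si powr b') powr (- ga) <= - (Au * (b' * ((b' - 1) * si powr (b' - 1 - 1)))) - bm * (Au * (b' * si powr (b' - 1)))"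
   if si: "0 < si" "si < de" for si
  proof -
   define P where "P = si powr (b' - 2)"
   have P: "P > 0" using si by (simp add: P_def)
   have "P * si powr 1 = si powr (b' - 1)" unfolding P_def by (simp only: powr_add[symmetric]) simp
   hence P1: "si powr (b' - 1) = P * si" "si powr (b' - 1 - 1) = P" using si by (auto simp: P_def)
   have "Au * (b' * ((1 - b') / 2)) * P <= Au * b' * (1 - b' - bm * si) * P"
   using bmde[of si] si Au b' P by simp
   also have "... = - (Au * (b' * ((b' - 1) * si powr (b' - 1 - 1)))) - bm * (Au * (b' * si powr (b' - 1)))"
   unfolding P1 by (simp add: algebra_simps)
   finally have 1: "Au * (b' * ((1 - b') / 2)) * P <= - (Au * (b' * ((b' - 1) * si powr (b' - 1 - 1)))) - bm * (Au * (b' * si powr (b' - 1)))" .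
   have "LL <= Au powr (1 + ga) * (b' * ((1 - b') / 2))"
   using Au1 b' by (simp add: field_simps)
   hence "LL * (Au powr (- ga) * P) <= Au powr (1 + ga) * (b' * ((1 - b') / 2)) * (Au powr (- ga) * P)"
   using P by (intro mult_right_mono) auto
   also have "... = (Au powr (1 + ga) * Au powr (- ga)) * (b' * ((1 - b') / 2)) * P" by simp
   also have "Au powr (1 + ga) * Au powr (- ga) = Au" using Au by (simp flip: powr_add)
   finally have 2: "LL * (Au powr (- ga) * P) <= Au * (b' * ((1 - b') / 2)) * P" .
   have "(Au * si powr b') powr (- ga) = Au powr (- ga) * si powr (- (b' * ga))"
   by (simp add: powr_mult powr_powr)
   also have "... <= Au powr (- ga) * P" unfolding P_def
   using si de1 b'(3) by (intro mult_left_mono powr_mono') (auto simp: algebra_simps)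
   finally have "LL * (Au * si powr b') powr (- ga) <= LL * (Au powr (- ga) * P)" using LL by simp
   thus ?thesis using 1 2 by auto
  qed
  show "asub D u (%z. LL * (Au * p z powr b') powr (- ga))"
   if o: "open D" and cp: "continuous_on D p" and
   D: "!!z. z : D ==> 0 < rho g z & norm (z - y) < 1 / 2 / 4 & 0 < p z & p z < de & Au * p z powr b' < u z" for p D
  proof (rule sing_asub(1)[OF e sg o])
   show "D <= usec g"
   proof
   fix z assume "z : D"
   from D[OF this] n1[of z] show "z : usec g" by (simp add: epicone_def)
   qed
   show "continuous_on D (%z. LL * (Au * p z powr b') powr - ga)"
   by (intro continuous_intros cp) (use D Au in force)+
   fix z assume "z : D"
   note d = D[OF this]
   have "u z powr (- ga) <= (Au * p z powr b') powr (- ga)"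
   using d Au ga by (intro powr_mono2') auto
   thus "Lam * u z powr (- ga) <= LL * (Au * p z powr b') powr (- ga)"
   using LL by (intro mult_mono) auto
  qed
  qed (use y in auto)
 qed
 define Av where "Av = Cv * s"
 have Av: "Av > 0" using Cv sp by (simp add: Av_def)
 have Av1: "LL <= Av powr (1 + ga) * (a * c4)"
 proof -
  define k where "k = (LL / (a * c4)) powr a"
  have k: "k > 0" using LL a0 Ac by (simp add: k_def)
  have "k = k / s0 * s0" using s0 by simp
  also have "... <= Cv * s" using Cv(1,3) s s0 unfolding k_def by (intro mult_mono) auto
  finally have "k powr (1 + ga) <= Av powr (1 + ga)" using k ga by (intro powr_mono2) (auto simp: Av_def)
  moreover have "k powr (1 + ga) = LL / (a * c4)" using LL a0 Ac a1 by (simp add: k_def powr_powr)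
  ultimately show ?thesis using a0 Ac by (simp add: field_simps)
 qed
 define W where "W = Wf A ph b g H"
 define V where "V = (%y. Av * (W y powr a * H y powr (1 - a)))"
 define D where "D = {y. 0 < rho g y & norm y < 1/2}"
 note reg = two_sided_region[OF continuous_rho[OF e] continuous_on_norm_id, where d="1/2", folded D_def]
 have cl: "closure D <= {y. 0 <= rho g y & norm y <= 1/2}" using reg(2) by blast
 have DC: "D <= epicone g" by (auto simp: D_def epicone_def)
 have Wp: "0 < W y" if "y : D" for y
  using Wf_pos[OF e H, of y A b] that Ac by (simp add: W_def D_def)
 have Vp: "0 < V y" if "y : D" for y
 proof -
  have "0 < W y" "0 < H y" using Wp that Hp DC by blast+
  thus ?thesis using Av by (simp add: V_def)
 qed
 have cV: "continuous_on {y. 0 <= rho g y & norm y <= 1/2} V"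
  unfolding V_def W_def
 proof (intro continuous_on_mult continuous_on_const continuous_on_powr')
  show "continuous_on {y. 0 <= rho g y & norm y <= 1/2} (Wf A ph b g H)" by (rule Wf_cont[OF e H b(1)])
  show "continuous_on {y. 0 <= rho g y & norm y <= 1/2} H"
  by (rule continuous_on_subset[OF cone_harmD(2)[OF H]]) auto
  show "ALL y:{y. 0 <= rho g y & norm y <= 1/2}. 0 <= Wf A ph b g H y & (Wf A ph b g H y = 0 --> 0 < a)"
  proof
  fix y assume "y : {y. 0 <= rho g y & norm y <= 1/2}"
  thus "0 <= Wf A ph b g H y & (Wf A ph b g H y = 0 --> 0 < a)"
   using Wf_ge(2)[OF H, of y A b] Ac a0 by simp
  qed
  show "ALL y:{y. 0 <= rho g y & norm y <= 1/2}. 0 <= H y & (H y = 0 --> 0 < 1 - a)"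
  proof
  fix y assume "y : {y. 0 <= rho g y & norm y <= 1/2}"
  thus "0 <= H y & (H y = 0 --> 0 < 1 - a)"
   using cone_harm_bounds(1)[OF H, of y] a0 by simp
  qed
 qed
 have cu: "continuous_on {y. 0 <= rho g y & norm y <= 1/2} u"
  by (rule continuous_on_subset[OF singD(1)[OF sg]]) auto
 have ux: "u x <= V x"
 proof (rule comparison[OF reg(1), where q="%y. LL * V y powr (- ga)"])
  show "bounded D" by (rule bounded_subset[of "cball 0 (1/2)"]) (auto simp: D_def)
  show "continuous_on (closure D) u" "continuous_on (closure D) V"
  by (rule continuous_on_subset[OF cu cl], rule continuous_on_subset[OF cV cl])
  show "u y <= V y" if "y : frontier D" for y
  proof -
  note f = reg(3)[OF that]
  show ?thesis
  proof (cases "rho g y = 0")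
   case True
   have "0 <= V y" unfolding V_def using Av by simp
   thus ?thesis using singD(2)[OF sg True] f by simp
  next
   case False
   hence y: "0 < rho g y" "norm y = 1/2" using f by auto
   have yc: "y : epicone g" using y by (simp add: epicone_def)
   define R where "R = rho g y"
   have R: "0 < R" using y by (simp add: R_def)
   have "R <= (1 + L) * (1/2)" using rho_bound[OF e, of y] y by (simp add: R_def)
   hence "R / (2 * (1 + L)) <= 1/4" using L by auto
   moreover have "R / (2 * (1 + L)) <= R" using L R by (simp add: field_simps)
   ultimately have m: "R * (1 / (2 * (1 + L))) <= min (rho g y) (norm y / 2)"
   unfolding y(2) R_def[symmetric] by simp
   have "(1/2) powr (ph - b) * (R * (1 / (2 * (1 + L)))) powr b <= norm y powr (ph - b) * (min (rho g y) (norm y / 2)) powr b"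
   using m R L b unfolding y(2) by (intro mult_left_mono powr_mono2) auto
   also have "... <= W y" unfolding W_def
   proof (rule Wf_ge(1)[OF H])
   show "norm y <= 1" using y(2) by simp
   qed (use y(1) Ac(1) in simp_all)
   finally have W1: "((1/2) powr (ph - b) * (1 / (2 * (1 + L))) powr b) * R powr b <= W y"
   by (subst (asm) powr_mult) (auto simp only: mult_ac)
   have H1: "(c1 * (1/2) powr ph * 2) * R <= H y"
   proof -
   have "c1 * norm y powr ph * (rho g y / norm y) <= H y" using Hl yc by blast
   thus ?thesis unfolding y(2) R_def[symmetric] by auto
   qed
   define w1 where "w1 = (1/2) powr (ph - b) * (1 / (2 * (1 + L))) powr b"
   define h1 where "h1 = c1 * (1/2) powr ph * 2"
   have wh: "w1 > 0" "h1 > 0" using L c1 by (auto simp: w1_def h1_def)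
   have "cw * R powr b' = (w1 * R powr b) powr a * (h1 * R) powr (1 - a)"
   unfolding cw_def w1_def[symmetric] h1_def[symmetric] b'_def by (simp add: powr_mult powr_powr powr_add mult_ac)
   also have "... <= W y powr a * H y powr (1 - a)"
   using W1 H1 wh R a0 unfolding w1_def[symmetric] h1_def[symmetric]
   by (intro mult_mono powr_mono2) auto
   finally have "Av * (cw * R powr b') <= V y" unfolding V_def using Av by auto
   moreover have "Au <= Av * cw"
   proof -
   have "Cu <= Cv * cw" using Cv(2) cw by (simp add: pos_divide_le_eq)
   hence "Cu * s <= Cv * cw * s" using sp by simp
   thus ?thesis by (simp add: Au_def Av_def mult_ac)
   qed
   hence "Au * R powr b' <= Av * cw * R powr b'" by (intro mult_right_mono) auto
   ultimately show ?thesis using lat[OF y] by (simp add: R_def)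
  qed
  qed
  show "asub {y : D. V y < u y} u (%y. LL * V y powr (- ga))"
  proof (rule sing_asub(1)[OF e sg])
  have sub: "D <= {y. 0 <= rho g y & norm y <= 1/2}" by (auto simp: D_def)
  have "open (D Int (%y. u y - V y) -` {0<..})"
   using reg(1) continuous_on_subset[OF cV sub] continuous_on_subset[OF cu sub]
   by (intro continuous_open_preimage continuous_intros) auto
  moreover have "D Int (%y. u y - V y) -` {0<..} = {y : D. V y < u y}" by auto
  ultimately show "open {y : D. V y < u y}" by metis
  show "{y : D. V y < u y} <= usec g" by (auto simp: D_def epicone_def)
  show "continuous_on {y : D. V y < u y} (%y. LL * V y powr - ga)"
  proof (intro continuous_intros continuous_on_subset[OF cV] ballI)
   fix y assume "y : {y : D. V y < u y}"
   thus "V y ~= 0" using Vp[of y] by auto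
  qed (auto simp: D_def)
  fix y assume y: "y : {y : D. V y < u y}"
  hence "u y powr (- ga) <= V y powr (- ga)" using Vp[of y] ga by (intro powr_mono2') auto
  thus "Lam * u y powr (- ga) <= LL * V y powr (- ga)" using LL by (intro mult_mono) auto
  qed
  show "touch_above V y (LL * V y powr (- ga))" if y: "y : D" for y
  proof -
  obtain G where G: "has_lap (epicone g) H G (%_. 0)" using cone_harmD(8)[OF H] by blast
  have yc: "y : epicone g" using y DC by blast
  have t: "touch_above V y (Av * (a * W y powr (a - 1) * H y powr (1 - a) * (c4 * H y powr (- ga))))"
   unfolding V_def
  proof (rule touch_geometric_mean[OF _ reg(1) y has_lap_subset[OF G DC] _ _ a0 Av])
   show "touch_above W y (c4 * H y powr (- ga))" unfolding W_def by (rule tW[OF yc])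
   show "!!y. y : D ==> 0 < W y" by (rule Wp)
   show "!!y. y : D ==> 0 < H y" using Hp DC by blast
  qed
  define w h where "w = W y" and "h = H y"
  have wh: "w > 0" "h > 0" using Wp[OF y] Hp[OF yc] by (auto simp: w_def h_def)
  \<comment> \<open>Since \<open>a * ga = 1 - a\<close>, the exponents of \<open>w\<close> and
    \<open>h\<close> in \<open>V powr (- ga)\<close> are those produced by the geometric mean; this
    is what fixes the weights \<open>a\<close> and \<open>1 - a\<close>.\<close>
  have "LL * V y powr (- ga) = LL * (Av powr (- ga) * (w powr (a * - ga) * h powr ((1 - a) * - ga)))"
   unfolding V_def w_def[symmetric] h_def[symmetric] by (simp add: powr_mult powr_powr)
  also have "a * - ga = a - 1" using aga by simp
  also have "(1 - a) * - ga = 1 - a - ga" using aga by (simp add: algebra_simps)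
  also have "LL * (Av powr (- ga) * (w powr (a - 1) * h powr (1 - a - ga)))
   <= (Av powr (1 + ga) * (a * c4)) * (Av powr (- ga) * (w powr (a - 1) * h powr (1 - a - ga)))"
   using Av1 by (intro mult_right_mono) auto
  also have "... = (Av powr (1 + ga) * Av powr (- ga)) * (a * w powr (a - 1) * (h powr (1 - a - ga)) * c4)"
   by simp
  also have "Av powr (1 + ga) * Av powr (- ga) = Av" using Av by (simp flip: powr_add)
  also have "h powr (1 - a - ga) = h powr (1 - a) * h powr (- ga)" by (simp flip: powr_add)
  finally have le: "LL * V y powr (- ga) <= Av * (a * W y powr (a - 1) * H y powr (1 - a) * (c4 * H y powr (- ga)))"
   unfolding w_def h_def by (simp only: mult_ac)
  show ?thesis using t le unfolding touch_above_def by (meson order_trans)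
  qed
  show "x : D" using x xn by (simp add: D_def epicone_def)
 qed
 have nx: "norm x > 0" using cone_nz[OF e x] by simp
 define r where "r = norm x"
 define l where "l = ln (1 / r)"
 have r: "0 < r" "r < 1/2" using nx xn by (auto simp: r_def)
 have lr: "l = - ln r" by (simp add: l_def ln_div)
 have l2: "ln 2 <= l"
 proof -
  have "2 <= 1 / r" using r by (simp add: field_simps)
  thus ?thesis unfolding l_def using r by auto
 qed
 hence lh: "1/2 <= l" using ln_facts(1) by simp
 have W2: "W x <= r powr ph * ((2 * A + 2) * l)"
 proof -
  have "H x <= r powr ph" using cone_harmD(6)[OF H x] by (simp add: r_def)
  hence "A * ((ln 2 - ln r) * H x) <= A * ((2 * l) * r powr ph)"
  using l2 lr lh Ac Hp[OF x] by (intro mult_left_mono mult_mono) auto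
  moreover have "r powr (ph - b) * (min (rho g x) (r / 2)) powr b <= r powr (ph - b) * r powr b"
  using r x b by (intro mult_left_mono powr_mono2) (auto simp: epicone_def)
  moreover have "r powr (ph - b) * r powr b = r powr ph" by (simp flip: powr_add)
  moreover have "r powr ph * 1 <= r powr ph * (2 * l)" using lh by (intro mult_left_mono) auto
  ultimately show ?thesis unfolding W_def Wf_def r_def[symmetric] by (simp add: algebra_simps)
 qed
 have "V x <= Av * ((r powr ph * ((2 * A + 2) * l)) powr a * (r powr ph) powr (1 - a))"
  unfolding V_def
 proof (intro mult_left_mono mult_mono powr_mono2 W2)
  have xD: "x : D" using x xn by (simp add: D_def epicone_def)
  show "0 <= W x" using Wp[OF xD] by simp
  show "0 <= H x" using Hp[OF x] by simp
  show "H x <= r powr ph" using cone_harmD(6)[OF H x] by (simp add: r_def)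
 qed (use a0 Av in auto)
 also have "(r powr ph * ((2 * A + 2) * l)) powr a * (r powr ph) powr (1 - a) = ((r powr ph) powr a * (r powr ph) powr (1 - a)) * ((2 * A + 2) powr a * l powr a)"
  by (simp add: powr_mult)
 also have "(r powr ph) powr a * (r powr ph) powr (1 - a) = r powr ph" by (simp add: powr_add[symmetric] del: powr_powr)
 finally have "V x <= C * s * r powr ph * l powr a" unfolding C_def Av_def by (simp only: mult_ac)
 thus "u x <= C * s * norm x powr (2 * a) * ln (1 / norm x) powr a"
  using ux unfolding r_def l_def ph_def by simp
 qed
qed

section \<open>The Poisson problem by finite differences\<close>

definition gridav :: "real => ('b::euclidean_space => real) => 'b => real" where
 "gridav h w x = (SUM b:Basis. w (x + h *R b) + w (x - h *R b)) / (2 * real DIM('b))"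

lemma gridav_const: "gridav h (%x::'b::euclidean_space. c) x = c"
 by (simp add: gridav_def)

lemma gridav_add: "gridav h (%x. f x + g x) x = gridav h f x + gridav h g x"
 by (simp add: gridav_def sum.distrib add_divide_distrib[symmetric])

lemma gridav_cmul: "gridav h (%x. c * f x) x = c * gridav h f x"
 by (simp add: gridav_def sum_distrib_left algebra_simps)

lemma gridav_shift: "gridav h (%x. f (x + y)) x = gridav h f (x + y)"
 by (simp add: gridav_def algebra_simps)

lemma gridav_mono:
 assumes "!!b. b : Basis ==> f (x + h *R b) <= g (x + h *R b)" "!!b. b : Basis ==> f (x - h *R b) <= g (x - h *R b)"
 shows "gridav h f x <= gridav h g x"
 unfolding gridav_def using assms by (intro divide_right_mono sum_mono add_mono) auto

lemma gridav_paraboloid: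
 "gridav h (%x::'b::euclidean_space. e + mu * (R - (norm x)^2)) x = e + mu * (R - (norm x)^2) - mu * h^2"
proof -
 have "(SUM b:Basis. (norm (x + h *R b))^2 + (norm (x - h *R b))^2) = (SUM b:(Basis::'b set). 2 * (norm x)^2 + 2 * h^2)"
 unfolding power2_norm_eq_inner by (rule sum.cong) (simp_all add: inner_add_right inner_diff_right inner_commute power2_eq_square)
 also have "... = real DIM('b) * (2 * (norm x)^2 + 2 * h^2)" by simp
 finally have "gridav h (%x::'b. (norm x)^2) x = (norm x)^2 + h^2"
 unfolding gridav_def by auto
 moreover have "gridav h (%x::'b. (e + mu * R) + (- mu) * (norm x)^2) x = (e + mu * R) + (- mu) * gridav h (%x. (norm x)^2) x"
 unfolding gridav_add gridav_cmul gridav_const ..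
 ultimately show ?thesis by (simp add: algebra_simps)
qed

lemma gridav_taylor:
 fixes f :: "'b::euclidean_space => real"
 assumes "D2on S f G H2" "!!s b. b : Basis ==> abs s <= abs h ==> x + s *R b : S"
 obtains si ta where "!!b. b : Basis ==> abs (si b) <= abs h & abs (ta b) <= abs h"
 "gridav h f x = f x + h^2 / (2 * real DIM('b)) * ((SUM b:Basis. H2 b (x + si b *R b) + H2 b (x + ta b *R b)) / 2)"
proof -
 have "EX s s'. abs s <= abs h & abs s' <= abs h & f (x + h *R b) + f (x - h *R b) = 2 * f x + h^2 / 2 * (H2 b (x + s *R b) + H2 b (x + s' *R b))"
 if b: "b : Basis" for b
 proof -
 obtain s where s: "abs s <= abs h" "f (x + h *R b) = f x + h * (G x \<bullet> b) + H2 b (x + s *R b) * h^2 / 2"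
  by (rule line_taylor[OF assms(1) b, of h x]) (use assms(2) b in auto)
 obtain s' where s': "abs s' <= abs (- h)" "f (x + (- h) *R b) = f x + (- h) * (G x \<bullet> b) + H2 b (x + s' *R b) * (- h)^2 / 2"
  by (rule line_taylor[OF assms(1) b, of "- h" x]) (use assms(2) b in auto)
 show ?thesis using s s' by (intro exI[of _ s] exI[of _ s']) (simp add: algebra_simps)
 qed
 then obtain si ta where st: "!!b. b : Basis ==> abs (si b) <= abs h & abs (ta b) <= abs h &
 f (x + h *R b) + f (x - h *R b) = 2 * f x + h^2 / 2 * (H2 b (x + si b *R b) + H2 b (x + ta b *R b))" by metis
 have "gridav h f x = (SUM b:Basis. 2 * f x + h^2 / 2 * (H2 b (x + si b *R b) + H2 b (x + ta b *R b))) / (2 * real DIM('b))"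
 unfolding gridav_def using st by auto
 also have "... = f x + h^2 / (2 * real DIM('b)) * ((SUM b:Basis. H2 b (x + si b *R b) + H2 b (x + ta b *R b)) / 2)"
 proof -
 have "(SUM b:(Basis::'b set). 2 * f x + h^2 / 2 * (H2 b (x + si b *R b) + H2 b (x + ta b *R b)))
  = real DIM('b) * (2 * f x) + h^2 / 2 * (SUM b:Basis. H2 b (x + si b *R b) + H2 b (x + ta b *R b))"
  by (simp add: sum.distrib sum_distrib_left distrib_left)
 thus ?thesis by (simp add: field_simps)
 qed
 finally show ?thesis using st that by blast
qed

text \<open>The scheme is imposed at every point, thus on all translates of the lattice at once, so
  that \<open>w\<close> can be compared with its shift by an arbitrary vector. The last clause
  expresses minimality and replaces a discrete maximum principle: \<open>B\<close> has to be a
  supersolution only where it is not already above \<open>w\<close>. The factor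
  \<open>h^2 / (2 * real DIM('b))\<close> relates the stencil average to the Laplacian.\<close>

definition gridsol :: "'b::euclidean_space set => ('b => real) => real => ('b => real) => bool" where
 "gridsol Om F h w \<longleftrightarrow> w : borel_measurable borel & (ALL x. 0 <= w x) & (ALL x. x ~: Om --> w x = 0) &
 (ALL x:Om. w x = gridav h w x + h^2 / (2 * real DIM('b)) * F x) &
 (ALL B N. (ALL x:N. 0 <= B x) --> (ALL x:Om. ALL b:Basis. x + h *R b : N & x - h *R b : N) -->
  (ALL x:Om. w x <= B x | gridav h B x + h^2 / (2 * real DIM('b)) * F x <= B x) --> (ALL x:N. w x <= B x))"

lemma gridsolD:
 assumes "gridsol Om F h (w :: 'b::euclidean_space => real)"
 shows "w : borel_measurable borel" "0 <= w x" "x ~: Om ==> w x = 0"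
 "x : Om ==> w x = gridav h w x + h^2 / (2 * real DIM('b)) * F x"
proof -
 note a = assms[unfolded gridsol_def]
 note a2 = a[THEN conjunct2]
 note a3 = a2[THEN conjunct2]
 note a4 = a3[THEN conjunct2]
 show "w : borel_measurable borel" "0 <= w x" "x ~: Om ==> w x = 0"
 "x : Om ==> w x = gridav h w x + h^2 / (2 * real DIM('b)) * F x"
 by (rule a[THEN conjunct1], rule a2[THEN conjunct1, rule_format],
  erule a3[THEN conjunct1, rule_format], erule a4[THEN conjunct1, rule_format])
qed

lemma gridsol_least:
 assumes "gridsol Om F h (w :: 'b::euclidean_space => real)" "!!x. x : N ==> 0 <= B x"
 "!!x b. x : Om ==> b : Basis ==> x + h *R b : N & x - h *R b : N"
 "!!x. x : Om ==> w x <= B x | gridav h B x + h^2 / (2 * real DIM('b)) * F x <= B x" "x : N"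
 shows "w x <= B x"
proof -
 have "ALL B N. (ALL x:N. 0 <= B x) --> (ALL x:Om. ALL b:Basis. x + h *R b : N & x - h *R b : N) -->
  (ALL x:Om. w x <= B x | gridav h B x + h^2 / (2 * real DIM('b)) * F x <= B x) --> (ALL x:N. w x <= B x)"
 using assms(1) unfolding gridsol_def by auto
 from this[rule_format, OF assms(2-5)] show ?thesis .
qed

text \<open>Monotone iteration from 0. The iterates stay below a paraboloid, on which the stencil is
  exact; its radius \<open>R0 + abs h\<close> leaves room for the neighbours of points of the
  domain.\<close>

lemma grid_solution:
 fixes Om :: "'b::euclidean_space set"
 assumes Om: "open Om" and R0: "R0 > 0" "!!x. x : Om ==> norm x <= R0"
 and F: "continuous_on UNIV F" "!!x. 0 <= F x" and M: "!!x. norm x <= R0 ==> F x <= M"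
 shows "EX w. gridsol Om F h w & (ALL x. w x <= M / (2 * real DIM('b)) * (R0 + abs h)^2)"
proof -
 define c where "c = h^2 / (2 * real DIM('b))"
 have c: "0 <= c" by (simp add: c_def)
 define T where "T = (%w x. if x : Om then gridav h w x + c * F x else 0)"
 define W where "W = (%j. (T ^^ j) (%x. 0))"
 have W0: "W 0 = (%x. 0)" and WS: "W (Suc j) = T (W j)" for j by (simp_all add: W_def)
 have Tmono: "T f x <= T g x" if "!!x. f x <= g x" for f g x
 unfolding T_def using gridav_mono[of f x h g] that by simp
 have mono: "W j x <= W (Suc j) x" for j x
 proof (induction j arbitrary: x)
 case 0
 show ?case unfolding WS W0 T_def using F c by (simp add: gridav_const)
 next
 case (Suc j)
 show ?case unfolding WS[of "Suc j"] WS[of j] by (rule Tmono) (rule Suc[unfolded WS[of j]])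
 qed
 have pos: "0 <= W j x" for j x
 using lift_Suc_mono_le[of "%j. W j x" 0 j] mono by (simp add: W0)
 have bor: "W j : borel_measurable borel" for j
 proof (induction j)
 case 0
 show ?case by (simp add: W0)
 next
 case (Suc j)
 have t: "(%x. W j (x + v)) : borel_measurable borel" for v
  by (rule measurable_compose[OF _ Suc]) simp
 have "gridav h (W j) : borel_measurable borel"
  unfolding gridav_def diff_conv_add_uminus
  by (intro borel_measurable_divide borel_measurable_sum borel_measurable_add t borel_measurable_const)
 moreover have "F : borel_measurable borel" using F(1) by (rule borel_measurable_continuous_onI)
 ultimately show ?case unfolding WS T_def using Om by auto
 qed
 \<comment> \<open>The limit is not yet available, so \<open>w x <= B x\<close> is phrased through
   all iterates.\<close>
 have least: "W j x <= B x"
 if B: "!!x. x : N ==> 0 <= B x" "!!x b. x : Om ==> b : Basis ==> x + h *R b : N & x - h *R b : N"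
  "!!x. x : Om ==> (ALL j. W j x <= B x) | gridav h B x + c * F x <= B x" "x : N"
 for B N x j
 using B(4)
 proof (induction j arbitrary: x)
 case 0
 thus ?case using B(1) by (simp add: W0)
 next
 case (Suc j)
 show ?case
 proof (cases "x : Om")
  case True
  have "gridav h (W j) x <= gridav h B x" using Suc.IH B(2)[OF True] by (intro gridav_mono) auto
  hence "gridav h B x + c * F x <= B x ==> W (Suc j) x <= B x" unfolding WS T_def using True by simp
  thus ?thesis using B(3)[OF True] by blast
 next
  case False
  thus ?thesis using B(1) Suc.prems by (simp add: WS T_def)
 qed
 qed
 define w where "w = (%x. lim (%j. W j x))"
 have "F 0 <= M" using M[of 0] R0 by simp
 hence M0: "0 <= M" using F(2)[of 0] by auto
 define R where "R = R0 + abs h"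
 have bound: "W j x <= M / (2 * real DIM('b)) * R^2" for j x
 proof (cases "x : Om")
 case True
 have "W j x <= 0 + M / (2 * real DIM('b)) * (R^2 - (norm x)^2)"
 proof (rule least[where N="cball 0 R" and B="%x. 0 + M / (2 * real DIM('b)) * (R^2 - (norm x)^2)"])
  show "0 <= 0 + M / (2 * real DIM('b)) * (R^2 - (norm x)^2)" if "x : cball 0 R" for x
  proof -
  have "(norm x)^2 <= R^2" using that by (intro power_mono) auto
  thus ?thesis using M0 by simp
  qed
  show "x + h *R b : cball 0 R & x - h *R b : cball 0 R" if "x : Om" "b : Basis" for x b
  using R0(2)[OF that(1)] norm_triangle_ineq[of x "h *R b"] norm_triangle_ineq4[of x "h *R b"] that(2)
  by (simp add: R_def)
  show "(ALL j. W j x <= 0 + M / (2 * real DIM('b)) * (R^2 - (norm x)^2)) |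
  gridav h (%x. 0 + M / (2 * real DIM('b)) * (R^2 - (norm x)^2)) x + c * F x <= 0 + M / (2 * real DIM('b)) * (R^2 - (norm x)^2)"
  if "x : Om" for x
  proof -
  have "c * F x <= c * M" using M R0(2)[OF that] c by (intro mult_left_mono) auto
  thus ?thesis unfolding gridav_paraboloid by (simp add: c_def mult_ac)
  qed
  show "x : cball 0 R" using R0(2)[OF True] by (simp add: R_def)
 qed
 also have "... <= M / (2 * real DIM('b)) * R^2" using M0 by (simp add: mult_left_mono divide_right_mono)
 finally show ?thesis .
 next
 case False
 hence "W j x = 0" by (cases j) (simp_all add: W0 WS T_def)
 thus ?thesis using M0 by simp
 qed
 have lim: "(%j. W j x) ----> w x" and Wle: "W j x <= w x" for x j
 proof -
 have i: "incseq (%j. W j x)" using mono by (rule incseq_SucI)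
 then obtain l where l: "(%j. W j x) ----> l" "ALL i. W i x <= l"
  by (rule incseq_convergent) (use bound in auto)
 hence "w x = l" unfolding w_def by (metis limI)
 thus "(%j. W j x) ----> w x" "W j x <= w x" using l by auto
 qed
 show ?thesis
 proof (rule exI[of _ w], unfold gridsol_def, intro conjI allI impI ballI)
 show "w x <= M / (2 * real DIM('b)) * (R0 + abs h)^2" for x
  using LIMSEQ_le_const2[OF lim] bound unfolding R_def by blast
 show "w : borel_measurable borel" by (rule borel_measurable_LIMSEQ_real[OF lim bor])
 show "0 <= w x" for x using pos[of 0 x] Wle[of 0 x] by auto
 show "w x = 0" if "x ~: Om" for x
 proof -
  have "(%j. W (Suc j) x) ----> w x" using lim by (rule LIMSEQ_Suc)
  moreover have "(%j. W (Suc j) x) = (%j. 0)" using that by (simp add: WS T_def)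
  ultimately show ?thesis by (simp add: LIMSEQ_const_iff)
 qed
 show "w x = gridav h w x + h^2 / (2 * real DIM('b)) * F x" if "x : Om" for x
 proof (rule LIMSEQ_unique)
  show "(%j. W (Suc j) x) ----> w x" using lim by (rule LIMSEQ_Suc)
  have "(%j. W (Suc j) x) = (%j. gridav h (W j) x + c * F x)" using that by (simp add: WS T_def)
  thus "(%j. W (Suc j) x) ----> gridav h w x + h^2 / (2 * real DIM('b)) * F x"
  unfolding gridav_def c_def by (auto intro!: tendsto_intros lim)
 qed
 show "w x <= B x"
  if B: "ALL x:N. 0 <= B x" "ALL x:Om. ALL b:Basis. x + h *R b : N & x - h *R b : N"
  "ALL x:Om. w x <= B x | gridav h B x + h^2 / (2 * real DIM('b)) * F x <= B x" "x : N" for B N x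
 proof (rule LIMSEQ_le_const2[OF lim])
  have "W j x <= B x" for j
  proof (rule least[OF bspec[OF B(1)] bspec[OF bspec[OF B(2)]] _ B(4)])
  show "(ALL j. W j x <= B x) | gridav h B x + c * F x <= B x" if "x : Om" for x
   using bspec[OF B(3) that] Wle[of _ x] unfolding c_def by (meson order_trans)
  qed
  thus "EX N. ALL n>=N. W n x <= B x" by blast
 qed
 qed
qed

section \<open>Discrete integration by parts and consistency of the scheme\<close>

lemma integrable_bounded_support:
 fixes f :: "'b::euclidean_space => real"
 assumes "f : borel_measurable borel" "!!x. abs (f x) <= M" "bounded S" "!!x. x ~: S ==> f x = 0"
 shows "integrable lebesgue f"
proof -
 obtain R where R: "!!x. x : S ==> norm x <= R" using assms(3) bounded_iff by metis
 have "f : borel_measurable lebesgue" using assms(1) measurable_completion measurable_lborel2 by blast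
 moreover have "emeasure lebesgue (cball (0::'b) R) < \<infinity>"
 using emeasure_bounded_finite[of "cball (0::'b) R"] by simp
 ultimately show ?thesis
 by (intro integrableI_bounded_set[of "cball 0 R" _ _ M] AE_I2) (use assms(2,4) R in auto)
qed

text \<open>The stencil is symmetric under reflection and Lebesgue measure is translation invariant,
  so the average can be moved from the test function to \<open>w\<close>.\<close>

lemma gridav_adjoint:
 fixes w ph :: "'b::euclidean_space => real"
 assumes w: "w : borel_measurable borel" "!!x. abs (w x) <= M"
 and ph: "continuous_on UNIV ph" "compact S" "!!x. x ~: S ==> ph x = 0"
 shows "(LINT x|lebesgue. w x * gridav h ph x) = (LINT x|lebesgue. gridav h w x * ph x)"
proof -
 obtain C where C: "C > 0" "!!y. abs (ph y) <= C" using cont_compact_support_bounded[OF ph(1,3,2)] by metis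
 have bor: "ph : borel_measurable borel" using ph(1) by (rule borel_measurable_continuous_onI)
 have wt: "(%x. w (x + v)) : borel_measurable borel" and pt: "(%x. ph (x + v)) : borel_measurable borel" for v
 by (rule measurable_compose[OF _ w(1)] measurable_compose[OF _ bor], simp)+
 have M: "0 <= M" using w(2)[of 0] by auto
 have bnd: "abs (w x * ph y) <= M * C" for x y
 unfolding abs_mult using w(2) C(2) M by (intro mult_mono) auto
 have bS: "bounded ((%x. - v + x) ` S)" for v using ph(2) by (intro bounded_translation compact_imp_bounded)
 have i1: "integrable lebesgue (%x. w x * ph (x + v))" for v
 proof (rule integrable_bounded_support[OF _ bnd bS[of v]])
 show "(%x. w x * ph (x + v)) : borel_measurable borel" using w(1) pt by auto
 show "w x * ph (x + v) = 0" if "x ~: (%x. - v + x) ` S" for x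
 proof -
  have "x + v ~: S" using that by (auto simp: image_iff)
  thus ?thesis using ph(3) by simp
 qed
 qed
 have m2: "(%x. w (x + v) * ph x) : borel_measurable borel" for v using wt bor by simp
 have i2: "integrable lebesgue (%x. w (x + v) * ph x)" for v
 by (rule integrable_bounded_support[OF m2 bnd compact_imp_bounded[OF ph(2)]]) (simp add: ph(3))
 have tr: "(LINT x|lebesgue. w x * ph (x + v)) = (LINT x|lebesgue. w (x + - v) * ph x)" for v
 using lebesgue_integral_translate[OF m2[of "- v"], of v] by (simp add: add.commute)
 have "(LINT x|lebesgue. w x * gridav h ph x)
 = (LINT x|lebesgue. (SUM b:Basis. w x * ph (x + h *R b) + w x * ph (x + - (h *R b))) / (2 * real DIM('b)))"
 unfolding gridav_def by (simp add: sum_distrib_left distrib_left)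
 also have "... = (SUM b:Basis. (LINT x|lebesgue. w x * ph (x + h *R b)) + (LINT x|lebesgue. w x * ph (x + - (h *R b)))) / (2 * real DIM('b))"
 using i1 by (simp only: integral_divide_zero Bochner_Integration.integral_sum Bochner_Integration.integral_add Bochner_Integration.integrable_add)
 also have "... = (SUM b:Basis. (LINT x|lebesgue. w (x + - (h *R b)) * ph x) + (LINT x|lebesgue. w (x + h *R b) * ph x)) / (2 * real DIM('b))"
 unfolding tr by simp
 also have "... = (LINT x|lebesgue. (SUM b:Basis. w (x + - (h *R b)) * ph x + w (x + h *R b) * ph x) / (2 * real DIM('b)))"
 using i2 by (simp only: integral_divide_zero Bochner_Integration.integral_sum Bochner_Integration.integral_add Bochner_Integration.integrable_add)
 also have "... = (LINT x|lebesgue. gridav h w x * ph x)"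
 unfolding gridav_def by (simp add: sum_distrib_right distrib_right add.commute)
 finally show ?thesis .
qed

lemma test_function_D2on:
 assumes "test_function Om ph"
 shows "continuous_on UNIV ph" "D2on UNIV ph (grad ph) (%b. partial b (partial b ph))"
 "b : Basis ==> continuous_on UNIV (partial b (partial b ph))"
proof -
 have C: "Ck_on 0 UNIV ph" "Ck_on (Suc (Suc 0)) UNIV ph" using assms unfolding test_function_def by auto
 thus "continuous_on UNIV ph" by simp
 have d: "ph differentiable (at x)" "c : Basis ==> partial c ph differentiable (at x)"
 "c : Basis ==> continuous_on UNIV (partial c (partial c ph))" for x c
 using C(2) by auto
 show "D2on UNIV ph (grad ph) (%b. partial b (partial b ph))" by (intro D2on_C2 d)
 show "b : Basis ==> continuous_on UNIV (partial b (partial b ph))" by (rule d(3))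
qed

text \<open>A common bound and a common bounded support make the quotients suitable for dominated
  convergence; convergence itself only needs continuous second derivatives.\<close>

lemma grid_laplacian:
 fixes ph :: "'b::euclidean_space => real"
 assumes t: "test_function Om ph"
 defines "Q \<equiv> %h x. (gridav h ph x - ph x) / (h^2 / (2 * real DIM('b)))"
 shows "EX C R. ALL h x. 0 < h --> h <= 1 --> abs (Q h x) <= C & (norm x > R --> Q h x = 0)"
 "et ----> 0 ==> (!!i. 0 < et i) ==> (%i. Q (et i) x) ----> laplacian ph x"
proof -
 define S where "S = closure {x. ph x ~= 0}"
 have S: "compact S" "!!x. x ~: S ==> ph x = 0"
 using t closure_subset[of "{x. ph x ~= 0}"] unfolding test_function_def S_def by auto
 define P where "P = (%b. partial b (partial b ph))"
 have D: "D2on UNIV ph (grad ph) P" and cP: "!!b. b : Basis ==> continuous_on UNIV (P b)"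
 using test_function_D2on[OF t] by (simp_all add: P_def)
 have cl: "closed S" using S(1) by (rule compact_imp_closed)
 have P0: "P b x = 0" if "x ~: S" for b x
 unfolding P_def by (rule partial_outside[OF partial_outside[OF S(2) cl] cl that])
 have Qe: "EX si ta. (ALL b:Basis. abs (si b) <= h & abs (ta b) <= h) & Q h x = (SUM b:Basis. P b (x + si b *R b) + P b (x + ta b *R b)) / 2"
 if h: "0 < h" for h x
 proof -
 obtain si ta where st: "!!b. b : Basis ==> abs (si b) <= abs h & abs (ta b) <= abs h"
  "gridav h ph x = ph x + h^2 / (2 * real DIM('b)) * ((SUM b:Basis. P b (x + si b *R b) + P b (x + ta b *R b)) / 2)"
  by (rule gridav_taylor[OF D, of h x]) auto
 thus ?thesis using h by (intro exI[of _ si] exI[of _ ta]) (simp add: Q_def)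
 qed
 have "EX C. ALL y. abs (P b y) <= C" if "b : Basis" for b
 using cont_compact_support_bounded[OF cP[OF that] P0 S(1)] by metis
 then obtain C where C: "!!b y. b : Basis ==> abs (P b y) <= C b" by metis
 have "EX R. ALL x:S. norm x <= R" using compact_imp_bounded[OF S(1)] unfolding bounded_iff .
 then obtain R where R: "!!x. x : S ==> norm x <= R" by blast
 have "abs (Q h x) <= (SUM b:Basis. C b)" "norm x > R + 1 --> Q h x = 0" if h: "0 < h" "h <= 1" for h x
 proof -
 obtain si ta where st: "ALL b:Basis. abs (si b) <= h & abs (ta b) <= h"
  "Q h x = (SUM b:Basis. P b (x + si b *R b) + P b (x + ta b *R b)) / 2" using Qe[OF h(1), of x] by blast
 have "abs (SUM b:Basis. P b (x + si b *R b) + P b (x + ta b *R b)) <= (SUM b:Basis. 2 * C b)"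
 proof (rule order_trans[OF sum_abs sum_mono])
  fix b :: 'b assume "b : Basis"
  thus "abs (P b (x + si b *R b) + P b (x + ta b *R b)) <= 2 * C b"
  using C[of b "x + si b *R b"] C[of b "x + ta b *R b"] by simp
 qed
 thus "abs (Q h x) <= (SUM b:Basis. C b)" unfolding st(2) sum_distrib_left[symmetric] by simp
 show "norm x > R + 1 --> Q h x = 0"
 proof
  assume x: "norm x > R + 1"
  have "x + s *R b ~: S" if "b : Basis" "abs s <= h" for s b
  proof
  assume "x + s *R b : S"
  from R[OF this] have "norm (x + s *R b) <= R" .
  moreover have "norm x <= norm (x + s *R b) + norm (s *R b)" using norm_triangle_ineq4[of "x + s *R b" "s *R b"] by simp
  ultimately show False using x that h by simp
  qed
  thus "Q h x = 0" unfolding st(2) using st(1) P0 by simp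
 qed
 qed
 thus "EX C R. ALL h x. 0 < h --> h <= 1 --> abs (Q h x) <= C & (norm x > R --> Q h x = 0)" by blast
 show "(%i. Q (et i) x) ----> laplacian ph x" if et: "et ----> 0" "!!i. 0 < et i"
 proof -
 have "ALL i. EX si ta. (ALL b:Basis. abs (si b) <= et i & abs (ta b) <= et i) &
  Q (et i) x = (SUM b:Basis. P b (x + si b *R b) + P b (x + ta b *R b)) / 2" by (intro allI Qe et(2))
 then obtain si where "ALL i. EX ta. (ALL b:Basis. abs (si i b) <= et i & abs (ta b) <= et i) &
  Q (et i) x = (SUM b:Basis. P b (x + si i b *R b) + P b (x + ta b *R b)) / 2" by (rule choice[THEN exE])
 then obtain ta where st': "ALL i. (ALL b:Basis. abs (si i b) <= et i & abs (ta i b) <= et i) &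
  Q (et i) x = (SUM b:Basis. P b (x + si i b *R b) + P b (x + ta i b *R b)) / 2" by (rule choice[THEN exE])
 have st: "!!i b. b : Basis ==> abs (si i b) <= et i" "!!i b. b : Basis ==> abs (ta i b) <= et i"
  "!!i. Q (et i) x = (SUM b:Basis. P b (x + si i b *R b) + P b (x + ta i b *R b)) / 2" using st' by auto
 have lim: "(%i. P b (x + s i b *R b)) ----> P b x" if b: "b : Basis" and s: "!!i. abs (s i b) <= et i" for b s
 proof -
  have "(%i. s i b) ----> 0"
  by (rule tendsto_rabs_zero_cancel, rule tendsto_sandwich[OF _ _ tendsto_const et(1)]) (use s in auto)
  hence "(%i. x + s i b *R b) ----> x + 0 *R b" by (intro tendsto_intros)
  hence "(%i. x + s i b *R b) ----> x" by simp
  moreover have "isCont (P b) x" using cP[OF b] by (simp add: continuous_on_eq_continuous_at)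
  ultimately show ?thesis using isCont_tendsto_compose by blast
 qed
 have "(%i. Q (et i) x) ----> (SUM b:Basis. P b x + P b x) / 2"
  unfolding st(3) by (intro tendsto_intros lim st) auto
 moreover have "(SUM b:Basis. P b x + P b x) / 2 = laplacian ph x"
  by (simp add: laplacian_def P_def flip: sum_distrib_left)
 ultimately show ?thesis by simp
 qed
qed

text \<open>A strict classical inequality on a compact set has a positive margin \<open>m\<close>,
  and uniform continuity of the second derivatives keeps the discretisation error below it.\<close>

lemma discrete_supersolution:
 fixes B :: "'b::euclidean_space => real"
 assumes S: "open S" "compact C" "C <= S" and D: "D2on S B G H2"
 and cH: "!!b. b : Basis ==> continuous_on S (H2 b)" and cF: "continuous_on C F"
 and neg: "!!x. x : C ==> (SUM b:Basis. H2 b x) < - F x"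
 shows "EX h0>0. ALL h x. 0 < h --> h <= h0 --> x : C -->
 (ALL b:Basis. x + h *R b : S & x - h *R b : S) & gridav h B x + h^2 / (2 * real DIM('b)) * F x <= B x"
proof (cases "C = {}")
 case True
 thus ?thesis by (intro exI[of _ 1]) auto
next
 case False
 obtain e where e: "e > 0" "(\<Union>x\<in>C. cball x e) <= S"
 using compact_subset_open_imp_cball_epsilon_subset[OF S(2,1,3)] by metis
 define T where "T = (\<Union>x\<in>C. cball x e)"
 have T: "compact T" unfolding T_def using compact_minkowski_sum_cball[OF S(2)] .
 \<comment> \<open>Packing all second derivatives into one vector field yields a single modulus of
   continuity for every direction.\<close>
 define Hv where "Hv = (%x. SUM b:Basis. H2 b x *R b)"
 have "continuous_on S Hv" unfolding Hv_def by (intro continuous_intros cH)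
 hence uc: "uniformly_continuous_on T Hv"
 using T e(2) by (intro compact_uniformly_continuous) (auto simp: T_def intro: continuous_on_subset)
 have "continuous_on C (%x. (SUM b:Basis. H2 b x) + F x)"
 by (intro continuous_intros cF continuous_on_subset[OF cH S(3)])
 from continuous_attains_sup[OF S(2) False this] obtain x1 where x1: "x1 : C"
 "!!x. x : C ==> (SUM b:Basis. H2 b x) + F x <= (SUM b:Basis. H2 b x1) + F x1" by blast
 define m where "m = - ((SUM b:Basis. H2 b x1) + F x1)"
 have m: "m > 0" "!!x. x : C ==> (SUM b:Basis. H2 b x) <= - F x - m"
 using neg[OF x1(1)] x1(2) by (auto simp: m_def) force
 have n: "0 < real DIM('b)" by simp
 hence "0 < m / real DIM('b)" using m by simp
 then obtain d where d: "d > 0" "!!x y. x : T ==> y : T ==> dist y x < d ==> dist (Hv y) (Hv x) < m / real DIM('b)"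
 using uc unfolding uniformly_continuous_on_def by metis
 have comp: "H2 b y <= H2 b x + m / real DIM('b)" if "x : T" "y : T" "dist y x < d" "b : Basis" for x y b
 proof -
 have "Hv z \<bullet> b = H2 b z" for z unfolding Hv_def using that(4) by simp
 hence "abs (H2 b y - H2 b x) = abs ((Hv y - Hv x) \<bullet> b)" by (simp add: inner_diff_left)
 also have "... <= norm (Hv y - Hv x)" using that(4) by (rule Basis_le_norm)
 finally show ?thesis using d(2)[OF that(1-3)] unfolding dist_norm by auto
 qed
 define h0 where "h0 = min e (d / 2)"
 have h0: "0 < h0" "h0 <= e" "h0 < d" using e d by (auto simp: h0_def)
 show ?thesis
 proof (rule exI[of _ h0], rule conjI[OF h0(1)], intro allI impI)
 fix h x assume h: "0 < h" "h <= h0" and x: "x : C"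
 have xT: "x : T" using x e(1) unfolding T_def by force
 have near: "x + s *R b : T" "dist (x + s *R b) x < d" if "b : Basis" "abs s <= h" for s b
 proof -
  have "dist (x + s *R b) x = abs s" using that(1) by (simp add: dist_norm)
  moreover from this have "x + s *R b : cball x e" using that h h0 by (simp add: dist_commute)
  ultimately show "x + s *R b : T" "dist (x + s *R b) x < d" using x that h h0 unfolding T_def by auto
 qed
 have TS: "T <= S" using e(2) by (simp add: T_def)
 obtain si ta where st: "!!b. b : Basis ==> abs (si b) <= abs h & abs (ta b) <= abs h"
  "gridav h B x = B x + h^2 / (2 * real DIM('b)) * ((SUM b:Basis. H2 b (x + si b *R b) + H2 b (x + ta b *R b)) / 2)"
  by (rule gridav_taylor[OF D, of h x]) (use near(1) h TS in auto)
 have "(SUM b:Basis. H2 b (x + si b *R b) + H2 b (x + ta b *R b)) <= (SUM b:Basis. 2 * H2 b x + 2 * (m / real DIM('b)))"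
 proof (rule sum_mono)
  fix b :: 'b assume b: "b : Basis"
  have s: "abs (si b) <= h" "abs (ta b) <= h" using st(1)[OF b] h by auto
  show "H2 b (x + si b *R b) + H2 b (x + ta b *R b) <= 2 * H2 b x + 2 * (m / real DIM('b))"
  using comp[OF xT near[OF b s(1)] b] comp[OF xT near[OF b s(2)] b] by simp
 qed
 also have "... = 2 * (SUM b:Basis. H2 b x) + 2 * m"
  by (simp add: sum.distrib sum_distrib_left)
 also have "... <= 2 * (- F x)" using m(2)[OF x] by simp
 finally have "h^2 / (2 * real DIM('b)) * ((SUM b:Basis. H2 b (x + si b *R b) + H2 b (x + ta b *R b)) / 2) <= h^2 / (2 * real DIM('b)) * (- F x)"
  by (intro mult_left_mono) auto
 hence "gridav h B x + h^2 / (2 * real DIM('b)) * F x <= B x" unfolding st(2) by auto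
 moreover have "x + h *R b : S & x - h *R b : S" if "b : Basis" for b
  using near(1)[OF that, of h] near(1)[OF that, of "- h"] h TS by auto
 ultimately show "(ALL b:Basis. x + h *R b : S & x - h *R b : S) & gridav h B x + h^2 / (2 * real DIM('b)) * F x <= B x"
  by blast
 qed
qed

text \<open>The solution is compared with its own translate plus a small paraboloid. Near the
  boundary of \<open>Om\<close>, outside \<open>K\<close>, the barrier makes it at most
  \<open>ep\<close>; on \<open>K\<close> the translate solves the same scheme with a slightly
  shifted right-hand side. The modulus \<open>d\<close> is independent of the mesh.\<close>

lemma gridsol_equicontinuous:
 fixes Om :: "'b::euclidean_space set"
 assumes R0: "R0 > 0" "!!x. x : Om ==> norm x <= R0" and Om: "open Om"
 and F: "continuous_on UNIV F" and ep: "ep > 0"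
 and S: "open S" "closure Om <= S" and D: "D2on S B G H2"
 and cH: "!!b. b : Basis ==> continuous_on S (H2 b)" and B0: "!!x. x : S ==> 0 <= B x"
 and neg: "!!x. x : closure Om ==> (SUM b:Basis. H2 b x) < - F x"
 and K: "compact K" "K <= Om" "!!x. x : Om - K ==> B x <= ep"
 shows "EX h0>0. EX d>0. ALL h w x y. 0 < h --> h <= h0 --> gridsol Om F h w --> norm y < d --> w (x + y) <= w x + 2 * ep"
proof -
 have bd: "bounded Om" using R0 bounded_iff by blast
 have cc: "compact (closure Om)" using bd by simp
 obtain h1 where h1: "h1 > 0" "!!h x. 0 < h ==> h <= h1 ==> x : closure Om ==>
 (ALL b:Basis. x + h *R b : S & x - h *R b : S) & gridav h B x + h^2 / (2 * real DIM('b)) * F x <= B x"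
 using discrete_supersolution[OF S(1) cc S(2) D cH continuous_on_subset[OF F] neg] by auto
 obtain d1 where d1: "d1 > 0" "(\<Union>x\<in>K. cball x d1) <= Om"
 using compact_subset_open_imp_cball_epsilon_subset[OF K(1) Om K(2)] by metis
 define R where "R = (R0 + 2)^2"
 have R: "R > 0" using R0 by (simp add: R_def)
 \<comment> \<open>The paraboloid \<open>Q\<close> then lies between \<open>ep\<close> and
   \<open>2 * ep\<close> on the domain, and its discrete Laplacian pays for a variation of
   \<open>F\<close> up to \<open>2 * real DIM('b) * mu\<close>.\<close>
 define mu where "mu = ep / R"
 have mu: "mu > 0" "mu * R = ep" using R ep by (auto simp: mu_def)
 have n: "0 < real DIM('b)" by simp
 have "uniformly_continuous_on (cball 0 (R0 + 1)) F"
 by (rule compact_uniformly_continuous[OF continuous_on_subset[OF F]]) auto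
 moreover have "0 < 2 * real DIM('b) * mu" using mu by simp
 ultimately obtain d2 where d2: "d2 > 0" "!!x y. x : cball 0 (R0 + 1) ==> y : cball 0 (R0 + 1) ==> dist y x < d2 ==> dist (F y) (F x) < 2 * real DIM('b) * mu"
 unfolding uniformly_continuous_on_def by metis
 define d where "d = min 1 (min d1 d2)"
 define h0 where "h0 = min 1 h1"
 have dh: "d > 0" "d <= 1" "d <= d1" "d <= d2" "h0 > 0" "h0 <= 1" "h0 <= h1" using d1 d2 h1 by (auto simp: d_def h0_def)
 show ?thesis
 proof (rule exI[of _ h0], rule conjI[OF dh(5)], rule exI[of _ d], rule conjI[OF dh(1)], intro allI impI)
 fix h w and x y :: 'b
 assume h: "0 < h" "h <= h0" and w: "gridsol Om F h w" and y: "norm y < d"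
 have wB: "w z <= B z" if z: "z : Om" for z
 proof (rule gridsol_least[OF w, of S B])
  show "x + h *R b : S & x - h *R b : S" if "x : Om" "b : Basis" for x b
  using h1(2)[of h x] h dh that closure_subset[of Om] by auto
  show "w x <= B x | gridav h B x + h^2 / (2 * real DIM('b)) * F x <= B x" if "x : Om" for x
  using h1(2)[of h x] h dh that closure_subset[of Om] by auto
  show "z : S" using z S(2) closure_subset[of Om] by auto
 qed (rule B0)
 define Q where "Q = (%x::'b. ep + mu * (R - (norm x)^2))"
 have Q: "ep <= Q z" if "norm z <= R0 + 2" for z
  using mu that R0 unfolding Q_def R_def by auto
 have Qg: "gridav h Q z = Q z - mu * h^2" for z unfolding Q_def by (rule gridav_paraboloid)
 show "w (x + y) <= w x + 2 * ep"
 proof (cases "x + y : cball 0 (R0 + 1)")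
  case True
  have "w (x + y) <= w (x + y + - y) + Q (x + y + - y)"
  proof (rule gridsol_least[OF w, where B="%z. w (z + - y) + Q (z + - y)" and N="cball 0 (R0 + 1)"])
  have Qy: "ep <= Q (z + - y)" if "z : cball 0 (R0 + 1)" for z
  proof (rule Q)
   show "norm (z + - y) <= R0 + 2" using norm_triangle_ineq[of z "- y"] that y dh by simp
  qed
  show "0 <= w (z + - y) + Q (z + - y)" if "z : cball 0 (R0 + 1)" for z
   using gridsolD(2)[OF w, of "z + - y"] Qy[OF that] ep by auto
  show "z + h *R b : cball 0 (R0 + 1) & z - h *R b : cball 0 (R0 + 1)" if "z : Om" "b : Basis" for z b
   using R0(2)[OF that(1)] norm_triangle_ineq[of z "h *R b"] norm_triangle_ineq4[of z "h *R b"] that(2) h dh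
   by simp
  show "x + y : cball 0 (R0 + 1)" by (rule True)
  fix z assume z: "z : Om"
  have zc: "z : cball 0 (R0 + 1)" using R0(2)[OF z] by simp
  show "w z <= w (z + - y) + Q (z + - y) |
   gridav h (%z. w (z + - y) + Q (z + - y)) z + h^2 / (2 * real DIM('b)) * F z <= w (z + - y) + Q (z + - y)"
  proof (cases "z : K")
   case False
   hence "w z <= ep" using wB[OF z] K(3)[of z] z by auto
   thus ?thesis using Qy[OF zc] gridsolD(2)[OF w, of "z + - y"] by auto
  next
   case True
   have "z + - y : cball z d1" using y dh by simp
   hence zy: "z + - y : Om" using True d1(2) by blast
   have "gridav h (%z. w (z + - y) + Q (z + - y)) z = gridav h w (z + - y) + (Q (z + - y) - mu * h^2)"
   unfolding gridav_add gridav_shift Qg ..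
   moreover have "w (z + - y) = gridav h w (z + - y) + h^2 / (2 * real DIM('b)) * F (z + - y)"
   by (rule gridsolD(4)[OF w zy])
   moreover have "h^2 / (2 * real DIM('b)) * F z <= h^2 / (2 * real DIM('b)) * F (z + - y) + mu * h^2"
   proof -
   have "z + - y : cball 0 (R0 + 1)" using R0(2)[OF zy] by simp
   hence "dist (F z) (F (z + - y)) < 2 * real DIM('b) * mu"
    using d2(2)[of "z + - y" z] zc y dh by simp
   hence "F z <= F (z + - y) + 2 * real DIM('b) * mu" by (simp add: dist_norm)
   hence "h^2 / (2 * real DIM('b)) * F z <= h^2 / (2 * real DIM('b)) * (F (z + - y) + 2 * real DIM('b) * mu)"
    by (intro mult_left_mono) auto
   thus ?thesis by (simp add: field_simps)
   qed
   ultimately show ?thesis by auto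
  qed
  qed
  moreover have "x + y + - y = x" by simp
  moreover have "Q x <= 2 * ep"
  proof -
  have "mu * (R - (norm x)^2) <= mu * R" using mu by auto
  thus ?thesis unfolding Q_def using mu by simp
  qed
  ultimately show ?thesis by simp
 next
  case False
  hence "x + y ~: Om" using R0(2)[of "x + y"] by auto
  thus ?thesis using gridsolD(3)[OF w, of "x + y"] gridsolD(2)[OF w, of x] ep by simp
 qed
 qed
qed

text \<open>Summation by parts for the scheme: the test function vanishes off the domain, so the
  discrete equation, valid only inside, is enough.\<close>

lemma gridsol_weak:
 fixes Om :: "'b::euclidean_space set"
 assumes Om: "bounded Om" and F: "continuous_on UNIV F" and h: "h > 0"
 and w: "gridsol Om F h w" "!!x. w x <= M" and t: "test_function Om ph"
 shows "(LINT x|lebesgue. w x * ((gridav h ph x - ph x) / (h^2 / (2 * real DIM('b))))) = - (LINT x|lebesgue. F x * ph x)"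
proof -
 define c where "c = h^2 / (2 * real DIM('b))"
 have c: "c > 0" using h by (simp add: c_def)
 define S where "S = closure {x. ph x ~= 0}"
 have S: "compact S" "!!x. x ~: S ==> ph x = 0" "S <= Om"
 using t closure_subset[of "{x. ph x ~= 0}"] unfolding test_function_def S_def by auto
 have cp: "continuous_on UNIV ph" by (rule test_function_D2on[OF t])
 obtain C where C: "!!y. abs (ph y) <= C" using cont_compact_support_bounded[OF cp S(2,1)] by metis
 have bp: "ph : borel_measurable borel" using cp by (rule borel_measurable_continuous_onI)
 have wM: "abs (w x) <= M" for x using w(2)[of x] gridsolD(2)[OF w(1), of x] by simp
 have cg: "continuous_on UNIV (gridav h ph)" unfolding gridav_def
 by (intro continuous_intros continuous_on_compose2[OF cp]) auto
 have gC: "abs (gridav h ph x) <= C" for x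
 proof -
 have "gridav h ph x <= gridav h (%x. C) x" "gridav h (%x. - C) x <= gridav h ph x"
  using C by (intro gridav_mono; simp add: abs_le_iff minus_le_iff)+
 thus ?thesis unfolding gridav_const by simp
 qed
 have wi: "integrable lebesgue w"
 by (rule integrable_bounded_support[OF gridsolD(1)[OF w(1)] wM Om gridsolD(3)[OF w(1)]])
 have i1: "integrable lebesgue (%x. w x * gridav h ph x)" by (rule integrable_mult_bounded[OF wi cg gC])
 have i2: "integrable lebesgue (%x. w x * ph x)" by (rule integrable_mult_bounded[OF wi cp C])
 have cFp: "continuous_on UNIV (%x. F x * ph x)" by (intro continuous_intros F cp)
 obtain C2 where C2: "!!y. abs (F y * ph y) <= C2"
 using cont_compact_support_bounded[OF cFp _ S(1)] S(2) by (metis mult_zero_right)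
 have i3: "integrable lebesgue (%x. F x * ph x)"
 by (rule integrable_bounded_support[OF borel_measurable_continuous_onI[OF cFp] C2 compact_imp_bounded[OF S(1)]]) (simp add: S(2))
 have eq: "gridav h w x * ph x = w x * ph x - c * (F x * ph x)" for x
 proof (cases "x : Om")
 case True
 from gridsolD(4)[OF w(1) True] have "gridav h w x = w x - c * F x" by (simp add: c_def)
 thus ?thesis by (simp only: left_diff_distrib mult.assoc)
 next
 case False
 hence "ph x = 0" using S by blast
 thus ?thesis by simp
 qed
 have "(LINT x|lebesgue. w x * ((gridav h ph x - ph x) / c)) = (LINT x|lebesgue. (w x * gridav h ph x - w x * ph x) / c)"
 by (simp add: right_diff_distrib)
 also have "... = ((LINT x|lebesgue. w x * gridav h ph x) - (LINT x|lebesgue. w x * ph x)) / c"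
 using i1 i2 by simp
 also have "(LINT x|lebesgue. w x * gridav h ph x) = (LINT x|lebesgue. w x * ph x - c * (F x * ph x))"
 unfolding eq[symmetric] by (rule gridav_adjoint[OF gridsolD(1)[OF w(1)] wM cp S(1)]) (rule S(2))
 also have "... = (LINT x|lebesgue. w x * ph x) - c * (LINT x|lebesgue. F x * ph x)"
 using i2 i3 by simp
 finally have "(LINT x|lebesgue. w x * ((gridav h ph x - ph x) / c)) = - (LINT x|lebesgue. F x * ph x)" using c by simp
 thus ?thesis unfolding c_def .
qed

lemma continuous_locally_integrable:
 assumes "continuous_on Om v"
 shows "locally_integrable_on Om v"
 unfolding locally_integrable_on_def set_integrable_def
proof (intro allI impI)
 fix S assume S: "compact S" "S <= Om"
 have i: "integrable lborel (%x. indicator S x *R v x)"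
 by (rule borel_integrable_compact[OF S(1) continuous_on_subset[OF assms S(2)]])
 thus "integrable lebesgue (%x. indicator S x *R v x)"
 using integrable_completion[OF borel_measurable_integrable[OF i]] by simp
qed

text \<open>Compactness as in Arzela-Ascoli, but with equicontinuity only for small mesh: no single
  approximation is known to be continuous. The limit is continuous and inherits the equation through
  the weak form. Hypothesis \<open>bar\<close> asks for barriers that are small near the boundary up
  to any \<open>ep\<close>.\<close>

theorem poisson_exists:
 fixes Om :: "'b::euclidean_space set"
 assumes Om: "open Om" "bounded Om" and F: "continuous_on UNIV F" "!!x. 0 <= F x"
 and bar: "!!ep. ep > 0 ==> EX S B G H2 K. open S & closure Om <= S & D2on S B G H2 &
  (ALL b:Basis. continuous_on S (H2 b)) & (ALL x:S. 0 <= B x) & (ALL x:closure Om. (SUM b:Basis. H2 b x) < - F x) &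
  compact K & K <= Om & (ALL x:Om - K. B x <= ep)"
 obtains w where "continuous_on UNIV w" "!!x. 0 <= w x" "!!x. x ~: Om ==> w x = 0" "poisson_distr Om w F"
proof -
 obtain R0 where R0: "R0 > 0" "!!x. x : Om ==> norm x <= R0" using Om(2) bounded_pos by metis
 have "compact (F ` cball 0 R0)" by (rule compact_continuous_image[OF continuous_on_subset[OF F(1)]]) auto
 then obtain MF where MF: "!!x. norm x <= R0 ==> F x <= MF"
 using bounded_imp_bdd_above[OF compact_imp_bounded] unfolding bdd_above_def by fastforce
 have MF0: "0 <= MF" using MF[of 0] F(2)[of 0] R0 by simp
 define et where "et = (%i::nat. 1 / (real i + 1))"
 have et: "0 < et i" "et i <= 1" for i by (auto simp: et_def)
 have et0: "et ----> 0" unfolding et_def using LIMSEQ_inverse_real_of_nat by (simp add: inverse_eq_divide add.commute)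
 define M where "M = MF / (2 * real DIM('b)) * (R0 + 1)^2"
 have "EX w. gridsol Om F (et i) w & (ALL x. w x <= M)" for i
 proof -
 obtain w where w: "ALL x. w x <= MF / (2 * real DIM('b)) * (R0 + abs (et i))^2" "gridsol Om F (et i) w"
 proof -
  have "EX w. gridsol Om F (et i) w & (ALL x. w x <= MF / (2 * real DIM('b)) * (R0 + abs (et i))^2)"
  by (rule grid_solution[OF Om(1) R0(1) R0(2) F MF])
  thus ?thesis using that by auto
 qed
 have "w x <= M" for x
 proof -
  have "MF / (2 * real DIM('b)) * (R0 + abs (et i))^2 <= M"
  unfolding M_def using et[of i] R0 MF0 by (intro mult_left_mono power_mono) auto
  thus ?thesis using spec[OF w(1), of x] by auto
 qed
 thus ?thesis using w(2) by blast
 qed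
 hence "EX f. ALL i. gridsol Om F (et i) (f i) & (ALL x. f i x <= M)" by (rule choice[OF allI])
 then obtain f where f': "ALL i. gridsol Om F (et i) (f i) & (ALL x. f i x <= M)" by auto
 have f: "gridsol Om F (et i) (f i)" and fM: "f i x <= M" for i x using f' by auto
 have f0: "0 <= f i x" for i x by (rule gridsolD(2)[OF f])
 have equi: "EX N. EX d>0. ALL i x y. N <= i --> norm y < d --> abs (f i (x + y) - f i x) <= ep" if "ep > 0" for ep
 proof -
 have e2: "ep / 2 > 0" using that by simp
 obtain S B G H2 K where b: "open S" "closure Om <= S" "D2on S B G H2"
  "ALL b:Basis. continuous_on S (H2 b)" "ALL x:S. 0 <= B x" "ALL x:closure Om. (SUM b:Basis. H2 b x) < - F x"
  "compact K" "K <= Om" "ALL x:Om - K. B x <= ep / 2" using bar[OF e2] by blast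
 obtain h0 d where hd: "h0 > 0" "d > 0" "ALL h w x y. 0 < h --> h <= h0 --> gridsol Om F h w --> norm y < d --> w (x + y) <= w x + 2 * (ep / 2)"
 proof -
  have "EX h0>0. EX d>0. ALL h w x y. 0 < h --> h <= h0 --> gridsol Om F h w --> norm y < d --> w (x + y) <= w x + 2 * (ep / 2)"
  by (rule gridsol_equicontinuous[OF R0 Om(1) F(1) e2 b(1-3) bspec[OF b(4)] bspec[OF b(5)] bspec[OF b(6)] b(7,8) bspec[OF b(9)]])
  thus ?thesis using that by auto
 qed
 obtain N where N: "!!i. N <= i ==> et i < h0"
  using order_tendstoD(2)[OF et0 hd(1)] unfolding eventually_sequentially by blast
 have one: "f i (x + y) <= f i x + ep" if "N <= i" "norm y < d" for i x y
 proof -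
  have "f i (x + y) <= f i x + 2 * (ep / 2)"
  using hd(3)[rule_format, OF et(1) less_imp_le[OF N[OF that(1)]] f that(2)] .
  thus ?thesis by simp
 qed
 have "abs (f i (x + y) - f i x) <= ep" if "N <= i" "norm y < d" for i x y
  using one[OF that, of x] one[OF that(1), of "- y" "x + y"] that(2) by simp
 thus ?thesis using hd(2) by blast
 qed
 \<comment> \<open>A diagonal subsequence converges on a countable dense set, and the asymptotic
   modulus extends the convergence to every point.\<close>
 obtain Q :: "'b set" where Q: "countable Q" "!!X. open X ==> X ~= {} ==> EX d:Q. d : X"
 using countable_dense_exists[where 'a='b] by metis
 obtain k where k: "strict_mono (k :: nat => nat)" "!!x. x : Q ==> EX l. (%n. f (k n) x) ----> l"
 by (rule function_convergent_subsequence[OF Q(1), of f M]) (use f0 fM in auto)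
 have kge: "i <= k i" for i using k(1) by (rule seq_suble)
 have conv: "convergent (%n. f (k n) x)" for x
 proof (unfold convergent_eq_Cauchy convergent_def, rule metric_CauchyI)
 fix e :: real assume "e > 0"
 hence e3: "e / 4 > 0" by simp
 obtain N d where Nd: "d > 0" "ALL i x y. N <= i --> norm y < d --> abs (f i (x + y) - f i x) <= e / 4"
  using equi[OF e3] by auto
 obtain q where q: "q : Q" "q : ball x d" using Q(2)[of "ball x d"] Nd(1) by auto
 have "Cauchy (%n. f (k n) q)" using k(2)[OF q(1)] convergent_Cauchy convergent_def by blast
 then obtain N' where N': "!!m n. m >= N' ==> n >= N' ==> dist (f (k m) q) (f (k n) q) < e / 4"
  using e3 unfolding Cauchy_def by meson
 have qd: "norm (q - x) < d" using q(2) by (simp add: dist_norm norm_minus_commute)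
 have c: "abs (f (k i) q - f (k i) x) <= e / 4" if "N <= i" for i
 proof -
  have "N <= k i" using that kge[of i] by simp
  from Nd(2)[rule_format, OF this qd, of x] show ?thesis by simp
 qed
 show "EX M. ALL m>=M. ALL n>=M. dist (f (k m) x) (f (k n) x) < e"
 proof (intro exI[of _ "max N N'"] allI impI)
  fix m n assume "max N N' <= m" "max N N' <= n"
  thus "dist (f (k m) x) (f (k n) x) < e"
  using c[of m] c[of n] N'[of m n] unfolding dist_real_def by linarith
 qed
 qed
 define w where "w = (%x. lim (%n. f (k n) x))"
 have lim: "(%n. f (k n) x) ----> w x" for x
 unfolding w_def using conv convergent_LIMSEQ_iff by blast
 have w0: "0 <= w x" for x by (rule LIMSEQ_le_const[OF lim]) (use f0 in auto)
 have wM: "w x <= M" for x by (rule LIMSEQ_le_const2[OF lim]) (use fM in auto)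
 have woff: "w x = 0" if "x ~: Om" for x
 proof -
 have "(%n. f (k n) x) = (%n. 0)" using gridsolD(3)[OF f that] by auto
 thus ?thesis using lim[of x] by (simp add: LIMSEQ_const_iff)
 qed
 have cw: "continuous_on UNIV w"
 proof (rule continuous_on_iff[THEN iffD2], intro ballI allI impI)
 fix x :: 'b and e :: real assume "e > 0"
 hence e2: "e / 2 > 0" by simp
 obtain N d where Nd: "d > 0" "ALL i x y. N <= i --> norm y < d --> abs (f i (x + y) - f i x) <= e / 2"
  using equi[OF e2] by auto
 show "EX d>0. ALL x':UNIV. dist x' x < d --> dist (w x') (w x) < e"
 proof (rule exI[of _ d], rule conjI[OF Nd(1)], intro ballI impI)
  fix x' assume d: "dist x' x < d"
  have "(%n. abs (f (k n) x' - f (k n) x)) ----> abs (w x' - w x)" by (intro tendsto_intros lim)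
  moreover have "abs (f (k n) x' - f (k n) x) <= e / 2" if "N <= n" for n
  proof -
  have "N <= k n" using that kge[of n] by simp
  from Nd(2)[rule_format, OF this, of "x' - x" x] d show ?thesis by (simp add: dist_norm)
  qed
  ultimately have "abs (w x' - w x) <= e / 2" by (intro LIMSEQ_le_const2) auto
  thus "dist (w x') (w x) < e" using \<open>e > 0\<close> by (simp add: dist_real_def)
 qed
 qed
 have "poisson_distr Om w F" unfolding poisson_distr_def
 proof (intro conjI continuous_locally_integrable continuous_on_subset[OF cw] continuous_on_subset[OF F(1)] subset_UNIV allI impI)
 fix ph assume t: "test_function Om ph"
 define P where "P = (%h x. (gridav h ph x - ph x) / (h^2 / (2 * real DIM('b))))"
 obtain C R where CR: "ALL h x. 0 < h --> h <= 1 --> abs (P h x) <= C & (norm x > R --> P h x = 0)"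
  using grid_laplacian(1)[OF t] unfolding P_def by auto
 have Pl: "(%i. P (et (k i)) x) ----> laplacian ph x" for x
  unfolding P_def by (rule grid_laplacian(2)[OF t LIMSEQ_subseq_LIMSEQ[OF et0 k(1), unfolded o_def] et(1)])
 have cp: "continuous_on UNIV ph" by (rule test_function_D2on[OF t])
 have cP: "continuous_on UNIV (P h)" for h unfolding P_def gridav_def divide_inverse
  by (intro continuous_intros continuous_on_compose2[OF cp]) auto
 have bP: "P h : borel_measurable lebesgue" for h by (rule borel_cont_lebesgue[OF cP])
 have bf: "f i : borel_measurable lebesgue" for i
  using gridsolD(1)[OF f] measurable_completion measurable_lborel2 by blast
 have "continuous_on UNIV (laplacian ph)"
  unfolding laplacian_def[abs_def] by (intro continuous_on_sum test_function_D2on(3)[OF t])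
 hence bl: "laplacian ph : borel_measurable lebesgue" by (rule borel_cont_lebesgue)
 have M0: "0 <= M" using f0[of 0 0] fM[of 0 0] by auto
 have "(%i. LINT x|lebesgue. f (k i) x * P (et (k i)) x) ----> (LINT x|lebesgue. w x * laplacian ph x)"
 proof (rule integral_dominated_convergence[where w="%x. M * C * indicator (cball 0 R) x"])
  show "(%x. w x * laplacian ph x) : borel_measurable lebesgue"
  using borel_cont_lebesgue[OF cw] bl by simp
  show "(%x. f (k i) x * P (et (k i)) x) : borel_measurable lebesgue" for i
  using bf bP by auto
  have "emeasure lebesgue (cball (0::'b) R) < \<infinity>" using emeasure_bounded_finite[of "cball (0::'b) R"] by simp
  hence "integrable lebesgue (indicator (cball (0::'b) R) :: 'b => real)" by auto
  thus "integrable lebesgue (%x::'b. M * C * indicator (cball 0 R) x :: real)" by auto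
  show "AE x in lebesgue. (%i. f (k i) x * P (et (k i)) x) ----> w x * laplacian ph x"
  by (intro AE_I2 tendsto_mult lim Pl)
  show "AE x in lebesgue. norm (f (k i) x * P (et (k i)) x) <= M * C * indicator (cball 0 R) x" for i
  proof (rule AE_I2)
  fix x :: 'b
  have p: "abs (P (et (k i)) x) <= C" "norm x > R --> P (et (k i)) x = 0" using CR et[of "k i"] by auto
  have "abs (f (k i) x * P (et (k i)) x) <= M * C"
   unfolding abs_mult using p(1) f0[of "k i" x] fM[of "k i" x] by (intro mult_mono) auto
  thus "norm (f (k i) x * P (et (k i)) x) <= M * C * indicator (cball 0 R) x"
   using p(2) by auto
  qed
 qed
 moreover have "(LINT x|lebesgue. f (k i) x * P (et (k i)) x) = - (LINT x|lebesgue. F x * ph x)" for i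
  unfolding P_def by (rule gridsol_weak[OF Om(2) F(1) et(1) f fM t])
 ultimately have e: "(LINT x|lebesgue. w x * laplacian ph x) = - (LINT x|lebesgue. F x * ph x)"
  by (simp add: LIMSEQ_const_iff)
 have "ph x = 0" if "x ~: Om" for x
  using t that closure_subset[of "{x. ph x ~= 0}"] unfolding test_function_def by blast
 hence "(LINT x:Om|lebesgue. F x * ph x) = (LINT x|lebesgue. F x * ph x)"
  "(LINT x:Om|lebesgue. w x * laplacian ph x) = (LINT x|lebesgue. w x * laplacian ph x)"
  unfolding set_lebesgue_integral_def using woff
  by (intro Bochner_Integration.integral_cong refl; auto simp: indicator_def)+
 thus "- (LINT x:Om|lebesgue. w x * laplacian ph x) = (LINT x:Om|lebesgue. F x * ph x)" using e by simp
 qed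
 thus ?thesis using that cw w0 woff by blast
qed

text \<open>Below the graph \<open>H\<close> is unspecified; extension by zero is continuous because
  \<open>H\<close> vanishes on the boundary.\<close>

definition Hz :: "('a::euclidean_space => real) => ('a * real => real) => 'a * real => real" where
 "Hz g H x = (if 0 <= rho g x then H x else 0)"

text \<open>A continuous truncation of \<open>H powr - ga\<close>, dominated by a multiple of \<open>H\<close> and exact where \<open>ta \<le> H\<close>.\<close>

definition cutF :: "('a::euclidean_space => real) => real => real => ('a * real => real) => 'a * real => real" where
 "cutF g ga ta H x = min (ta powr (- ga - 1) * Hz g H x) (max (Hz g H x) ta powr (- ga))"

section \<open>The truncated problems on the unit sector\<close>

lemma Hz_cont:
 assumes e: "epi L K g" and H: "cone_harm g ph H"
 shows "continuous_on UNIV (Hz g H)"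
proof -
 have c: "closed {x. 0 <= rho g x}" "closed {x. rho g x <= 0}"
 using closed_Collect_le[OF continuous_on_const continuous_rho[OF e]] closed_Collect_le[OF continuous_rho[OF e] continuous_on_const]
 by auto
 have "continuous_on ({x. 0 <= rho g x} Un {x. rho g x <= 0}) (%x. if 0 <= rho g x then H x else 0)"
 by (rule continuous_on_If[OF c]) (use cone_harmD(2,3)[OF H] in \<open>auto \<close>)
 moreover have "{x. 0 <= rho g x} Un {x. rho g x <= 0} = UNIV" by auto
 ultimately show ?thesis unfolding Hz_def[abs_def] by simp
qed

lemma Hz_nonneg: "cone_harm g ph H ==> 0 <= Hz g H x"
 by (auto simp: Hz_def dest: cone_harm_bounds(1))

lemma cutF_facts:
 assumes e: "epi L K g" and H: "cone_harm g ph H" and ta: "ta > 0" and ga: "ga > 0"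
 shows "continuous_on UNIV (cutF g ga ta H)" "0 <= cutF g ga ta H x" "cutF g ga ta H x <= ta powr (- ga - 1) * Hz g H x"
 "0 < rho g x ==> 0 < H x ==> cutF g ga ta H x <= H x powr (- ga)"
 "0 < rho g x ==> ta <= H x ==> cutF g ga ta H x = H x powr (- ga)"
proof -
 have m: "max t ta ~= 0" for t using ta by auto
 show "continuous_on UNIV (cutF g ga ta H)"
 unfolding cutF_def[abs_def] using m by (intro continuous_intros Hz_cont[OF e H]) auto
 show "0 <= cutF g ga ta H x" using Hz_nonneg[OF H] by (simp add: cutF_def)
 show "cutF g ga ta H x <= ta powr (- ga - 1) * Hz g H x" by (simp add: cutF_def)
 show "cutF g ga ta H x <= H x powr (- ga)" if "0 < rho g x" "0 < H x"
 proof -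
 have "max (H x) ta powr (- ga) <= H x powr (- ga)" using that ga by (intro powr_mono2') auto
 thus ?thesis using that by (simp add: cutF_def Hz_def)
 qed
 show "cutF g ga ta H x = H x powr (- ga)" if "0 < rho g x" "ta <= H x"
 proof -
 have "H x powr (- ga) <= ta powr (- ga)" using that ga ta by (intro powr_mono2') auto
 also have "... = ta powr (- ga - 1) * ta" using ta by (simp add: powr_diff)
 also have "... <= ta powr (- ga - 1) * H x" using that by (intro mult_left_mono) auto
 finally show ?thesis using that by (simp add: cutF_def Hz_def)
 qed
qed

lemma unit_sector:
 assumes e: "epi L K g"
 shows "open (usec g)" "x : closure (usec g) ==> 0 <= rho g x & norm x <= 1"
 "x : frontier (usec g) ==> 0 <= rho g x & norm x <= 1 & (rho g x = 0 | norm x = 1)"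
proof -
 have "{y. 0 < rho g y & norm y < 1} = usec g" by (auto simp: epicone_def)
 note reg = two_sided_region[OF continuous_rho[OF e] continuous_on_norm_id, where d=1, unfolded this]
 show "open (usec g)" by (rule reg(1))
 show "0 <= rho g x & norm x <= 1" if "x : closure (usec g)" by (rule reg(2)[OF that])
 show "0 <= rho g x & norm x <= 1 & (rho g x = 0 | norm x = 1)" if "x : frontier (usec g)"
 by (rule reg(3)[OF that])
qed

text \<open>The truncated right-hand side is dominated by a multiple of \<open>H\<close>, and
  multiples of \<open>H\<close> have an explicit potential: a quadratic times \<open>H\<close>
  itself. This supplies the barriers that the finite difference existence theorem demands.\<close>

lemma cutoff_solution:
 fixes g :: "'a::euclidean_space => real"
 assumes e: "epi L K g" and H: "cone_harm g ph H" and ta: "ta > 0" and ga: "ga > 0"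
 defines "Om \<equiv> usec g"
 shows "EX w. continuous_on UNIV w & (ALL x. 0 <= w x) & (ALL x. x ~: Om --> w x = 0) & poisson_distr Om w (cutF g ga ta H)"
proof (rule poisson_exists[of Om "cutF g ga ta H"])
 have ph: "ph > 0" by (rule cone_harmD(1)[OF H])
 show "open Om" unfolding Om_def by (rule unit_sector[OF e])
 show "bounded Om" by (rule bounded_subset[of "ball 0 1"]) (auto simp: Om_def)
 show "continuous_on UNIV (cutF g ga ta H)" "0 <= cutF g ga ta H x" for x
 by (rule cutF_facts[OF e H ta ga])+
 show "EX S B G H2 K. open S & closure Om <= S & D2on S B G H2 &
  (ALL b:Basis. continuous_on S (H2 b)) & (ALL x:S. 0 <= B x) & (ALL x:closure Om. (SUM b:Basis. H2 b x) < - cutF g ga ta H x) &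
  compact K & K <= Om & (ALL x:Om - K. B x <= ep)" if ep: "ep > 0" for ep
 proof -
 define n where "n = real DIM('a * real)"
 have n: "n >= 1" unfolding n_def using DIM_positive[where 'a="'a * real"] by simp
 define k where "k = ta powr (- ga - 1)"
 have k: "k > 0" using ta by (simp add: k_def)
 \<comment> \<open>The two summands of the barrier will be at most \<open>9/2 * de\<close> and
   \<open>4 * de\<close> on the boundary.\<close>
 define de where "de = ep / 10"
 have de: "de > 0" "9 * de <= ep" using ep by (auto simp: de_def)
 define c0 where "c0 = k / (2 * n + 4 * ph)"
 have c0: "c0 > 0" "c0 * (2 * n + 4 * ph) = k" using k n ph by (auto simp: c0_def)
 have uc: "uniformly_continuous_on (cball 0 2) (Hz g H)"
  by (rule compact_uniformly_continuous[OF continuous_on_subset[OF Hz_cont[OF e H]]]) auto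
 have "0 < n * de / k" using n de k by simp
 then obtain d where d: "d > 0" "!!x y. x : cball 0 2 ==> y : cball 0 2 ==> dist y x < d ==> dist (Hz g H y) (Hz g H x) < n * de / k"
  using uc unfolding uniformly_continuous_on_def by metis
 define s where "s = min (1/2) (min (d / 2) (de / (c0 * 9 * 2 powr ph)))"
 have s: "0 < s" "s <= 1/2" "s < d" "c0 * (9 * s * 2 powr ph) <= de"
 proof -
  show "0 < s" "s <= 1/2" "s < d" using d de c0 by (auto simp: s_def)
  have "s <= de / (c0 * 9 * 2 powr ph)" by (simp add: s_def)
  thus "c0 * (9 * s * 2 powr ph) <= de" using c0 by (simp add: pos_le_divide_eq mult_ac)
 qed
 define R where "R = (1 + 2 * s)^2"
 \<comment> \<open>An upward shift by \<open>s\<close> carries the closed sector into the open cone,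
   so the barrier is twice differentiable in a neighbourhood of the closure.\<close>
 define v :: "'a * real" where "v = (0, s)"
 have nv: "norm v = s" using s by (simp add: v_def)
 have rv: "rho g (x + v) = rho g x + s" for x unfolding v_def by (rule rho_up)
 obtain G h where Gh: "D2on (epicone g) H G h" "continuous_on (epicone g) G" "!!b. b : Basis ==> continuous_on (epicone g) (h b)"
  "!!x. x : epicone g ==> (SUM b:Basis. h b x) = 0" "!!x. x : epicone g ==> G x \<bullet> x = ph * H x"
  using H unfolding cone_harm_def by metis
 have cH: "continuous_on (epicone g) H"
  by (rule continuous_on_subset[OF cone_harmD(2)[OF H]]) (auto simp: epicone_def)
 \<comment> \<open>By the Euler identity its Laplacian is \<open>- (2 * n + 4 * ph) * H\<close>; the
   factor \<open>R - (norm z)^2\<close> makes it small near the outer sphere, the factor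
   \<open>H\<close> near the lateral boundary.\<close>
 define P where "P = (%z::'a * real. (R - (norm z)^2) * H z)"
 define PG where "PG = (%z::'a * real. (R - (norm z)^2) *R G z + H z *R (- (2 *R z)))"
 define Ph where "Ph = (%b z::'a * real. (R - (norm z)^2) * h b z + H z * (- 2) + 2 * ((- (2 *R z)) \<bullet> b) * (G z \<bullet> b))"
 have DP: "D2on (epicone g) P PG Ph"
  unfolding P_def PG_def Ph_def by (rule D2on_mult[OF D2on_sqnorm Gh(1)])
 have Phc: "continuous_on (epicone g) (Ph b)" if "b : Basis" for b
  unfolding Ph_def by (intro continuous_intros Gh(2) Gh(3)[OF that] cH)
 have Phs: "(SUM b:Basis. Ph b z) = - (2 * n + 4 * ph) * H z" if "z : epicone g" for z
 proof -
  have "(SUM b:Basis. Ph b z) = (R - (norm z)^2) * (SUM b:Basis. h b z) + n * (H z * (- 2)) - 4 * (SUM b:Basis. (z \<bullet> b) * (G z \<bullet> b))"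
  proof -
  have "(SUM b:Basis. Ph b z) = (SUM b:Basis. (R - (norm z)^2) * h b z + H z * (- 2) + (- 4) * ((z \<bullet> b) * (G z \<bullet> b)))"
   unfolding Ph_def by (rule sum.cong) simp_all
  thus ?thesis unfolding sum.distrib sum_distrib_left[symmetric] n_def by (simp add: algebra_simps)
  qed
  also have "(SUM b:Basis. (z \<bullet> b) * (G z \<bullet> b)) = G z \<bullet> z" by (subst inner_commute) (rule euclidean_inner[symmetric])
  finally show ?thesis using Gh(4,5)[OF that] by (simp add: algebra_simps)
 qed
 define S where "S = {x. x + v : epicone g} Int {x. norm (x + v) < 1 + 2 * s} Int {x. norm x < 2}"
 \<comment> \<open>The second term gives the strict margin \<open>2 * n * de\<close>, which covers
   the error \<open>n * de\<close> from evaluating \<open>H\<close> at the shifted point.\<close>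
 define B where "B = (%x. c0 * P (x + v) + de * (4 - (norm x)^2))"
 define BG where "BG = (%x. c0 *R PG (x + v) + de *R (- (2 *R x)))"
 define Bh where "Bh = (%b x. c0 * Ph b (x + v) + de * (- 2))"
 have shift: "continuous_on S (%x. p (x + v))" if "continuous_on (epicone g) p" for p :: "'a * real => real"
  by (rule continuous_on_compose2[OF that]) (intro continuous_intros, simp add: S_def image_subset_iff)
 have oS: "open S"
 proof -
  have "open ((%x. x + v) -` epicone g)" by (intro open_vimage open_cone[OF e] continuous_intros)
  moreover have "open {x. norm (x + v) < 1 + 2 * s}" "open {x::'a * real. norm x < 2}"
  by (intro open_Collect_less continuous_intros)+
  ultimately show ?thesis unfolding S_def vimage_def by auto
 qed
 have cl: "0 <= rho g x & norm x <= 1" if "x : closure Om" for x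
  using unit_sector(2)[OF e] that unfolding Om_def by blast
 have xv: "x + v : epicone g" "norm (x + v) <= 1 + s" "abs (Hz g H x - H (x + v)) < n * de / k" if x: "0 <= rho g x" "norm x <= 1" for x
 proof -
  show a: "x + v : epicone g" using rv[of x] x s by (simp add: epicone_def)
  show b: "norm (x + v) <= 1 + s" using norm_triangle_ineq[of x v] nv x by auto
  have "dist (Hz g H x) (Hz g H (x + v)) < n * de / k"
  proof (rule d(2))
  show "x + v : cball 0 2" using b s by auto
  show "x : cball 0 2" using x by simp
  show "dist x (x + v) < d" using nv s by (simp add: dist_norm)
  qed
  thus "abs (Hz g H x - H (x + v)) < n * de / k" using a by (simp add: dist_norm Hz_def epicone_def)
 qed
 have clS: "closure Om <= S"
 proof
  fix x assume "x : closure Om"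
  note c = cl[OF this]
  show "x : S" using xv(1,2)[of x] c s unfolding S_def by simp
 qed
 have DB: "D2on S B BG Bh"
 proof -
  have "D2on {x. x + v : epicone g} (%x. P (x + v)) (%x. PG (x + v)) (%b x. Ph b (x + v))" by (rule D2on_shift[OF DP])
  hence "D2on S (%x. P (x + v)) (%x. PG (x + v)) (%b x. Ph b (x + v))" by (rule D2on_subset) (auto simp: S_def)
  thus ?thesis unfolding B_def BG_def Bh_def by (intro D2on_add D2on_cmul D2on_sqnorm)
 qed
 have Bhc: "ALL b:Basis. continuous_on S (Bh b)"
 proof
  fix b :: "'a * real" assume "b : Basis"
  from shift[OF Phc[OF this]] show "continuous_on S (Bh b)" unfolding Bh_def by (intro continuous_intros)
 qed
 have BS: "ALL x:S. 0 <= B x"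
 proof
  fix x assume x: "x : S"
  have "(norm (x + v))^2 <= R" unfolding R_def using x by (intro power_mono) (auto simp: S_def)
  moreover have "0 <= H (x + v)" using x cone_harmD(5)[OF H] by (simp add: S_def)
  ultimately have "0 <= P (x + v)" by (simp add: P_def)
  moreover have "(norm x)^2 <= 2^2" using x by (intro power_mono) (auto simp: S_def)
  ultimately show "0 <= B x" using c0 de by (simp add: B_def)
 qed
 have Bs: "ALL x:closure Om. (SUM b:Basis. Bh b x) < - cutF g ga ta H x"
 proof
  fix x assume "x : closure Om"
  note c = xv[OF conjunct1 conjunct2, OF cl cl, OF this this]
  have "(SUM b:Basis. Bh b x) = c0 * (SUM b:Basis. Ph b (x + v)) - 2 * n * de"
  unfolding Bh_def n_def by (simp add: sum_subtractf sum_distrib_left)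
  also have "... = - k * H (x + v) - 2 * n * de" unfolding Phs[OF c(1)] c0(2)[symmetric] by (simp only: mult_ac mult_minus_left mult_minus_right)
  also have "... < - (k * Hz g H x)"
  proof -
  have "k * Hz g H x <= k * (H (x + v) + n * de / k)" using c(3) k by simp
  also have "... = k * H (x + v) + n * de" using k by (simp add: algebra_simps)
  finally have "k * Hz g H x <= k * H (x + v) + n * de" .
  moreover have "0 < n * de" using n de by simp
  ultimately show ?thesis by auto
  qed
  also have "... <= - cutF g ga ta H x" using cutF_facts(3)[OF e H ta ga, of x] by (simp add: k_def)
  finally show "(SUM b:Basis. Bh b x) < - cutF g ga ta H x" .
 qed
 have cB: "continuous_on (closure Om) B"
 proof -
  have "continuous_on (epicone g) P" unfolding P_def by (intro continuous_intros cH)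
  from shift[OF this] show ?thesis unfolding B_def by (intro continuous_intros) (rule continuous_on_subset[OF _ clS])
 qed
 define K where "K = {x : closure Om. ep <= B x}"
 have Kc: "compact K"
 proof -
  have "closed K" unfolding K_def using continuous_closed_preimage[OF cB closed_closure closed_atLeast[of ep]] by (simp add: Int_def)
  moreover have "bounded K" by (rule bounded_subset[of "cball 0 1"]) (use cl in \<open>auto simp: K_def\<close>)
  ultimately show ?thesis by (simp add: compact_eq_bounded_closed)
 qed
 have KO: "x : Om" if x: "x : K" for x
 proof (rule ccontr)
  assume no: "x ~: Om"
  have xc: "x : closure Om" and xB: "ep <= B x" using x by (simp_all add: K_def)
  have c: "0 <= rho g x" "norm x <= 1" using cl[OF xc] by auto
  note b = xv[OF c]
  have n1: "norm x <= norm (x + v) + s" using norm_triangle_ineq4[of "x + v" v] nv by simp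
  have Hv0: "0 <= H (x + v)" using b(1) by (rule cone_harmD(5)[OF H])
  have R4: "R <= 4" using power_mono[of "1 + 2 * s" 2 2] s by (simp add: R_def)
  have "c0 * P (x + v) <= 9/2 * de"
  proof (cases "rho g x = 0")
  case True
  hence "Hz g H x = 0" using cone_harmD(3)[OF H True] by (simp add: Hz_def)
  hence "H (x + v) <= n * de / k" using b(3) by simp
  hence "P (x + v) <= 4 * (n * de / k)" unfolding P_def using R4 Hv0 by (intro mult_mono) (auto intro: order_trans[of _ R])
  hence "c0 * P (x + v) <= c0 * (4 * (n * de / k))" using c0 by (intro mult_left_mono) auto
  also have "... = (4 * n / (2 * n + 4 * ph)) * de" using k by (simp add: c0_def)
  also have "... <= 9/2 * de" using n ph de by (intro mult_right_mono) (auto simp: pos_divide_le_eq)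
  finally show ?thesis .
  next
  case False
  hence "norm x = 1" using no c by (auto simp: Om_def epicone_def)
  hence "(1 - s)^2 <= (norm (x + v))^2" using n1 s by simp
  moreover have "R - (1 - s)^2 <= 9 * s"
  proof -
   have "R - (1 - s)^2 = 6 * s + 3 * (s * s)" by (simp add: R_def power2_eq_square algebra_simps)
   also have "s * s <= s * 1" using s by simp
   finally show ?thesis by simp
  qed
  ultimately have "R - (norm (x + v))^2 <= 9 * s" by auto
  moreover have "H (x + v) <= 2 powr ph"
  proof -
   have "H (x + v) <= norm (x + v) powr ph" by (rule cone_harmD(6)[OF H b(1)])
   also have "... <= 2 powr ph" using b(2) s ph by (intro powr_mono2) auto
   finally show ?thesis .
  qed
  ultimately have "P (x + v) <= 9 * s * 2 powr ph" unfolding P_def using Hv0 s by (intro mult_mono) auto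
  hence "c0 * P (x + v) <= c0 * (9 * s * 2 powr ph)" using c0 by auto
  thus ?thesis using s(4) de by simp
  qed
  moreover have "de * (4 - (norm x)^2) <= de * 4" using de by auto
  ultimately have "B x <= 9/2 * de + 4 * de" unfolding B_def by simp
  thus False using xB de by simp
 qed
 have off: "ALL x:Om - K. B x <= ep" using closure_subset[of Om] by (auto simp: K_def)
 show ?thesis
  by (rule exI[of _ S], rule exI[of _ B], rule exI[of _ BG], rule exI[of _ Bh], rule exI[of _ K])
  (intro conjI oS clS DB Bhc BS Bs Kc off subsetI KO)
 qed
qed blast

section \<open>Removal of the truncation\<close>

lemma touch_above_scale:
 assumes "touch_above V x m" "0 <= c"
 shows "touch_above (%y. c * V y) x (c * m)"
proof -
 obtain S ps G l where S: "open S" "x : S" "has_lap S ps G l" "ps x = V x" "ALL y:S. V y <= ps y" "m <= - l x"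
 using assms(1) unfolding touch_above_def by auto
 show ?thesis
 proof (rule touch_aboveI[OF S(1,2) has_lap_cmul[OF S(3), of c]])
 show "c * m <= - (c * l x)" using mult_left_mono[OF S(6) assms(2)] by simp
 show "c * V y <= c * ps y" if "y : S" for y using S(5) that assms(2) by (intro mult_left_mono) auto
 qed (simp add: S(4))
qed

text \<open>All truncated solutions lie below one multiple \<open>V\<close> of the barrier. That
  common majorant gives uniform convergence directly, without a further compactness
  argument.\<close>

lemma unit_problem_solvable:
 fixes g :: "'a::euclidean_space => real"
 assumes e: "epi L K g" and ga: "0 < ga" "ga < 2" and ph: "ph * ga = 2 - ph" and H: "cone_harm g ph H"
 defines "Om \<equiv> usec g"
 shows "EX w. continuous_on UNIV w & (ALL x. x ~: Om --> w x = 0) & poisson_distr Om w (%x. H x powr (- ga))"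
proof -
 have L: "1 <= L" "1 <= K" using epiD[OF e] by auto
 have ph0: "ph > 0" by (rule cone_harmD(1)[OF H])
 have oOm: "open Om" unfolding Om_def by (rule unit_sector[OF e])
 have bOm: "bounded Om" by (rule bounded_subset[of "ball 0 1"]) (auto simp: Om_def)
 obtain c1 where c1: "c1 > 0" "ALL x:epicone g. c1 * norm x powr ph * (rho g x / norm x) <= H x"
 using cone_harm_lower[OF L ph0, where 'a='a] e H by blast
 define b where "b = min (1/2) (2 - ga)"
 have b: "0 < b" "b < 1" "b <= 2 - ga" using ga by (auto simp: b_def)
 obtain A c where Ac: "A > 0" "c > 0" "ALL x:epicone g. touch_above (Wf A ph b g H) x (c * H x powr (- ga))"
 using W_touch[OF L ph0 b ga(1) ph c1(1), where 'a='a] e H c1(2) by blast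
 define V where "V = (%x. (1 / c) * Wf A ph b g H x)"
 have Hp: "0 < H y" if "y : epicone g" for y
 proof -
 have "0 < c1 * norm y powr ph * (rho g y / norm y)"
  using that c1 cone_nz[OF e that] by (simp add: epicone_def)
 thus ?thesis using c1(2) that by auto
 qed
 define C1 where "C1 = {x. 0 <= rho g x & norm x <= 1}"
 have cV: "continuous_on C1 V" unfolding V_def C1_def
 by (intro continuous_intros Wf_cont[OF e H b(1)])
 have cl: "closure Om <= C1"
 proof
 fix x assume "x : closure Om"
 thus "x : C1" using unit_sector(2)[OF e, of x] unfolding Om_def C1_def by simp
 qed
 have frC: "x : C1" "x ~: Om" if "x : frontier Om" for x
 using that cl oOm unfolding frontier_def by (auto simp: interior_open)
 have V0: "0 <= V x" if "x : C1" for x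
 using Wf_ge(2)[OF H, of x A b] that Ac unfolding V_def C1_def by simp
 have tV: "touch_above V x (H x powr (- ga))" if "x : Om" for x
 proof -
 have "touch_above (Wf A ph b g H) x (c * H x powr (- ga))" using Ac(3) that by (simp add: Om_def)
 from touch_above_scale[OF this, of "1 / c"] show ?thesis unfolding V_def using Ac(2) by simp
 qed
 define sol where "sol = (%ta w. continuous_on UNIV w & (ALL x. 0 <= w x) & (ALL x. x ~: Om --> w x = 0) & poisson_distr Om w (cutF g ga ta H))"
 have ex: "EX w. sol ta w" if t: "ta > 0" for ta
 unfolding sol_def Om_def by (rule cutoff_solution[OF e H t ga(1)])
 have cH: "continuous_on Om H"
 by (rule continuous_on_subset[OF cone_harmD(2)[OF H]]) (auto simp: Om_def epicone_def)
 have HpOm: "0 < H x" if "x : Om" for x using Hp that by (simp add: Om_def)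
 have Hne: "ALL x:Om. H x ~= 0" using HpOm by fastforce
 have cq: "continuous_on Om (%x. H x powr (- ga))" by (intro continuous_intros cH Hne)
 have rp: "0 < rho g x" if "x : Om" for x using that by (simp add: Om_def epicone_def)
 have sub: "asub D w (%x. H x powr (- ga))" if "sol ta w" "ta > 0" "open D" "D <= Om" for D ta w
 proof (rule asub_poisson[where h="cutF g ga ta H"])
 show "poisson_distr Om w (cutF g ga ta H)" "continuous_on D w"
  using that(1) unfolding sol_def by (auto intro: continuous_on_subset)
 show "continuous_on D (%x. H x powr (- ga))" by (rule continuous_on_subset[OF cq that(4)])
 fix x assume "x : D"
 hence "x : Om" using that by blast
 thus "cutF g ga ta H x <= H x powr (- ga)" by (intro cutF_facts(4)[OF e H that(2) ga(1)] rp HpOm)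
 qed (rule that)+
 have opn: "open {x : Om. A x < B x}" if "continuous_on Om A" "continuous_on Om B" for A B :: "'a * real => real"
 proof -
 have "open (Om Int (%x. B x - A x) -` {0<..})"
  using oOm by (intro continuous_open_preimage continuous_intros that) auto
 moreover have "Om Int (%x. B x - A x) -` {0<..} = {x : Om. A x < B x}" by auto
 ultimately show ?thesis by metis
 qed
 have wV: "w x <= V x" if s: "sol ta w" and t: "ta > 0" and x: "x : Om" for ta w x
 proof (rule comparison[OF oOm bOm, where q="%x. H x powr (- ga)"])
 have cw: "continuous_on S w" for S using s unfolding sol_def by (auto intro: continuous_on_subset)
 show "continuous_on (closure Om) w" by (rule cw)
 show "continuous_on (closure Om) V" by (rule continuous_on_subset[OF cV cl])
 show "w y <= V y" if "y : frontier Om" for y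
 proof -
  have "w y = 0" using s frC(2)[OF that] unfolding sol_def by blast
  thus ?thesis using V0[OF frC(1)[OF that]] by simp
 qed
 have "Om <= C1" by (rule order_trans[OF closure_subset cl])
 thus "asub {x : Om. V x < w x} w (%x. H x powr - ga)"
  by (intro sub[OF s t] opn continuous_on_subset[OF cV] cw) auto
 show "touch_above V y (H y powr - ga)" if "y : Om" for y by (rule tV[OF that])
 qed (rule x)
 \<comment> \<open>The closed superlevel set of \<open>V\<close> in the closed sector is compact and
   avoids the lateral boundary, where \<open>V\<close> vanishes, so \<open>H\<close> has a positive
   minimum on it.\<close>
 have lvl: "EX t>0. ALL x:Om. ep < V x --> t <= H x" if ep: "ep > 0" for ep
 proof -
 define Q where "Q = {x : C1. ep <= V x}"
 have cC: "closed C1"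
  unfolding C1_def Collect_conj_eq
  by (intro closed_Int closed_Collect_le continuous_intros continuous_rho[OF e])
 have "closed Q" unfolding Q_def using continuous_closed_preimage[OF cV cC closed_atLeast[of ep]] by (simp add: Int_def)
 moreover have "bounded Q" by (rule bounded_subset[of "cball 0 1"]) (auto simp: Q_def C1_def)
 ultimately have Qc: "compact Q" by (simp add: compact_eq_bounded_closed)
 have QH: "0 < H x" if "x : Q" for x
 proof (rule Hp, rule ccontr)
  assume "x ~: epicone g"
  hence r: "rho g x = 0" using that by (auto simp: Q_def C1_def epicone_def)
  hence "V x = 0" unfolding V_def Wf_def using cone_harmD(3)[OF H r] by simp
  thus False using that ep by (simp add: Q_def)
 qed
 have cHQ: "continuous_on Q H"
  by (rule continuous_on_subset[OF cone_harmD(2)[OF H]]) (auto simp: Q_def C1_def)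
 have "EX t>0. ALL x:Q. t <= H x"
 proof (cases "Q = {}")
  case True
  thus ?thesis by (intro exI[of _ 1]) auto
 next
  case False
  thus ?thesis using continuous_attains_inf[OF Qc False cHQ] QH by blast
 qed
 then obtain t where t: "t > 0" "ALL x:Q. t <= H x" by auto
 show ?thesis
 proof (rule exI[of _ t], rule conjI[OF t(1)], intro ballI impI)
  fix x assume "x : Om" "ep < V x"
  hence "x : Q" using cl closure_subset[of Om] by (auto simp: Q_def)
  thus "t <= H x" using t(2) by blast
 qed
 qed
 \<comment> \<open>Where the difference exceeds \<open>ep\<close>, so does \<open>V\<close>, hence
   \<open>H\<close> is above both truncation levels and the two right-hand sides coincide; the
   difference is harmonic there and cannot exceed its boundary value \<open>ep\<close>.\<close>
 have cauchy: "w x - w' x <= ep"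
 if s: "sol ta w" "sol ta' w'" and t: "ta > 0" "ta' > 0" "ta <= t" "ta' <= t" and ep: "ep > 0" "ALL x:Om. ep < V x --> t <= H x"
  and x: "x : Om"
 for w w' ta ta' ep t x
 proof (rule comparison[OF oOm bOm, where q="%x. 0" and V="%x. ep" and u="%x. w x - w' x"])
 have cw: "continuous_on S w" "continuous_on S w'" for S
  using s unfolding sol_def by (auto intro: continuous_on_subset)
 have p: "poisson_distr Om w (cutF g ga ta H)" "poisson_distr Om w' (cutF g ga ta' H)" and w'0: "!!x. 0 <= w' x"
  and off: "!!x. x ~: Om ==> w x = 0" using s unfolding sol_def by auto
 show "continuous_on (closure Om) (%x. w x - w' x)" by (intro continuous_intros cw)
 show "w y - w' y <= ep" if "y : frontier Om" for y
  using off[OF frC(2)[OF that]] w'0[of y] ep(1) by auto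
 define D where "D = {x : Om. ep < w x - w' x}"
 have D: "open D" "D <= Om" unfolding D_def by (intro opn continuous_intros cw) auto
 have DH: "cutF g ga si H y = H y powr (- ga)" if "y : D" "si > 0" "si <= t" for y si
 proof -
  have y: "y : Om" "ep < w y" using that(1) w'0[of y] by (auto simp: D_def)
  have "ep < V y" using wV[OF s(1) t(1) y(1)] y(2) by auto
  hence "si <= H y" using ep(2) y(1) that(3) by force
  thus ?thesis by (rule cutF_facts(5)[OF e H that(2) ga(1) rp[OF y(1)]])
 qed
 have cqD: "continuous_on D (%x. H x powr (- ga))" by (rule continuous_on_subset[OF cq D(2)])
 have "asub D w (%x. H x powr (- ga))"
  by (rule asub_poisson[OF p(1) D cw(1) cqD]) (use DH[OF _ t(1,3)] in simp)
 moreover have "asub D (%x. - w' x) (%x. - (H x powr (- ga)))"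
  by (rule asub_poisson[OF poisson_distr_minus[OF p(2)] D]) (use DH[OF _ t(2,4)] in \<open>auto intro!: continuous_intros cw cqD\<close>)
 ultimately have "asub D (%x. w x + - w' x) (%x. H x powr (- ga) + - (H x powr (- ga)))" by (rule asub_add)
 thus "asub {x : Om. ep < w x - w' x} (%x. w x - w' x) (%x. 0)" unfolding D_def[symmetric] by simp
 show "touch_above (%x. ep) y 0" for y :: "'a * real"
  by (rule touch_aboveI[OF open_UNIV UNIV_I has_lap_const[of UNIV ep]]) auto
 qed (use x in auto)
 \<comment> \<open>Starting below the level that belongs to \<open>ep = 1\<close> makes any two
   approximations differ by at most 1, which provides a dominating function for the limit.\<close>
 obtain t1 where t1: "t1 > 0" "ALL x:Om. 1 < V x --> t1 <= H x" using lvl[of 1] by auto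
 define ta where "ta = (%i::nat. t1 / (real i + 1))"
 have ta: "ta i > 0" "ta i <= t1" for i using t1 by (auto simp: ta_def divide_le_eq)
 have ta0: "ta ----> 0" unfolding ta_def by real_asymp
 obtain f where f: "!!i. sol (ta i) (f i)" using ex[OF ta(1)] by metis
 have f1: "0 <= f i x" "x ~: Om ==> f i x = 0" "continuous_on S (f i)" "poisson_distr Om (f i) (cutF g ga (ta i) H)" for i x S
 proof -
 note a = f[of i, unfolded sol_def]
 note a2 = a[THEN conjunct2]
 note a3 = a2[THEN conjunct2]
 show "0 <= f i x" "x ~: Om ==> f i x = 0" "continuous_on S (f i)" "poisson_distr Om (f i) (cutF g ga (ta i) H)"
  by (rule a2[THEN conjunct1, rule_format], erule a3[THEN conjunct1, rule_format],
  rule continuous_on_subset[OF a[THEN conjunct1] subset_UNIV], rule a3[THEN conjunct2])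
 qed
 have near: "abs (f i x - f j x) <= ep" if "ta i <= t" "ta j <= t" "ep > 0" "ALL x:Om. ep < V x --> t <= H x" for i j t ep x
 proof (cases "x : Om")
 case True
 show ?thesis using cauchy[OF f f ta(1) ta(1) that(1,2) that(3,4) True] cauchy[OF f f ta(1) ta(1) that(2,1) that(3,4) True] by simp
 qed (use f1(2) that in simp)
 have "uniformly_Cauchy_on UNIV f"
 proof (rule uniformly_Cauchy_onI)
 fix ep :: real assume "ep > 0"
 hence e2: "ep / 2 > 0" by simp
 obtain t where t: "t > 0" "ALL x:Om. ep / 2 < V x --> t <= H x" using lvl[OF e2] by auto
 obtain N where N: "!!i. N <= i ==> ta i < t"
  using order_tendstoD(2)[OF ta0 t(1)] unfolding eventually_sequentially by blast
 show "EX M. ALL x:UNIV. ALL m>=M. ALL n>=M. dist (f m x) (f n x) < ep"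
 proof (intro exI[of _ N] ballI allI impI)
  fix x m n assume "N <= m" "N <= n"
  from near[OF less_imp_le[OF N[OF this(1)]] less_imp_le[OF N[OF this(2)]] e2 t(2), of x]
  show "dist (f m x) (f n x) < ep" using \<open>ep > 0\<close> by (simp add: dist_real_def)
 qed
 qed
 then obtain w where w: "uniform_limit UNIV f w sequentially"
 using uniformly_convergent_eq_Cauchy uniformly_convergent_on_def by blast
 have cw: "continuous_on UNIV w" by (rule uniform_limit_theorem[OF always_eventually[OF allI[OF f1(3)]] w]) simp
 have lim: "(%i. f i x) ----> w x" for x using tendsto_uniform_limitI[OF w] by simp
 have woff: "w x = 0" if "x ~: Om" for x
 using lim[of x] f1(2)[OF that] by (simp add: LIMSEQ_const_iff)
 have fw: "abs (f i x) <= abs (w x) + 1" for i x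
 proof -
 have "(%j. abs (f i x - f j x)) ----> abs (f i x - w x)" by (intro tendsto_intros lim)
 moreover have "abs (f i x - f j x) <= 1" for j by (rule near[OF ta(2) ta(2) _ t1(2)]) simp
 ultimately have "abs (f i x - w x) <= 1" by (intro LIMSEQ_le_const2) auto
 thus ?thesis by auto
 qed
 have "poisson_distr Om w (%x. H x powr (- ga))" unfolding poisson_distr_def
 proof (intro conjI continuous_locally_integrable continuous_on_subset[OF cw] cq subset_UNIV allI impI)
 fix ps assume t: "test_function Om ps"
 define S where "S = closure {x. ps x ~= 0}"
 have S: "compact S" "!!x. x ~: S ==> ps x = 0" "S <= Om"
  using t closure_subset[of "{x. ps x ~= 0}"] unfolding test_function_def S_def by auto
 have lap0: "laplacian ps x = 0" if "x ~: S" for x using that unfolding S_def by (rule laplacian_outside)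
 have cl: "continuous_on UNIV (laplacian ps)"
  unfolding laplacian_def[abs_def] by (intro continuous_on_sum test_function_D2on(3)[OF t])
 have "EX t>0. ALL x:S. t <= H x"
 proof (cases "S = {}")
  case True
  thus ?thesis by (intro exI[of _ 1]) auto
 next
  case False
  obtain z where "z : S" "ALL x:S. H z <= H x"
  using continuous_attains_inf[OF S(1) False continuous_on_subset[OF cH S(3)]] by blast
  thus ?thesis using HpOm[of z] S(3) by blast
 qed
 \<comment> \<open>On the compact support of a test function \<open>H\<close> is bounded below, so
   the truncation is eventually exact there.\<close>
 then obtain t2 where t2: "t2 > 0" "ALL x:S. t2 <= H x" by auto
 have "\<forall>\<^sub>F i in sequentially. ta i < t2" using order_tendstoD(2)[OF ta0 t2(1)] .
 hence ev: "\<forall>\<^sub>F i in sequentially. - (LINT x:Om|lebesgue. f i x * laplacian ps x) = (LINT x:Om|lebesgue. H x powr (- ga) * ps x)"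
 proof eventually_elim
  case (elim i)
  have "- (LINT x:Om|lebesgue. f i x * laplacian ps x) = (LINT x:Om|lebesgue. cutF g ga (ta i) H x * ps x)"
  using f1(4)[of i] t unfolding poisson_distr_def by blast
  also have "... = (LINT x:Om|lebesgue. H x powr (- ga) * ps x)"
  unfolding set_lebesgue_integral_def
  proof (rule Bochner_Integration.integral_cong[OF refl])
  fix x :: "'a * real"
  show "indicator Om x *R (cutF g ga (ta i) H x * ps x) = indicator Om x *R (H x powr (- ga) * ps x)"
  proof (cases "x : S")
   case True
   have "ta i <= H x" using t2(2) True elim by force
   moreover have "0 < rho g x" using True S(3) rp by blast
   ultimately show ?thesis using cutF_facts(5)[OF e H ta(1) ga(1)] by simp
  qed (simp add: S(2))
  qed
  finally show ?case .
 qed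
 have "(%i. LINT x:Om|lebesgue. f i x * laplacian ps x) ----> (LINT x:Om|lebesgue. w x * laplacian ps x)"
  unfolding set_lebesgue_integral_def
 proof (rule integral_dominated_convergence[where w="%x. (abs (w x) + 1) * abs (laplacian ps x)"])
  have bm: "(%x. indicator Om x *R (v x * laplacian ps x)) : borel_measurable lebesgue"
  if "continuous_on UNIV v" for v :: "'a * real => real"
  using oOm borel_cont_lebesgue[OF that] borel_cont_lebesgue[OF cl]
  by (intro borel_measurable_scaleR borel_measurable_indicator borel_measurable_times) auto
  show "(%x. indicator Om x *R (w x * laplacian ps x)) : borel_measurable lebesgue" by (rule bm[OF cw])
  show "(%x. indicator Om x *R (f i x * laplacian ps x)) : borel_measurable lebesgue" for i by (rule bm[OF f1(3)])
  have cd: "continuous_on UNIV (%x. (abs (w x) + 1) * abs (laplacian ps x))" by (intro continuous_intros cw cl)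
  obtain M where M: "!!y. abs ((abs (w y) + 1) * abs (laplacian ps y)) <= M"
  using cont_compact_support_bounded[OF cd _ S(1)] lap0 by (metis abs_zero mult_zero_right)
  show "integrable lebesgue (%x. (abs (w x) + 1) * abs (laplacian ps x))"
  by (rule integrable_bounded_support[OF borel_measurable_continuous_onI[OF cd] M compact_imp_bounded[OF S(1)]]) (simp add: lap0)
  show "AE x in lebesgue. (%i. indicator Om x *R (f i x * laplacian ps x)) ----> indicator Om x *R (w x * laplacian ps x)"
  by (intro AE_I2 tendsto_intros lim)
  show "AE x in lebesgue. norm (indicator Om x *R (f i x * laplacian ps x)) <= (abs (w x) + 1) * abs (laplacian ps x)" for i
  proof (rule AE_I2)
  fix x :: "'a * real"
  have "abs (f i x) * abs (laplacian ps x) <= (abs (w x) + 1) * abs (laplacian ps x)" by (intro mult_right_mono fw) auto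
  thus "norm (indicator Om x *R (f i x * laplacian ps x)) <= (abs (w x) + 1) * abs (laplacian ps x)"
   by (cases "x : Om") (auto simp: abs_mult)
  qed
 qed
 hence "(%i. - (LINT x:Om|lebesgue. f i x * laplacian ps x)) ----> - (LINT x:Om|lebesgue. w x * laplacian ps x)"
  by (rule tendsto_minus)
 from LIMSEQ_unique[OF this tendsto_eventually[OF ev]]
 show "- (LINT x:Om|lebesgue. w x * laplacian ps x) = (LINT x:Om|lebesgue. H x powr (- ga) * ps x)" .
 qed
 thus ?thesis using cw woff by blast
qed

section \<open>Exponents at least two\<close>

lemma para_norm_bound:
 fixes g :: "'a::euclidean_space => real"
 assumes v: "norm v <= L" and M: "0 <= M" and y: "norm (y - z) <= r" "r <= 1" and z: "rho g z = 0"
 shows "abs (para g (fst z) v M y) <= (1 + L + M) * r"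
proof -
 have f: "norm (fst y - fst z) <= r" "abs (snd y - snd z) <= r"
 using norm_fst_snd[of "y - z"] y by auto
 have r: "0 <= r" using f(2) by auto
 have "abs (v \<bullet> (fst y - fst z)) <= norm v * norm (fst y - fst z)" by (rule Cauchy_Schwarz_ineq2)
 also have "... <= L * r" using v f order_trans[OF norm_ge_zero v] by (intro mult_mono) auto
 finally have 1: "abs (v \<bullet> (fst y - fst z)) <= L * r" .
 have "(norm (fst y - fst z))^2 <= r^2" using f by auto
 also have "r^2 <= r" using r y(2) by (simp add: power2_eq_square mult_left_le)
 finally have "M * (norm (fst y - fst z))^2 <= M * r" using M by (intro mult_left_mono) auto
 moreover have "0 <= M * (norm (fst y - fst z))^2" using M by simp
 moreover have "snd z = g (fst z)" using z by (simp add: rho_def)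
 ultimately show ?thesis using 1 f(2) by (simp add: para_def algebra_simps)
qed

text \<open>The potential of \<open>rho^(-2)\<close> diverges logarithmically. The competitor is
  \<open>ln ((rho + si) / si)\<close>, whose negative Laplacian is at most
  \<open>CK / (rho + si)^2\<close>, minus a superharmonic localiser. All constants are fixed before
  \<open>v\<close>, \<open>c\<close> and \<open>si\<close>, so \<open>si\<close> can be sent to 0
  later.\<close>

lemma log_blowup:
 fixes g :: "'a::euclidean_space => real"
 assumes e: "epi L K g" and z: "rho g z = 0" "fst z ~= 0" and R: "R > 0"
 shows "EX r0 m C t. 0 < r0 & r0 <= R & 0 < m & 0 < t & t <= R &
 (ALL v c si. 0 <= c --> 0 < si --> si < 1 -->
  continuous_on {y. 0 <= rho g y & norm (y - z) <= r0} v -->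
  (ALL y. 0 <= rho g y & norm (y - z) <= r0 --> 0 <= v y) -->
  asub {y. 0 < rho g y & norm (y - z) < r0} (%y. - v y) (%y. - (c / (rho g y + si)^2)) -->
  (ALL w:cball (z + (0, t)) (t / (8 * (1 + L))). c * (m * (ln (1 / si) / 2 - C)) <= v w))"
proof -
 have L: "1 <= L" "1 <= K" using epiD[OF e] by auto
 define n where "n = real DIM('a * real)"
 have n: "n >= 1" unfolding n_def using DIM_positive[where 'a="'a * real"] by simp
 define d where "d = real DIM('a)"
 have d: "d >= 1" unfolding d_def using DIM_positive[where 'a='a] by auto
 define M where "M = 2 * K / norm (fst z)"
 have M: "M > 0" using z L by (simp add: M_def)
 have foot: "EX v. norm v <= L & (ALL y. abs (rho g y - para g x v 0 y) <= M * (norm (fst y - x))^2)"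
 if x: "norm (fst z) / 2 <= norm x" for x
 proof -
 have xn: "0 < norm x" using x z(2) by auto
 hence "x ~= 0" by simp
 then obtain v where v: "norm v <= L" "ALL y. abs (g y - g x - v \<bullet> (y - x)) <= K / norm x * (norm (y - x))^2"
  using e unfolding epi_def by blast
 have "K / norm x <= K / (norm (fst z) / 2)" using x z(2) L by (intro divide_left_mono mult_pos_pos) auto
 hence KM: "K / norm x <= M" by (simp add: M_def mult.commute)
 show ?thesis
 proof (rule exI[of _ v], rule conjI[OF v(1)], rule allI)
  fix y :: "'a * real"
  have "rho g y - para g x v 0 y = - (g (fst y) - g x - v \<bullet> (fst y - x))"
  by (simp add: rho_def para_def)
  hence "abs (rho g y - para g x v 0 y) = abs (g (fst y) - g x - v \<bullet> (fst y - x))" by auto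
  also have "... <= K / norm x * (norm (fst y - x))^2" using v(2) by blast
  also have "... <= M * (norm (fst y - x))^2" using KM by (intro mult_right_mono) auto
  finally show "abs (rho g y - para g x v 0 y) <= M * (norm (fst y - x))^2" .
 qed
 qed
 obtain v0 where v0: "norm v0 <= L" "!!y. abs (rho g y - para g (fst z) v0 0 y) <= M * (norm (fst y - fst z))^2"
 using foot[of "fst z"] by auto
 define p where "p = para g (fst z) v0 M"
 have prho: "rho g y <= p y" for y
 using v0(2)[of y] para_split[of g "fst z" v0 M y] unfolding p_def by simp
 define N1 where "N1 = 2 * M * d"
 have N1: "N1 > 0" using M d by (simp add: N1_def)
 define C0 where "C0 = N1 + 1"
 have C0: "C0 > 0" using N1 by (simp add: C0_def)
 define B1 where "B1 = 1 + L + M"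
 have B1: "B1 > 0" "1 + L <= B1" using L M by (auto simp: B1_def)
 define r0 where "r0 = min (min R 1) (min (norm (fst z) / 2) (min (1 / B1) (1 / (2 * C0 * B1))))"
 have r0: "0 < r0" "r0 <= R" "r0 <= 1" "r0 <= norm (fst z) / 2" "r0 <= 1 / B1" "r0 <= 1 / (2 * C0 * B1)"
 using R z(2) C0 B1 by (auto simp: r0_def)
 have p1: "abs (p y) <= B1 * r" if "norm (y - z) <= r" "r <= 1" for y r
 using para_norm_bound[OF v0(1) _ that z(1), of M] M unfolding p_def B1_def by simp
 have pC: "p y * (2 * C0) <= 1" if "norm (y - z) <= r0" for y
 proof -
 have "p y <= B1 * (1 / (2 * C0 * B1))" using p1[OF that r0(3)] mult_left_mono[OF r0(6), of B1] B1 by simp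
 thus ?thesis using B1 C0 by (simp add: field_simps)
 qed
 have rho1: "rho g y <= 1" if "norm (y - z) <= r0" for y
 proof -
 have "rho g y <= (1 + L) * norm (y - z)" using rho_lip[OF e, of y z] z(1) by auto
 also have "... <= B1 * (1 / B1)" using that r0(5) B1 by (intro mult_mono) auto
 finally show ?thesis using B1 by simp
 qed
 define A where "A = n / r0^2"
 have A: "A > 0" using n r0 by (simp add: A_def)
 \<comment> \<open>The localiser is nonnegative, at least 1 on the sphere of radius
   \<open>r0\<close> about \<open>z\<close>, and small near \<open>z\<close>. The concave function
   of the paraboloid cancels the positive Laplacian of the squared distance.\<close>
 define b where "b = (%y. (1 / r0^2) * (norm (y - z))^2 + A * (p y - C0 * (p y)^2))"
 have lp: "has_lap S p (%x. ((2 * M) *R (fst x - fst z) - v0, 1)) (%x. N1)" for S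
 unfolding p_def N1_def d_def by (rule has_lap_para)
 obtain Gb where lb: "has_lap UNIV b Gb (%x. (1 / r0^2) * (2 * n) +
  A * (- (2 * C0) * ((((2 * M) *R (fst x - fst z) - v0, 1::real)) \<bullet> ((2 * M) *R (fst x - fst z) - v0, 1)) + (1 - 2 * C0 * p x) * N1))"
 proof -
 have "has_lap UNIV (%x. p x - C0 * (p x)^2) (%x. (1 - 2 * C0 * p x) *R ((2 * M) *R (fst x - fst z) - v0, 1))
  (%x. - (2 * C0) * ((((2 * M) *R (fst x - fst z) - v0, 1::real)) \<bullet> ((2 * M) *R (fst x - fst z) - v0, 1)) + (1 - 2 * C0 * p x) * N1)"
  by (rule has_lap_comp[OF lp]) (auto intro!: derivative_eq_intros)
 from has_lap_add[OF has_lap_cmul[OF has_lap_sqnorm[of UNIV z], of "1 / r0^2"] has_lap_cmul[OF this, of A]]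
 show ?thesis using that unfolding b_def n_def by blast
 qed
 have lb0: "(1 / r0^2) * (2 * n) +
  A * (- (2 * C0) * ((((2 * M) *R (fst x - fst z) - v0, 1::real)) \<bullet> ((2 * M) *R (fst x - fst z) - v0, 1)) + (1 - 2 * C0 * p x) * N1) <= 0"
 if x: "0 <= rho g x" "norm (x - z) <= r0" for x
 proof -
 define q where "q = (((2 * M) *R (fst x - fst z) - v0, 1::real)) \<bullet> ((2 * M) *R (fst x - fst z) - v0, 1)"
 have q: "1 <= q" unfolding q_def inner_Pair by auto
 have "0 <= p x" using prho[of x] x by simp
 hence "(1 - 2 * C0 * p x) * N1 <= 1 * N1" using N1 C0 by simp
 moreover have "- (2 * C0) * q <= - (2 * C0) * 1" using q C0 by simp
 ultimately have "- (2 * C0) * q + (1 - 2 * C0 * p x) * N1 <= - 2" using N1 C0_def by linarith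
 hence "A * (- (2 * C0) * q + (1 - 2 * C0 * p x) * N1) <= A * (- 2)" using A by (intro mult_left_mono) auto
 also have "... = - ((1 / r0^2) * (2 * n))" by (simp add: A_def)
 finally show ?thesis unfolding q_def by auto
 qed
 have bge: "(1 / r0^2) * (norm (x - z))^2 <= b x" "0 <= b x" if x: "0 <= rho g x" "norm (x - z) <= r0" for x
 proof -
 have p0: "0 <= p x" using prho[of x] x by simp
 have "C0 * p x <= 1" using pC[OF x(2)] by (simp add: mult_ac)
 hence "p x * (C0 * p x) <= p x * 1" using p0 by (intro mult_left_mono) auto
 hence "0 <= A * (p x - C0 * (p x)^2)" using A by (simp add: power2_eq_square mult_ac)
 thus "(1 / r0^2) * (norm (x - z))^2 <= b x" by (simp add: b_def)
 moreover have "0 <= (1 / r0^2) * (norm (x - z))^2" by simp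
 ultimately show "0 <= b x" by linarith
 qed
 define t where "t = min (min R (r0 / 4)) (1 / (8 * A * B1))"
 have t: "0 < t" "t <= R" "t <= r0 / 4" "t <= 1 / (8 * A * B1)" using r0 A B1 by (auto simp: t_def)
 define CK where "CK = 1 + L^2 + 2 * N1"
 have CK: "CK > 0" using N1 by (simp add: CK_def add_pos_nonneg)
 define m where "m = 1 / CK"
 have m: "m > 0" using CK by (simp add: m_def)
 have Wpt: "norm (w - z) <= 2 * t" "t / 2 <= rho g w" "b w <= 1/2" if w: "w : cball (z + (0, t)) (t / (8 * (1 + L)))" for w
 proof -
 have dw: "norm (w - (z + (0, t))) <= t / (8 * (1 + L))" using w by (simp add: dist_norm norm_minus_commute)
 also have "... <= t / 1" using L t by (intro divide_left_mono) auto
 finally have 1: "norm (w - (z + (0, t))) <= t" by simp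
 have "norm (w - z) <= norm (w - (z + (0, t))) + norm ((0::'a, t))"
  using norm_triangle_ineq[of "w - (z + (0, t))" "(0, t)"] by auto
 thus 2: "norm (w - z) <= 2 * t" using 1 t by auto
 have "abs (rho g w - rho g (z + (0, t))) <= (1 + L) * (t / (8 * (1 + L)))"
  using rho_lip[OF e, of w "z + (0, t)"] mult_left_mono[OF dw, of "1 + L"] L by simp
 also have "(1 + L) * (t / (8 * (1 + L))) = t / 8" using L by (simp add: field_simps)
 finally show rw: "t / 2 <= rho g w" unfolding rho_up z(1) by linarith
 have wr: "norm (w - z) <= r0" using 2 t r0 by auto
 have "b w <= (1 / r0^2) * (norm (w - z))^2 + A * p w" unfolding b_def using A C0 by auto
 also have "... <= (1 / r0^2) * (r0 / 2)^2 + A * (B1 * (2 * t))"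
 proof (intro add_mono mult_left_mono power_mono)
  show "norm (w - z) <= r0 / 2" using 2 t by auto
  show "p w <= B1 * (2 * t)" using p1[OF 2] t r0 by auto
 qed (use A in auto)
 also have "A * (B1 * (2 * t)) <= 1/4"
 proof -
  have "A * B1 * t <= A * B1 * (1 / (8 * A * B1))" using t A B1 by (intro mult_left_mono) auto
  thus ?thesis using A B1 by simp
 qed
 finally show "b w <= 1/2" using r0 by (simp add: power_divide)
 qed
 define C5 where "C5 = ln 2 / 2 - ln (t / 2)"
 show ?thesis
 proof (rule exI[of _ r0], rule exI[of _ m], rule exI[of _ C5], rule exI[of _ t],
  intro conjI r0(1,2) m t(1,2) allI impI ballI)
 fix v c si w
 assume c: "0 <= c" and si: "0 < si" "si < 1" and cv: "continuous_on {y. 0 <= rho g y & norm (y - z) <= r0} v"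
  and v0': "ALL y. 0 <= rho g y & norm (y - z) <= r0 --> 0 <= v y"
  and as: "asub {y. 0 < rho g y & norm (y - z) < r0} (%y. - v y) (%y. - (c / (rho g y + si)^2))"
  and w: "w : cball (z + (0, t)) (t / (8 * (1 + L)))"
 have vpos: "0 <= v y" if "0 <= rho g y" "norm (y - z) <= r0" for y using v0' that by blast
 define D where "D = {y. 0 < rho g y & norm (y - z) < r0}"
 note reg = two_sided_region[OF continuous_rho[OF e] continuous_on_norm_id2[of _ z], where d=r0, folded D_def]
 \<comment> \<open>Since \<open>rho + si <= 2\<close>, this bounds the logarithmic term, so
   \<open>La * b\<close> cancels it on the sphere. At the target ball \<open>b <= 1/2\<close>, and
   about half of the logarithm survives.\<close>
 define La where "La = ln 2 - ln si"
 have La: "La > 0" using si ln_less_zero[of si] ln_gt_zero[of "2::real"] unfolding La_def by auto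
 define k where "k = c * m"
 have k: "0 <= k" using c m by (simp add: k_def)
 define Z where "Z = (%y. k * ((ln (rho g y + si) - ln si) - La * b y))"
 have wD: "norm (w - z) < r0" "0 < rho g w" using Wpt[OF w] t r0 by auto
 have cb: "continuous_on S b" for S
 proof -
  have cp: "continuous_on S p" unfolding p_def by (rule continuous_para)
  show ?thesis unfolding b_def by (intro continuous_intros cp)
 qed
 have "Z w <= v w"
 proof (rule comparison_below[OF reg(1), where q="%y. c / (rho g y + si)^2"])
  have sub: "closure D <= {y. 0 <= rho g y & norm (y - z) <= r0}" using reg(2) by auto
  show "bounded D" by (rule bounded_subset[of "ball z r0"]) (auto simp: D_def dist_norm norm_minus_commute)
  show "continuous_on (closure D) v" by (rule continuous_on_subset[OF cv sub])
  show "continuous_on (closure D) Z" unfolding Z_def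
  proof (intro continuous_intros cb continuous_rho[OF e] ballI)
  fix y assume "y : closure D"
  thus "rho g y + si ~= 0" using reg(2)[of y] si by simp
  qed
  show "Z y <= v y" if "y : frontier D" for y
  proof -
  note f = reg(3)[OF that]
  have f1: "0 <= rho g y" "norm (y - z) <= r0" using f by auto
  have "(ln (rho g y + si) - ln si) - La * b y <= 0"
  proof (cases "rho g y = 0")
   case True
   have "0 <= La * b y" using bge(2)[OF f1] La by simp
   thus ?thesis using True by simp
  next
   case False
   hence "norm (y - z) = r0" using f by blast
   hence "1 <= b y" using bge(1)[OF f1] r0 by simp
   hence "La * 1 <= La * b y" using La by simp
   moreover have "ln (rho g y + si) <= ln 2" using rho1[OF f1(2)] f1 si by simp
   ultimately show ?thesis using La_def by auto
  qed
  hence "Z y <= 0" unfolding Z_def using k by (intro mult_nonneg_nonpos)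
  thus ?thesis using vpos[OF f1] by auto
  qed
  show "asub {x : D. v x < Z x} (%x. - v x) (%x. - (c / (rho g x + si)^2))"
  by (rule asub_mono[OF as]) (auto simp: D_def)
  show "touch_below Z y (c / (rho g y + si)^2)" if y: "y : D" for y
  proof -
  have y1: "0 < rho g y" "norm (y - z) < r0" using y by (simp_all add: D_def)
  have "norm (fst z) <= norm (fst y) + norm (fst (y - z))"
   using norm_triangle_ineq4[of "fst y" "fst (y - z)"] by simp
  hence "norm (fst z) / 2 <= norm (fst y)" using norm_fst_snd(1)[of "y - z"] y1 r0(4) by simp
  then obtain v' where v': "norm v' <= L" "!!x. abs (rho g x - para g (fst y) v' 0 x) <= M * (norm (fst x - fst y))^2"
   using foot by blast
  define q where "q = para g (fst y) v' (- M)"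
  have qr: "q x <= rho g x" for x
   using v'(2)[of x] para_split[of g "fst y" v' "- M" x] unfolding q_def by auto
  have qy: "q y = rho g y" by (simp add: q_def para_def rho_def)
  define S where "S = {x. 0 < q x + si}"
  have oS: "open S" unfolding S_def q_def by (intro open_Collect_less continuous_intros continuous_para)
  have lq: "has_lap S q (%x. ((2 * (- M)) *R (fst x - fst y) - v', 1)) (%x. 2 * (- M) * d)"
   unfolding q_def d_def by (rule has_lap_para)
  have "has_lap S (%x. ln (q x + si) - ln si) (%x. (1 / (q x + si)) *R ((2 * (- M)) *R (fst x - fst y) - v', 1))
   (%x. - (1 / (q x + si)^2) * (((2 * (- M)) *R (fst x - fst y) - v', 1::real) \<bullet> ((2 * (- M)) *R (fst x - fst y) - v', 1))
    + 1 / (q x + si) * (2 * (- M) * d))"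
   by (rule has_lap_comp[OF lq]) (auto simp: S_def power2_eq_square intro!: derivative_eq_intros)
  note hlap = has_lap_cmul[OF has_lap_diff[OF this has_lap_cmul[OF has_lap_subset[OF lb subset_UNIV], where c=La]], where c=k]
  have hl: "EX G l. has_lap S (%x. k * ((ln (q x + si) - ln si) - La * b x)) G l & - l y <= c / (rho g y + si)^2"
  proof (rule exI, rule exI, rule conjI[OF hlap])
   define X where "X = rho g y + si"
   have X: "0 < X" "X <= 2" using y1 si rho1[of y] unfolding X_def by auto
   define lby where "lby = (1 / r0^2) * (2 * n) + A * (- (2 * C0) * ((((2 * M) *R (fst y - fst z) - v0, 1::real)) \<bullet> ((2 * M) *R (fst y - fst z) - v0, 1)) + (1 - 2 * C0 * p y) * N1)"
   have lby: "lby <= 0" unfolding lby_def by (rule lb0) (use y1 in auto)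
   have "(norm v')^2 <= L^2" using v'(1) by (intro power_mono) auto
   hence in1: "((2 * (- M)) *R (fst y - fst y) - v', 1::real) \<bullet> ((2 * (- M)) *R (fst y - fst y) - v', 1) <= 1 + L^2"
   by (simp add: power2_norm_eq_inner)
   define I where "I = ((2 * (- M)) *R (fst y - fst y) - v', 1::real) \<bullet> ((2 * (- M)) *R (fst y - fst y) - v', 1)"
   have "1 / X <= 2 / X^2" using X by (simp add: field_simps power2_eq_square)
   hence "1 / X * N1 <= 2 / X^2 * N1" using N1 by (intro mult_right_mono) auto
   moreover have "1 / X^2 * I <= 1 / X^2 * (1 + L^2)" using in1 unfolding I_def by (intro mult_left_mono) auto
   moreover have "1 / X^2 * (1 + L^2) + 2 / X^2 * N1 = CK / X^2" by (simp add: CK_def add_divide_distrib)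
   moreover have "La * lby <= 0" using La lby by (simp add: mult_nonneg_nonpos)
   ultimately have "1 / X^2 * I + 1 / X * N1 + La * lby <= CK / X^2" by auto
   hence "k * (1 / X^2 * I + 1 / X * N1 + La * lby) <= k * (CK / X^2)" using k by (intro mult_left_mono)
   also have "... = c / X^2" using CK by (simp add: k_def m_def)
   finally show "- (k * (- (1 / (q y + si)^2) * (((2 * (- M)) *R (fst y - fst y) - v', 1::real) \<bullet> ((2 * (- M)) *R (fst y - fst y) - v', 1))
    + 1 / (q y + si) * (2 * (- M) * d) - La * ((1 / r0^2) * (2 * n) +
  A * (- (2 * C0) * ((((2 * M) *R (fst y - fst z) - v0, 1::real)) \<bullet> ((2 * M) *R (fst y - fst z) - v0, 1)) + (1 - 2 * C0 * p y) * N1)))) <= c / (rho g y + si)^2"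
   proof -
   have nM: "2 * (- M) * d = - N1" by (simp add: N1_def)
   show ?thesis if "k * (1 / X^2 * I + 1 / X * N1 + La * lby) <= c / X^2"
    using that unfolding qy X_def[symmetric] I_def[symmetric] lby_def[symmetric] nM by (simp add: algebra_simps)
   qed
  qed
  then obtain G l where Gl: "has_lap S (%x. k * ((ln (q x + si) - ln si) - La * b x)) G l" "- l y <= c / (rho g y + si)^2"
   by auto
  show ?thesis
  proof (rule touch_belowI[OF oS _ Gl(1) _ _ Gl(2)])
   show "y : S" using y1 si by (simp add: S_def qy)
   show "k * ((ln (q y + si) - ln si) - La * b y) = Z y" by (simp add: Z_def qy)
   show "k * ((ln (q x + si) - ln si) - La * b x) <= Z x" if "x : S" for x
   proof -
   have "ln (q x + si) <= ln (rho g x + si)" using that qr[of x] by (intro ln_mono) (auto simp: S_def)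
   thus ?thesis unfolding Z_def using k by (intro mult_left_mono) auto
   qed
  qed
  qed
  show "w : D" using wD by (simp add: D_def)
 qed
 moreover have "k * (ln (1 / si) / 2 - C5) <= Z w"
 proof -
  have "ln (t / 2) <= ln (rho g w + si)" using Wpt(2)[OF w] t si by simp
  moreover have "La * b w <= La * (1/2)" using Wpt(3)[OF w] La by simp
  moreover have "ln (1 / si) = - ln si" by (simp add: ln_div)
  ultimately have "ln (1 / si) / 2 - C5 <= (ln (rho g w + si) - ln si) - La * b w"
  using C5_def La_def by simp
  thus ?thesis unfolding Z_def using k by (intro mult_left_mono)
 qed
 ultimately show "c * (m * (ln (1 / si) / 2 - C5)) <= v w" unfolding k_def by simp
 qed
qed

text \<open>Homogeneity carries the linear bound from the sphere of radius 1/2 to the shell between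
  \<open>t\<close> and 1.\<close>

lemma cone_harm_linear:
 fixes g :: "'a::euclidean_space => real"
 assumes e: "epi L K g" and H: "cone_harm g ph H" and t: "0 < t"
 shows "EX C>0. ALL x. 0 <= rho g x --> t <= norm x --> norm x <= 1 --> H x <= C * rho g x"
proof -
 have L: "1 <= L" "1 <= K" using epiD[OF e] by auto
 define B where "B = 2 / bd TYPE('a) L K (1/2)"
 have B: "B > 0" using bd_pos[OF L, of "1/2", where 'a='a] by (simp add: B_def)
 have ph: "ph > 0" by (rule cone_harmD(1)[OF H])
 define C where "C = 2 powr ph * (B * (1 / (2 * t)))"
 have C: "C > 0" using B t by (simp add: C_def)
 show ?thesis
 proof (rule exI[of _ C], rule conjI[OF C], intro allI impI)
 fix x assume x: "0 <= rho g x" "t <= norm x" "norm x <= 1"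
 show "H x <= C * rho g x"
 proof (cases "rho g x = 0")
  case True
  thus ?thesis using cone_harmD(3)[OF H] by simp
 next
  case False
  hence xc: "x : epicone g" using x by (simp add: epicone_def)
  define s where "s = 2 * norm x"
  have s: "0 < s" "s <= 2" "2 * t <= s" using x t by (auto simp: s_def)
  define y where "y = (1 / s) *R x"
  have y: "norm y = 1/2" "rho g y = 1 / s * rho g x" "x = s *R y"
  using s rho_scale[OF e, of "1 / s" x] by (auto simp: y_def s_def)
  have yc: "y : epicone g" using cone_scale[OF e, of "1 / s" x] s xc by (simp add: y_def)
  have "H x = s powr ph * H y" using cone_harmD(4)[OF H yc s(1)] y(3) by simp
  also have "... <= 2 powr ph * (B * (1 / (2 * t) * rho g x))"
  proof (intro mult_mono)
  show "s powr ph <= 2 powr ph" using s ph by (intro powr_mono2) auto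
  have "H y <= B * rho g y" unfolding B_def using yc by (intro cone_harm_upper[OF e H _ y(1)]) (simp add: epicone_def)
  also have "... <= B * (1 / (2 * t) * rho g x)"
   unfolding y(2) using B x s t by (intro mult_left_mono mult_right_mono divide_left_mono) auto
  finally show "H y <= B * (1 / (2 * t) * rho g x)" .
  qed (use cone_harmD(5)[OF H yc] in auto)
  finally show ?thesis by (simp add: C_def)
 qed
 qed
qed

lemma boundary_point:
 fixes g :: "'a::euclidean_space => real"
 assumes e: "epi L K g" and s: "s > 0"
 obtains z where "rho g z = 0" "fst z ~= 0" "norm z = s"
proof -
 obtain b :: 'a where "b : Basis" using nonempty_Basis by blast
 hence b: "b ~= 0" by auto
 define y where "y = (b, g b)"
 have y: "rho g y = 0" "norm y > 0" using b by (auto simp: y_def rho_def zero_prod_def)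
 show ?thesis
 proof (rule that[of "(s / norm y) *R y"])
 show "rho g ((s / norm y) *R y) = 0" using rho_scale[OF e, of "s / norm y" y] s y by simp
 show "fst ((s / norm y) *R y) ~= 0" using b s y by (simp add: y_def)
 show "norm ((s / norm y) *R y) = s" using s y by simp
 qed
qed

text \<open>Exponents above 2 reduce to 2, where the potential already diverges; the bound
  \<open>X <= 2\<close> fixes the constant.\<close>

lemma powr_neg_ge_square:
 fixes X ga :: real
 assumes "0 < X" "X <= 2" "2 <= ga"
 shows "2 powr (2 - ga) / X^2 <= X powr (- ga)"
proof -
 have "2 powr (2 - ga) * X powr (- 2) <= X powr (2 - ga) * X powr (- 2)"
 using assms by (intro mult_right_mono powr_mono2') auto
 also have "... = X powr (- ga)" by (simp flip: powr_add)
 also have "X powr (- 2) = 1 / X^2" using assms by (simp add: powr_minus_divide)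
 finally show ?thesis by simp
qed

text \<open>As \<open>H <= Cl * rho\<close>, the right-hand side is at least
  \<open>c / (rho + si)^2\<close> for every \<open>si\<close>, with \<open>c\<close> independent of
  \<open>si\<close>. The value of \<open>w\<close> at one interior point would exceed every multiple
  of \<open>ln (1 / si)\<close>.\<close>

lemma unit_problem_unsolvable:
 fixes g :: "'a::euclidean_space => real"
 assumes e: "epi L K g" and ga: "2 <= ga" and H: "cone_harm g ph H"
 defines "Om \<equiv> usec g"
 assumes cw: "continuous_on (closure Om) w" and w0: "!!x. x : frontier Om ==> w x = 0"
 and p: "poisson_distr Om w (%x. H x powr (- ga))"
 shows False
proof -
 have L: "1 <= L" "1 <= K" using epiD[OF e] by auto
 have ph0: "ph > 0" by (rule cone_harmD(1)[OF H])
 have oOm: "open Om" unfolding Om_def by (rule unit_sector[OF e])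
 have bOm: "bounded Om" by (rule bounded_subset[of "ball 0 1"]) (auto simp: Om_def)
 obtain c1 where c1: "c1 > 0" "ALL x:epicone g. c1 * norm x powr ph * (rho g x / norm x) <= H x"
 using cone_harm_lower[OF L ph0, where 'a='a] e H by blast
 have Hp: "0 < H y" if "y : epicone g" for y
 proof -
 have "0 < c1 * norm y powr ph * (rho g y / norm y)"
  using that c1 cone_nz[OF e that] by (simp add: epicone_def)
 thus ?thesis using c1(2) that by auto
 qed
 have cwOm: "continuous_on Om w" by (rule continuous_on_subset[OF cw closure_subset])
 have pm: "poisson_distr Om (%x. - w x) (%x. - (H x powr (- ga)))" by (rule poisson_distr_minus[OF p])
 have wpos: "0 <= w x" if "x : Om" for x
 proof (rule comparison_below[OF oOm bOm cw, where V="%x. 0" and q="%x. 0"])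
 have "open (Om Int w -` {..<0})" using oOm cwOm by (intro continuous_open_preimage) auto
 moreover have "Om Int w -` {..<0} = {x : Om. w x < 0}" by auto
 ultimately have op: "open {x : Om. w x < 0}" by metis
 show "asub {x : Om. w x < 0} (%x. - w x) (%x. - 0)"
  by (rule asub_poisson[OF pm op]) (auto intro!: continuous_intros continuous_on_subset[OF cwOm])
 show "touch_below (%x. 0) y 0" for y :: "'a * real"
  by (rule touch_belowI[OF open_UNIV UNIV_I has_lap_const[of UNIV 0]]) auto
 qed (use w0 that in auto)
 obtain z where z: "rho g z = 0" "fst z ~= 0" "norm z = 1/2" using boundary_point[OF e, of "1/2"] by auto
 obtain Cl where Cl: "Cl > 0" "!!x. 0 <= rho g x ==> 1/4 <= norm x ==> norm x <= 1 ==> H x <= Cl * rho g x"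
 using cone_harm_linear[OF e H, of "1/4"] by auto
 define R where "R = 1 / (4 * (1 + L))"
 have R: "0 < R" "R <= 1/4" "(1 + L) * R <= 1/4" using L by (auto simp: R_def)
 obtain r0 m C t where lb: "0 < r0" "r0 <= R" "0 < m" "0 < t" "t <= R"
 "ALL v c si. 0 <= c --> 0 < si --> si < 1 -->
  continuous_on {y. 0 <= rho g y & norm (y - z) <= r0} v -->
  (ALL y. 0 <= rho g y & norm (y - z) <= r0 --> 0 <= v y) -->
  asub {y. 0 < rho g y & norm (y - z) < r0} (%y. - v y) (%y. - (c / (rho g y + si)^2)) -->
  (ALL w:cball (z + (0, t)) (t / (8 * (1 + L))). c * (m * (ln (1 / si) / 2 - C)) <= v w)"
 using log_blowup[OF e z(1,2) R(1)] by (elim exE conjE)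
 define c where "c = Cl powr (- ga) * 2 powr (2 - ga)"
 have c: "c > 0" using Cl by (simp add: c_def)
 have near: "1/4 <= norm y" "norm y < 1" "rho g y <= 1/4" if "norm (y - z) <= r0" for y
 proof -
 have 1: "norm (y - z) <= 1/4" using that lb R by simp
 have "norm z <= norm y + norm (y - z)" using norm_triangle_ineq4[of y "y - z"] by simp
 thus "1/4 <= norm y" using 1 z(3) by simp
 have "norm y <= norm z + norm (y - z)" using norm_triangle_ineq[of z "y - z"] by simp
 thus "norm y < 1" using 1 z(3) by simp
 have "rho g y <= (1 + L) * norm (y - z)" using rho_lip[OF e, of y z] z(1) by auto
 also have "... <= (1 + L) * R" using that lb L by auto
 finally show "rho g y <= 1/4" using R by auto
 qed
 \<comment> \<open>Points of the graph are limits of upward translates in the open sector; being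
   outside the sector, they belong to its frontier, where \<open>w\<close> vanishes.\<close>
 have cl: "y : closure Om" "rho g y = 0 ==> w y = 0" if y: "0 <= rho g y" "norm y < 1" for y
 proof -
 have "(%n. y + (0, inverse (real (Suc n)))) ----> y + (0, 0)"
  by (intro tendsto_intros LIMSEQ_inverse_real_of_nat)
 hence lim: "(%n. y + (0, inverse (real (Suc n)))) ----> y" by (simp add: zero_prod_def[symmetric])
 have "\<forall>\<^sub>F n in sequentially. y + (0, inverse (real (Suc n))) : Om"
 proof -
  have "(%n. norm (y + (0, inverse (real (Suc n))))) ----> norm y" using lim by (rule tendsto_norm)
  hence "\<forall>\<^sub>F n in sequentially. norm (y + (0, inverse (real (Suc n)))) < 1" using y(2) by (rule order_tendstoD)
  thus ?thesis
  proof eventually_elim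
  case (elim n)
  have "0 < rho g (y + (0, inverse (real (Suc n))))" unfolding rho_up using y(1) by (simp add: add_nonneg_pos)
  thus ?case using elim by (simp add: Om_def epicone_def)
  qed
 qed
 thus 1: "y : closure Om"
  using Lim_in_closed_set[OF closed_closure _ _ lim] closure_subset[of Om] by (smt (verit) eventually_mono in_mono sequentially_bot)
 show "w y = 0" if "rho g y = 0"
  by (rule w0) (use 1 oOm that in \<open>simp add: frontier_def interior_open, simp add: Om_def epicone_def\<close>)
 qed
 have low: "c * (m * (ln (1 / si) / 2 - C)) <= w (z + (0, t))" if si: "0 < si" "si < 1" for si
 proof (rule lb(6)[rule_format])
 show "0 <= c" using c by simp
 show "continuous_on {y. 0 <= rho g y & norm (y - z) <= r0} w"
  by (rule continuous_on_subset[OF cw]) (use cl(1) near(2) in auto)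
 show "0 <= w y" if "0 <= rho g y & norm (y - z) <= r0" for y
 proof (cases "rho g y = 0")
  case True
  thus ?thesis using cl(2)[of y] that near(2)[of y] by simp
 next
  case False
  hence "y : Om" using that near(2)[of y] by (simp add: Om_def epicone_def)
  thus ?thesis by (rule wpos)
 qed
 show "asub {y. 0 < rho g y & norm (y - z) < r0} (%y. - w y) (%y. - (c / (rho g y + si)^2))"
 proof (rule asub_poisson[OF pm])
  show "open {y. 0 < rho g y & norm (y - z) < r0}"
  unfolding Collect_conj_eq by (intro open_Int open_Collect_less continuous_intros continuous_rho[OF e])
  show sub: "{y. 0 < rho g y & norm (y - z) < r0} <= Om" using near(2) by (auto simp: Om_def epicone_def)
  show "continuous_on {y. 0 < rho g y & norm (y - z) < r0} (%y. - w y)"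
  by (intro continuous_intros continuous_on_subset[OF cwOm sub])
  show "continuous_on {y. 0 < rho g y & norm (y - z) < r0} (%y. - (c / (rho g y + si)^2))"
  by (intro continuous_intros continuous_rho[OF e]) (use si in auto)
  fix y assume "y : {y. 0 < rho g y & norm (y - z) < r0}"
  hence y: "0 < rho g y" "norm (y - z) <= r0" by auto
  have yc: "y : epicone g" using y by (simp add: epicone_def)
  have "H y <= Cl * rho g y" using Cl(2)[of y] near[OF y(2)] y(1) by simp
  also have "... <= Cl * (rho g y + si)" using Cl si by simp
  finally have "(Cl * (rho g y + si)) powr (- ga) <= H y powr (- ga)" using Hp[OF yc] ga by (intro powr_mono2') auto
  moreover have "(Cl * (rho g y + si)) powr (- ga) = Cl powr (- ga) * (rho g y + si) powr (- ga)"
  by (simp add: powr_mult)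
  moreover have "Cl powr (- ga) * (2 powr (2 - ga) / (rho g y + si)^2) <= Cl powr (- ga) * (rho g y + si) powr (- ga)"
  by (intro mult_left_mono powr_neg_ge_square) (use y si near[OF y(2)] ga in auto)
  ultimately show "- (H y powr - ga) <= - (c / (rho g y + si)^2)" by (simp add: c_def)
 qed
 show "z + (0, t) : cball (z + (0, t)) (t / (8 * (1 + L)))" using lb L by simp
 qed (rule si)+
 define W where "W = w (z + (0, t))"
 have "0 <= W" unfolding W_def
 proof (rule wpos)
 have "norm (z + (0, t)) <= norm z + norm ((0::'a, t))" by (rule norm_triangle_ineq)
 thus "z + (0, t) : Om" using lb R z by (simp add: Om_def epicone_def rho_up)
 qed
 \<comment> \<open>The choice \<open>si = exp (- B)\<close> pushes the logarithmic lower bound above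
   the actual value \<open>W\<close>.\<close>
 define B where "B = 2 * (W / (c * m) + abs C + 1)"
 have B: "B > 0" using \<open>0 <= W\<close> c lb by (simp add: B_def add_nonneg_pos)
 have "c * (m * (ln (1 / exp (- B)) / 2 - C)) <= W" unfolding W_def using B by (intro low) auto
 hence "c * (m * (B / 2 - C)) <= W" by (simp add: ln_div)
 moreover have "c * m * (W / (c * m) + 1) <= c * m * (B / 2 - C)"
 proof (rule mult_left_mono)
 have "B / 2 = W / (c * m) + abs C + 1" by (simp add: B_def)
 thus "W / (c * m) + 1 <= B / 2 - C" by linarith
 qed (use c lb(3) in simp)
 moreover have "c * m * (W / (c * m) + 1) = W + c * m" using c lb by (simp add: field_simps)
 moreover have "0 < c * m" using c lb by simp
 ultimately show False by auto
qed

lemma asub_nonneg_mult_harm: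
 assumes e: "epi L K g" and H: "cone_harm g ph H" and S: "open S" "S <= epicone g" and k: "0 <= k"
 shows "asub S (%x. k * H x) (%_. 0)"
proof -
 obtain G where G: "has_lap (epicone g) H G (%_. 0)" using cone_harmD(8)[OF H] by blast
 have "continuous_on S H"
 by (rule continuous_on_subset[OF cone_harmD(2)[OF H]]) (use S in \<open>auto simp: epicone_def\<close>)
 thus ?thesis
 by (intro asub_classical[OF S(1) has_lap_cmul[OF has_lap_subset[OF G S(2)], of k]] continuous_intros) auto
qed

section \<open>Eigenfunctions of epigraphical cones\<close>

lemma grad_has_derivative:
 assumes "f differentiable (at x)"
 shows "(f has_derivative (%h. grad f x \<bullet> h)) (at x)"
proof -
 let ?D = "frechet_derivative f (at x)"
 have D: "(f has_derivative ?D) (at x)" using assms frechet_derivative_works by blast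
 have "?D h = grad f x \<bullet> h" for h
 proof -
 have "?D h = ?D (SUM b:Basis. (h \<bullet> b) *R b)" by (simp add: euclidean_representation)
 also have "... = (SUM b:Basis. (h \<bullet> b) * partial b f x)"
  unfolding partial_def using has_derivative_linear[OF D] by (simp add: linear_sum linear_scale)
 also have "... = grad f x \<bullet> h" unfolding inner_commute[of _ h] by (simp add: grad_def inner_sum_right mult.commute)
 finally show ?thesis .
 qed
 hence "?D = (%h. grad f x \<bullet> h)" by blast
 thus ?thesis using D by simp
qed

lemma norm_grad_le:
 assumes "f differentiable (at x)" and lip: "!!y. abs (f y - f x) <= L * norm (y - x)" and L: "0 <= L"
 shows "norm (grad f x) <= L"
proof -
 let ?v = "grad f x"
 have "DERIV (%t. f (x + t *R ?v)) 0 :> ?v \<bullet> ?v"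
 by (rule has_derivative_line[OF grad_has_derivative[OF assms(1)]])
 hence "((%t. (f (x + t *R ?v) - f x) / t) ---> ?v \<bullet> ?v) (at 0)"
 by (simp add: DERIV_def)
 moreover have "\<forall>\<^sub>F t in at 0. (f (x + t *R ?v) - f x) / t <= L * norm ?v"
 proof (rule eventually_at_topological[THEN iffD2], intro exI[of _ UNIV] conjI ballI impI)
 fix t :: real assume t: "t ~= 0"
 have "abs (f (x + t *R ?v) - f x) <= L * norm ?v * abs t" using lip[of "x + t *R ?v"] by (simp add: mult_ac)
 hence "abs ((f (x + t *R ?v) - f x) / t) <= L * norm ?v" using t by (simp add: pos_divide_le_eq)
 thus "(f (x + t *R ?v) - f x) / t <= L * norm ?v" by linarith
 qed auto
 ultimately have "?v \<bullet> ?v <= L * norm ?v" by (intro tendsto_upperbound) auto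
 hence "norm ?v * norm ?v <= L * norm ?v" by (simp flip: power2_norm_eq_inner add: power2_eq_square)
 thus ?thesis using L by (cases "?v = 0") auto
qed

lemma lip_seminorm_le:
 assumes "M-lipschitz_on S f" "x : S" "y : S"
 shows "dist (f x) (f y) <= lip_seminorm S f * dist x y"
proof (cases "x = y")
 case False
 have "bdd_above {dist (f x) (f y) / dist x y | x y. x : S & y : S & x ~= y}"
 using lipschitz_onD[OF assms(1)] by (intro bdd_aboveI[of _ M]) (auto simp: divide_le_eq)
 hence "dist (f x) (f y) / dist x y <= lip_seminorm S f"
 unfolding lip_seminorm_def using assms False by (intro cSup_upper) auto
 thus ?thesis using False by (simp add: divide_le_eq)
qed simp

lemma C01_norm_bounds:
 assumes l: "M-lipschitz_on S f" and b: "bounded S" and x: "x : S" and y: "y : S" "x ~= y"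
 shows "abs (f z) <= C01_norm S f | z ~: S" "lip_seminorm S f <= C01_norm S f" "0 <= C01_norm S f"
proof -
 obtain B where B: "!!z. z : S ==> dist z x <= B"
 using bounded_any_center[of S x] b by (auto simp: dist_commute)
 have "bdd_above ((%z. abs (f z)) ` S)"
 proof (rule bdd_aboveI2[of _ _ "abs (f x) + M * B"])
 fix z assume z: "z : S"
 have "dist (f z) (f x) <= M * dist z x" by (rule lipschitz_onD[OF l z x])
 also have "... <= M * B" using B[OF z] lipschitz_on_nonneg[OF l] by (intro mult_left_mono) auto
 finally show "abs (f z) <= abs (f x) + M * B" by (simp add: dist_real_def)
 qed
 hence 1: "abs (f z) <= (SUP z\<in>S. abs (f z))" if "z : S" for z using that by (rule cSUP_upper[rotated])
 have "0 <= lip_seminorm S f * dist x y" using lip_seminorm_le[OF l x y(1)] zero_le_dist order_trans by blast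
 hence 2: "0 <= lip_seminorm S f" using y(2) by (simp add: zero_le_mult_iff)
 show "abs (f z) <= C01_norm S f | z ~: S" using 1[of z] 2 by (auto simp: C01_norm_def)
 show "lip_seminorm S f <= C01_norm S f" "0 <= C01_norm S f" using 1[OF x] 2 by (auto simp: C01_norm_def)
qed

text \<open>Split the increment into a change of direction and a change of length. Normalising the
  two vectors doubles their distance at worst, and the length part adds one more, hence the factor
  3.\<close>

lemma homogeneous_lipschitz:
 fixes g :: "'a::euclidean_space => real"
 assumes hom: "!!t x. 0 <= t ==> g (t *R x) = t * g x"
 and bd: "!!x. norm x = 1 ==> abs (g x) <= L" and lip: "!!x y. norm x = 1 ==> norm y = 1 ==> abs (g x - g y) <= L * norm (x - y)"
 and L: "0 <= L"
 shows "abs (g x - g y) <= 3 * L * norm (x - y)"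
proof -
 have g: "g x = norm x * g (x /\<^sub>R norm x)" for x using hom[of "norm x" "x /\<^sub>R norm x"] by (cases "x = 0") auto
 have 0: "g 0 = 0" using hom[of 0 0] by simp
 have bd': "abs (g x) <= L * norm x" for x
 proof (cases "x = 0")
 case False
 hence "norm x * abs (g (x /\<^sub>R norm x)) <= norm x * L" by (intro mult_left_mono bd) auto
 thus ?thesis using g[of x] by (simp add: abs_mult mult.commute)
 qed (simp add: 0)
 show ?thesis
 proof (cases "x = 0 | y = 0")
 case True
 thus ?thesis using bd'[of x] bd'[of y] 0 L by auto
 next
 case False
 define e where "e = x /\<^sub>R norm x"
 define f where "f = y /\<^sub>R norm y"
 have ef: "norm e = 1" "norm f = 1" "x = norm x *R e" "y = norm y *R f" using False by (auto simp: e_def f_def)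
 have d: "norm x *R (e - f) = x - y + (norm y - norm x) *R f"
  using ef(3,4) by (metis (no_types, lifting) add_diff_eq diff_add_cancel scaleR_left_diff_distrib scaleR_right_diff_distrib)
 have n: "abs (norm y - norm x) <= norm (x - y)" using norm_triangle_ineq3[of y x] by (simp add: norm_minus_commute)
 have "norm x * norm (e - f) = norm (norm x *R (e - f))" by simp
 also have "... <= norm (x - y) + abs (norm y - norm x)" unfolding d using norm_triangle_ineq[of "x - y" "(norm y - norm x) *R f"] ef by simp
 finally have 1: "norm x * norm (e - f) <= 2 * norm (x - y)" using n by auto
 have "g x - g y = norm x * (g e - g f) - (norm y - norm x) * g f" using g[of x] g[of y] by (simp add: e_def f_def algebra_simps)
 hence "abs (g x - g y) <= norm x * abs (g e - g f) + abs (norm y - norm x) * abs (g f)"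
  using abs_triangle_ineq4[of "norm x * (g e - g f)" "(norm y - norm x) * g f"] by (simp add: abs_mult)
 also have "... <= norm x * (L * norm (e - f)) + norm (x - y) * L"
  by (intro add_mono mult_mono lip bd n) (use ef in auto)
 also have "norm x * (L * norm (e - f)) <= L * (2 * norm (x - y))" using mult_left_mono[OF 1 L] by (simp add: mult_ac)
 finally show ?thesis by auto
 qed
qed

text \<open>The mean value inequality for \<open>g\<close> minus its linear part at
  \<open>z\<close>: on the ball of radius \<open>norm (x - z)\<close> the gradient of that
  difference is at most \<open>K * norm (x - z)\<close>.\<close>

lemma C11_linearisation:
 fixes g :: "'a::euclidean_space => real"
 assumes diff: "!!y. y : ball z r ==> g differentiable (at y)"
 and lip: "!!y. y : ball z r ==> norm (grad g y - grad g z) <= K * norm (y - z)" and x: "x : ball z r"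
 shows "abs (g x - g z - grad g z \<bullet> (x - z)) <= K * (norm (x - z))^2"
proof (cases "x = z")
 case False
 let ?G = "cball z (norm (x - z))"
 have sub: "?G <= ball z r" using x by (auto simp: dist_norm norm_minus_commute)
 have "norm ((g (z + (x - z)) - grad g z \<bullet> (z + (x - z))) - (g z - grad g z \<bullet> z)) <= norm (x - z) * (K * norm (x - z))"
 proof (rule differentiable_bound_segment[where G="?G" and f="%y. g y - grad g z \<bullet> y" and f'="%y h. (grad g y - grad g z) \<bullet> h"])
 show "z + t *R (x - z) : ?G" if "t : {0..1}" for t
  using that by (auto simp: dist_norm intro!: mult_left_le_one_le)
 have K: "0 <= K"
 proof -
  have "0 <= K * norm (x - z)" using lip[OF x] norm_ge_zero order_trans by blast
  thus ?thesis using False by (simp add: zero_le_mult_iff)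
 qed
 have on: "onorm (%h. (grad g y - grad g z) \<bullet> h) <= K * norm (x - z)" if y: "y : ?G" for y
 proof (rule onorm_bound)
  have "norm (grad g y - grad g z) <= K * norm (x - z)"
  using order_trans[OF lip[of y] mult_left_mono[OF _ K, of "norm (y - z)" "norm (x - z)"]] subsetD[OF sub y] y
  by (simp add: dist_norm norm_minus_commute)
  thus "norm ((grad g y - grad g z) \<bullet> h) <= K * norm (x - z) * norm h" for h
  using Cauchy_Schwarz_ineq2[of "grad g y - grad g z" h] by (smt (verit) mult_right_mono norm_ge_zero real_norm_def)
 qed (use K in simp)
 show "onorm (%h. (grad g (z + t *R (x - z)) - grad g z) \<bullet> h) <= K * norm (x - z)" if "t : {0..1}" for t
  by (rule on) (use that in \<open>auto simp: dist_norm intro!: mult_left_le_one_le\<close>)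
 fix y assume "y : ?G"
 hence yb: "y : ball z r" using sub by blast
 show "((%y. g y - grad g z \<bullet> y) has_derivative (%h. (grad g y - grad g z) \<bullet> h)) (at y within ?G)"
  by (rule has_derivative_at_withinI)
  (auto intro!: derivative_eq_intros grad_has_derivative[OF diff[OF yb]] simp: inner_diff_left)
 qed
 thus ?thesis by (simp add: power2_eq_square algebra_simps)
qed simp

text \<open>The new constants depend on \<open>L\<close> and \<open>K\<close> alone, so uniformity
  in \<open>epi\<close> is uniformity in the original norms. One sphere suffices; homogeneity
  transports the paraboloids to all other radii.\<close>

lemma epi_of_C11:
 fixes Sg :: "('a::euclidean_space * real) set" and L K :: real
 assumes C: "C11_epigraphical_cone Sg L K"
 defines "L' \<equiv> max 1 (3 * L)"
 defines "K' \<equiv> max 1 (3/2 * max K (4 * L'))"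
 shows "EX g. epi L' K' g & epicone g = cone_over Sg"
proof -
 define S where "S = (ball 0 2 - ball 0 1 :: 'a set)"
 obtain g :: "'a => real" and M1 M2 where co: "cone_over Sg = {(x', xn). xn > g x'}" and hom: "ALL t>=0. ALL x'. g (t *R x') = t * g x'"
 and M1: "M1-lipschitz_on S g" and df: "ALL x':S. g differentiable (at x')"
 and M2: "M2-lipschitz_on S (grad g)" and LK: "L = C01_norm S g" "K = lip_seminorm S (grad g)"
 using C unfolding C11_epigraphical_cone_def S_def by blast
 obtain b :: 'a where b: "b : Basis" using nonempty_Basis by blast
 have bS: "b : S" "- b : S" "b ~= - b" using b by (auto simp: S_def eq_neg_iff_add_eq_0 simp flip: scaleR_2)
 have bS': "bounded S" unfolding S_def by auto
 note Cb = C01_norm_bounds[OF M1 bS' bS, folded LK]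
 have unitS: "x : S" if "norm x = 1" for x using that by (simp add: S_def)
 have lip: "abs (g x - g y) <= 3 * L * norm (x - y)" for x y
 proof (rule homogeneous_lipschitz)
 fix x y :: 'a assume xy: "norm x = 1" "norm y = 1"
 show "abs (g x) <= L" using Cb(1)[of x] unitS[OF xy(1)] by blast
 have "abs (g x - g y) <= lip_seminorm S g * norm (x - y)"
  using lip_seminorm_le[OF M1 unitS[OF xy(1)] unitS[OF xy(2)]] by (simp add: dist_norm)
 also have "... <= L * norm (x - y)" by (rule mult_right_mono[OF Cb(2)]) simp
 finally show "abs (g x - g y) <= L * norm (x - y)" .
 qed (use hom Cb(3) in auto)
 have L': "1 <= L'" by (simp add: L'_def)
 have lip': "abs (g x - g y) <= L' * norm (x - y)" for x y
 by (rule order_trans[OF lip mult_right_mono]) (auto simp: L'_def)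
 define K1 where "K1 = max K (4 * L')"
 \<comment> \<open>The radius 3/2 is the middle of the annulus, so the ball of radius 1/2 stays
   inside. Beyond that ball the Lipschitz bound is already quadratic, with constant
   \<open>4 * L'\<close>.\<close>
 have para1: "norm (grad g z) <= L' & (ALL x. abs (g x - g z - grad g z \<bullet> (x - z)) <= K1 * (norm (x - z))^2)" if z: "norm z = 3/2" for z
 proof (intro conjI allI)
 have zS: "z : S" using z by (simp add: S_def)
 have sub: "ball z (1/2) <= S"
 proof
  fix y assume "y : ball z (1/2)"
  hence "norm (y - z) < 1/2" by (simp add: dist_norm norm_minus_commute)
  thus "y : S" using norm_triangle_ineq3[of y z] z by (simp add: S_def) linarith
 qed
 show v: "norm (grad g z) <= L'" by (rule norm_grad_le) (use df zS lip' L' in auto)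
 fix x
 show "abs (g x - g z - grad g z \<bullet> (x - z)) <= K1 * (norm (x - z))^2"
 proof (cases "x : ball z (1/2)")
  case True
  have "abs (g x - g z - grad g z \<bullet> (x - z)) <= K * (norm (x - z))^2"
  proof (rule C11_linearisation[OF _ _ True])
  show "norm (grad g y - grad g z) <= K * norm (y - z)" if "y : ball z (1/2)" for y
   using lip_seminorm_le[OF M2 _ zS, of y] sub that LK(2) by (auto simp: dist_norm)
  qed (use df sub in blast)
  also have "... <= K1 * (norm (x - z))^2" by (rule mult_right_mono) (auto simp: K1_def)
  finally show ?thesis .
 next
  case False
  hence far: "1/2 <= norm (x - z)" by (simp add: dist_norm norm_minus_commute)
  have "abs (grad g z \<bullet> (x - z)) <= L' * norm (x - z)"
  by (rule order_trans[OF Cauchy_Schwarz_ineq2 mult_right_mono[OF v]]) simp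
  hence "abs (g x - g z - grad g z \<bullet> (x - z)) <= 2 * L' * norm (x - z)" using lip'[of x z] by simp
  also have "... <= 2 * L' * norm (x - z) * (2 * norm (x - z))" using far L' mult_left_mono[of 1 "2 * norm (x - z)" "2 * L' * norm (x - z)"] by simp
  also have "... = (4 * L') * (norm (x - z))^2" by (simp add: power2_eq_square)
  also have "... <= K1 * (norm (x - z))^2" by (rule mult_right_mono) (auto simp: K1_def)
  finally show ?thesis .
 qed
 qed
 have para: "EX v. norm v <= L' & (ALL x. abs (g x - g z - v \<bullet> (x - z)) <= K' / norm z * (norm (x - z))^2)" if z: "z ~= 0" for z
 proof -
 define s where "s = 2 * norm z / 3"
 have s: "s > 0" using z by (simp add: s_def)
 define z0 where "z0 = (1 / s) *R z"
 have z0: "norm z0 = 3/2" "z = s *R z0" using s by (auto simp: z0_def s_def)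
 show ?thesis
 proof (intro exI[of _ "grad g z0"] conjI allI)
  fix x :: 'a
  define y where "y = (1 / s) *R x"
  have xy: "x = s *R y" using s by (simp add: y_def)
  have "g x - g z - grad g z0 \<bullet> (x - z) = s * (g y - g z0 - grad g z0 \<bullet> (y - z0))"
  using hom s by (simp add: xy z0(2) algebra_simps)
  hence "abs (g x - g z - grad g z0 \<bullet> (x - z)) = s * abs (g y - g z0 - grad g z0 \<bullet> (y - z0))" using s by (simp add: abs_mult)
  also have "... <= s * (K1 * (norm (y - z0))^2)" using s para1[OF z0(1)] by auto
  also have "... = K1 / s * (norm (x - z))^2"
  using s by (simp add: xy z0(2) power2_eq_square flip: scaleR_diff_right)
  also have "... = (3/2 * K1) / norm z * (norm (x - z))^2" by (simp add: s_def)
  also have "... <= K' / norm z * (norm (x - z))^2"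
  by (intro mult_right_mono divide_right_mono) (auto simp: K'_def K1_def)
  finally show "abs (g x - g z - grad g z0 \<bullet> (x - z)) <= K' / norm z * (norm (x - z))^2" .
 qed (use para1[OF z0(1)] in blast)
 qed
 have "epi L' K' g" unfolding epi_def using L' hom lip' para by (auto simp: K'_def)
 moreover have "epicone g = cone_over Sg" by (auto simp: co epicone_def rho_def)
 ultimately show ?thesis by blast
qed

text \<open>A boundary point of the cone is approached from inside by raising it vertically and
  projecting back to the sphere.\<close>

lemma sector_of_epicone:
 fixes Sg :: "('a::euclidean_space * real) set"
 assumes e: "epi L K g" and c: "epicone g = cone_over Sg" and S: "Sg <= sphere 0 1"
 shows "x : Sg \<longleftrightarrow> norm x = 1 & x : epicone g"
 "x : closure Sg \<longleftrightarrow> norm x = 1 & 0 <= rho g x"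
 "norm x = 1 ==> rho g x = 0 ==> x : top_of_set (sphere 0 1) frontier_of Sg"
proof -
 show S1: "x : Sg \<longleftrightarrow> norm x = 1 & x : epicone g" for x
 using subsetD[OF S, of x] unfolding c cone_over_def by auto
 have cl: "closure Sg <= sphere 0 1 Int {x. 0 <= rho g x}"
 proof (rule closure_minimal)
 show "Sg <= sphere 0 1 Int {x. 0 <= rho g x}" using S1 by (auto simp: epicone_def)
 show "closed (sphere 0 1 Int {x. 0 <= rho g x})"
  by (intro closed_Int closed_sphere closed_Collect_le continuous_intros continuous_rho[OF e])
 qed
 have cl': "x : closure Sg" if x: "norm x = 1" "0 <= rho g x" for x
 proof -
 define y where "y = (%t::real. x + (0, t))"
 have y: "(y ---> x + (0, 0)) (at_right 0)" unfolding y_def by (intro tendsto_intros)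
 have "((%t. y t /\<^sub>R norm (y t)) ---> (x + (0, 0)) /\<^sub>R norm (x + (0, 0))) (at_right 0)"
  by (intro tendsto_intros y) (use x in \<open>auto simp flip: zero_prod_def\<close>)
 hence "((%t. y t /\<^sub>R norm (y t)) ---> x) (at_right 0)" using x by (simp flip: zero_prod_def)
 moreover have "\<forall>\<^sub>F t in at_right 0. y t /\<^sub>R norm (y t) : closure Sg"
 proof (rule eventually_at_rightI[of 0 1])
  fix t :: real assume "t : {0<..<1}"
  hence "y t : epicone g" using x by (simp add: y_def epicone_def rho_up)
  moreover from this have "norm (y t) > 0" using cone_nz[OF e] by auto
  ultimately have "y t /\<^sub>R norm (y t) : Sg" using cone_scale[OF e, of "inverse (norm (y t))" "y t"] by (simp add: S1)
  thus "y t /\<^sub>R norm (y t) : closure Sg" using closure_subset by blast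
 qed simp
 ultimately show ?thesis by (intro Lim_in_closed_set[of "closure Sg"]) auto
 qed
 show "x : closure Sg \<longleftrightarrow> norm x = 1 & 0 <= rho g x" for x using cl cl'[of x] by auto
 show "x : top_of_set (sphere 0 1) frontier_of Sg" if "norm x = 1" "rho g x = 0"
 proof -
 have "x ~: top_of_set (sphere 0 1) interior_of Sg"
  using interior_of_subset[of "top_of_set (sphere 0 1)" Sg] S1[of x] that by (auto simp: epicone_def)
 moreover have "x : top_of_set (sphere 0 1) closure_of Sg"
  using cl'[of x] that S by (simp add: closure_of_subtopology Int_absorb1)
 ultimately show ?thesis by (simp add: frontier_of_def)
 qed
qed

section \<open>Eigenfunctions and their homogeneous extensions\<close>

lemma hom0_ext_scale: "t > 0 ==> hom0_ext E (t *R x) = hom0_ext E x"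
proof -
 assume "t > 0"
 hence "inverse (norm (t *R x)) * t = inverse (norm x)" by simp
 thus ?thesis unfolding hom0_ext_def scaleR_scaleR by (simp only:)
qed

text \<open>The eigenvalue equation is given only on the sphere; degree 0 homogeneity gives the
  factor \<open>1 / (norm x)^2\<close> elsewhere and makes the radial derivative vanish.\<close>

lemma eigenfunction_calculus:
 fixes Sg :: "('a::euclidean_space * real) set"
 assumes e: "epi L K g" and c: "epicone g = cone_over Sg" and S: "Sg <= sphere 0 1"
 and E: "dirichlet_eigenfunction Sg mu E"
 shows "EX G h. D2on (epicone g) (hom0_ext E) G h & continuous_on (epicone g) G &
  (ALL b:Basis. continuous_on (epicone g) (h b)) &
  (ALL x:epicone g. (SUM b:Basis. h b x) = - mu * hom0_ext E x / (norm x)^2 & G x \<bullet> x = 0)"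
proof -
 let ?f = "hom0_ext E"
 have C2: "Ck_on 2 (epicone g) ?f" and ev: "!!x. x : Sg ==> - laplacian ?f x = mu * E x"
 using E unfolding dirichlet_eigenfunction_def laplace_beltrami_def c by auto
 have df: "?f differentiable (at x)" if "x : epicone g" for x using C2 that by (simp add: numeral_2_eq_2)
 have dp: "partial b ?f differentiable (at x)" if "x : epicone g" "b : Basis" for x b using C2 that by (simp add: numeral_2_eq_2)
 have cp: "continuous_on (epicone g) (partial b (partial b ?f))" if "b : Basis" for b using C2 that by (simp add: numeral_2_eq_2)
 have D: "D2on (epicone g) ?f (grad ?f) (%b. partial b (partial b ?f))" by (rule D2on_C2[OF df dp])
 have cG: "continuous_on (epicone g) (grad ?f)" unfolding grad_def
 proof (intro continuous_intros)
 show "continuous_on (epicone g) (partial b ?f)" if "b : Basis" for b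
  by (intro continuous_at_imp_continuous_on ballI differentiable_imp_continuous_within dp that)
 qed
 have "laplacian ?f x = - mu * ?f x / (norm x)^2 & grad ?f x \<bullet> x = 0" if x: "x : epicone g" for x
 proof
 define r where "r = inverse (norm x)"
 have r: "r > 0" using cone_nz[OF e x] by (simp add: r_def)
 have sc: "{y. r *R y : epicone g} = epicone g" using cone_scale[OF e r] by auto
 have "D2on (epicone g) (%y. ?f (r *R y)) (%y. r *R grad ?f (r *R y)) (%b y. r^2 * partial b (partial b ?f) (r *R y))"
  using D2on_scale[OF D, of r] unfolding sc .
 hence "D2on (epicone g) ?f (%y. r *R grad ?f (r *R y)) (%b y. r^2 * partial b (partial b ?f) (r *R y))"
  unfolding hom0_ext_scale[OF r] .
 note D2on_unique[OF D this open_cone[OF e] x]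
 hence l: "laplacian ?f x = r^2 * laplacian ?f (r *R x)" by (simp add: laplacian_def sum_distrib_left)
 have "r *R x : Sg" using x r cone_scale[OF e r] sector_of_epicone(1)[OF e c S, of "r *R x"] by (simp add: r_def)
 from ev[OF this] have "laplacian ?f (r *R x) = - mu * ?f x" by (simp add: hom0_ext_def r_def)
 thus "laplacian ?f x = - mu * ?f x / (norm x)^2" unfolding l by (simp add: r_def power_inverse divide_inverse)
 have "DERIV (%t. ?f (x + t *R x)) 0 :> grad ?f x \<bullet> x"
  by (rule has_derivative_line[OF grad_has_derivative[OF df[OF x]]])
 moreover have "DERIV (%t. ?f (x + t *R x)) 0 :> 0"
 proof (rule DERIV_cong_ev[OF refl _ refl, THEN iffD2])
  have "\<forall>\<^sub>F t in nhds (0::real). t : {-1<..}" by (rule eventually_nhds_in_open) auto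
  thus "\<forall>\<^sub>F t in nhds 0. ?f (x + t *R x) = ?f x"
  proof eventually_elim
  case (elim t)
  have "x + t *R x = (1 + t) *R x" by (simp add: scaleR_add_left)
  thus ?case using hom0_ext_scale[of "1 + t" E x] elim by simp
  qed
 qed simp
 ultimately show "grad ?f x \<bullet> x = 0" by (rule DERIV_unique)
 qed
 thus ?thesis using D cG cp unfolding laplacian_def by blast
qed

text \<open>On the unit sphere the function \<open>- exp (- al x\<^sub>n)\<close> is superharmonic away from the south pole if
 \<open>al\<close> is large.\<close>

lemma exp_height_laplacian:
 fixes g :: "'a::euclidean_space => real"
 assumes e: "epi L K g"
 shows "EX V G l. has_lap (epicone g) V G l & (ALL x:epicone g. 0 < V x & (norm x = 1 --> l x < 0)) &
 continuous_on (sphere 0 1) V & (ALL x. norm x = 1 --> 0 < V x) & (ALL t>0. ALL x. V (t *R x) = V x)"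
proof -
 define d where "d = real DIM('a)"
 have d: "d >= 1" unfolding d_def using DIM_positive[where 'a='a] by auto
 define al where "al = (d + 1) * (1 + L^2)"
 have al: "al > 0" using d by (simp add: al_def add_pos_nonneg)
 define s where "s = (%x::'a * real. (0, 1) \<bullet> x * norm x powr (- 1))"
 define F where "F = (%t. 2 * exp al - exp (- al * t))"
 define Gs where "Gs = (%x::'a * real. ((0, 1) \<bullet> x) *R ((- 1 * norm x powr (- 1 - 2)) *R x) + norm x powr (- 1) *R (0, 1))"
 define ls where "ls = (%x::'a * real. ((0, 1) \<bullet> x) * (- 1 * (- 1 + real DIM('a * real) - 2) * norm x powr (- 1 - 2))
  + norm x powr (- 1) * 0 + 2 * ((0, 1) \<bullet> ((- 1 * norm x powr (- 1 - 2)) *R x)))"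
 have nz: "0 ~: epicone g" using cone_nz[OF e] by blast
 have "has_lap (epicone g) s Gs ls" unfolding s_def Gs_def ls_def
 by (rule has_lap_mult[OF has_lap_inner has_lap_norm_powr[OF nz]])
 hence V: "has_lap (epicone g) (%x. F (s x)) (%x. (al * exp (- al * s x)) *R Gs x)
  (%x. - (al^2) * exp (- al * s x) * (Gs x \<bullet> Gs x) + al * exp (- al * s x) * ls x)"
 by (rule has_lap_comp) (auto simp: F_def power2_eq_square intro!: derivative_eq_intros)
 have Fpos: "0 < F (s x)" for x
 proof -
 have "abs ((0, 1) \<bullet> x) <= norm x" using norm_fst_snd(2)[of x] by (cases x) simp
 hence "abs (s x) <= 1" by (cases "x = 0") (auto simp: s_def)
 hence "- al * s x <= al * 1" using mult_left_mono[of "- s x" 1 al] al by simp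
 hence "exp (- al * s x) <= exp al" by simp
 thus ?thesis using exp_gt_zero[of al] unfolding F_def by linarith
 qed
 have l: "- (al^2) * exp (- al * s x) * (Gs x \<bullet> Gs x) + al * exp (- al * s x) * ls x < 0" if x: "x : epicone g" "norm x = 1" for x
 proof -
 define t where "t = snd x"
 have t: "(norm (fst x))^2 + t^2 = 1" using x(2) norm_prod_def[of x] by (simp add: t_def)
 have i: "(0, 1) \<bullet> x = t" by (cases x) (simp add: t_def)
 have xx: "x \<bullet> x = 1" using x(2) by (simp add: norm_eq_1)
 have G: "Gs x = (0, 1) - t *R x" using x(2) by (simp add: Gs_def i)
 have "(v - t *R x) \<bullet> (v - t *R x) = v \<bullet> v - 2 * t * (v \<bullet> x) + t^2 * (x \<bullet> x)" for v
  by (simp add: inner_diff_right inner_commute power2_eq_square)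
 from this[of "(0, 1)"] have GG: "Gs x \<bullet> Gs x = 1 - t^2" unfolding G i xx by (simp add: power2_eq_square)
 have lsx: "ls x = - d * t" using x(2) by (simp add: ls_def i d_def algebra_simps)
 \<comment> \<open>For negative height the Lipschitz bound on \<open>g\<close> keeps the cone off
   the south pole: \<open>1 < (1 + L^2) * (1 - t^2)\<close>. So
   \<open>al = (d + 1) * (1 + L^2)\<close> beats the drift, which is at least
   \<open>- d\<close>.\<close>
 have "0 < al * (1 - t^2) + d * t"
 proof (cases "t < 0")
  case True
  have "- g (fst x) <= L * norm (fst x)" using epiD(4)[OF e, of "fst x" 0] epiD(3)[OF e, of 0 0] by simp
  hence "- t < L * norm (fst x)" using x(1) by (simp add: epicone_def rho_def t_def)
  hence "(- t)^2 < (L * norm (fst x))^2" using True by (intro power_strict_mono) auto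
  hence "1 - (norm (fst x))^2 < L^2 * (norm (fst x))^2" using t by (simp add: power_mult_distrib)
  moreover have q: "1 - t^2 = (norm (fst x))^2" using t by simp
  ultimately have "1 < (1 + L^2) * (1 - t^2)" unfolding q by (simp add: algebra_simps)
  from mult_strict_left_mono[OF this, of "d + 1"] have "d + 1 < al * (1 - t^2)" using d by (simp add: al_def)
  moreover have "t^2 <= 1" using t zero_le_power2[of "norm (fst x)"] by linarith
  hence "- 1 <= t" using abs_square_le_1[of t] by simp
  hence "- d <= d * t" using mult_left_mono[of "- 1" t d] d by simp
  ultimately show ?thesis by auto
 next
  case False
  have "t^2 <= 1" using t zero_le_power2[of "norm (fst x)"] by linarith
  hence "0 <= al * (1 - t^2)" using al by simp
  moreover have "0 <= d * t" using False d by simp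
  moreover have "t = 0 ==> 0 < al * (1 - t^2)" using al by simp
  moreover have "t ~= 0 ==> 0 < d * t" using False d by simp
  ultimately show ?thesis by linarith
 qed
 hence "0 < al * exp (- al * s x) * (al * (1 - t^2) + d * t)" using al by simp
 thus ?thesis unfolding GG lsx by (simp add: algebra_simps power2_eq_square)
 qed
 have "continuous_on (sphere 0 1) (%x. F (s x))" unfolding F_def s_def by (intro continuous_intros) auto
 moreover have "F (s (r *R x)) = F (s x)" if "r > 0" for r x
 using that by (simp add: s_def)
 ultimately show ?thesis using l Fpos by (intro exI conjI ballI impI allI) (rule V, auto)
qed

text \<open>At a maximum point of \<open>E / V\<close>, which is interior because \<open>E\<close>
  vanishes on the boundary, the extension of \<open>E\<close> is touched from above by a multiple of
  the strictly superharmonic \<open>V\<close>; the sign of the Laplacian there forces a positive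
  eigenvalue.\<close>

lemma eigenvalue_positive:
 fixes Sg :: "('a::euclidean_space * real) set"
 assumes e: "epi L K g" and c: "epicone g = cone_over Sg" and S: "Sg <= sphere 0 1"
 and E: "dirichlet_eigenfunction Sg mu E" and nn: "!!x. x : Sg ==> 0 <= E x"
 shows "0 < mu"
proof -
 note sec = sector_of_epicone[OF e c S]
 obtain V GV lV where V: "has_lap (epicone g) V GV lV" "!!x. x : epicone g ==> norm x = 1 ==> lV x < 0"
 "continuous_on (sphere 0 1) V" "!!x. norm x = 1 ==> 0 < V x" "!!t x. t > 0 ==> V (t *R x) = V x"
 proof -
 from exp_height_laplacian[OF e] show thesis
  by (elim exE conjE) (rule that, assumption, auto)
 qed
 obtain G h where D: "D2on (epicone g) (hom0_ext E) G h"
 "!!x. x : epicone g ==> (SUM b:Basis. h b x) = - mu * hom0_ext E x / (norm x)^2"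
 using eigenfunction_calculus[OF e c S E] by auto
 have cE: "continuous_on (closure Sg) E" and E0: "!!x. norm x = 1 ==> rho g x = 0 ==> E x = 0"
 using E sec(3) by (simp_all add: dirichlet_eigenfunction_def)
 obtain th where th: "th : Sg" "0 < E th" 
 proof -
 have "EX th:Sg. E th ~= 0" using E by (simp add: dirichlet_eigenfunction_def)
 thus thesis using nn that by (metis order_le_less)
 qed
 have cs: "closure Sg <= sphere 0 1" using sec(2) by auto
 have "compact (closure Sg)" using cs by (meson bounded_sphere bounded_subset closed_closure compact_eq_bounded_closed)
 moreover have "continuous_on (closure Sg) (%x. E x / V x)"
 by (intro continuous_intros cE continuous_on_subset[OF V(3) cs]) (metis V(4) sec(2) less_irrefl)
 ultimately obtain p where p: "p : closure Sg" "!!x. x : closure Sg ==> E x / V x <= E p / V p"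
 using continuous_attains_sup[of "closure Sg" "%x. E x / V x"] th(1) by blast
 define k where "k = E p / V p"
 have "0 < E th / V th" using th sec(1) V(4) by simp
 also have "... <= k" unfolding k_def using p(2)[of th] th closure_subset[of Sg] by blast
 finally have k: "k > 0" .
 have np: "norm p = 1" "0 <= rho g p" using p(1) sec(2) by auto
 have "E p ~= 0" using k by (auto simp: k_def)
 hence pc: "p : epicone g" using E0[OF np(1)] np(2) by (auto simp: epicone_def less_le)
 have "has_lap (epicone g) (hom0_ext E) G (%x. - mu * hom0_ext E x / (norm x)^2)"
 unfolding has_lap_def using D by auto
 note has_lap_add[OF this has_lap_cmul[OF V(1), of "- k"]]
 moreover have "hom0_ext E y + - k * V y <= hom0_ext E p + - k * V p" if y: "y : epicone g" for y
 proof -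
 define z where "z = inverse (norm y) *R y"
 have r: "0 < inverse (norm y)" using cone_nz[OF e y] by simp
 have z: "norm z = 1" "z : epicone g" using cone_nz[OF e y] cone_scale[OF e r] y by (auto simp: z_def)
 hence "z : Sg" using sec(1) by simp
 hence "E z / V z <= k" using p(2)[of z] closure_subset[of Sg] by (auto simp: k_def)
 hence "E z <= k * V z" using V(4)[OF z(1)] by (simp add: divide_le_eq)
 moreover have "hom0_ext E y = E z" "V y = V z" using V(5)[OF r, of y] by (simp_all add: hom0_ext_def z_def)
 moreover have "hom0_ext E p = k * V p" using V(4)[OF np(1)] np(1) by (simp add: k_def hom0_ext_def)
 ultimately show ?thesis by simp
 qed
 ultimately have "- mu * hom0_ext E p / (norm p)^2 + - k * lV p <= 0"
 by (rule has_lap_local_max[OF _ open_cone[OF e] pc])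
 moreover have "k * lV p < 0" using k V(2)[OF pc np(1)] by (simp add: mult_pos_neg)
 ultimately have "0 < mu * E p" using np(1) by (simp add: hom0_ext_def)
 moreover have "0 < E p" using k V(4)[OF np(1)] by (simp add: k_def zero_less_divide_iff)
 ultimately show ?thesis by (simp add: zero_less_mult_iff)
qed

text \<open>For a positive eigenvalue the quadratic has exactly one positive root, so the definite
  description in \<open>frequency\<close> denotes it.\<close>

lemma frequency_root:
 fixes Sg :: "('a::euclidean_space * real) set"
 assumes "0 < first_eigenvalue Sg"
 shows "0 < frequency Sg" "frequency Sg * (frequency Sg + real DIM('a * real) - 2) = first_eigenvalue Sg"
proof -
 define m where "m = real DIM('a * real) - 2"
 have m: "0 <= m" by (simp add: m_def)
 define mu where "mu = first_eigenvalue Sg"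
 define ph where "ph = (sqrt (m^2 + 4 * mu) - m) / 2"
 have mu: "0 < mu" using assms by (simp add: mu_def)
 have "sqrt (m^2) < sqrt (m^2 + 4 * mu)" using mu by (subst real_sqrt_less_iff) simp
 hence pos: "0 < ph" by (simp add: ph_def)
 have "2 * ph + m = sqrt (m^2 + 4 * mu)" by (simp add: ph_def diff_divide_distrib)
 hence "(2 * ph + m)^2 = m^2 + 4 * mu" using mu by simp
 hence eq: "ph * (ph + m) = mu" by (simp add: power2_eq_square algebra_simps)
 have uniq: "ps = ph" if "0 < ps" "ps * (ps + m) = mu" for ps
 proof -
 have "(ps - ph) * (ps + ph + m) = 0" using that(2) eq by (simp add: algebra_simps)
 thus ?thesis using that(1) pos m by auto
 qed
 have fr: "frequency Sg = (THE ph. 0 < ph & ph * (ph + m) = mu)"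
 unfolding frequency_def m_def mu_def add_diff_eq ..
 have "frequency Sg = ph" unfolding fr by (rule the_equality) (use pos eq in simp, use uniq in blast)
 thus "0 < frequency Sg" "frequency Sg * (frequency Sg + real DIM('a * real) - 2) = first_eigenvalue Sg"
 using pos eq unfolding m_def mu_def add_diff_eq by auto
qed

text \<open>In the Laplacian of \<open>norm x powr ph\<close> times the degree 0 extension the cross
  term vanishes and the other two cancel by the equation for \<open>ph\<close>. Division by the
  maximum \<open>M\<close> of the eigenfunction gives the normalisation.\<close>

lemma cone_harm_of_eigenfunction:
 fixes Sg :: "('a::euclidean_space * real) set"
 assumes e: "epi L K g" and c: "epicone g = cone_over Sg" and S: "Sg <= sphere 0 1" and FE: "first_eigenfunction Sg E"
 shows "EX M>0. cone_harm g (frequency Sg) (%x. H_cone Sg E x / M)"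
proof -
 note sec = sector_of_epicone[OF e c S]
 define mu where "mu = first_eigenvalue Sg"
 have E: "dirichlet_eigenfunction Sg mu E" and nn: "!!x. x : Sg ==> 0 <= E x" using FE by (auto simp: first_eigenfunction_def mu_def)
 define ph where "ph = frequency Sg"
 have ph: "0 < ph" "ph * (ph + real DIM('a * real) - 2) = mu"
 using frequency_root[of Sg] eigenvalue_positive[OF e c S E nn] by (auto simp: ph_def mu_def)
 have cE: "continuous_on (closure Sg) E" and E0: "!!x. norm x = 1 ==> rho g x = 0 ==> E x = 0"
 using E sec(3) by (simp_all add: dirichlet_eigenfunction_def)
 have cs: "closure Sg <= sphere 0 1" using sec(2) by auto
 have "compact (closure Sg)" using cs by (meson bounded_sphere bounded_subset closed_closure compact_eq_bounded_closed)
 moreover obtain th where th: "th : Sg" "E th ~= 0" using E by (auto simp: dirichlet_eigenfunction_def)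
 ultimately obtain p where p: "p : closure Sg" "!!x. x : closure Sg ==> E x <= E p"
 using continuous_attains_sup[OF _ _ cE] by blast
 define M where "M = E p"
 have "0 < E th" using nn[OF th(1)] th(2) by simp
 also have "... <= M" unfolding M_def using p(2)[of th] th closure_subset[of Sg] by blast
 finally have M: "M > 0" .
 have np: "norm p = 1" "0 <= rho g p" using p(1) sec(2) by auto
 have pc: "p : epicone g" using E0[OF np(1)] np(2) M by (auto simp: epicone_def M_def less_le)
 define f where "f = hom0_ext E"
 define H where "H = (%x. H_cone Sg E x / M)"
 have H: "H x = 1 / M * (norm x powr ph * f x)" for x by (simp add: H_def H_cone_def f_def hom0_ext_def ph_def)
 have unit: "x /\<^sub>R norm x : closure Sg & (rho g x = 0 --> f x = 0) & f x <= M & 0 <= f x" if x: "0 <= rho g x" "x ~= 0" for x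
 proof -
 have n: "norm (x /\<^sub>R norm x) = 1" "0 <= rho g (x /\<^sub>R norm x)" "rho g x = 0 ==> rho g (x /\<^sub>R norm x) = 0"
  using x rho_scale[OF e, of "inverse (norm x)" x] by auto
 have "0 <= E (x /\<^sub>R norm x)"
  using E0[OF n(1)] nn[of "x /\<^sub>R norm x"] sec(1)[of "x /\<^sub>R norm x"] n by (cases "rho g (x /\<^sub>R norm x) = 0") (auto simp: epicone_def)
 thus ?thesis using n sec(2)[of "x /\<^sub>R norm x"] E0[OF n(1)] p(2)[of "x /\<^sub>R norm x"] by (simp add: f_def hom0_ext_def M_def)
 qed
 have cf: "continuous_on ({x. 0 <= rho g x} - {0}) f" unfolding f_def hom0_ext_def
 proof (rule continuous_on_compose2[OF cE])
 show "(%x. x /\<^sub>R norm x) ` ({x. 0 <= rho g x} - {0}) <= closure Sg" by (rule image_subsetI) (use unit in blast)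
 qed (intro continuous_intros, simp)
 have ub: "H x <= norm x powr ph & 0 <= H x" if x: "0 <= rho g x" for x
 proof (cases "x = 0")
 case False
 have "norm x powr ph * f x <= norm x powr ph * M" using unit[OF x False] by (intro mult_left_mono) auto
 thus ?thesis using unit[OF x False] M by (simp add: H pos_divide_le_eq)
 qed (simp add: H)
 have cH: "continuous_on {x. 0 <= rho g x} H" unfolding continuous_on_def
 proof
 fix x assume x: "x : {x. 0 <= rho g x}"
 show "(H ---> H x) (at x within {x. 0 <= rho g x})"
 proof (cases "x = 0")
  case True
  have "((%y::'a * real. norm y powr ph) ---> norm (0 :: 'a * real) powr ph) (at 0 within {x. 0 <= rho g x})"
  using ph(1) by (intro tendsto_powr' tendsto_intros) auto
  hence "((%y::'a * real. norm y powr ph) ---> 0) (at 0 within {x. 0 <= rho g x})" by simp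
  hence "(H ---> 0) (at 0 within {x. 0 <= rho g x})"
  by (rule Lim_null_comparison[rotated]) (use ub in \<open>auto simp: eventually_at_filter\<close>)
  thus ?thesis unfolding True by (simp add: H)
 next
  case False
  have "continuous_on ({x. 0 <= rho g x} - {0}) H" unfolding H by (intro continuous_intros cf) auto
  hence "(H ---> H x) (at x within {x. 0 <= rho g x} - {0})" using x False by (simp add: continuous_on_def)
  moreover have "at x within {x. 0 <= rho g x} - {0} = at x within {x. 0 <= rho g x}"
  by (rule at_within_nhd[of _ "- {0}"]) (use False in auto)
  ultimately show ?thesis by simp
 qed
 qed
 have H0: "H x = 0" if "rho g x = 0" for x
 using unit[of x] that by (cases "x = 0") (auto simp: H)
 have Hs: "H (t *R x) = t powr ph * H x" if "t > 0" for t x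
 using hom0_ext_scale[OF that, of E x] that by (simp add: H f_def powr_mult)
 have Hp: "H p = 1" using M np(1) by (simp add: H f_def hom0_ext_def M_def)
 obtain G h where D: "D2on (epicone g) f G h" "continuous_on (epicone g) G" "!!b. b : Basis ==> continuous_on (epicone g) (h b)"
 "!!x. x : epicone g ==> (SUM b:Basis. h b x) = - mu * f x / (norm x)^2" "!!x. x : epicone g ==> G x \<bullet> x = 0"
 using eigenfunction_calculus[OF e c S E, folded f_def] by auto
 have nz: "0 ~: epicone g" using cone_nz[OF e] by blast
 define GP where "GP = (%x::'a * real. (ph * norm x powr (ph - 2)) *R x)"
 define hP where "hP = (%b x::'a * real. ph * (ph - 2) * norm x powr (ph - 4) * (x \<bullet> b)^2 + ph * norm x powr (ph - 2))"
 define G' where "G' = (%x. (1 / M) *R (norm x powr ph *R G x + f x *R GP x))"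
 define h' where "h' = (%b x. 1 / M * (norm x powr ph * h b x + f x * hP b x + 2 * (GP x \<bullet> b) * (G x \<bullet> b)))"
 have "D2on (epicone g) H G' h'"
 unfolding H G'_def h'_def GP_def hP_def by (rule D2on_cmul[OF D2on_mult[OF D2on_norm_powr[OF nz] D(1)]])
 moreover have cf': "continuous_on (epicone g) f" by (rule continuous_on_subset[OF cf]) (use nz in \<open>auto simp: epicone_def\<close>)
 have "continuous_on (epicone g) G'" unfolding G'_def GP_def by (intro continuous_intros D(2) cf') (use nz in auto)
 moreover have "continuous_on (epicone g) (h' b)" if "b : Basis" for b
 unfolding h'_def hP_def GP_def by (intro continuous_intros D(2,3) cf' that) (use nz in auto)
 moreover have "(SUM b:Basis. h' b x) = 0 & G' x \<bullet> x = ph * H x" if x: "x : epicone g" for x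
 proof
 have n: "norm x > 0" using nz x by auto
 have n2: "norm x powr ph = norm x powr (ph - 2) * (norm x)^2" by (simp add: powr_diff)
 have "(SUM b:Basis. h' b x) = 1 / M * (norm x powr ph * (SUM b:Basis. h b x) + f x * (SUM b:Basis. hP b x) + 2 * (SUM b:Basis. (GP x \<bullet> b) * (G x \<bullet> b)))"
  by (simp add: h'_def sum.distrib sum_distrib_left algebra_simps)
 also have "(SUM b:Basis. (GP x \<bullet> b) * (G x \<bullet> b)) = GP x \<bullet> G x" by (rule euclidean_inner[symmetric])
 also have "... = 0" using D(5)[OF x] by (simp add: GP_def inner_commute)
 also have "(SUM b:Basis. hP b x) = mu * norm x powr (ph - 2)"
  unfolding hP_def sum_second_derivs_norm_powr[OF n] ph(2) ..
 also have "norm x powr ph * (SUM b:Basis. h b x) = - (mu * f x * norm x powr (ph - 2))"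
  unfolding D(4)[OF x] n2 by simp
 finally show "(SUM b:Basis. h' b x) = 0" by simp
 have "G' x \<bullet> x = 1 / M * (f x * (ph * norm x powr (ph - 2) * (norm x)^2))"
  using D(5)[OF x] by (simp add: G'_def GP_def inner_add_left power2_norm_eq_inner)
 thus "G' x \<bullet> x = ph * H x" by (simp add: H n2)
 qed
 ultimately have exG: "EX G h. D2on (epicone g) H G h & continuous_on (epicone g) G &
  (ALL b:Basis. continuous_on (epicone g) (h b)) &
  (ALL x:epicone g. (SUM b:Basis. h b x) = 0 & G x \<bullet> x = ph * H x)" by blast
 have ex: "EX x:epicone g. norm x = 1 & H x = 1" using pc np(1) Hp by blast
 have "0 <= rho g x" if "x : epicone g" for x using that by (simp add: epicone_def)
 hence "cone_harm g ph H" unfolding cone_harm_def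
 by (intro conjI ph(1) cH ex exG) (use H0 Hs ub in blast)+
 thus ?thesis using M unfolding ph_def H_def by blast
qed

text \<open>Passing from radius \<open>r\<close> to \<open>th * r\<close>, the multiple of
  \<open>H\<close> below \<open>u\<close> increases by \<open>c * B * s powr (a - 1)\<close>, where
  \<open>s = ln (1 / r)\<close>. The point is the order of the quantifiers: \<open>c\<close> and
  \<open>th\<close> are fixed before \<open>B\<close>, and an arbitrarily large \<open>B\<close> is
  allowed once \<open>r\<close> is small.\<close>

lemma growth_step:
 fixes g :: "'a::euclidean_space => real"
 assumes e: "epi L K g" and ga: "2 <= ga" and a: "a = 1 / (1 + ga)" and H: "cone_harm g (2 * a) H"
 and sg: "sing g ga lam Lam u" and lam: "lam > 0" and C3: "C3 > 0"
 and ub: "!!x. x : epicone g ==> norm x < 1/2 ==> u x <= C3 * norm x powr (2 * a) * ln (1 / norm x) powr a"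
 shows "EX c>0. EX th>0. th < 1 & (ALL B>=0. EX r1>0. r1 < 1/2 & (ALL r ka. 0 < r --> r < r1 --> 0 <= ka -->
  (ALL x:epicone g. norm x < r --> ka * H x <= u x) -->
  (ALL x:epicone g. norm x < th * r --> (ka + c * B * ln (1 / r) powr (a - 1)) * H x <= u x)))"
proof -
 have L: "1 <= L" "1 <= K" using epiD[OF e] by auto
 define ph where "ph = 2 * a"
 have a0: "0 < a" "a < 1" using ga by (auto simp: a)
 have a1: "a * (1 + ga) = 1" using ga by (simp add: a)
 have ph0: "ph > 0" using a0 by (simp add: ph_def)
 have H': "cone_harm g ph H" using H by (simp add: ph_def)
 define T where "T = t0 L"
 have T: "0 < T" "T <= 1/10" using t0[OF L(1)] by (auto simp: T_def)
 obtain z where z: "rho g z = 0" "fst z ~= 0" "norm z = T / 2" using boundary_point[OF e, of "T / 2"] T by auto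
 define R where "R = T / (4 * (1 + L))"
 have R: "0 < R" "R <= T / 4" "(1 + L) * R <= T / 4" using L T by (auto simp: R_def field_simps)
 obtain r0 m C t where lb: "0 < r0" "r0 <= R" "0 < m" "0 < t" "t <= R"
 "ALL v c si. 0 <= c --> 0 < si --> si < 1 -->
  continuous_on {y. 0 <= rho g y & norm (y - z) <= r0} v -->
  (ALL y. 0 <= rho g y & norm (y - z) <= r0 --> 0 <= v y) -->
  asub {y. 0 < rho g y & norm (y - z) < r0} (%y. - v y) (%y. - (c / (rho g y + si)^2)) -->
  (ALL w:cball (z + (0, t)) (t / (8 * (1 + L))). c * (m * (ln (1 / si) / 2 - C)) <= v w)"
 using log_blowup[OF e z(1,2) R(1)] by (elim exE conjE)
 have near: "T / 4 <= norm y" "norm y <= 3/4 * T" "rho g y <= T / 4" if "norm (y - z) <= r0" for y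
 proof -
 have 1: "norm (y - z) <= T / 4" using that lb R by simp
 have "norm z <= norm y + norm (y - z)" using norm_triangle_ineq4[of y "y - z"] by simp
 thus "T / 4 <= norm y" using 1 z(3) by simp
 have "norm y <= norm z + norm (y - z)" using norm_triangle_ineq[of z "y - z"] by simp
 thus "norm y <= 3/4 * T" using 1 z(3) by simp
 have "rho g y <= (1 + L) * norm (y - z)" using rho_lip[OF e, of y z] z(1) by simp
 also have "... <= (1 + L) * R" using that lb L by auto
 finally show "rho g y <= T / 4" using R by simp
 qed
 define x0 where "x0 = z + (0, t)"
 have x0: "norm x0 <= T" "rho g x0 = t"
 proof -
 have "norm x0 <= norm z + norm ((0::'a, t))" unfolding x0_def by (rule norm_triangle_ineq)
 thus "norm x0 <= T" using z lb R by auto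
 show "rho g x0 = t" unfolding x0_def rho_up z(1) by simp
 qed
 obtain cs where cs: "cs > 0" "ALL (g :: 'a => real) v m x0.
  epi L K g --> 0 <= m --> continuous_on (csec g) v -->
  (ALL y. 0 <= rho g y & norm y < 1 --> 0 <= v y) -->
  asub (usec g) (%y. - v y) (%y. 0) -->
  norm x0 <= t0 L --> t <= rho g x0 --> (ALL w:cball x0 (t / (8 * (1 + L))). m <= v w) -->
  (ALL x. 0 < rho g x & t0 L / 2 <= norm x & norm x <= 3/4 * t0 L --> cs * m * rho g x <= v x)"
 using cone_spread[OF L lb(4), where 'a='a] by blast
 obtain Cl where Cl: "Cl > 0" "!!x. 0 <= rho g x ==> T / 2 <= norm x ==> norm x <= 1 ==> H x <= Cl * rho g x"
 using cone_harm_linear[OF e H', of "T / 2"] T by auto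
 define t1 where "t1 = T / 4"
 have t1: "0 < t1" "t1 <= 1/2" using T by (auto simp: t1_def)
 define de where "de = bd TYPE('a) L K t1"
 define bm where "bm = bM TYPE('a) L K t1"
 have de: "de > 0" and bm: "bm > 0"
 using bd_pos[OF L t1(1), where 'a='a] bM_pos[OF L t1(1), where 'a='a] by (auto simp: de_def bm_def)
 define l0 where "l0 = ln (8 / T)"
 have l0: "l0 >= 0" using T by (simp add: l0_def)
 define C4 where "C4 = C3 * (1 + l0)"
 have C4: "C4 > 0" using C3 l0 by (simp add: C4_def)
 define A where "A = max 1 (max (1 / bm) (2 * C4 / de))"
 have A: "1 <= A" "1 / bm <= A" "2 * C4 / de <= A" by (auto simp: A_def)
 have Abm: "1 <= A * bm" using A(2) bm by (simp add: pos_divide_le_eq)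
 have Ade: "2 * C4 <= A * de" using A(3) de by (simp add: pos_divide_le_eq)
 define k0 where "k0 = A powr (- ga) * 2 powr (2 - ga)"
 have k0: "k0 > 0" using A by (simp add: k0_def)
 define c where "c = cs * lam * k0 / Cl"
 have c: "c > 0" using cs lam k0 Cl by (simp add: c_def)
 define LL where "LL = max Lam 1"
 have LL: "0 < LL" "Lam <= LL" by (auto simp: LL_def)
 define th where "th = T / 2"
 have th: "0 < th" "th < 1" using T by (auto simp: th_def)
 show ?thesis
 proof (rule exI[of _ c], rule conjI[OF c], rule exI[of _ th], rule conjI[OF th(1)], rule conjI[OF th(2)], intro allI impI)
 fix B :: real assume B: "0 <= B"
 \<comment> \<open>The regularisation level at which the logarithmic blow-up is worth at least
   \<open>B\<close>.\<close>
 define ta where "ta = exp (- (2 * (B / m + abs C) + 1))"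
 have "0 <= B / m" using B lb by simp
 hence ta: "0 < ta" "ta < 1" unfolding ta_def by auto
 have taB: "B <= m * (ln (1 / ta) / 2 - C)"
 proof -
  have "ln (1 / ta) = 2 * (B / m + abs C) + 1" by (simp add: ta_def ln_div)
  hence "ln (1 / ta) / 2 = B / m + abs C + 1/2" by simp
  hence "B / m <= ln (1 / ta) / 2 - C" by linarith
  thus ?thesis using lb(3) by (simp add: pos_divide_le_eq mult.commute)
 qed
 \<comment> \<open>Once \<open>s\<close> exceeds this, the rescaled right-hand side is at most 1
   wherever the rescaled solution exceeds \<open>ta\<close>.\<close>
 define s1 where "s1 = max 1 (LL * ta powr (- ga))"
 define r1 where "r1 = exp (- s1) / 2"
 have r1: "0 < r1" "r1 < 1/2"
 proof -
  have "exp (- s1) < 1" by (simp add: s1_def)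
  thus "r1 < 1/2" by (simp add: r1_def)
 qed (simp add: r1_def)
 show "EX r1>0. r1 < 1/2 & (ALL r ka. 0 < r --> r < r1 --> 0 <= ka -->
  (ALL x:epicone g. norm x < r --> ka * H x <= u x) -->
  (ALL x:epicone g. norm x < th * r --> (ka + c * B * ln (1 / r) powr (a - 1)) * H x <= u x))"
 proof (rule exI[of _ r1], rule conjI[OF r1(1)], rule conjI[OF r1(2)], intro allI impI ballI)
  fix r ka x assume r: "0 < r" "r < r1" and ka: "0 <= ka" and low: "ALL x:epicone g. norm x < r --> ka * H x <= u x"
  and x: "x : epicone g" and xn: "norm x < th * r"
  define s where "s = ln (1 / r)"
  have sr: "s = - ln r" by (simp add: s_def ln_div)
  have "ln r < ln r1" using r by simp
  moreover have "ln r1 = - s1 - ln 2" by (simp add: r1_def ln_div)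
  ultimately have "s1 <= s" using ln_facts(1) sr by auto
  hence s: "1 <= s" "LL * ta powr (- ga) <= s" unfolding s1_def by auto
  \<comment> \<open>With this factor the upper bound makes the rescaled solution bounded on the
    shell, and the identity \<open>cUg\<close> leaves a factor \<open>1 / s\<close> in front of the
    singular term.\<close>
  define cU where "cU = 1 / (r powr ph * s powr a)"
  have cU: "cU > 0" using r s by (simp add: cU_def)
  have cUg: "cU * r^2 * cU powr ga = 1 / s"
  proof -
  have "cU * cU powr ga = cU powr (1 + ga)" using cU by (simp add: powr_add)
  also have "... = 1 / ((r powr ph) powr (1 + ga) * (s powr a) powr (1 + ga))"
   unfolding cU_def by (simp add: powr_divide powr_mult)
  also have "(r powr ph) powr (1 + ga) = r powr 2" unfolding powr_powr ph_def mult.assoc a1 by simp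
  also have "(s powr a) powr (1 + ga) = s" using a1 s by (simp add: powr_powr)
  also have "r powr 2 = r^2" using r by simp
  finally have "cU * cU powr ga = 1 / (r^2 * s)" .
  moreover have "cU * r^2 * cU powr ga = r^2 * (cU * cU powr ga)" by simp
  ultimately show ?thesis using r by simp
  qed
  define U where "U = (%y. cU * u (r *R y))"
  have r12: "r < 1/2" using r r1 by simp
  have rn: "norm (r *R y) < 1/2" "norm (r *R y) < r" if "norm y < 1" for y :: "'a * real"
  proof -
  have "norm (r *R y) = r * norm y" using r by simp
  also have "... < r * 1" using that r by auto
  finally show "norm (r *R y) < r" by simp
  thus "norm (r *R y) < 1/2" using r12 by simp
  qed
  have rr: "rho g (r *R y) = r * rho g y" for y using rho_scale[OF e] r by simp
  have Uc: "continuous_on (csec g) U" unfolding U_def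
  proof (intro continuous_intros continuous_on_compose2[OF singD(1)[OF sg]])
  show "(%x. r *R x) ` (csec g) <= (csec g)"
  proof (rule image_subsetI)
   fix y assume "y : (csec g)"
   thus "r *R y : (csec g)" using rn(1)[of y] rr[of y] r by simp
  qed
  qed
  have Up: "0 < U y" if "0 < rho g y" "norm y < 1" for y
  proof -
  have "0 < u (r *R y)" using rn(1)[of y] rr[of y] that r by (intro singD(3)[OF sg]) auto
  thus ?thesis using cU by (simp add: U_def)
  qed
  have U0: "U y = 0" if "rho g y = 0" "norm y < 1" for y
  proof -
  have "u (r *R y) = 0" using rn(1)[of y] rr[of y] that by (intro singD(2)[OF sg]) auto
  thus ?thesis by (simp add: U_def)
  qed
  have U4: "U y <= C4" if "0 <= rho g y" "T / 8 <= norm y" "norm y < 1" for y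
  proof (cases "rho g y = 0")
  case True
  thus ?thesis using U0 that C4 by simp
  next
  case False
  have yc: "r *R y : epicone g" using False that r rr[of y] by (simp add: epicone_def)
  have ny: "0 < norm y" using that T by auto
  have nr: "norm (r *R y) = r * norm y" using r by simp
  have "ln (1 / (r * norm y)) = s + - ln (norm y)" using r ny by (simp add: sr ln_div ln_mult)
  moreover have "ln (T / 8) <= ln (norm y)" using that T ny by simp
  moreover have "ln (T / 8) = - l0" by (simp add: l0_def ln_div)
  ultimately have l1: "ln (1 / (r * norm y)) <= s + l0" by simp
  have l2: "0 <= ln (1 / (r * norm y))"
  proof -
   have "r * norm y < 1/2" using rn(1)[OF that(3)] unfolding nr .
   thus ?thesis using r ny by auto
  qed
  have "u (r *R y) <= C3 * (r * norm y) powr ph * ln (1 / (r * norm y)) powr a"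
   using ub[OF yc rn(1)[OF that(3)]] unfolding nr ph_def .
  also have "... <= C3 * (r powr ph) * ((1 + l0) * s) powr a"
  proof (intro mult_mono powr_mono2)
   show "r * norm y <= r" using that r by simp
   have "l0 * 1 <= l0 * s" using l0 s by (intro mult_left_mono) auto
   thus "ln (1 / (r * norm y)) <= (1 + l0) * s" using l1 by (simp add: algebra_simps)
  qed (use C3 ph0 a0 r ny l2 in auto)
  also have "... = C3 * (1 + l0) powr a * (r powr ph * s powr a)" by (simp add: powr_mult)
  also have "... <= C3 * (1 + l0) * (r powr ph * s powr a)"
  proof (intro mult_right_mono mult_left_mono)
   show "(1 + l0) powr a <= 1 + l0" using powr_mono[of a 1 "1 + l0"] a0 l0 by simp
  qed (use C3 in auto)
  finally have "u (r *R y) <= C4 * (r powr ph * s powr a)" by (simp add: C4_def)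
  hence "cU * u (r *R y) <= cU * (C4 * (r powr ph * s powr a))" using cU by auto
  also have "... = C4" using r s by (simp add: cU_def)
  finally show ?thesis by (simp add: U_def)
  qed
  have op: "open (usec g)" by (rule unit_sector[OF e])
  have uc: "continuous_on (usec g) u"
  by (rule continuous_on_subset[OF singD(1)[OF sg]]) (auto simp: epicone_def)
  have scl: "usec g <= {y. r *R y : usec g}"
  proof (rule subsetI, rule CollectI)
  fix y assume "y : usec g"
  thus "r *R y : usec g" using rn(1)[of y] rr[of y] r by (simp add: epicone_def)
  qed
  have Uas: "asub D U (%_. 1)" if D: "D <= {y. 0 < rho g y & norm y < 1 & ta < U y}" for D
  proof -
  define S where "S = {y : usec g. ta / cU < u y}"
  have "open ((usec g) Int u -` {ta / cU <..})" by (rule continuous_open_preimage[OF uc op open_greaterThan])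
  moreover have "(usec g) Int u -` {ta / cU <..} = S" by (auto simp: S_def)
  ultimately have oS: "open S" by metis
  have "asub S u (%_. LL * (ta / cU) powr (- ga))"
  proof (rule sing_asub(1)[OF e sg oS])
   fix y assume y: "y : S"
   have "0 < ta / cU" using ta cU by simp
   moreover have "ta / cU <= u y" using y by (simp add: S_def)
   ultimately have "u y powr (- ga) <= (ta / cU) powr (- ga)" using ga by (intro powr_mono2') auto
   thus "Lam * u y powr (- ga) <= LL * (ta / cU) powr (- ga)" using LL by (intro mult_mono) auto
  qed (auto simp: S_def)
  from asub_scale[OF this r(1) cU]
  have as: "asub {y. r *R y : S} U (%_. cU * (r^2 * (LL * (ta / cU) powr (- ga))))" unfolding U_def .
  have eq: "cU * (r^2 * (LL * (ta / cU) powr (- ga))) <= 1"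
  proof -
   have "(ta / cU) powr (- ga) = ta powr (- ga) * cU powr ga" by (simp add: powr_divide powr_minus field_simps)
   hence "cU * (r^2 * (LL * (ta / cU) powr (- ga))) = (LL * ta powr (- ga)) * (cU * r^2 * cU powr ga)" by simp
   also have "... <= s * (1 / s)" unfolding cUg using s by auto
   also have "... = 1" using s by simp
   finally show ?thesis .
  qed
  show ?thesis
  proof (rule asub_mono[OF as])
   show "D <= {y. r *R y : S}"
   proof (rule subsetI, rule CollectI)
   fix y assume "y : D"
   hence y: "0 < rho g y" "norm y < 1" "ta < cU * u (r *R y)" using D by (auto simp: U_def)
   hence "ta / cU < u (r *R y)" using cU by (simp add: pos_divide_less_eq mult.commute)
   thus "r *R y : S" using rn(1)[OF y(2)] rr[of y] y(1) r by (simp add: S_def epicone_def)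
   qed
  qed (rule eq)
  qed
  \<comment> \<open>The equation is controlled only above the level \<open>ta\<close>, so linear
    decay at the boundary holds up to that level. This is how \<open>ta\<close> becomes the
    regularisation in the blow-up estimate.\<close>
  have Ulin: "U y <= A * (rho g y + ta)" if y: "0 < rho g y" "t1 <= norm y" "norm y <= 1/2" for y
  proof -
  have yn: "norm w < 1" "T / 8 <= norm w" if "norm (w - y) <= t1 / 4" for w
  proof -
   show "norm w < 1" using norm_triangle_ineq[of y "w - y"] that y by simp
   have "norm y <= norm w + norm (w - y)" using norm_triangle_ineq4[of w "w - y"] by simp
   thus "T / 8 <= norm w" using that y(2) T by (simp add: t1_def)
  qed
  have "U y <= ta + A * rho g y"
  proof (rule linear_upper[OF e t1(1) y(2,3,1), where M=C4 and q=1])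
   show "continuous_on {w. 0 <= rho g w & norm (w - y) <= t1 / 4} U"
   by (rule continuous_on_subset[OF Uc]) (use yn(1) in auto)
   show "U w <= 0" if "rho g w = 0" "norm (w - y) <= t1 / 4" for w
   using U0[OF that(1) yn(1)[OF that(2)]] by simp
   show "U w <= C4" if "0 <= rho g w" "norm (w - y) <= t1 / 4" for w
   by (rule U4[OF that(1) yn(2,1)[OF that(2)]])
   show "asub D U (%y. 1)" if "!!w. w : D ==> 0 < rho g w & norm (w - y) < t1 / 4 & ta < U w" for D
   proof (rule Uas, rule subsetI, rule CollectI)
   fix w assume "w : D"
   with that[OF this] yn(1)[of w] show "0 < rho g w & norm w < 1 & ta < U w" by simp
   qed
  qed (use A Ade Abm ta in \<open>simp_all add: de_def bm_def\<close>)
  also have "... <= A * (rho g y + ta)" using A ta by (simp add: distrib_left)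
  finally show ?thesis .
  qed
  define ka' where "ka' = ka / s powr a"
  have ka': "0 <= ka'" using ka by (simp add: ka'_def)
  \<comment> \<open>The excess over the current multiple of \<open>H\<close>. It is nonnegative by
    \<open>low\<close>, and since \<open>H\<close> is harmonic the whole singular right-hand side
    remains available to it.\<close>
  define V where "V = (%y. U y - ka' * H y)"
  have Hr: "H (r *R y) = r powr ph * H y" if "y : epicone g" for y using cone_harmD(4)[OF H' that r(1)] .
  have V0: "0 <= V y" if "0 <= rho g y" "norm y < 1" for y
  proof (cases "rho g y = 0")
  case True
  thus ?thesis using U0[OF True that(2)] cone_harmD(3)[OF H' True] by (simp add: V_def)
  next
  case False
  hence yc: "y : epicone g" using that by (simp add: epicone_def)
  have "r *R y : epicone g" using cone_scale[OF e r(1)] yc by blast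
  hence "ka * H (r *R y) <= u (r *R y)" using low rn(2)[OF that(2)] by blast
  hence "cU * (ka * (r powr ph * H y)) <= U y" unfolding Hr[OF yc] U_def using cU by simp
  moreover have "cU * (ka * (r powr ph * H y)) = ka' * H y" using r by (simp add: cU_def ka'_def)
  ultimately show ?thesis by (simp add: V_def)
  qed
  have Hc: "continuous_on (csec g) H"
  by (rule continuous_on_subset[OF cone_harmD(2)[OF H']]) auto
  have Vc: "continuous_on (csec g) V" unfolding V_def by (intro continuous_intros Uc Hc)
  have Vas: "asub (usec g) (%y. - V y) (%y. - (lam / s * U y powr (- ga)))"
  proof -
  have "asub (usec g) (%y. - u y) (%y. - (lam * u y powr (- ga)))"
  proof (rule sing_asub(2)[OF e sg op order_refl])
   have "ALL y:usec g. u y ~= 0"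
   proof
   fix y assume "y : usec g"
   hence "0 < u y" by (intro singD(3)[OF sg]) (simp_all add: epicone_def)
   thus "u y ~= 0" by simp
   qed
   thus "continuous_on (usec g) (%y. lam * u y powr - ga)"
   by (intro continuous_intros uc)
  qed simp
  from asub_scale[OF this r(1) cU]
  have "asub {y. r *R y : usec g} (%y. cU * - u (r *R y)) (%y. cU * (r^2 * - (lam * u (r *R y) powr (- ga))))" .
  hence "asub (usec g) (%y. cU * - u (r *R y)) (%y. - (lam / s * U y powr (- ga)))"
  proof (rule asub_mono[OF _ scl])
   fix y assume "y : usec g"
   hence "0 < U y" by (intro Up) (simp_all add: epicone_def)
   hence up: "0 < u (r *R y)" using cU by (simp add: U_def zero_less_mult_iff)
   have "U y powr (- ga) = cU powr (- ga) * u (r *R y) powr (- ga)" unfolding U_def by (simp add: powr_mult)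
   hence "lam / s * U y powr (- ga) = lam * (cU * r^2 * cU powr ga) * (cU powr (- ga) * u (r *R y) powr (- ga))"
   unfolding cUg by simp
   also have "... = (cU powr ga * cU powr (- ga)) * (cU * (r^2 * (lam * u (r *R y) powr (- ga))))" by simp
   also have "cU powr ga * cU powr (- ga) = 1" using cU by (simp flip: powr_add)
   finally show "cU * (r^2 * - (lam * u (r *R y) powr (- ga))) <= - (lam / s * U y powr (- ga))" by simp
  qed
  from asub_add[OF this asub_nonneg_mult_harm[OF e H' op _ ka']]
  have "asub (usec g) (%y. cU * - u (r *R y) + ka' * H y) (%y. - (lam / s * U y powr (- ga)) + 0)" by auto
  thus ?thesis by (simp add: V_def U_def)
  qed
  define c0 where "c0 = lam / s * k0"
  have c0: "0 < c0" using lam s k0 by (simp add: c0_def)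
  have Vlow: "ALL w:cball (z + (0, t)) (t / (8 * (1 + L))). c0 * (m * (ln (1 / ta) / 2 - C)) <= V w"
  proof (rule lb(6)[THEN spec, THEN spec, THEN spec, THEN mp, THEN mp, THEN mp, THEN mp, THEN mp, THEN mp])
  show "0 <= c0" using c0 by simp
  have n1: "norm y < 1" if "norm (y - z) <= r0" for y using near(2)[OF that] T by auto
  show "continuous_on {y. 0 <= rho g y & norm (y - z) <= r0} V"
   by (rule continuous_on_subset[OF Vc]) (use n1 in auto)
  show "ALL y. 0 <= rho g y & norm (y - z) <= r0 --> 0 <= V y" using V0 n1 by blast
  show "asub {y. 0 < rho g y & norm (y - z) < r0} (%y. - V y) (%y. - (c0 / (rho g y + ta)^2))"
  proof (rule asub_mono[OF Vas])
   show "{y. 0 < rho g y & norm (y - z) < r0} <= usec g" using n1 by (auto simp: epicone_def)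
   fix y assume "y : {y. 0 < rho g y & norm (y - z) < r0}"
   hence y: "0 < rho g y" "norm (y - z) <= r0" by auto
   have y2: "t1 <= norm y" "norm y <= 1/2" using near(1,2)[OF y(2)] T by (auto simp: t1_def)
   have "(A * (rho g y + ta)) powr (- ga) <= U y powr (- ga)"
   using Ulin[OF y(1) y2] Up[OF y(1) n1[OF y(2)]] ga by (intro powr_mono2') auto
   moreover have "(A * (rho g y + ta)) powr (- ga) = A powr (- ga) * (rho g y + ta) powr (- ga)"
   by (simp add: powr_mult)
   moreover have "A powr (- ga) * (2 powr (2 - ga) / (rho g y + ta)^2) <= A powr (- ga) * (rho g y + ta) powr (- ga)"
   by (intro mult_left_mono powr_neg_ge_square) (use y ta near[OF y(2)] T ga in auto)
   ultimately have "k0 / (rho g y + ta)^2 <= U y powr (- ga)" by (simp add: k0_def)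
   hence "lam / s * (k0 / (rho g y + ta)^2) <= lam / s * U y powr (- ga)" using lam s by (intro mult_left_mono) auto
   thus "- (lam / s * U y powr (- ga)) <= - (c0 / (rho g y + ta)^2)" by (simp add: c0_def)
  qed
  qed (rule ta)+
  have Vnn: "asub (usec g) (%y. - V y) (%y. 0)"
  by (rule asub_mono[OF Vas order_refl]) (use lam s in simp)
  have Vsp: "cs * (c0 * B) * rho g y <= V y" if y: "0 < rho g y" "T / 2 <= norm y" "norm y <= 3/4 * T" for y
  proof (rule cs(2)[rule_format, OF e _ Vc _ Vnn])
  show "0 <= c0 * B" using c0 B by simp
  show "0 <= V w" if "0 <= rho g w & norm w < 1" for w using V0 that by simp
  show "norm x0 <= t0 L" "t <= rho g x0" using x0 by (simp_all add: T_def)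
  show "c0 * B <= V w" if "w : cball x0 (t / (8 * (1 + L)))" for w
   using order_trans[OF mult_left_mono[OF taB, of c0] Vlow[THEN bspec, of w]] c0 that by (simp add: x0_def)
  show "0 < rho g y & t0 L / 2 <= norm y & norm y <= 3/4 * t0 L" using y by (simp add: T_def)
  qed
  \<comment> \<open>The gain at unit scale; multiplication by \<open>s powr a\<close>, which undoes
    the rescaling, turns it into \<open>c * B * s powr (a - 1)\<close>.\<close>
  define d where "d = c * B / s"
  have d: "0 <= d" using c B s by (simp add: d_def)
  have dV: "d * H y <= V y" if y: "y : epicone g" "norm y < T / 2" for y
  proof (rule comparison_below[where D="{y. 0 < rho g y & norm y < T / 2}" and q="%_. 0"])
  note reg = two_sided_region[OF continuous_rho[OF e] continuous_on_norm_id, where d="T / 2"]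
  show "open {y. 0 < rho g y & norm y < T / 2}" by (rule reg(1))
  show "bounded {y. 0 < rho g y & norm y < T / 2}" by (rule bounded_subset[of "ball 0 (T / 2)"]) auto
  have sub: "closure {y. 0 < rho g y & norm y < T / 2} <= (csec g)"
  proof (rule subsetI, rule CollectI)
   fix y assume "y : closure {y. 0 < rho g y & norm y < T / 2}"
   from reg(2)[OF this] show "0 <= rho g y & norm y < 1" using T by auto
  qed
  show "continuous_on (closure {y. 0 < rho g y & norm y < T / 2}) V" by (rule continuous_on_subset[OF Vc sub])
  show "continuous_on (closure {y. 0 < rho g y & norm y < T / 2}) (%y. d * H y)"
   by (intro continuous_intros continuous_on_subset[OF Hc sub])
  show "d * H y <= V y" if "y : frontier {y. 0 < rho g y & norm y < T / 2}" for y
  proof (cases "rho g y = 0")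
   case True
   hence "0 <= V y" using V0[of y] reg(3)[OF that] T by auto
   thus ?thesis using cone_harmD(3)[OF H' True] by simp
  next
   case False
   hence y: "0 < rho g y" "norm y = T / 2" using reg(3)[OF that] by auto
   have "H y <= Cl * rho g y" using y T by (intro Cl(2)) auto
   hence "d * H y <= d * (Cl * rho g y)" using d by (rule mult_left_mono)
   also have "... = cs * (c0 * B) * rho g y" using Cl by (simp add: d_def c_def c0_def)
   also have "... <= V y" using y by (intro Vsp) auto
   finally show ?thesis .
  qed
  show "asub {x : {y. 0 < rho g y & norm y < T / 2}. V x < d * H x} (%x. - V x) (%x. - 0)"
   by (rule asub_mono[OF Vnn]) (use T in \<open>auto simp: epicone_def\<close>)
  obtain G where G: "has_lap (epicone g) H G (%_. 0)" using cone_harmD(8)[OF H'] by blast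
  show "touch_below (%y. d * H y) y 0" if "y : {y. 0 < rho g y & norm y < T / 2}" for y
   by (rule touch_belowI[OF open_cone[OF e] _ has_lap_cmul[OF G, of d]]) (use that in \<open>auto simp: epicone_def\<close>)
  show "y : {y. 0 < rho g y & norm y < T / 2}" using y by (simp add: epicone_def)
  qed
  define y where "y = (1 / r) *R x"
  have xy: "x = r *R y" using r by (simp add: y_def)
  have y: "y : epicone g" "norm y < T / 2"
  using cone_scale[OF e, of "1 / r" x] x xn r by (auto simp: y_def th_def field_simps)
  have "(ka' + d) * H y <= cU * u x" using dV[OF y] unfolding V_def U_def xy by (simp add: algebra_simps)
  hence "(r powr ph * s powr a) * ((ka' + d) * H y) <= (r powr ph * s powr a) * (cU * u x)"
  by (rule mult_left_mono) simp
  also have "(r powr ph * s powr a) * (cU * u x) = u x" using r s by (simp add: cU_def)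
  also have "(r powr ph * s powr a) * ((ka' + d) * H y) = (s powr a * ka' + s powr a * d) * H x"
  unfolding xy Hr[OF y(1)] by (simp add: algebra_simps)
  also have "s powr a * ka' = ka" using s by (simp add: ka'_def)
  also have "s powr a * d = c * B * s powr (a - 1)" using s by (simp add: d_def powr_diff)
  finally show "(ka + c * B * ln (1 / r) powr (a - 1)) * H x <= u x" by (simp add: s_def)
 qed
 qed
qed

text \<open>Summing the gains over geometric radii gives a multiple of \<open>B * s powr a\<close>,
  the same order as the assumed upper bound but with a free constant \<open>B\<close>.\<close>

lemma no_log_growth:
 fixes g :: "'a::euclidean_space => real"
 assumes e: "epi L K g" and ga: "2 <= ga" and a: "a = 1 / (1 + ga)" and H: "cone_harm g (2 * a) H"
 and sg: "sing g ga lam Lam u" and lam: "lam > 0" and C3: "C3 > 0"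
 and ub: "!!x. x : epicone g ==> norm x < 1/2 ==> u x <= C3 * norm x powr (2 * a) * ln (1 / norm x) powr a"
 shows False
proof -
 have a0: "0 < a" "a < 1" using ga by (auto simp: a)
 obtain c th where c: "c > 0" and th: "0 < th" "th < 1" and step: "ALL B>=0. EX r1>0. r1 < 1/2 & (ALL r ka. 0 < r --> r < r1 --> 0 <= ka -->
  (ALL x:epicone g. norm x < r --> ka * H x <= u x) -->
  (ALL x:epicone g. norm x < th * r --> (ka + c * B * ln (1 / r) powr (a - 1)) * H x <= u x))"
 by (rule exE[OF growth_step[OF e ga a H sg lam C3 ub]], assumption+, elim exE conjE, rule that)
 define q where "q = ln (1 / th)"
 have q: "q > 0" using th by (simp add: q_def)
 \<comment> \<open>The upper bound tolerates at most \<open>2 * C3 * q\<close> for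
   \<open>c * B\<close>.\<close>
 define B where "B = (2 * C3 * q + 1) / c"
 have B: "B >= 0" "c * B = 2 * C3 * q + 1" using c C3 q by (auto simp: B_def)
 obtain r1 where r1: "0 < r1" "r1 < 1/2" "ALL r ka. 0 < r --> r < r1 --> 0 <= ka -->
  (ALL x:epicone g. norm x < r --> ka * H x <= u x) -->
  (ALL x:epicone g. norm x < th * r --> (ka + c * B * ln (1 / r) powr (a - 1)) * H x <= u x)"
 using step B(1) by blast
 define r where "r = (%j::nat. th ^ j * (r1 / 2))"
 define l0 where "l0 = ln (2 / r1)"
 have l0: "l0 > 0" using r1 by (simp add: l0_def)
 have r: "0 < r j" "r j < r1" for j
 proof -
 show "0 < r j" using th r1 by (simp add: r_def)
 have "th ^ j * (r1 / 2) <= 1 * (r1 / 2)" using th r1 by (intro mult_right_mono power_le_one) auto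
 thus "r j < r1" using r1 by (simp add: r_def)
 qed
 have lr: "ln (1 / r j) = l0 + j * q" for j
 using th r1 by (simp add: r_def l0_def q_def ln_div ln_mult ln_realpow)
 define ka where "ka = (%j. c * B * (\<Sum>i<j. (l0 + real i * q) powr (a - 1)))"
 have ka0: "0 <= ka j" for j using c B(1) by (auto simp: ka_def intro!: mult_nonneg_nonneg sum_nonneg)
 have low: "ALL x:epicone g. norm x < r j --> ka j * H x <= u x" for j
 proof (induction j)
 case 0
 show ?case
 proof (intro ballI impI)
  fix x assume "x : epicone g" "norm x < r 0"
  hence "0 < u x" using r(2)[of 0] r1 by (intro singD(3)[OF sg]) (auto simp: epicone_def)
  thus "ka 0 * H x <= u x" by (simp add: ka_def)
 qed
 next
 case (Suc j)
 have "ALL x:epicone g. norm x < th * r j --> (ka j + c * B * ln (1 / r j) powr (a - 1)) * H x <= u x"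
  using r1(3) r ka0 Suc by blast
 moreover have "ka j + c * B * ln (1 / r j) powr (a - 1) = ka (Suc j)"
  by (simp add: ka_def lr algebra_simps)
 moreover have "th * r j = r (Suc j)" by (simp add: r_def)
 ultimately show ?case by simp
 qed
 obtain h where h: "h : epicone g" "norm h = 1" "H h = 1" using cone_harmD(7)[OF H] by blast
 obtain j :: nat where j: "(l0 + ln 2) / q < real j" using reals_Archimedean2 by blast
 hence jq: "l0 + ln 2 < j * q" using q by (simp add: pos_divide_less_eq)
 have l2: "0 < ln (2::real)" by simp
 have jp: "0 < j * q" using jq l0 l2 by linarith
 define x where "x = (r j / 2) *R h"
 have x: "x : epicone g" "norm x = r j / 2" using cone_scale[OF e, of "r j / 2" h] h r(1)[of j] by (auto simp: x_def)
 have Hx: "H x = (r j / 2) powr (2 * a)" using cone_harmD(4)[OF H h(1), of "r j / 2"] h r(1)[of j] by (simp add: x_def)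
 \<comment> \<open>As \<open>a < 1\<close>, every summand is at least the power of the common bound
   \<open>2 * (j * q)\<close>, so no integral comparison is needed.\<close>
 have "c * B * (j * (2 * (j * q)) powr (a - 1)) <= ka j"
 proof -
 have "(\<Sum>i<j. (2 * (j * q)) powr (a - 1)) <= (\<Sum>i<j. (l0 + i * q) powr (a - 1))"
 proof (rule sum_mono)
  fix i assume "i : {..<j}"
  hence "i * q <= j * q" using q by simp
  hence "l0 + i * q <= 2 * (j * q)" using jq l2 by linarith
  moreover have "0 < l0 + i * q" using l0 q by (simp add: add_pos_nonneg)
  ultimately show "(2 * (j * q)) powr (a - 1) <= (l0 + i * q) powr (a - 1)" using a0 by (intro powr_mono2') auto
 qed
 thus ?thesis unfolding ka_def using c B(1) by (intro mult_left_mono) auto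
 qed
 hence "c * B * (j * (2 * (j * q)) powr (a - 1)) * H x <= ka j * H x" by (rule mult_right_mono) (simp add: Hx)
 also have "... <= u x" using low[of j] x r(1)[of j] by simp
 also have "u x <= C3 * norm x powr (2 * a) * ln (1 / norm x) powr a"
 using x r(2)[of j] r1 by (intro ub) auto
 also have "... = C3 * ln (1 / norm x) powr a * H x" by (simp add: Hx x)
 finally have "c * B * (j * (2 * (j * q)) powr (a - 1)) <= C3 * ln (1 / norm x) powr a"
 by (rule mult_right_le_imp_le) (use r(1)[of j] in \<open>simp add: Hx\<close>)
 also have "... <= C3 * (2 * (j * q)) powr a"
 proof (intro mult_left_mono powr_mono2)
 have "ln (1 / norm x) = ln 2 + ln (1 / r j)" using r(1)[of j] by (simp add: x ln_div)
 hence eq: "ln (1 / norm x) = ln 2 + (l0 + j * q)" using lr by simp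
 thus "ln (1 / norm x) <= 2 * (j * q)" using jq by linarith
 show "0 <= ln (1 / norm x)" using eq jp l0 l2 by auto
 qed (use a0 C3 in auto)
 also have "(2 * (j * q)) powr a = 2 * (j * q) * (2 * (j * q)) powr (a - 1)" using jp by (simp add: powr_diff)
 finally have "(c * B * j) * (2 * (j * q)) powr (a - 1) <= (C3 * (2 * (j * q))) * (2 * (j * q)) powr (a - 1)"
 by simp
 hence "c * B * j <= C3 * (2 * (j * q))" by (rule mult_right_le_imp_le) (use jp in \<open>cases j, auto\<close>)
 hence "(2 * C3 * q + 1) * j <= (2 * C3 * q) * j" unfolding B(2) by (simp add: mult_ac)
 moreover have "0 < real j" using jp by (cases j) auto
 ultimately show False by simp
qed

section \<open>Translation to the original definitions and choice of constants\<close>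

lemma frontier_epicone:
 assumes e: "epi L K g"
 shows "frontier (epicone g) = {x. rho g x = 0}"
proof -
 have "closure (epicone g) <= {x. 0 <= rho g x}"
 by (rule closure_minimal) (auto simp: epicone_def intro!: closed_Collect_le continuous_rho[OF e])
 moreover have "x : closure (epicone g)" if "rho g x = 0" for x
 proof -
 have "((%t::real. x + (0, t)) ---> x + (0, 0)) (at_right 0)" by (intro tendsto_intros)
 hence "((%t::real. x + (0, t)) ---> x) (at_right 0)" by (simp flip: zero_prod_def)
 moreover have "\<forall>\<^sub>F t in at_right 0. x + (0, t) : closure (epicone g)"
  by (rule eventually_at_rightI[of 0 1]) (use that in \<open>auto simp: epicone_def rho_up intro!: subsetD[OF closure_subset]\<close>)
 ultimately show ?thesis by (intro Lim_in_closed_set[of "closure (epicone g)"]) auto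
 qed
 ultimately show ?thesis unfolding frontier_def interior_open[OF open_cone[OF e]] by (auto simp: epicone_def)
qed

lemma sing_of_singular_solution:
 fixes Sg :: "('a::euclidean_space * real) set"
 assumes e: "epi L K g" and c: "epicone g = cone_over Sg" and u: "singular_solution Sg ga f u"
 and f: "!!x. x : sector Sg ==> lam <= f x & f x <= Lam"
 shows "sing g ga lam Lam u"
proof -
 have "usec g Un ball 0 1 Int {x. rho g x = 0} = (csec g)" by (auto simp: epicone_def)
 thus ?thesis using u f unfolding singular_solution_def sing_def c[symmetric] frontier_epicone[OF e] by auto
qed

text \<open>A larger value at one point would persist on a nonempty open set, which is not
  negligible.\<close>

lemma le_Linf_norm:
 fixes u :: "'b::euclidean_space => real"
 assumes S: "open S" and u: "continuous_on S u" and x: "x : S"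
 shows "ereal (u x) <= Linf_norm S u"
proof (rule ccontr)
 assume "~ ereal (u x) <= Linf_norm S u"
 hence "Linf_norm S u < ereal (u x)" by simp
 then obtain r where r: "Linf_norm S u < ereal r" "r < u x" using ereal_dense2 by force
 have "AE y in lebesgue_on S. ereal \<bar>u y\<bar> <= Linf_norm S u" unfolding Linf_norm_def by (rule esssup_AE)
 hence ae: "AE y in lebesgue. y : S --> ereal \<bar>u y\<bar> <= Linf_norm S u"
 using S by (subst (asm) AE_restrict_space_iff) auto
 have o: "open (S Int u -` {r<..})" by (rule continuous_open_preimage[OF u S open_greaterThan])
 have "AE y in lebesgue. y ~: S Int u -` {r<..}"
 using ae
 proof eventually_elim
 case (elim y)
 hence "y : S ==> ereal \<bar>u y\<bar> < ereal r" using r(1) by (blast intro: le_less_trans)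
 thus ?case by auto
 qed
 hence "negligible (S Int u -` {r<..})"
 using o by (simp add: negligible_iff_null_sets AE_iff_null_sets)
 thus False using open_not_negligible[OF o] x r(2) by auto
qed

lemma poisson_distr_cmul_cong:
 assumes p: "poisson_distr D u h" and D: "open D" and eq: "!!x. x : D ==> u' x = c * u x" "!!x. x : D ==> h' x = c * h x"
 shows "poisson_distr D u' h'"
proof -
 have li: "locally_integrable_on D v'" if "locally_integrable_on D v" "!!x. x : D ==> v' x = c * v x" for v v'
 unfolding locally_integrable_on_def
 proof (intro allI impI)
 fix S assume S: "compact S" "S <= D"
 have "set_integrable lebesgue S (%x. c * v x)" using that(1) S by (simp add: locally_integrable_on_def)
 thus "set_integrable lebesgue S v'" using set_integrable_cong[OF refl refl, of S v' "%x. c * v x"] that(2) S by auto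
 qed
 have m: "D : sets lebesgue" using D by simp
 have "- (LINT x:D|lebesgue. u' x * laplacian ps x) = (LINT x:D|lebesgue. h' x * ps x)" if "test_function D ps" for ps
 proof -
 have "(LINT x:D|lebesgue. u' x * laplacian ps x) = (LINT x:D|lebesgue. c * (u x * laplacian ps x))"
  by (rule set_lebesgue_integral_cong[OF m]) (simp add: eq)
 moreover have "(LINT x:D|lebesgue. h' x * ps x) = (LINT x:D|lebesgue. c * (h x * ps x))"
  by (rule set_lebesgue_integral_cong[OF m]) (simp add: eq)
 moreover have "- (LINT x:D|lebesgue. u x * laplacian ps x) = (LINT x:D|lebesgue. h x * ps x)"
  using p that by (simp add: poisson_distr_def)
 ultimately show ?thesis by (simp flip: mult_minus_right)
 qed
 thus ?thesis using p li eq unfolding poisson_distr_def by blast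
qed

text \<open>The rate is the power \<open>a\<close> of \<open>t^2 * ln (1 / t)\<close>, which
  increases up to \<open>exp (- 1/2)\<close> and hence on the range up to 1/2.\<close>

lemma growth_rate_mono:
 fixes t r a :: real
 assumes t: "0 < t" "t <= r" "r <= 1/2" and a: "0 <= a"
 shows "t powr (2 * a) * ln (1 / t) powr a <= r powr (2 * a) * ln (1 / r) powr a"
proof -
 have eq: "s powr (2 * a) * ln (1 / s) powr a = (s^2 * - ln s) powr a" if "0 < s" "s <= 1/2" for s :: real
 proof -
 have "s powr (2 * a) = (s^2) powr a" using that powr_powr[of s 2 a] by auto
 moreover have "(s^2 * - ln s) powr a = s\<^sup>2 powr a * (- ln s) powr a" by (rule powr_mult)
 moreover have "ln (1 / s) = - ln s" by (simp add: ln_div)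
 ultimately show ?thesis by simp
 qed
 have "t^2 * - ln t <= r^2 * - ln r"
 proof (rule DERIV_nonneg_imp_nondecreasing[OF t(2)])
 fix s assume s: "t <= s" "s <= r"
 have "ln s <= ln (1/2)" using s t by simp
 hence "0 <= s * (2 * - ln s - 1)" using s t ln_facts(1) by (intro mult_nonneg_nonneg) (auto simp: ln_div)
 moreover have "DERIV (%s. s^2 * - ln s) s :> s * (2 * - ln s - 1)"
  by (auto intro!: derivative_eq_intros simp: power2_eq_square field_simps) (use s t in auto)
 ultimately show "EX y. DERIV (%s. s^2 * - ln s) s :> y & 0 <= y" by blast
 qed
 moreover have "0 <= t^2 * - ln t" using t by (intro mult_nonneg_nonneg) auto
 ultimately have "(t^2 * - ln t) powr a <= (r^2 * - ln r) powr a" using a by (intro powr_mono2) auto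
 thus ?thesis using eq[of t] eq[of r] t by simp
qed

text \<open>For large \<open>s\<close> the subtracted constant is at most half of
  \<open>s powr a\<close>; for bounded \<open>s\<close> the difference is at least its positive
  value at \<open>ln 2\<close>.\<close>

lemma powr_shift_lower:
 fixes a :: real
 assumes a: "0 < a"
 shows "EX c>0. ALL s>=ln 2. c * s powr a <= (ln 3 + s) powr a - ln 2 powr a"
proof -
 define A where "A = ln (2::real) powr a"
 define d where "d = (ln 3 + ln (2::real)) powr a - A"
 have A: "A > 0" by (simp add: A_def)
 have d: "d > 0" using a by (auto simp: d_def A_def intro!: powr_less_mono2)
 show ?thesis
 proof (rule exI[of _ "min (1/2) (d / (2 * A))"], intro conjI allI impI)
 show "0 < min (1/2) (d / (2 * A))" using A d by simp
 fix s :: real assume s: "ln 2 <= s"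
 have s0: "0 < s" using s by (rule less_le_trans[rotated]) simp
 show "min (1/2) (d / (2 * A)) * s powr a <= (ln 3 + s) powr a - ln 2 powr a"
 proof (cases "2 * A <= s powr a")
  case True
  have "min (1/2) (d / (2 * A)) * s powr a <= 1/2 * s powr a" by (intro mult_right_mono) auto
  moreover have "s powr a <= (ln 3 + s) powr a" using s0 a by (intro powr_mono2) auto
  ultimately show ?thesis using True unfolding A_def by simp
 next
  case False
  have "min (1/2) (d / (2 * A)) * s powr a <= d / (2 * A) * (2 * A)" using False A d by (intro mult_mono) auto
  moreover have "(ln 3 + ln 2) powr a <= (ln 3 + s) powr a" using s a by (intro powr_mono2) auto
  ultimately show ?thesis unfolding d_def A_def by simp
 qed
 qed
qed

text \<open>The explicit subsolution is evaluated at radius \<open>r / 2\<close>, strictly inside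
  the ball, where its logarithm is \<open>ln 3 + ln (1 / r)\<close> and so stays away from its
  zero.\<close>

lemma solution_sup_lower:
 fixes a ga lam :: real
 assumes ga: "0 < ga" and lam: "0 < lam" and a: "a = 1 / (1 + ga)"
 shows "EX c>0. ALL (g :: 'a::euclidean_space => real) L K H u Lam r. epi L K g --> cone_harm g (2 * a) H -->
  sing g ga lam Lam u --> 0 < r --> r <= 1/2 -->
  (EX x:epicone g. norm x < r & c * (r powr (2 * a) * ln (1 / r) powr a) <= u x)"
proof -
 have a0: "0 < a" using ga by (simp add: a)
 obtain c where c: "c > 0" "!!s. ln 2 <= s ==> c * s powr a <= (ln 3 + s) powr a - ln 2 powr a"
 using powr_shift_lower[OF a0] by blast
 define ka where "ka = (lam / (a * (real DIM('a) + 1 + 4 * a))) powr a"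
 have ka: "ka > 0" using lam a0 by (simp add: ka_def)
 define q where "q = ka * (1/2) powr (2 * a) * c"
 have q: "q > 0" using ka c by (simp add: q_def)
 show ?thesis
 proof (rule exI[of _ q], intro conjI allI impI)
 fix g :: "'a => real" and L K H u Lam and r :: real
 assume e: "epi L K g" and H: "cone_harm g (2 * a) H" and s: "sing g ga lam Lam u" and r: "0 < r" "r <= 1/2"
 obtain x where x: "x : epicone g" "norm x = r / 2" "ka * (r / 2) powr (2 * a) * ((ln (3/2) - ln (r / 2)) powr a - ln 2 powr a) <= u x"
  using sol_sup_lower[OF e H s ga lam a ka_def, of "r / 2"] r by auto
 have l: "ln (3/2) - ln (r / 2) = ln 3 + ln (1 / r)" using r by (simp add: ln_div)
 have "ln 2 <= ln (1 / r)" using r by (intro ln_mono) (auto simp: field_simps)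
 note c = c(2)[OF this]
 have rr: "(r / 2) powr (2 * a) = (1/2) powr (2 * a) * r powr (2 * a)" using powr_mult[of "1/2" r "2 * a"] by simp
 have "q * (r powr (2 * a) * ln (1 / r) powr a) = ka * (r / 2) powr (2 * a) * (c * ln (1 / r) powr a)" by (simp add: q_def rr)
 also have "...
  <= ka * (r / 2) powr (2 * a) * ((ln (3/2) - ln (r / 2)) powr a - ln 2 powr a)"
  unfolding l using ka c by (intro mult_left_mono) auto
 finally have "q * (r powr (2 * a) * ln (1 / r) powr a) <= u x" using x(3) by simp
 thus "EX x:epicone g. norm x < r & q * (r powr (2 * a) * ln (1 / r) powr a) <= u x"
  using x r by (intro bexI[of _ x]) auto
 qed (rule q)
qed

text \<open>The eigenfunction is arbitrary up to a positive factor; dividing \<open>H_cone\<close>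
  by \<open>M\<close> multiplies the right-hand side by \<open>M powr ga\<close>, which the linear
  problem passes on to \<open>w\<close>.\<close>

lemma H_problem_iff:
 fixes Sg :: "('a::euclidean_space * real) set"
 assumes e: "epi L K g" and c: "epicone g = cone_over Sg" and ga: "0 < ga" and ph: "frequency Sg = 2 / (1 + ga)"
 and M: "M > 0" and H: "cone_harm g (frequency Sg) (%x. H_cone Sg E x / M)"
 shows "H_problem_solvable Sg ga E \<longleftrightarrow> ga < 2"
proof -
 have o: "open (sector Sg)" unfolding c[symmetric] by (rule unit_sector[OF e])
 have MM: "M powr (- ga) * M powr ga = 1" using M by (simp flip: powr_add)
 have Heq: "(H_cone Sg E x / M) powr (- ga) = M powr ga * H_cone Sg E x powr (- ga)" if "x : sector Sg" for x
 proof -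
 have "0 <= H_cone Sg E x / M" using cone_harmD(5)[OF H, of x] that c by blast
 hence "0 <= H_cone Sg E x" using M by (simp add: zero_le_divide_iff)
 thus ?thesis by (simp add: powr_divide powr_minus field_simps)
 qed
 show ?thesis
 proof
 assume ga2: "ga < 2"
 have "frequency Sg * ga = 2 - frequency Sg" using ga by (simp add: ph field_simps)
 from unit_problem_solvable[OF e ga ga2 this H] obtain w where w: "continuous_on UNIV w" "!!x. x ~: sector Sg ==> w x = 0"
  "poisson_distr (sector Sg) w (%x. (H_cone Sg E x / M) powr (- ga))" unfolding c by blast
 have "poisson_distr (sector Sg) (%x. M powr (- ga) * w x) (%x. H_cone Sg E x powr (- ga))"
  by (rule poisson_distr_cmul_cong[OF w(3) o, where c="M powr (- ga)"]) (rule refl, simp only: Heq MM mult_1 flip: mult.assoc)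
 moreover have "continuous_on (closure (sector Sg)) (%x. M powr (- ga) * w x)"
  by (intro continuous_intros continuous_on_subset[OF w(1)]) auto
 moreover have "M powr (- ga) * w x = 0" if "x : frontier (sector Sg)" for x
  using that w(2)[of x] unfolding frontier_def interior_open[OF o] by simp
 ultimately show "H_problem_solvable Sg ga E" unfolding H_problem_solvable_def by blast
 next
 assume "H_problem_solvable Sg ga E"
 then obtain w where w: "continuous_on (closure (sector Sg)) w" "!!x. x : frontier (sector Sg) ==> w x = 0"
  "poisson_distr (sector Sg) w (%x. H_cone Sg E x powr (- ga))" unfolding H_problem_solvable_def by blast
 show "ga < 2"
 proof (rule ccontr)
  assume "~ ga < 2"
  hence ga2: "2 <= ga" by simp
  have "poisson_distr (sector Sg) (%x. M powr ga * w x) (%x. (H_cone Sg E x / M) powr (- ga))"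
  by (rule poisson_distr_cmul_cong[OF w(3) o]) (auto simp: Heq)
  moreover have "continuous_on (closure (sector Sg)) (%x. M powr ga * w x)" by (intro continuous_intros w(1))
  moreover have "M powr ga * w x = 0" if "x : frontier (sector Sg)" for x using w(2)[OF that] by simp
  ultimately show False using unit_problem_unsolvable[OF e ga2 H, of "%x. M powr ga * w x"] unfolding c by blast
 qed
 qed
qed

text \<open>The supremum over the open ball of radius \<open>r\<close> sees \<open>x\<close> only
  for \<open>r > norm x\<close>, so the pointwise bound is the limit from the right.\<close>

lemma log_growth_imp_bound:
 fixes Sg :: "('a::euclidean_space * real) set"
 assumes c: "epicone g = cone_over Sg" and ph: "frequency Sg = 2 * a" and lg: "log_growth Sg u C" and s: "Linf_norm (sector Sg) u = ereal s"
 and x: "x : epicone g" "x ~= 0" "norm x < 1/2"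
 shows "u x <= C * s * norm x powr (2 * a) * ln (1 / norm x) powr a"
proof -
 define F where "F = (%r. C * s * r powr (2 * a) * ln (1 / r) powr a)"
 have n: "0 < norm x" using x by simp
 have "0 < ln (1 / norm x)" using n x(3) by auto
 hence "(F ---> F (norm x)) (at_right (norm x))"
 unfolding F_def by (intro tendsto_intros) auto
 moreover have "\<forall>\<^sub>F r in at_right (norm x). u x <= F r"
 proof (rule eventually_at_rightI[of _ "1/2"])
 fix r assume "r : {norm x<..<1/2}"
 hence r: "norm x < r" "r <= 1/2" by auto
 hence r0: "0 < r" using n by linarith
 have "ereal (u x) <= (SUP x\<in>cone_over Sg Int ball 0 r. ereal (u x))"
  by (rule SUP_upper) (use x r c in auto)
 also have "... <= ereal C * ereal s * ereal (r powr (2 * a) * ln (1 / r) powr a)"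
  using lg r r0 unfolding log_growth_def Let_def ph s by auto
 finally show "u x <= F r" by (simp add: F_def)
 qed (use x in simp)
 ultimately have "u x <= F (norm x)" by (intro tendsto_lowerbound) auto
 thus ?thesis by (simp add: F_def)
qed

lemma log_growthI:
 fixes Sg :: "('a::euclidean_space * real) set"
 assumes e: "epi L K g" and c: "epicone g = cone_over Sg" and ph: "frequency Sg = 2 * a" and a: "0 < a"
 and sg: "sing g ga lam Lam u" and C: "0 < C" "inverse C <= c1" "c2 <= C"
 and low: "!!r. 0 < r ==> r <= 1/2 ==> EX x:epicone g. norm x < r & c1 * (r powr (2 * a) * ln (1 / r) powr a) <= u x"
 and up: "!!s x. (!!y. y : epicone g ==> norm y < 1 ==> u y <= s) ==> x : epicone g ==> norm x < 1/2 ==>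
  u x <= c2 * s * norm x powr (2 * a) * ln (1 / norm x) powr a"
 shows "log_growth Sg u C"
 unfolding log_growth_def Let_def
proof (intro allI impI conjI)
 fix r :: real assume r: "0 < r & r <= 1 / 2"
 define rh where "rh = r powr (2 * a) * ln (1 / r) powr a"
 have rh: "r powr frequency Sg * ln (1 / r) powr (frequency Sg / 2) = rh" by (simp add: rh_def ph)
 have "0 < ln (1 / r)" using r by simp
 hence rh0: "0 < rh" using r by (simp add: rh_def)
 obtain x where x: "x : epicone g" "norm x < r" "c1 * rh <= u x" using low[of r] r unfolding rh_def by blast
 have "inverse C * rh <= c1 * rh" using C rh0 by auto
 hence "ereal (inverse C * rh) <= ereal (u x)" using x by simp
 thus "ereal (inverse C * (r powr frequency Sg * ln (1 / r) powr (frequency Sg / 2))) <= (SUP x\<in>cone_over Sg Int ball 0 r. ereal (u x))"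
 unfolding rh by (rule SUP_upper2[rotated]) (use x c in auto)
 have o: "open (sector Sg)" unfolding c[symmetric] by (rule unit_sector[OF e])
 have cu: "continuous_on (sector Sg) u" unfolding c[symmetric]
 by (rule continuous_on_subset[OF singD(1)[OF sg]]) (auto simp: epicone_def)
 have Linf: "ereal (u y) <= Linf_norm (sector Sg) u" if "y : epicone g" "norm y < 1" for y
 by (rule le_Linf_norm[OF o cu]) (use that c in auto)
 show "(SUP x\<in>cone_over Sg Int ball 0 r. ereal (u x)) <= ereal C * Linf_norm (sector Sg) u * ereal (r powr frequency Sg * ln (1 / r) powr (frequency Sg / 2))"
 unfolding rh
 proof (rule SUP_least)
 fix x assume "x : cone_over Sg Int ball 0 r"
 hence x: "x : epicone g" "norm x < r" "norm x < 1" "0 < norm x" using c r cone_nz[OF e, of x] by auto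
 show "ereal (u x) <= ereal C * Linf_norm (sector Sg) u * ereal rh"
 proof (cases "Linf_norm (sector Sg) u")
  case (real s)
  have us: "u y <= s" if "y : epicone g" "norm y < 1" for y using Linf[OF that] real by simp
  have "0 < u x" using x by (intro singD(3)[OF sg]) (auto simp: epicone_def)
  hence s: "0 < s" using us[OF x(1,3)] by simp
  have "u x <= c2 * s * (norm x powr (2 * a) * ln (1 / norm x) powr a)"
  using up[OF us x(1)] x r by auto
  also have "... <= C * s * rh" unfolding rh_def using C s a x r by (intro mult_mono growth_rate_mono) auto
  finally show ?thesis using real by simp
 next
  case PInf
  thus ?thesis using C rh0 by simp
 next
  case MInf
  thus ?thesis using Linf[OF x(1,3)] by simp
 qed
 qed
qed

text \<open>The constant is chosen before the cone, the eigenfunction, \<open>f\<close> and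
  \<open>u\<close>, so it depends on the dimension and the displayed parameters only. The converse
  in the last clause assumes merely some \<open>C'\<close>, possibly depending on \<open>u\<close>.
  It is stated for finite norm because with infinite norm the upper bound is vacuous, while the
  lower bound holds for every exponent.\<close>

theorem theorem1p3:
  fixes \<gamma> L K lam Lam :: real
  assumes "\<gamma> > 0" and "lam > 0"
  shows "\<exists>C>0. \<forall>(\<Sigma> :: ((real ^ 'm) \<times> real) set) E f u.
    C11_epigraphical_cone \<Sigma> L K \<and>
    first_eigenfunction \<Sigma> E \<and>
    frequency \<Sigma> = 2 / (1 + \<gamma>) \<and>
    f \<in> borel_measurable (lebesgue_on (sector \<Sigma>)) \<and>
    (\<forall>x\<in>sector \<Sigma>. lam \<le> f x \<and> f x \<le> Lam) \<and>
    singular_solution \<Sigma> \<gamma> f u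
    \<longrightarrow>
    (\<gamma> < 2 \<longleftrightarrow> H_problem_solvable \<Sigma> \<gamma> E) \<and>
    (\<gamma> < 2 \<longrightarrow> log_growth \<Sigma> u C) \<and>
    (Linf_norm (sector \<Sigma>) u < \<infinity> \<longrightarrow> (\<gamma> < 2 \<longleftrightarrow> (\<exists>C'>0. log_growth \<Sigma> u C')))"
proof -
 define a where "a = 1 / (1 + \<gamma>)"
 have a0: "0 < a" using assms by (simp add: a_def)
 define L' where "L' = max 1 (3 * L)"
 define K' where "K' = max 1 (3/2 * max K (4 * L'))"
 have LK: "1 <= L'" "1 <= K'" by (auto simp: L'_def K'_def)
 obtain c1 where c1: "c1 > 0" "ALL (g :: real ^ 'm => real) L K H u Lam r. epi L K g --> cone_harm g (2 * a) H -->
  sing g \<gamma> lam Lam u --> 0 < r --> r <= 1/2 -->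
  (EX x:epicone g. norm x < r & c1 * (r powr (2 * a) * ln (1 / r) powr a) <= u x)"
 using solution_sup_lower[OF assms a_def, where 'a="real ^ 'm"] by blast
 \<comment> \<open>The upper constant exists only for exponents below 2; the value 1 fills the other
   case, so that one \<open>C\<close> can be defined before the case distinction.\<close>
 have "EX c2>0. \<gamma> < 2 --> (ALL (g :: real ^ 'm => real) H u s. epi L' K' g --> cone_harm g (2 * a) H -->
  sing g \<gamma> lam Lam u --> (ALL x:epicone g. norm x < 1 --> u x <= s) -->
  (ALL x:epicone g. norm x < 1/2 --> u x <= c2 * s * norm x powr (2 * a) * ln (1 / norm x) powr a))"
 using sol_upper[OF LK assms(1) _ assms(2) a_def, of Lam, where 'a="real ^ 'm"] by (cases "\<gamma> < 2") (simp, auto intro: exI[of _ 1])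
 then obtain c2 where c2: "c2 > 0" "\<gamma> < 2 ==> ALL (g :: real ^ 'm => real) H u s. epi L' K' g --> cone_harm g (2 * a) H -->
  sing g \<gamma> lam Lam u --> (ALL x:epicone g. norm x < 1 --> u x <= s) -->
  (ALL x:epicone g. norm x < 1/2 --> u x <= c2 * s * norm x powr (2 * a) * ln (1 / norm x) powr a)" by blast
 define C where "C = max c2 (1 / c1)"
 have C: "0 < C" "c2 <= C" "inverse C <= c1"
 proof -
 show "0 < C" "c2 <= C" using c2(1) by (auto simp: C_def)
 have "inverse C <= inverse (1 / c1)" using c1(1) by (intro le_imp_inverse_le) (auto simp: C_def)
 thus "inverse C <= c1" by simp
 qed
 show ?thesis
 proof (rule exI[of _ C], rule conjI[OF C(1)], intro allI impI, elim conjE)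
 fix \<Sigma> :: "((real ^ 'm) * real) set" and E f u
 assume C11: "C11_epigraphical_cone \<Sigma> L K" and FE: "first_eigenfunction \<Sigma> E" and fr: "frequency \<Sigma> = 2 / (1 + \<gamma>)"
  and f: "ALL x:sector \<Sigma>. lam <= f x & f x <= Lam" and u: "singular_solution \<Sigma> \<gamma> f u"
 obtain g where g: "epi L' K' g" "epicone g = cone_over \<Sigma>" using epi_of_C11[OF C11] unfolding L'_def K'_def by blast
 have S: "\<Sigma> <= sphere 0 1" using C11 by (simp add: C11_epigraphical_cone_def)
 obtain M where M: "M > 0" "cone_harm g (frequency \<Sigma>) (%x. H_cone \<Sigma> E x / M)"
  using cone_harm_of_eigenfunction[OF g S FE] by blast
 have fr2: "frequency \<Sigma> = 2 * a" by (simp add: fr a_def)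
 have H: "cone_harm g (2 * a) (%x. H_cone \<Sigma> E x / M)" using M(2) unfolding fr2 .
 have sg: "sing g \<gamma> lam Lam u" by (rule sing_of_singular_solution[OF g u]) (use f in blast)
 have lg: "log_growth \<Sigma> u C" if \<gamma>2: "\<gamma> < 2"
 proof (rule log_growthI[OF g fr2 a0 sg C(1,3,2)])
  show "EX x:epicone g. norm x < r & c1 * (r powr (2 * a) * ln (1 / r) powr a) <= u x" if "0 < r" "r <= 1/2" for r
  using c1(2) g(1) H sg that by blast
  show "u x <= c2 * s * norm x powr (2 * a) * ln (1 / norm x) powr a"
  if "!!y. y : epicone g ==> norm y < 1 ==> u y <= s" "x : epicone g" "norm x < 1/2" for s x
  using c2(2)[OF \<gamma>2] g(1) H sg that by blast
 qed
 have no: False if lg': "log_growth \<Sigma> u C'" "C' > 0" and fin: "Linf_norm (sector \<Sigma>) u < \<infinity>" and \<gamma>2: "2 <= \<gamma>" for C'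
 proof -
  have o: "open (sector \<Sigma>)" unfolding g(2)[symmetric] by (rule unit_sector[OF g(1)])
  have cu: "continuous_on (sector \<Sigma>) u" unfolding g(2)[symmetric]
  by (rule continuous_on_subset[OF singD(1)[OF sg]]) (auto simp: epicone_def)
  obtain x where x: "x : epicone g" "norm x < 1/2" using c1(2)[rule_format, OF g(1) H sg, of "1/2"] by auto
  hence "ereal (u x) <= Linf_norm (sector \<Sigma>) u" using g(2) by (intro le_Linf_norm[OF o cu]) auto
  moreover have "0 < u x" using x by (intro singD(3)[OF sg]) (auto simp: epicone_def)
  ultimately obtain s where s: "Linf_norm (sector \<Sigma>) u = ereal s" "0 < s" using fin by (cases "Linf_norm (sector \<Sigma>) u") auto
  show False
  proof (rule no_log_growth[OF g(1) \<gamma>2 a_def H sg assms(2), of "C' * s"])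
  show "0 < C' * s" using lg'(2) s(2) by simp
  show "u x <= C' * s * norm x powr (2 * a) * ln (1 / norm x) powr a" if "x : epicone g" "norm x < 1/2" for x
   by (rule log_growth_imp_bound[OF g(2) fr2 lg'(1) s(1) that(1) _ that(2)]) (use cone_nz[OF g(1) that(1)] in simp)
  qed
 qed
 show "(\<gamma> < 2 \<longleftrightarrow> H_problem_solvable \<Sigma> \<gamma> E) & (\<gamma> < 2 --> log_growth \<Sigma> u C) &
  (Linf_norm (sector \<Sigma>) u < \<infinity> --> (\<gamma> < 2 \<longleftrightarrow> (EX C'>0. log_growth \<Sigma> u C')))"
  using H_problem_iff[OF g assms(1) fr M] lg C(1) no by auto
 qed
qed

end
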